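(* Let $R$ be a commutative $\mathbb{Q}$-algebra and let $(X,[X])$ be a local Poincaré duality pair of dimension $n\geqslant 1$. None of the $n$-pre-Calabi–Yau algebra structures on $A=C_*(\Omega X,R)$ that are compatible with $[X]$ are formal (as $\mathcal{V}^{(n)}_\infty$-algebras).
   Context: Conventions. $R$ is a commutative $\mathbb{Q}$-algebra; modules are $\mathbb{Z}$-graded over $R$ with homological grading; $s$ is the suspension; arities are written (outputs; inputs). Dioperads have compositions along directed graphs of genus zero only. For a quadratic dioperad $\mathcal{Q}=\mathcal{T}(E)/(S)$, $\mathcal{Q}^{\text{¡}}$ denotes its quadratic dual codioperad (cogenerated by $sE$ with corelations $s^2S$), and $\Omega$ is the cobar construction. The dioperad $\mathcal{V}^{(n)}$ is generated by $\mu$ (arity $(1;2)$, degree $0$, no symmetry) and $\nu$ (arity $(2;0)$, degree $-n$, symmetric), with relations $\mu(\mu(1,2),3)-\mu(1,\mu(2,3))$ and $\mu(1,\nu_1)\otimes\nu_2-\nu_1\otimes\mu(\nu_2,1)$, where $\nu=\nu_1\otimes\nu_2$ and tensor positions are output labels. Put $\mathcal{V}^{(n)}_\infty=\Omega(\mathcal{V}^{(n)\text{¡}})$. Pre-Calabi–Yau structures. Let $CH^*_{(\ell)}(A)=\prod_{k_1,\dots,k_\ell\ge0}\mathrm{Hom}_R(sA^{\otimes k_1}\otimes\cdots\otimes sA^{\otimes k_\ell},A^{\otimes\ell})$, with $\mathbb{Z}/\ell$ rotating blocks of inputs and outputs; $CH^*_{(\ell)}(A)^{(\mathbb{Z}/\ell,n)}$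 is the isotypic part on which the generator acts by the Koszul sign (inputs and outputs seen in $sA$) times $(-1)^{(n-1)(\ell-1)}$; $CH^*_{[n]}(A)=\prod_{\ell\ge1}s^{(n-2)(\ell-1)}CH^*_{(\ell)}(A)^{(\mathbb{Z}/\ell,n)}$. The necklace product $m\circ_{\mathrm{nec}}m'$ on $sCH^*_{[n]}(A)$ is the signed sum over all planar ways of plugging one output of $m'$ into one input of $m$. An $n$-pre-CY structure on $A$ is $m=\sum_\ell m_{(\ell)}$ with $m\circ_{\mathrm{nec}}m=0$ and zero component $m^0_{(1)}$; $m_{(1)}$ is then an $A_\infty$-structure. On a chain complex $(A,\delta)$ (with $m^1_{(1)}=\delta$) these are the same as $\mathcal{V}^{(n)}_\infty$-algebra structures (Poirier–Tradler). Formality. A $\mathcal{V}^{(n)}_\infty$-algebra $(A,\varphi)$ induces a $\mathcal{V}^{(n)}$-algebra structure $\varphi_*$ on $H_*(A)$, regarded as a $\mathcal{V}^{(n)}_\infty$-structure via $\mathcal{V}^{(n)}_\infty\to\mathcal{V}^{(n)}$. $(A,\varphi)$ is formal if there is a zig-zag of quasi-isomorphisms of $\mathcal{V}^{(n)}_\infty$-algebras between $(A,\varphi)$ and $(H_*(A),\varphi_* )$. Compatibility. Let $X$ be path-connected with the homotopy type of a finite simplicial complex and $[X]\in H_n(X,R)$; $(X,[X])$ is a local Poincaré duality pair of dimension $n$ if cap product with a chain representing $[X]$ is a quasi-isomorphism $C^*(X,\mathcal{L})\to C_{n-*}(X,\mathcal{L})$ for every local system $\mathcal{L}$. $C_*(\Omega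 X,R)$ is the dg algebra of chains on the based Moore loop space. A smooth $n$-CY structure on a smooth $A_\infty$-algebra $A$ is a class in $HC^-_n(A)$ whose image in $HH_n(A)\cong H_n(\mathbb{R}\mathrm{Hom}_{A-A}(A^!,A))$ is an equivalence $A^!\simeq A$ ($A^!$ the inverse dualizing bimodule). For a local Poincaré duality pair, $[X]$ induces a smooth $n$-CY structure on $C_*(\Omega X,R)$, namely its image under $H_n(X)\to HC^-_n(C_*(\Omega X,R))$ induced by the inclusion of constant loops (Holstein–Rivera). A closed element $\varphi_{(2)}\in CH^n_{(2)}(A)$ defines a chain map $g_{\varphi_{(2)}}:CH_*(A)\to CH^{-*}(A)[n]$; for a dg algebra, up to Koszul sign, $g_{\varphi_{(2)}}(a_0[a_1|\cdots|a_k])(b_1,\dots,b_m)$ is the product $u\,a_0\,v$, where $u\otimes v$ are the two outputs of $\varphi_{(2)}$ applied to $b_1,\dots,b_m$ in one block of inputs and $a_1,\dots,a_k$ in the other. $\varphi_{(2)}$ is compatible with $[\omega_0]\in HH_n(A)$ if $[g_{\varphi_{(2)}}(\omega_0)]=1\in HH^0(A)$. For $A$ smooth and $[\omega_0]$ nondegenerate there is a bijection (Kontsevich–Takeda–Vlassopoulos, noncommutative Legendre transform) between lifts of $[\omega_0]$ to smooth $n$-CY structures and $\pi_0$ of the (simplicial) space of $n$-pre-CY structures on $A$ (with the given $A_\infty$-structure) whose component $\varphi_{(2)}$ is compatible with $[\omega_0]$. An $n$-pre-CY structure on $C_*(\Omega X,R)$ is compatible with $[X]$ if it corresponds under this bijection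 to the smooth CY structure induced by $[X]$. *)

theory Defs
  imports "HOL-Homology.Homology" "HOL-Algebra.Module"
begin

section \<open>Linear algebra over the ground ring\<close>

text \<open>The ground ring is a type \<open>'r\<close> of class \<open>comm_ring_1\<close> (so it is not the zero ring).
  Modules over it are \<open>HOL-Algebra\<close> modules, and finite formal linear combinations are elements of
  \<open>'k \<Rightarrow>\<^sub>0 'r\<close>.\<close>

definition rational_algebra :: "'r::comm_ring_1 itself \<Rightarrow> bool" where
  "rational_algebra _ \<longleftrightarrow> (\<forall>k::nat. 0 < k \<longrightarrow> (of_nat k :: 'r) dvd 1)"

definition ground_ring :: "'r::comm_ring_1 ring" where
  "ground_ring = \<lparr>carrier = UNIV, mult = (*), one = 1, zero = 0, add = (+)\<rparr>"

definition is_module :: "('r::comm_ring_1, 'm) module \<Rightarrow> bool" where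
  "is_module M \<longleftrightarrow> Module.module ground_ring M"

definition linear_map :: "('r::comm_ring_1, 'm) module \<Rightarrow> ('r, 'k) module \<Rightarrow> ('m \<Rightarrow> 'k) \<Rightarrow> bool" where
  "linear_map M N f \<longleftrightarrow> f \<in> carrier M \<rightarrow> carrier N \<and>
     (\<forall>x\<in>carrier M. \<forall>y\<in>carrier M. f (x \<oplus>\<^bsub>M\<^esub> y) = f x \<oplus>\<^bsub>N\<^esub> f y) \<and>
     (\<forall>r. \<forall>x\<in>carrier M. f (r \<odot>\<^bsub>M\<^esub> x) = r \<odot>\<^bsub>N\<^esub> f x)"

definition sgn_pow :: "int \<Rightarrow> 'r::comm_ring_1" where
  "sgn_pow k = (if even k then 1 else - 1)"

definition pm_scale :: "'r::comm_ring_1 \<Rightarrow> ('k \<Rightarrow>\<^sub>0 'r) \<Rightarrow> ('k \<Rightarrow>\<^sub>0 'r)" where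
  "pm_scale r p = Poly_Mapping.map ((*) r) p"

text \<open>Linear extension of a map given on basis elements.\<close>

definition lin_ext :: "('a \<Rightarrow> ('k \<Rightarrow>\<^sub>0 'r::comm_ring_1)) \<Rightarrow> ('a \<Rightarrow>\<^sub>0 'r) \<Rightarrow> ('k \<Rightarrow>\<^sub>0 'r)" where
  "lin_ext g p = (\<Sum>a\<in>Poly_Mapping.keys p. pm_scale (Poly_Mapping.lookup p a) (g a))"

abbreviation pt :: "'k \<Rightarrow> ('k \<Rightarrow>\<^sub>0 'r::comm_ring_1)" where
  "pt k \<equiv> Poly_Mapping.single k 1"

definition free_module :: "'k set \<Rightarrow> ('r::comm_ring_1, 'k \<Rightarrow>\<^sub>0 'r) module" where
  "free_module S = \<lparr>carrier = {p. Poly_Mapping.keys p \<subseteq> S}, mult = undefined, one = undefined,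
     zero = 0, add = (+), smult = pm_scale\<rparr>"


section \<open>Graded modules, complexes and tensors\<close>

text \<open>A graded module is a family \<open>M :: int \<Rightarrow> ('r, 'm) module\<close>, and a differential a family \<open>\<delta>\<close> with
  \<open>\<delta> i\<close> mapping \<open>M i\<close> to \<open>M (i - 1)\<close>.\<close>

definition cycles ::
  "(int \<Rightarrow> ('r::comm_ring_1, 'm) module) \<Rightarrow> (int \<Rightarrow> 'm \<Rightarrow> 'm) \<Rightarrow> int \<Rightarrow> 'm set" where
  "cycles M \<delta> i = {x \<in> carrier (M i). \<delta> i x = \<zero>\<^bsub>M (i - 1)\<^esub>}"

definition boundaries ::
  "(int \<Rightarrow> ('r::comm_ring_1, 'm) module) \<Rightarrow> (int \<Rightarrow> 'm \<Rightarrow> 'm) \<Rightarrow> int \<Rightarrow> 'm set" where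
  "boundaries M \<delta> i = \<delta> (i + 1) ` carrier (M (i + 1))"

definition hclass ::
  "(int \<Rightarrow> ('r::comm_ring_1, 'm) module) \<Rightarrow> (int \<Rightarrow> 'm \<Rightarrow> 'm) \<Rightarrow> int \<Rightarrow> 'm \<Rightarrow> 'm set" where
  "hclass M \<delta> i x = boundaries M \<delta> i +>\<^bsub>M i\<^esub> x"

definition homology ::
  "(int \<Rightarrow> ('r::comm_ring_1, 'm) module) \<Rightarrow> (int \<Rightarrow> 'm \<Rightarrow> 'm) \<Rightarrow> int \<Rightarrow> ('r, 'm set) module" where
  "homology M \<delta> i = \<lparr>carrier = hclass M \<delta> i ` cycles M \<delta> i, mult = undefined, one = undefined,
     zero = boundaries M \<delta> i, add = set_add (M i),
     smult = (\<lambda>r C. boundaries M \<delta> i <+>\<^bsub>M i\<^esub> ((\<lambda>x. r \<odot>\<^bsub>M i\<^esub> x) ` C))\<rparr>"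

text \<open>A homogeneous element is recorded together with its degree. A list of homogeneous elements
  stands for a simple tensor, and a formal combination of such lists for a tensor; two combinations
  are the same tensor if they are related by \<open>teq\<close>, i.e. if they differ by a consequence of the
  multilinearity relations.\<close>

type_synonym 'm helem = "int \<times> 'm"
type_synonym ('r, 'm) tensor = "'m helem list \<Rightarrow>\<^sub>0 'r"

definition hlists :: "(int \<Rightarrow> ('r::comm_ring_1, 'm) module) \<Rightarrow> 'm helem list set" where
  "hlists M = {as. \<forall>(d, x) \<in> set as. x \<in> carrier (M d)}"

definition tensor_gens :: "(int \<Rightarrow> ('r::comm_ring_1, 'm) module) \<Rightarrow> ('r, 'm) tensor set" where
  "tensor_gens M =
     {pt (as @ [(d, x \<oplus>\<^bsub>M d\<^esub> y)] @ bs) - pt (as @ [(d, x)] @ bs) - pt (as @ [(d, y)] @ bs)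
       | as bs d x y. as \<in> hlists M \<and> bs \<in> hlists M \<and> x \<in> carrier (M d) \<and> y \<in> carrier (M d)} \<union>
     {pt (as @ [(d, r \<odot>\<^bsub>M d\<^esub> x)] @ bs) - pm_scale r (pt (as @ [(d, x)] @ bs))
       | as bs d r x. as \<in> hlists M \<and> bs \<in> hlists M \<and> x \<in> carrier (M d)}"

definition teq ::
  "(int \<Rightarrow> ('r::comm_ring_1, 'm) module) \<Rightarrow> ('r, 'm) tensor \<Rightarrow> ('r, 'm) tensor \<Rightarrow> bool" where
  "teq M p q \<longleftrightarrow> p - q \<in> Modules.module.span pm_scale (tensor_gens M)"

definition deg :: "'m helem \<Rightarrow> int" where
  "deg a = fst a"

text \<open>Degrees in \<open>sA\<close>. All Koszul signs below are taken with respect to these.\<close>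

definition sdeg :: "'m helem list \<Rightarrow> int" where
  "sdeg as = (\<Sum>a\<leftarrow>as. deg a + 1)"

definition bdeg :: "'m helem list list \<Rightarrow> int" where
  "bdeg bl = (\<Sum>b\<leftarrow>bl. sdeg b)"


section \<open>Pre-Calabi--Yau structures and the necklace product\<close>

text \<open>An operation takes a list of \<open>\<ell>\<close> blocks of inputs and returns a tensor with \<open>\<ell>\<close> factors; one
  function \<open>'m helem list list \<Rightarrow> ('r, 'm) tensor\<close> collects all its components, the number of
  blocks and their lengths being visible in the argument. Inputs and outputs are both seen in
  \<open>sA\<close>: the output list \<open>[u\<^sub>1, \<dots>, u\<^sub>\<ell>]\<close> stands for \<open>su\<^sub>1 \<otimes> \<dots> \<otimes> su\<^sub>\<ell>\<close>, identified factor by factor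
  (without sign) with \<open>u\<^sub>1 \<otimes> \<dots> \<otimes> u\<^sub>\<ell>\<close>; for two blocks without inputs, \<open>cyclic_op\<close> below then says that
  \<open>\<nu>\<close> is graded symmetric for every \<open>n\<close>. Inputs and outputs are placed around a disc in the cyclic order
  \<open>u\<^sub>1 B\<^sub>1 u\<^sub>2 B\<^sub>2 \<dots> u\<^sub>\<ell> B\<^sub>\<ell>\<close>.\<close>

type_synonym ('r, 'm) opn = "'m helem list list \<Rightarrow> ('r, 'm) tensor"

definition blocks :: "(int \<Rightarrow> ('r::comm_ring_1, 'm) module) \<Rightarrow> nat \<Rightarrow> 'm helem list list set" where
  "blocks M l = {bl. length bl = l \<and> set bl \<subseteq> hlists M}"

text \<open>The \<open>l\<close>-block component of \<open>x\<close> is multilinear and has degree \<open>e\<close> as a map of tensor powers of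
  \<open>sA\<close>.\<close>

definition multi_op ::
  "(int \<Rightarrow> ('r::comm_ring_1, 'm) module) \<Rightarrow> nat \<Rightarrow> int \<Rightarrow> ('r, 'm) opn \<Rightarrow> bool" where
  "multi_op M l e x \<longleftrightarrow>
     (\<forall>bl\<in>blocks M l. Poly_Mapping.keys (x bl) \<subseteq>
        {us \<in> hlists M. length us = l \<and> sdeg us = bdeg bl + e}) \<and>
     (\<forall>Bs P d a a' Q Cs.
        let ins = (\<lambda>c. Bs @ [P @ [(d, c)] @ Q] @ Cs) in
        ins a \<in> blocks M l \<and> a' \<in> carrier (M d) \<longrightarrow>
          teq M (x (ins (a \<oplus>\<^bsub>M d\<^esub> a'))) (x (ins a) + x (ins a')) \<and>
          (\<forall>r. teq M (x (ins (r \<odot>\<^bsub>M d\<^esub> a))) (pm_scale r (x (ins a)))))"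

definition cyclic_op ::
  "(int \<Rightarrow> ('r::comm_ring_1, 'm) module) \<Rightarrow> int \<Rightarrow> nat \<Rightarrow> ('r, 'm) opn \<Rightarrow> bool" where
  "cyclic_op M n l x \<longleftrightarrow> (\<forall>bl\<in>blocks M l.
     teq M (x (rotate1 bl))
       (lin_ext (\<lambda>us. Poly_Mapping.single (rotate1 us)
          (sgn_pow (sdeg (hd bl) * bdeg (tl bl) + sdeg [hd us] * sdeg (tl us)
             + (n - 1) * (int l - 1)))) (x bl)))"

text \<open>Elements of degree \<open>e\<close> of \<open>s CH\<^bsup>*\<^esup>\<^bsub>[n]\<^esub>(A)\<close>. The shift comes from \<open>s\<^bsup>(n-2)(\<ell>-1)\<^esup>\<close> and from the fact
  that the \<open>\<ell>\<close> outputs are seen in \<open>sA\<close>.\<close>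

definition sCH ::
  "(int \<Rightarrow> ('r::comm_ring_1, 'm) module) \<Rightarrow> int \<Rightarrow> int \<Rightarrow> ('r, 'm) opn \<Rightarrow> bool" where
  "sCH M n e x \<longleftrightarrow> (\<forall>l\<ge>1. multi_op M l (e - (n - 3) * (int l - 1)) x \<and> cyclic_op M n l x)"

text \<open>The necklace product \<open>x \<circ>\<^sub>n\<^sub>e\<^sub>c y\<close> of elements of degrees \<open>dx\<close>, \<open>dy\<close> of \<open>s CH\<^bsup>*\<^esup>\<^bsub>[n]\<^esub>(A)\<close>. As \<open>x\<close> and \<open>y\<close> are
  cyclically invariant, one may rotate so that the first output of \<open>y\<close> is plugged into the first
  block of \<open>x\<close>, i.e. so that the word \<open>u\<^sub>1 D\<^sub>1 u\<^sub>2 D\<^sub>2 \<dots>\<close> of the composite is split as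
  \<open>u\<^sub>1 P (C u\<^sub>2 D\<^sub>2 \<dots> u\<^sub>q C') Q u\<^sub>q\<^sub>+\<^sub>1 D\<^sub>q\<^sub>+\<^sub>1 \<dots>\<close> with the part in parentheses belonging to \<open>y\<close>; here
  \<open>D\<^sub>1 = P C\<close> and \<open>D\<^sub>q = C' Q\<close>, or \<open>D\<^sub>1 = P C Q\<close> if \<open>q = 1\<close>. \<open>splits\<close> lists the possible
  \<open>(P, blocks of y, Q)\<close>.\<close>

definition splits ::
  "nat \<Rightarrow> 'm helem list list \<Rightarrow> ('m helem list \<times> 'm helem list list \<times> 'm helem list) list" where
  "splits q D = (if q = 1
     then [(take i (D ! 0), [drop i (take j (D ! 0))], drop j (D ! 0)).
             j \<leftarrow> [0..<Suc (length (D ! 0))], i \<leftarrow> [0..<Suc j]]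
     else [(take i (D ! 0), [drop i (D ! 0)] @ drop 1 (take (q - 1) D) @ [take j (D ! (q - 1))],
              drop j (D ! (q - 1))).
             i \<leftarrow> [0..<Suc (length (D ! 0))], j \<leftarrow> [0..<Suc (length (D ! (q - 1)))]])"

text \<open>In \<open>nec_term\<close> the outputs are \<open>w = v # U\<close> for \<open>y\<close> and \<open>w' = u # U'\<close> for \<open>x\<close>; the first summands of the
  sign are the Koszul sign of moving \<open>y\<close> past \<open>P\<close> and of moving \<open>U\<close> out of and back into place, the
  last one accounts for the suspensions \<open>s\<^bsup>(n-2)(\<ell>-1)\<^esup>\<close>.\<close>

definition nec_term ::
  "int \<Rightarrow> int \<Rightarrow> int \<Rightarrow> ('r::comm_ring_1, 'm) opn \<Rightarrow> ('r, 'm) opn \<Rightarrow> nat \<Rightarrow> 'm helem list list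
     \<Rightarrow> 'm helem list \<times> 'm helem list list \<times> 'm helem list \<Rightarrow> ('r, 'm) tensor" where
  "nec_term n dx dy x y q D s = (case s of (P, yb, Q) \<Rightarrow>
     lin_ext (\<lambda>w. lin_ext (\<lambda>w'. Poly_Mapping.single (hd w' # tl w @ tl w')
          (sgn_pow ((dy + (n - 1) * (int q - 1)) * sdeg P
             + sdeg (tl w) * (sdeg Q + bdeg (drop q D)) + sdeg (tl w) * sdeg (tl w')
             + (n - 1) * dx * (int q - 1))))
        (x ((P @ [hd w] @ Q) # drop q D))) (y yb))"

definition nec ::
  "int \<Rightarrow> int \<Rightarrow> int \<Rightarrow> ('r::comm_ring_1, 'm) opn \<Rightarrow> ('r, 'm) opn \<Rightarrow> ('r, 'm) opn" where
  "nec n dx dy x y bl = (\<Sum>p<length bl. \<Sum>q\<in>{1..length bl}. \<Sum>s\<leftarrow>splits q (rotate p bl).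
     lin_ext (\<lambda>us. let k = length bl - p in Poly_Mapping.single (rotate k us)
          (sgn_pow (bdeg (take p bl) * bdeg (drop p bl) + sdeg (take k us) * sdeg (drop k us)
             + (n - 1) * (int (length bl) - 1) * int p)))
       (nec_term n dx dy x y q (rotate p bl) s))"


section \<open>Algebras over the resolution of the dioperad \<open>V\<^sup>(\<^sup>n\<^sup>)\<close> and formality\<close>

text \<open>An algebra over \<open>V\<^sup>(\<^sup>n\<^sup>)\<^sub>\<infinity>\<close> is a chain complex with an \<open>n\<close>-pre-Calabi--Yau structure whose component
  with one block and one input is the differential (Poirier--Tradler).\<close>

record (overloaded) ('r, 'm) vinf =
  mods :: "int \<Rightarrow> ('r, 'm) module"
  diff :: "int \<Rightarrow> 'm \<Rightarrow> 'm"
  ops :: "('r, 'm) opn"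

definition vinf_algebra :: "int \<Rightarrow> ('r::comm_ring_1, 'm) vinf \<Rightarrow> bool" where
  "vinf_algebra n V \<longleftrightarrow>
     (\<forall>i. is_module (mods V i) \<and> linear_map (mods V i) (mods V (i - 1)) (diff V i)) \<and>
     (\<forall>i. \<forall>x\<in>carrier (mods V i). diff V (i - 1) (diff V i x) = \<zero>\<^bsub>mods V (i - 2)\<^esub>) \<and>
     sCH (mods V) n (- 1) (ops V) \<and>
     teq (mods V) (ops V [[]]) 0 \<and>
     (\<forall>d. \<forall>x\<in>carrier (mods V d). teq (mods V) (ops V [[(d, x)]]) (pt [(d - 1, diff V d x)])) \<and>
     (\<forall>l\<ge>1. \<forall>bl\<in>blocks (mods V) l. teq (mods V) (nec n (- 1) (- 1) (ops V) (ops V) bl) 0)"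

definition hmap :: "(int \<Rightarrow> 'm \<Rightarrow> 'k) \<Rightarrow> 'm helem \<Rightarrow> 'k helem" where
  "hmap f a = (fst a, f (fst a) (snd a))"

definition quasi_iso ::
  "('r::comm_ring_1, 'm) vinf \<Rightarrow> ('r, 'k) vinf \<Rightarrow> (int \<Rightarrow> 'm \<Rightarrow> 'k) \<Rightarrow> bool" where
  "quasi_iso V W f \<longleftrightarrow>
     (\<forall>i. linear_map (mods V i) (mods W i) (f i)) \<and>
     (\<forall>i. \<forall>x\<in>carrier (mods V i). f (i - 1) (diff V i x) = diff W i (f i x)) \<and>
     (\<forall>l\<ge>1. \<forall>bl\<in>blocks (mods V) l.
        teq (mods W) (lin_ext (\<lambda>us. pt (map (hmap f) us)) (ops V bl))
          (ops W (map (map (hmap f)) bl))) \<and>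
     (\<forall>i. \<forall>x\<in>cycles (mods V) (diff V) i.
        f i x \<in> boundaries (mods W) (diff W) i \<longrightarrow> x \<in> boundaries (mods V) (diff V) i) \<and>
     (\<forall>i. \<forall>y\<in>cycles (mods W) (diff W) i. \<exists>x\<in>cycles (mods V) (diff V) i.
        \<exists>w\<in>boundaries (mods W) (diff W) i. y = f i x \<oplus>\<^bsub>mods W i\<^esub> w)"

definition linked :: "int \<Rightarrow> ('r::comm_ring_1, 'm) vinf \<Rightarrow> ('r, 'k) vinf \<Rightarrow> bool" where
  "linked n V W \<longleftrightarrow> vinf_algebra n V \<and> vinf_algebra n W \<and>
     ((\<exists>f. quasi_iso V W f) \<or> (\<exists>f. quasi_iso W V f))"

text \<open>The tensor differential on \<open>sA \<otimes> sA\<close>.\<close>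

definition diff2 :: "(int \<Rightarrow> 'm \<Rightarrow> 'm) \<Rightarrow> ('r::comm_ring_1, 'm) tensor \<Rightarrow> ('r, 'm) tensor" where
  "diff2 \<delta> = lin_ext (\<lambda>us. case us of [(i, x), (j, y)] \<Rightarrow>
       pt [(i - 1, \<delta> i x), (j, y)] + Poly_Mapping.single [(i, x), (j - 1, \<delta> j y)] (sgn_pow (i + 1))
     | _ \<Rightarrow> 0)"

text \<open>\<open>induced_ops V h\<close>: \<open>h\<close> is the structure \<open>\<phi>\<^sub>*\<close> on \<open>H\<^sub>*(A)\<close> induced by \<open>V\<close>, viewed as a \<open>V\<^sup>(\<^sup>n\<^sup>)\<^sub>\<infinity>\<close>-structure: the
  product is the induced one, the co-inner product is a lift of the class of \<open>\<nu>\<close> along the Kuenneth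
  map \<open>H\<^sub>*(A) \<otimes> H\<^sub>*(A) \<rightarrow> H\<^sub>*(A \<otimes> A)\<close> (unique where that map is injective), and all operations which are
  not generators of \<open>V\<^sup>(\<^sup>n\<^sup>)\<close> vanish. The sign relating the product to \<open>ops\<close> is the same for \<open>A\<close> and for
  \<open>H\<^sub>*(A)\<close>.\<close>

definition induced_ops :: "('r::comm_ring_1, 'm) vinf \<Rightarrow> ('r, 'm set) opn \<Rightarrow> bool" where
  "induced_ops V h \<longleftrightarrow>
     (let M = mods V; \<delta> = diff V; H = homology M \<delta>; cl = hclass M \<delta> in
       (\<forall>i j. \<forall>x\<in>cycles M \<delta> i. \<forall>y\<in>cycles M \<delta> j. \<forall>z\<in>cycles M \<delta> (i + j).
          teq M (ops V [[(i, x), (j, y)]]) (pt [(i + j, z)]) \<longrightarrow>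
          teq H (h [[(i, cl i x), (j, cl j y)]]) (pt [(i + j, cl (i + j) z)])) \<and>
       (\<exists>p q. Poly_Mapping.keys p \<subseteq> {us. length us = 2 \<and> (\<forall>(i, x) \<in> set us. x \<in> cycles M \<delta> i)} \<and>
          Poly_Mapping.keys q \<subseteq> {us \<in> hlists M. length us = 2} \<and>
          teq M (ops V [[], []]) (p + diff2 \<delta> q) \<and>
          teq H (h [[], []]) (lin_ext (\<lambda>us. pt (map (hmap cl) us)) p)) \<and>
       (\<forall>l\<ge>1. \<forall>bl\<in>blocks H l. map length bl \<notin> {[2], [0, 0]} \<longrightarrow> teq H (h bl) 0))"

text \<open>The type \<open>'u\<close> is the universe of the intermediate algebras of a zig-zag; a statement about all
  zig-zags has to be made for every \<open>'u\<close>.\<close>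

definition formal :: "'u itself \<Rightarrow> int \<Rightarrow> ('r::comm_ring_1, 'm) vinf \<Rightarrow> bool" where
  "formal _ n V \<longleftrightarrow> (\<exists>h. induced_ops V h \<and>
     (\<exists>U U' :: ('r, 'u) vinf. linked n V U \<and> equivclp (linked n) U U' \<and>
        linked n U' \<lparr>mods = homology (mods V) (diff V),
                      diff = (\<lambda>i _. \<zero>\<^bsub>homology (mods V) (diff V) (i - 1)\<^esub>), ops = h\<rparr>))"


section \<open>Hochschild theory of a differential graded algebra\<close>

record ('r, 'm) dga =
  dmods :: "int \<Rightarrow> ('r, 'm) module"
  ddiff :: "int \<Rightarrow> 'm \<Rightarrow> 'm"
  dmult :: "int \<Rightarrow> int \<Rightarrow> 'm \<Rightarrow> 'm \<Rightarrow> 'm"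
  dunit :: "'m"

definition delt :: "('r, 'm) dga \<Rightarrow> 'm helem \<Rightarrow> 'm helem" where
  "delt A a = (fst a - 1, ddiff A (fst a) (snd a))"

definition melt :: "('r, 'm) dga \<Rightarrow> 'm helem \<Rightarrow> 'm helem \<Rightarrow> 'm helem" where
  "melt A a b = (fst a + fst b, dmult A (fst a) (fst b) (snd a) (snd b))"

definition uelt :: "('r, 'm) dga \<Rightarrow> 'm helem" where
  "uelt A = (0, dunit A)"

text \<open>A dg algebra as an \<open>A\<^sub>\<infinity>\<close>-algebra: \<open>sa \<mapsto> s\<delta>a\<close> and \<open>sa \<otimes> sb \<mapsto> (-1)\<^bsup>|a|\<^esup> s(ab)\<close>.\<close>

definition dga_ops :: "('r::comm_ring_1, 'm) dga \<Rightarrow> ('r, 'm) opn" where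
  "dga_ops A bl = (case bl of
       [[a]] \<Rightarrow> pt [delt A a]
     | [[a, b]] \<Rightarrow> Poly_Mapping.single [melt A a b] (sgn_pow (deg a))
     | _ \<Rightarrow> 0)"

text \<open>Hochschild chains: the list \<open>[a\<^sub>0, \<dots>, a\<^sub>k]\<close> stands for \<open>a\<^sub>0[a\<^sub>1|\<dots>|a\<^sub>k]\<close>.\<close>

definition hh_chains :: "('r::comm_ring_1, 'm) dga \<Rightarrow> int \<Rightarrow> ('r, 'm) tensor set" where
  "hh_chains A d =
     {\<omega>. Poly_Mapping.keys \<omega> \<subseteq> {as \<in> hlists (dmods A). as \<noteq> [] \<and> sdeg as = d + 1}}"

definition hh_b :: "('r::comm_ring_1, 'm) dga \<Rightarrow> ('r, 'm) tensor \<Rightarrow> ('r, 'm) tensor" where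
  "hh_b A = lin_ext (\<lambda>as.
     (\<Sum>i<length as. Poly_Mapping.single (as[i := delt A (as ! i)]) (sgn_pow (sdeg (take i as)))) +
     (\<Sum>i<length as - 1.
        Poly_Mapping.single (take i as @ [melt A (as ! i) (as ! Suc i)] @ drop (i + 2) as)
          (sgn_pow (sdeg (take i as) + deg (as ! i)))) +
     (if length as < 2 then 0
      else Poly_Mapping.single (melt A (last as) (hd as) # tl (butlast as))
        (sgn_pow (sdeg [last as] * sdeg (butlast as) + deg (last as)))))"

text \<open>Connes' operator in the form it takes on the normalized complex, in which tensors having the
  unit in a position other than the first are set to zero.\<close>

definition hh_B :: "('r::comm_ring_1, 'm) dga \<Rightarrow> ('r, 'm) tensor \<Rightarrow> ('r, 'm) tensor" where
  "hh_B A = lin_ext (\<lambda>as. \<Sum>i<length as. Poly_Mapping.single (uelt A # drop i as @ take i as)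
     (sgn_pow (sdeg (drop i as) * sdeg (take i as))))"

definition neq0 :: "('r::comm_ring_1, 'm) dga \<Rightarrow> ('r, 'm) tensor \<Rightarrow> bool" where
  "neq0 A p \<longleftrightarrow> p \<in> Modules.module.span pm_scale (tensor_gens (dmods A) \<union>
     {pt as | as. as \<in> hlists (dmods A) \<and> (\<exists>i\<in>{1..<length as}. as ! i = uelt A)})"

definition hh_cycle :: "('r::comm_ring_1, 'm) dga \<Rightarrow> int \<Rightarrow> ('r, 'm) tensor \<Rightarrow> bool" where
  "hh_cycle A d \<omega> \<longleftrightarrow> \<omega> \<in> hh_chains A d \<and> teq (dmods A) (hh_b A \<omega>) 0"

definition hh_class ::
  "('r::comm_ring_1, 'm) dga \<Rightarrow> int \<Rightarrow> ('r, 'm) tensor \<Rightarrow> ('r, 'm) tensor set" where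
  "hh_class A d \<omega> = {\<omega>'. hh_cycle A d \<omega>' \<and>
     (\<exists>\<eta>\<in>hh_chains A (d + 1). teq (dmods A) (\<omega>' - \<omega>) (hh_b A \<eta>))}"

text \<open>Negative cyclic chains of degree \<open>d\<close> are series \<open>\<Sum>\<^sub>i \<Lambda>\<^sub>i u\<^sup>i\<close> with \<open>\<Lambda>\<^sub>i\<close> a normalized Hochschild chain of
  degree \<open>d + 2i\<close> and \<open>|u| = -2\<close>; the differential is \<open>b + uB\<close>.\<close>

definition hc_diff ::
  "('r::comm_ring_1, 'm) dga \<Rightarrow> (nat \<Rightarrow> ('r, 'm) tensor) \<Rightarrow> nat \<Rightarrow> ('r, 'm) tensor" where
  "hc_diff A \<Lambda> i = hh_b A (\<Lambda> i) + (if i = 0 then 0 else hh_B A (\<Lambda> (i - 1)))"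

definition hc_cycle :: "('r::comm_ring_1, 'm) dga \<Rightarrow> int \<Rightarrow> (nat \<Rightarrow> ('r, 'm) tensor) \<Rightarrow> bool" where
  "hc_cycle A d \<Lambda> \<longleftrightarrow> (\<forall>i. \<Lambda> i \<in> hh_chains A (d + 2 * int i) \<and> neq0 A (hc_diff A \<Lambda> i))"

definition hc_class ::
  "('r::comm_ring_1, 'm) dga \<Rightarrow> int \<Rightarrow> (nat \<Rightarrow> ('r, 'm) tensor) \<Rightarrow> (nat \<Rightarrow> ('r, 'm) tensor) set" where
  "hc_class A d \<Lambda> = {\<Lambda>'. hc_cycle A d \<Lambda>' \<and>
     (\<exists>\<eta>. \<forall>i. \<eta> i \<in> hh_chains A (d + 1 + 2 * int i) \<and> neq0 A (\<Lambda>' i - \<Lambda> i - hc_diff A \<eta> i))}"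

text \<open>The map \<open>HC\<^sup>-\<^sub>d(A) \<rightarrow> HH\<^sub>d(A)\<close>: \<open>\<omega>\<close>, a cycle of the full Hochschild complex, represents the image of
  \<open>\<Lambda>\<close>. (The full and the normalized complex are quasi-isomorphic; the full one is used for \<open>HH\<close>
  because \<open>gmap\<close> below need not descend to normalized chains.)\<close>

definition hh_image ::
  "('r::comm_ring_1, 'm) dga \<Rightarrow> int \<Rightarrow> (nat \<Rightarrow> ('r, 'm) tensor) \<Rightarrow> ('r, 'm) tensor \<Rightarrow> bool" where
  "hh_image A d \<Lambda> \<omega> \<longleftrightarrow> hh_cycle A d \<omega> \<and>
     (\<exists>\<eta>\<in>hh_chains A (d + 1). neq0 A (\<Lambda> 0 - \<omega> - hh_b A \<eta>))"

text \<open>The differential \<open>[m\<^sub>(\<^sub>1\<^sub>), f]\<close> of a Hochschild cochain \<open>f\<close> of degree \<open>e\<close> as a map of tensor powers of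
  \<open>sA\<close>. Hochschild cochains are the one-block components of operations.\<close>

definition hh_codiff :: "('r::comm_ring_1, 'm) dga \<Rightarrow> int \<Rightarrow> ('r, 'm) opn \<Rightarrow> ('r, 'm) opn" where
  "hh_codiff A e f bl =
     nec 1 (- 1) e (dga_ops A) f bl - pm_scale (sgn_pow e) (nec 1 e (- 1) f (dga_ops A) bl)"

text \<open>\<open>g\<^sub>\<phi>(\<omega>)(b\<^sub>1, \<dots>, b\<^sub>m) = \<Sum> \<plusminus> u a\<^sub>0 v\<close>, where \<open>u \<otimes> v = \<phi>(b\<^sub>1, \<dots>, b\<^sub>m; a\<^sub>1, \<dots>, a\<^sub>k)\<close> and \<open>e\<close> is the degree of
  \<open>\<phi>\<close> as a map of tensor powers of \<open>sA\<close>. The sign is the Koszul sign, with the triple product written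
  as an iterate of the product of \<open>dga_ops\<close>.\<close>

definition gmap ::
  "('r::comm_ring_1, 'm) dga \<Rightarrow> int \<Rightarrow> ('r, 'm) opn \<Rightarrow> ('r, 'm) tensor \<Rightarrow> 'm helem list \<Rightarrow> ('r, 'm) tensor"
  where
  "gmap A e \<phi> \<omega> bs = lin_ext (\<lambda>as. lin_ext (\<lambda>us. case us of
        [u, v] \<Rightarrow> Poly_Mapping.single [melt A (melt A u (hd as)) v]
          (sgn_pow (sdeg (tl as) * sdeg bs + e * sdeg [hd as] + sdeg [u] * sdeg [hd as]
             + deg (hd as)))
      | _ \<Rightarrow> 0) (\<phi> [bs, tl as])) \<omega>"

text \<open>\<open>[g\<^sub>\<phi>(\<omega>)] = 1\<close> in \<open>HH\<^sup>0(A)\<close>, for \<open>\<phi>\<close> the two-block component of \<open>m\<close>.\<close>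

definition compatible_with ::
  "('r::comm_ring_1, 'm) dga \<Rightarrow> int \<Rightarrow> ('r, 'm) opn \<Rightarrow> ('r, 'm) tensor \<Rightarrow> bool" where
  "compatible_with A n m \<omega> \<longleftrightarrow> (\<exists>f. multi_op (dmods A) 1 2 f \<and> (\<forall>bs\<in>hlists (dmods A).
     teq (dmods A) (gmap A (2 - n) m \<omega> bs - (if bs = [] then pt [uelt A] else 0))
       (hh_codiff A 2 f [bs])))"


section \<open>Smooth Calabi--Yau structures\<close>

text \<open>The inverse dualizing bimodule \<open>A\<^sup>!\<close> is represented by the Hochschild cochains with values in
  \<open>A \<otimes> A\<close>. Such a cochain is an operation with two blocks of which only the values on \<open>[[], as]\<close>
  matter: for \<open>\<phi>(as) = u \<otimes> v\<close>, the bimodule structure that enters the Hochschild differential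
  multiplies \<open>u\<close> from the right and \<open>v\<close> from the left, and the one that remains on \<open>A\<^sup>!\<close> multiplies
  \<open>u\<close> from the left and \<open>v\<close> from the right.\<close>

definition dual_diff ::
  "('r::comm_ring_1, 'm) dga \<Rightarrow> int \<Rightarrow> ('r, 'm) opn \<Rightarrow> 'm helem list \<Rightarrow> ('r, 'm) tensor" where
  "dual_diff A e \<phi> as =
     diff2 (ddiff A) (\<phi> [[], as]) +
     (if as = [] then 0 else
        lin_ext (\<lambda>us. case us of [u, v] \<Rightarrow> Poly_Mapping.single [melt A u (last as), v]
            (sgn_pow (sdeg [last as] * sdeg [v] + deg u)) | _ \<Rightarrow> 0) (\<phi> [[], butlast as]) +
        lin_ext (\<lambda>us. case us of [u, v] \<Rightarrow> Poly_Mapping.single [u, melt A (hd as) v]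
            (sgn_pow (e * sdeg [hd as] + sdeg [hd as] * sdeg [u] + sdeg [u] + deg (hd as)))
          | _ \<Rightarrow> 0) (\<phi> [[], tl as])) -
     pm_scale (sgn_pow e)
       ((\<Sum>i<length as. pm_scale (sgn_pow (sdeg (take i as))) (\<phi> [[], as[i := delt A (as ! i)]])) +
        (\<Sum>i<length as - 1. pm_scale (sgn_pow (sdeg (take i as) + deg (as ! i)))
           (\<phi> [[], take i as @ [melt A (as ! i) (as ! Suc i)] @ drop (i + 2) as])))"

text \<open>\<open>\<omega>\<close> is nondegenerate if the induced map \<open>A\<^sup>! \<rightarrow> A\<close>, \<open>\<phi> \<mapsto> \<Sum> \<plusminus> u a\<^sub>0 v\<close> (of degree \<open>d\<close>, up to the shift of
  the grading of cochains by two) is a quasi-isomorphism.\<close>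

definition nondegenerate :: "('r::comm_ring_1, 'm) dga \<Rightarrow> int \<Rightarrow> ('r, 'm) tensor \<Rightarrow> bool" where
  "nondegenerate A d \<omega> \<longleftrightarrow>
     (let M = dmods A;
          cocycle = (\<lambda>e \<phi>. multi_op M 2 e \<phi> \<and> (\<forall>as\<in>hlists M. teq M (dual_diff A e \<phi> as) 0))
      in \<forall>e. (\<forall>\<phi>. cocycle e \<phi> \<and>
               (\<exists>w\<in>carrier (M (d - 1 + e)).
                  teq M (gmap A e \<phi> \<omega> []) (pt [(d - 2 + e, ddiff A (d - 1 + e) w)])) \<longrightarrow>
               (\<exists>\<psi>. multi_op M 2 (e + 1) \<psi> \<and>
                  (\<forall>as\<in>hlists M. teq M (\<phi> [[], as]) (dual_diff A (e + 1) \<psi> as)))) \<and>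
             (\<forall>y\<in>cycles M (ddiff A) (d - 2 + e). \<exists>\<phi>. cocycle e \<phi> \<and>
               (\<exists>w\<in>carrier (M (d - 1 + e)).
                  teq M (pt [(d - 2 + e, y)])
                    (gmap A e \<phi> \<omega> [] + pt [(d - 2 + e, ddiff A (d - 1 + e) w)]))))"

text \<open>Smoothness of \<open>A\<close> is not part of the following definition. It is applied to \<open>A = C\<^sub>*(\<Omega>X)\<close> with \<open>X\<close> of
  the homotopy type of a finite complex, and these algebras are smooth.\<close>

definition smooth_CY :: "('r::comm_ring_1, 'm) dga \<Rightarrow> int \<Rightarrow> (nat \<Rightarrow> ('r, 'm) tensor) \<Rightarrow> bool" where
  "smooth_CY A n \<Lambda> \<longleftrightarrow> hc_cycle A n \<Lambda> \<and> (\<exists>\<omega>. hh_image A n \<Lambda> \<omega> \<and> nondegenerate A n \<omega>)"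

definition CY_lifts ::
  "('r::comm_ring_1, 'm) dga \<Rightarrow> int \<Rightarrow> ('r, 'm) tensor \<Rightarrow> (nat \<Rightarrow> ('r, 'm) tensor) set set" where
  "CY_lifts A n \<omega> = {hc_class A n \<Lambda> | \<Lambda>. smooth_CY A n \<Lambda> \<and> hh_image A n \<Lambda> \<omega>}"


section \<open>The space of pre-Calabi--Yau structures\<close>

definition vinf_of :: "('r, 'm) dga \<Rightarrow> ('r, 'm) opn \<Rightarrow> ('r, 'm) vinf" where
  "vinf_of A m = \<lparr>mods = dmods A, diff = ddiff A, ops = m\<rparr>"

definition pre_CY :: "('r::comm_ring_1, 'm) dga \<Rightarrow> int \<Rightarrow> ('r, 'm) opn \<Rightarrow> bool" where
  "pre_CY A n m \<longleftrightarrow> vinf_algebra n (vinf_of A m) \<and>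
     (\<forall>b\<in>hlists (dmods A). teq (dmods A) (m [b]) (dga_ops A [b]))"

definition pre_CY_space ::
  "('r::comm_ring_1, 'm) dga \<Rightarrow> int \<Rightarrow> ('r, 'm) tensor \<Rightarrow> ('r, 'm) opn set" where
  "pre_CY_space A n \<omega> = {m. pre_CY A n m \<and> compatible_with A n m \<omega>}"

text \<open>A one-simplex of the space: a structure with coefficients in the polynomial forms on \<open>[0, 1]\<close>, that
  is \<open>\<Sum>\<^sub>j \<mu>\<^sub>j t\<^sup>j + \<Sum>\<^sub>j \<eta>\<^sub>j t\<^sup>j dt\<close> (for each shape of the inputs a finite sum), satisfying
  \<open>\<mu>(t) \<circ> \<mu>(t) = 0\<close> and \<open>\<mu>'(t) = [\<mu>(t), \<eta>(t)]\<close> and having the given \<open>A\<^sub>\<infinity>\<close>-part. Its vertices are \<open>\<mu>(0)\<close> and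
  \<open>\<mu>(1)\<close>. The class \<open>[g\<^sub>\<phi>(\<omega>)]\<close> is constant along such a path.\<close>

definition pre_CY_edge ::
  "('r::comm_ring_1, 'm) dga \<Rightarrow> int \<Rightarrow> ('r, 'm) tensor \<Rightarrow> ('r, 'm) opn \<Rightarrow> ('r, 'm) opn \<Rightarrow> bool" where
  "pre_CY_edge A n \<omega> m m' \<longleftrightarrow> m \<in> pre_CY_space A n \<omega> \<and> m' \<in> pre_CY_space A n \<omega> \<and>
     (let M = dmods A; T = {bl. bl \<noteq> [] \<and> set bl \<subseteq> hlists M} in
      \<exists>\<mu> \<eta> :: nat \<Rightarrow> ('r, 'm) opn.
        (\<forall>j. sCH M n (- 1) (\<mu> j) \<and> sCH M n 0 (\<eta> j)) \<and>
        (\<forall>b\<in>hlists M. \<forall>j. teq M (\<eta> j [b]) 0 \<and>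
           teq M (\<mu> j [b]) (if j = 0 then dga_ops A [b] else 0)) \<and>
        (\<forall>bl\<in>T. \<forall>j. teq M (\<Sum>i\<le>j. nec n (- 1) (- 1) (\<mu> i) (\<mu> (j - i)) bl) 0) \<and>
        (\<forall>bl\<in>T. \<forall>j. teq M (pm_scale (of_nat (Suc j)) (\<mu> (Suc j) bl))
           (\<Sum>i\<le>j. nec n (- 1) 0 (\<mu> i) (\<eta> (j - i)) bl - nec n 0 (- 1) (\<eta> (j - i)) (\<mu> i) bl)) \<and>
        (\<forall>ks. \<exists>N. \<forall>bl\<in>T. map length bl = ks \<longrightarrow>
           (\<forall>j\<ge>N. teq M (\<mu> j bl) 0 \<and> teq M (\<eta> j bl) 0) \<and>
           teq M (m bl) (\<mu> 0 bl) \<and> teq M (m' bl) (\<Sum>j<N. \<mu> j bl)))"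

definition pi0_class ::
  "('r::comm_ring_1, 'm) dga \<Rightarrow> int \<Rightarrow> ('r, 'm) tensor \<Rightarrow> ('r, 'm) opn \<Rightarrow> ('r, 'm) opn set" where
  "pi0_class A n \<omega> m = {m' \<in> pre_CY_space A n \<omega>. equivclp (pre_CY_edge A n \<omega>) m m'}"

definition pi0_pre_CY ::
  "('r::comm_ring_1, 'm) dga \<Rightarrow> int \<Rightarrow> ('r, 'm) tensor \<Rightarrow> ('r, 'm) opn set set" where
  "pi0_pre_CY A n \<omega> = pi0_class A n \<omega> ` pre_CY_space A n \<omega>"

text \<open>The noncommutative Legendre transform enters only through the fact that, for every nondegenerate
  class \<open>[\<omega>]\<close>, it is a bijection between the lifts of \<open>[\<omega>]\<close> to smooth Calabi--Yau structures and the
  connected components of the space of pre-Calabi--Yau structures compatible with \<open>[\<omega>]\<close>. No formula for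
  it is used: \<open>\<L>\<close> stands for any family of such bijections.\<close>

definition legendre_bijection ::
  "('r::comm_ring_1, 'm) dga \<Rightarrow> int \<Rightarrow>
     (('r, 'm) tensor set \<Rightarrow> (nat \<Rightarrow> ('r, 'm) tensor) set \<Rightarrow> ('r, 'm) opn set) \<Rightarrow> bool" where
  "legendre_bijection A n \<L> \<longleftrightarrow> (\<forall>\<omega>. hh_cycle A n \<omega> \<and> nondegenerate A n \<omega> \<longrightarrow>
     bij_betw (\<L> (hh_class A n \<omega>)) (CY_lifts A n \<omega>) (pi0_pre_CY A n \<omega>))"


section \<open>Singular chains and local Poincare duality\<close>

type_synonym 'a simplex = "(nat \<Rightarrow> real) \<Rightarrow> 'a"

definition sing_mod :: "'a topology \<Rightarrow> int \<Rightarrow> ('r::comm_ring_1, 'a simplex \<Rightarrow>\<^sub>0 'r) module" where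
  "sing_mod X i = free_module (if i < 0 then {} else singular_simplex_set (nat i) X)"

definition sing_diff :: "int \<Rightarrow> ('a simplex \<Rightarrow>\<^sub>0 'r::comm_ring_1) \<Rightarrow> ('a simplex \<Rightarrow>\<^sub>0 'r)" where
  "sing_diff i = lin_ext (\<lambda>\<sigma>. if i \<le> 0 then 0
     else (\<Sum>k\<le>nat i. Poly_Mapping.single (singular_face (nat i) k \<sigma>) (sgn_pow (int k))))"

definition vertex :: "nat \<Rightarrow> nat \<Rightarrow> real" where
  "vertex i = (\<lambda>k. if k = i then 1 else 0)"

definition edge :: "'a simplex \<Rightarrow> nat \<Rightarrow> nat \<Rightarrow> real \<Rightarrow> 'a" where
  "edge \<sigma> i j = (\<lambda>t. \<sigma> (\<lambda>k. (1 - t) * vertex i k + t * vertex j k))"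

text \<open>A local system of modules: a fibre \<open>L x\<close> for every point and a transport map \<open>T g : L (g 0) \<rightarrow> L (g 1)\<close>
  for every path, functorial and depending only on the homotopy class relative to the end points.\<close>

definition local_system ::
  "'a topology \<Rightarrow> ('a \<Rightarrow> ('r::comm_ring_1, 'l) module) \<Rightarrow> ((real \<Rightarrow> 'a) \<Rightarrow> 'l \<Rightarrow> 'l) \<Rightarrow> bool" where
  "local_system X L T \<longleftrightarrow>
     (\<forall>x\<in>topspace X. is_module (L x) \<and> (\<forall>v\<in>carrier (L x). T (\<lambda>_. x) v = v)) \<and>
     (\<forall>g. pathin X g \<longrightarrow> linear_map (L (g 0)) (L (g 1)) (T g)) \<and>
     (\<forall>g h. pathin X g \<and> pathin X h \<and>
        homotopic_with (\<lambda>k. k 0 = g 0 \<and> k 1 = g 1) (subtopology euclideanreal {0..1}) X g h \<longrightarrow>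
        (\<forall>v\<in>carrier (L (g 0)). T g v = T h v)) \<and>
     (\<forall>g h. pathin X g \<and> pathin X h \<and> g 1 = h 0 \<longrightarrow>
        (\<forall>v\<in>carrier (L (g 0)). T (\<lambda>t. if t \<le> 1/2 then g (2 * t) else h (2 * t - 1)) v = T h (T g v)))"

text \<open>Chains and cochains with local coefficients; the coefficient of a simplex lives over its initial
  vertex. Only the values on singular simplices matter.\<close>

definition lcochains ::
  "'a topology \<Rightarrow> ('a \<Rightarrow> ('r::comm_ring_1, 'l) module) \<Rightarrow> nat \<Rightarrow> ('a simplex \<Rightarrow> 'l) set" where
  "lcochains X L p = {c. \<forall>\<sigma>. singular_simplex p X \<sigma> \<longrightarrow> c \<sigma> \<in> carrier (L (\<sigma> (vertex 0)))}"

definition lchains ::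
  "'a topology \<Rightarrow> ('a \<Rightarrow> ('r::comm_ring_1, 'l) module) \<Rightarrow> nat \<Rightarrow> ('a simplex \<Rightarrow> 'l) set" where
  "lchains X L p = {c \<in> lcochains X L p.
     finite {\<sigma>. singular_simplex p X \<sigma> \<and> c \<sigma> \<noteq> \<zero>\<^bsub>L (\<sigma> (vertex 0))\<^esub>}}"

definition lboundary ::
  "'a topology \<Rightarrow> ('a \<Rightarrow> ('r::comm_ring_1, 'l) module) \<Rightarrow> ((real \<Rightarrow> 'a) \<Rightarrow> 'l \<Rightarrow> 'l) \<Rightarrow> nat
     \<Rightarrow> ('a simplex \<Rightarrow> 'l) \<Rightarrow> 'a simplex \<Rightarrow> 'l" where
  "lboundary X L T p c \<tau> = finsum (L (\<tau> (vertex 0)))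
     (\<lambda>(\<sigma>, k). sgn_pow (int k) \<odot>\<^bsub>L (\<tau> (vertex 0))\<^esub> (if k = 0 then T (edge \<sigma> 0 1) (c \<sigma>) else c \<sigma>))
     {(\<sigma>, k). singular_simplex p X \<sigma> \<and> c \<sigma> \<noteq> \<zero>\<^bsub>L (\<sigma> (vertex 0))\<^esub> \<and> k \<le> p \<and> singular_face p k \<sigma> = \<tau>}"

definition lcoboundary ::
  "('a \<Rightarrow> ('r::comm_ring_1, 'l) module) \<Rightarrow> ((real \<Rightarrow> 'a) \<Rightarrow> 'l \<Rightarrow> 'l) \<Rightarrow> nat
     \<Rightarrow> ('a simplex \<Rightarrow> 'l) \<Rightarrow> 'a simplex \<Rightarrow> 'l" where
  "lcoboundary L T p c \<sigma> = finsum (L (\<sigma> (vertex 0)))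
     (\<lambda>k. sgn_pow (int k) \<odot>\<^bsub>L (\<sigma> (vertex 0))\<^esub>
        (if k = 0 then T (edge \<sigma> 1 0) (c (singular_face (Suc p) 0 \<sigma>))
         else c (singular_face (Suc p) k \<sigma>))) {..Suc p}"

text \<open>Cap product of the \<open>n\<close>-chain \<open>z\<close> with a \<open>p\<close>-cochain: the cochain is evaluated on the front
  \<open>p\<close>-face and the value is transported to the initial vertex of the back face.\<close>

definition lcap ::
  "('a \<Rightarrow> ('r::comm_ring_1, 'l) module) \<Rightarrow> ((real \<Rightarrow> 'a) \<Rightarrow> 'l \<Rightarrow> 'l) \<Rightarrow> nat \<Rightarrow> ('a simplex \<Rightarrow>\<^sub>0 'r)
     \<Rightarrow> nat \<Rightarrow> ('a simplex \<Rightarrow> 'l) \<Rightarrow> 'a simplex \<Rightarrow> 'l" where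
  "lcap L T n z p c \<tau> = finsum (L (\<tau> (vertex 0)))
     (\<lambda>\<sigma>. Poly_Mapping.lookup z \<sigma> \<odot>\<^bsub>L (\<tau> (vertex 0))\<^esub>
        T (edge \<sigma> 0 p) (c (restrict \<sigma> (standard_simplex p))))
     {\<sigma> \<in> Poly_Mapping.keys z.
        restrict (\<lambda>x. \<sigma> (\<lambda>i. if i < p then 0 else x (i - p))) (standard_simplex (n - p)) = \<tau>}"

text \<open>Cap product with \<open>z\<close> is a quasi-isomorphism \<open>C\<^sup>*(X, L) \<rightarrow> C\<^bsub>n-*\<^esub>(X, L)\<close>.\<close>

definition cap_quasi_iso ::
  "'a topology \<Rightarrow> nat \<Rightarrow> ('a simplex \<Rightarrow>\<^sub>0 'r::comm_ring_1) \<Rightarrow> ('a \<Rightarrow> ('r, 'l) module)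
     \<Rightarrow> ((real \<Rightarrow> 'a) \<Rightarrow> 'l \<Rightarrow> 'l) \<Rightarrow> bool" where
  "cap_quasi_iso X n z L T \<longleftrightarrow>
     (let eqon = (\<lambda>p c c'. \<forall>\<sigma>. singular_simplex p X \<sigma> \<longrightarrow> c \<sigma> = c' \<sigma>);
          zer = (\<lambda>\<sigma>. \<zero>\<^bsub>L (\<sigma> (vertex 0))\<^esub>);
          cyc = (\<lambda>q w. w \<in> lchains X L q \<and> (0 < q \<longrightarrow> eqon (q - 1) (lboundary X L T q w) zer));
          bdry = (\<lambda>q w. \<exists>v\<in>lchains X L (Suc q). eqon q w (lboundary X L T (Suc q) v));
          cocyc = (\<lambda>p c. c \<in> lcochains X L p \<and> eqon (Suc p) (lcoboundary L T p c) zer);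
          cobdry = (\<lambda>p c. if p = 0 then eqon 0 c zer
             else \<exists>c'\<in>lcochains X L (p - 1). eqon p c (lcoboundary L T (p - 1) c'))
      in (\<forall>p\<le>n. \<forall>c. cocyc p c \<and> bdry (n - p) (lcap L T n z p c) \<longrightarrow> cobdry p c) \<and>
         (\<forall>p\<le>n. \<forall>w. cyc (n - p) w \<longrightarrow> (\<exists>c. cocyc p c \<and>
            bdry (n - p) (\<lambda>\<sigma>. w \<sigma> \<ominus>\<^bsub>L (\<sigma> (vertex 0))\<^esub> lcap L T n z p c \<sigma>))) \<and>
         (\<forall>p>n. \<forall>c. cocyc p c \<longrightarrow> cobdry p c) \<and>
         (\<forall>q>n. \<forall>w. cyc q w \<longrightarrow> bdry q w))"

text \<open>A finite simplicial complex is given by its set of faces, on a finite set of natural numbers.\<close>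

definition finite_complex_type :: "'a topology \<Rightarrow> bool" where
  "finite_complex_type X \<longleftrightarrow> (\<exists>K :: nat set set. finite K \<and>
     (\<forall>s\<in>K. finite s \<and> s \<noteq> {} \<and> (\<forall>t\<subseteq>s. t \<noteq> {} \<longrightarrow> t \<in> K)) \<and>
     X homotopy_equivalent_space
       subtopology (powertop_real UNIV)
         {x. (\<forall>i. 0 \<le> x i) \<and> (\<exists>s\<in>K. (\<forall>i. i \<notin> s \<longrightarrow> x i = 0) \<and> (\<Sum>i\<in>s. x i) = 1)})"

text \<open>Local systems range over those whose fibres are carried by subsets of the type
  \<open>(real \<Rightarrow> 'a) set \<Rightarrow> 'r\<close>. Up to isomorphism these include the universal local system, with fibres the
  combinations of homotopy classes of paths from a base point; as \<open>X\<close> has the homotopy type of a finite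
  complex, duality for the latter implies duality for all local systems.\<close>

definition local_PD_pair :: "'a topology \<Rightarrow> nat \<Rightarrow> ('a simplex \<Rightarrow>\<^sub>0 'r::comm_ring_1) set \<Rightarrow> bool" where
  "local_PD_pair X n \<xi> \<longleftrightarrow> path_connected_space X \<and> topspace X \<noteq> {} \<and> finite_complex_type X \<and>
     \<xi> \<in> carrier (homology (sing_mod X) sing_diff (int n)) \<and>
     (\<forall>z\<in>\<xi>. \<forall>(L :: 'a \<Rightarrow> ('r, (real \<Rightarrow> 'a) set \<Rightarrow> 'r) module) T.
        local_system X L T \<longrightarrow> cap_quasi_iso X n z L T)"


section \<open>Moore loops\<close>

text \<open>A Moore path of length \<open>r\<close> is recorded as a path on the whole real line that is constant outside
  \<open>[0, r]\<close>.\<close>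

type_synonym 'a moore = "real \<times> (real \<Rightarrow> 'a)"

definition compact_open_topology :: "'b topology \<Rightarrow> 'a topology \<Rightarrow> ('b \<Rightarrow> 'a) topology" where
  "compact_open_topology Y X = topology_generated_by
     {{f. continuous_map Y X f \<and> f ` K \<subseteq> U} | K U. compactin Y K \<and> openin X U}"

definition moore_paths :: "'a topology \<Rightarrow> 'a moore topology" where
  "moore_paths X = subtopology (prod_topology euclideanreal (compact_open_topology euclideanreal X))
     {(r, g). 0 \<le> r \<and> (\<forall>t\<le>0. g t = g 0) \<and> (\<forall>t\<ge>r. g t = g r)}"

definition mstart :: "'a moore \<Rightarrow> 'a" where "mstart \<gamma> = snd \<gamma> 0"

definition mend :: "'a moore \<Rightarrow> 'a" where "mend \<gamma> = snd \<gamma> (fst \<gamma>)"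

definition mconst :: "'a \<Rightarrow> 'a moore" where "mconst x = (0, \<lambda>_. x)"

definition mconcat :: "'a moore \<Rightarrow> 'a moore \<Rightarrow> 'a moore" where
  "mconcat \<gamma> \<gamma>' =
     (fst \<gamma> + fst \<gamma>', \<lambda>t. if t \<le> fst \<gamma> then snd \<gamma> t else snd \<gamma>' (t - fst \<gamma>))"

definition loop_space :: "'a topology \<Rightarrow> 'a \<Rightarrow> 'a moore topology" where
  "loop_space X b = subtopology (moore_paths X) {\<gamma>. mstart \<gamma> = b \<and> mend \<gamma> = b}"

text \<open>The Eilenberg--Zilber shuffle product of simplices \<open>fs ! j\<close> of dimensions \<open>ps ! j\<close>. A shuffle is a
  word in which the letter \<open>j\<close> occurs \<open>ps ! j\<close> times, the \<open>i\<close>-th letter indicating the factor which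
  advances in the \<open>i\<close>-th step.\<close>

definition shuffles_of :: "nat list \<Rightarrow> nat list set" where
  "shuffles_of ps = {s. length s = sum_list ps \<and> (\<forall>j<length ps. count_list s j = ps ! j)}"

definition inversions :: "nat list \<Rightarrow> nat" where
  "inversions s = card {(i, j). i < j \<and> j < length s \<and> s ! i > s ! j}"

definition shuffle_push :: "nat list \<Rightarrow> nat \<Rightarrow> (nat \<Rightarrow> real) \<Rightarrow> nat \<Rightarrow> real" where
  "shuffle_push s j x = (\<lambda>l. \<Sum>i | i \<le> length s \<and> count_list (take i s) j = l. x i)"

definition cross :: "nat list \<Rightarrow> 'a simplex list \<Rightarrow> ((nat \<Rightarrow> 'a) simplex \<Rightarrow>\<^sub>0 'r::comm_ring_1)" where
  "cross ps fs = (\<Sum>s\<in>shuffles_of ps. Poly_Mapping.single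
     (restrict (\<lambda>x. \<lambda>j\<in>{..<length ps}. (fs ! j) (shuffle_push s j x)) (standard_simplex (sum_list ps)))
     (sgn_pow (int (inversions s))))"

fun expand :: "('k \<Rightarrow>\<^sub>0 'r::comm_ring_1) list \<Rightarrow> ('k list \<Rightarrow>\<^sub>0 'r)" where
  "expand [] = pt []"
| "expand (c # cs) = lin_ext (\<lambda>k. lin_ext (\<lambda>ks. pt (k # ks)) (expand cs)) c"

definition ez :: "('a simplex \<Rightarrow>\<^sub>0 'r::comm_ring_1) helem list \<Rightarrow> ((nat \<Rightarrow> 'a) simplex \<Rightarrow>\<^sub>0 'r)" where
  "ez as = lin_ext (cross (map (nat \<circ> fst) as)) (expand (map snd as))"

definition loop_dga :: "'a topology \<Rightarrow> 'a \<Rightarrow> ('r::comm_ring_1, 'a moore simplex \<Rightarrow>\<^sub>0 'r) dga" where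
  "loop_dga X b = \<lparr>dmods = sing_mod (loop_space X b), ddiff = sing_diff,
     dmult = (\<lambda>i j x y. lin_ext (\<lambda>h. pt (restrict (\<lambda>t. mconcat (h t 0) (h t 1))
        (standard_simplex (nat i + nat j)))) (ez [(i, x), (j, y)])),
     dunit = pt (restrict (\<lambda>_. mconst b) (standard_simplex 0))\<rparr>"


section \<open>The Calabi--Yau structure induced by the fundamental class\<close>

text \<open>Let \<open>N\<^sub>k\<close> be the space of cyclically composable \<open>(k + 1)\<close>-tuples of Moore paths, that is of free Moore
  loops divided into \<open>k + 1\<close> segments. Composition and insertion of paths of length zero make \<open>N\<close> a
  cyclic space all of whose terms are homotopy equivalent to the free loop space. It receives cyclic maps
  from the constant cyclic space \<open>X\<close> (constant loops) and from the cyclic bar construction of the based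
  loop space. On chains the latter gives for path-connected \<open>X\<close>, via the shuffle product, a quasi-isomorphism of mixed complexes
  from the Hochschild complex of \<open>C\<^sub>*(\<Omega>X)\<close>, and this is how the inclusion of constant loops induces a map
  from \<open>H\<^sub>n(X)\<close> to negative cyclic homology.\<close>

definition cyc_nerve :: "'a topology \<Rightarrow> nat \<Rightarrow> (nat \<Rightarrow> 'a moore) topology" where
  "cyc_nerve X k = subtopology (product_topology (\<lambda>_. moore_paths X) {..k})
     {\<gamma>. \<forall>i\<le>k. mend (\<gamma> i) = mstart (\<gamma> ((i + 1) mod (k + 1)))}"

definition cyc_face :: "nat \<Rightarrow> nat \<Rightarrow> (nat \<Rightarrow> 'a moore) \<Rightarrow> (nat \<Rightarrow> 'a moore)" where
  "cyc_face k i \<gamma> = (\<lambda>j\<in>{..k - 1}.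
     if i < k then (if j < i then \<gamma> j else if j = i then mconcat (\<gamma> i) (\<gamma> (i + 1)) else \<gamma> (j + 1))
     else (if j = 0 then mconcat (\<gamma> k) (\<gamma> 0) else \<gamma> j))"

text \<open>Rotate so that the \<open>i\<close>-th segment comes first and insert a segment of length zero in front.\<close>

definition cyc_shift :: "nat \<Rightarrow> nat \<Rightarrow> (nat \<Rightarrow> 'a moore) \<Rightarrow> (nat \<Rightarrow> 'a moore)" where
  "cyc_shift k i \<gamma> = (\<lambda>j\<in>{..k + 1}.
     if j = 0 then mconst (mstart (\<gamma> i)) else \<gamma> ((i + j - 1) mod (k + 1)))"

text \<open>The total complex: a basis element \<open>(k, f)\<close> of degree \<open>d\<close> is a simplex \<open>f\<close> of dimension \<open>d - k\<close> in
  \<open>N\<^sub>k\<close>. It is degenerate if one of its segments other than the first has length zero.\<close>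

type_synonym ('r, 'a) nerve_chain = "nat \<times> (nat \<Rightarrow> 'a moore) simplex \<Rightarrow>\<^sub>0 'r"

definition nerve_chains :: "'a topology \<Rightarrow> int \<Rightarrow> ('r::comm_ring_1, 'a) nerve_chain set" where
  "nerve_chains X d = {c. Poly_Mapping.keys c \<subseteq>
     {(k, f). int k \<le> d \<and> singular_simplex (nat (d - int k)) (cyc_nerve X k) f}}"

definition nerve_degenerate :: "int \<Rightarrow> ('r::comm_ring_1, 'a) nerve_chain \<Rightarrow> bool" where
  "nerve_degenerate d c \<longleftrightarrow> Poly_Mapping.keys c \<subseteq>
     {(k, f). \<exists>i\<in>{1..k}. \<forall>x\<in>standard_simplex (nat (d - int k)). fst (f x i) = 0}"

definition nerve_b :: "int \<Rightarrow> ('r::comm_ring_1, 'a) nerve_chain \<Rightarrow> ('r, 'a) nerve_chain" where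
  "nerve_b d = lin_ext (\<lambda>(k, f). let p = nat (d - int k) in
     (if p = 0 then 0
      else (\<Sum>i\<le>p. Poly_Mapping.single (k, singular_face p i f) (sgn_pow (int i)))) +
     (if k = 0 then 0
      else (\<Sum>i\<le>k. Poly_Mapping.single
        (k - 1, restrict (\<lambda>x. cyc_face k i (f x)) (standard_simplex p)) (sgn_pow (int (p + i))))))"

definition nerve_B :: "int \<Rightarrow> ('r::comm_ring_1, 'a) nerve_chain \<Rightarrow> ('r, 'a) nerve_chain" where
  "nerve_B d = lin_ext (\<lambda>(k, f). let p = nat (d - int k) in
     (\<Sum>i\<le>k. Poly_Mapping.single
        (k + 1, restrict (\<lambda>x. cyc_shift k i (f x)) (standard_simplex p)) (sgn_pow (int (p + i * k)))))"

definition hh_to_nerve ::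
  "('r::comm_ring_1, 'a moore simplex \<Rightarrow>\<^sub>0 'r) tensor \<Rightarrow> ('r, 'a) nerve_chain" where
  "hh_to_nerve = lin_ext (\<lambda>as. pm_scale (sgn_pow (\<Sum>j<length as. int j * deg (as ! j)))
     (lin_ext (\<lambda>f. pt (length as - 1, f)) (ez as)))"

definition const_to_nerve :: "nat \<Rightarrow> ('a simplex \<Rightarrow>\<^sub>0 'r::comm_ring_1) \<Rightarrow> ('r, 'a) nerve_chain" where
  "const_to_nerve n = lin_ext (\<lambda>\<sigma>.
     pt (0, restrict (\<lambda>x. \<lambda>j\<in>{..0}. mconst (\<sigma> x)) (standard_simplex n)))"

text \<open>\<open>\<Lambda>\<close> represents the class in \<open>HC\<^sup>-\<^sub>n(C\<^sub>*(\<Omega>X))\<close> induced by \<open>\<xi> \<in> H\<^sub>n(X)\<close>: in the negative cyclic complex of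
  \<open>N\<close> it becomes homologous to the constant loops at a cycle representing \<open>\<xi>\<close>.\<close>

definition induced_CY ::
  "'a topology \<Rightarrow> 'a \<Rightarrow> nat \<Rightarrow> ('a simplex \<Rightarrow>\<^sub>0 'r::comm_ring_1) set
     \<Rightarrow> (nat \<Rightarrow> ('r, 'a moore simplex \<Rightarrow>\<^sub>0 'r) tensor) \<Rightarrow> bool" where
  "induced_CY X b n \<xi> \<Lambda> \<longleftrightarrow> hc_cycle (loop_dga X b) (int n) \<Lambda> \<and>
     (\<exists>z\<in>\<xi>. \<exists>\<eta>. \<forall>i. let d = int n + 2 * int i in
        \<eta> i \<in> nerve_chains X (d + 1) \<and>
        nerve_degenerate d (hh_to_nerve (\<Lambda> i) - (if i = 0 then const_to_nerve n z else 0)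
          - (nerve_b (d + 1) (\<eta> i) + (if i = 0 then 0 else nerve_B (d - 1) (\<eta> (i - 1))))))"

text \<open>\<open>m\<close> corresponds under \<open>\<L>\<close> to the smooth Calabi--Yau structure induced by \<open>\<xi>\<close>.\<close>

definition compatible_with_fundamental_class ::
  "'a topology \<Rightarrow> 'a \<Rightarrow> nat \<Rightarrow> ('a simplex \<Rightarrow>\<^sub>0 'r::comm_ring_1) set \<Rightarrow>
     (('r, 'a moore simplex \<Rightarrow>\<^sub>0 'r) tensor set \<Rightarrow> (nat \<Rightarrow> ('r, 'a moore simplex \<Rightarrow>\<^sub>0 'r) tensor) set
        \<Rightarrow> ('r, 'a moore simplex \<Rightarrow>\<^sub>0 'r) opn set) \<Rightarrow>
     ('r, 'a moore simplex \<Rightarrow>\<^sub>0 'r) opn \<Rightarrow> bool" where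
  "compatible_with_fundamental_class X b n \<xi> \<L> m \<longleftrightarrow>
     (let A = loop_dga X b in \<exists>\<Lambda> \<omega>.
        induced_CY X b n \<xi> \<Lambda> \<and> smooth_CY A (int n) \<Lambda> \<and> hh_image A (int n) \<Lambda> \<omega> \<and>
        m \<in> pre_CY_space A (int n) \<omega> \<and>
        \<L> (hh_class A (int n) \<omega>) (hc_class A (int n) \<Lambda>) = pi0_class A (int n) \<omega> m)"

end

theory Submission
 imports Defs
begin

text \<open>
  A \<open>V\<^sub>\<infinity>\<close>-structure consists of an \<open>A\<^sub>\<infinity>\<close>-algebra \<open>A\<close> and operations with several outputs. The proof is about the
  copairing \<open>\<phi>([], y)\<close>, which has two outputs, and whose inputs \<open>y\<close> all lie in one block. The relations say
  that \<open>y \<mapsto> \<phi>([], y)\<close> is a Hochschild cocycle with values in \<open>A \<otimes> A\<close> (\<open>copairing_relation\<close>). On homology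
  the induced operations are the product and the element \<open>\<phi>([], [])\<close> of degree \<open>- n\<close>; as \<open>n \<ge> 1\<close> and the homology
  lives in nonnegative degrees, the copairing on homology is zero. Compatibility with \<open>[X]\<close> says that
  the copairing on chains of the based loop space is far from zero: contracted with the fundamental cycle it gives
  the unit. The proof turns this difference into a homotopy invariant.

  Choose an augmentation \<open>\<epsilon>\<close> of the part of \<open>A\<close> in nonnegative degrees; for the loop space it is the sum of the
  coefficients of a 0-chain. Consider multiadditive cochains on words \<open>e, a\<^sub>1, \<dots>, a\<^sub>k, e'\<close>, where the ends \<open>e\<close> and
  \<open>e'\<close> are elements of \<open>A\<close> or scalars on which \<open>A\<close> acts through \<open>\<epsilon>\<close>: these are the duals of two-sided bar
  constructions, and \<open>D\<close> is the dual of the bar differential. Cocycles \<open>G\<close> and \<open>G'\<close> can be applied to the outputs of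
  the copairing, which yields a cochain \<open>cc G G'\<close> on words with two scalar ends. It is a cocycle, and its class
  depends only on the classes of \<open>G\<close> and \<open>G'\<close> (\<open>cc_Leibniz\<close>). The structure is called obstructed if some such class
  is not zero. This property is invariant under quasi-isomorphisms (\<open>obstructed_iff\<close>): a quasi-isomorphism induces a
  quasi-isomorphism on cochains (\<open>cone_acyclic\<close>), since over the rationals it has an additive homotopy inverse, and
  the leading part of \<open>D\<close> with respect to word length only involves the differential of \<open>A\<close>.

  If the copairing vanishes, then \<open>cc G G' = 0\<close> and nothing is obstructed. For the loop space, \<open>G\<close> and \<open>G'\<close> are the
  cocycles that evaluate a word \<open>e, e'\<close> by \<open>\<epsilon>\<close> on the nonscalar end. Suppose that \<open>cc G G' = D \<gamma>\<close>. The values of \<open>\<gamma>\<close> on words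
  between scalar ends form a Hochschild cochain with trivial coefficients whose coboundary is \<open>\<epsilon> \<otimes> \<epsilon>\<close> applied to the
  copairing, up to sign. Contracted with the fundamental Hochschild cycle \<open>\<omega>\<close>, it shows that
  \<open>\<epsilon> (g\<^sub>\<phi>(\<omega>)) = 0\<close>. But \<open>g\<^sub>\<phi>(\<omega>)\<close> differs from \<open>1\<close> by a coboundary, on which \<open>\<epsilon>\<close> is zero, so that
  \<open>\<epsilon> (g\<^sub>\<phi>(\<omega>)) = 1\<close> (\<open>compatible_implies_obstruction\<close>).

  Two points need care because modules over \<open>R\<close> need be neither free nor flat. First, homotopy inverses are only additive,
  so that cochains are additive too, while the outputs of the copairing live in a tensor product over \<open>R\<close>. A functional
  \<open>lam\<close> of rank one on the additive endomorphisms of \<open>R\<close>, with values in the residue field at a minimal prime, turns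
  additive cochains into \<open>R\<close>-linear ones at one end. Secondly, the augmentation must be transported along
  quasi-isomorphisms, and for this reason it is defined on a set of cycles of degree zero only.
\<close>

text \<open>Subscripts of module operations are written \<open>x \<oplus>`M` y\<close>.\<close>

syntax "_index" :: "logic => index" ("(00`_`)")

abbreviation ksg where "ksg == sgn_pow"
abbreviation lookup where "lookup == Poly_Mapping.lookup"
abbreviation keys where "keys == Poly_Mapping.keys"
abbreviation single where "single == Poly_Mapping.single"

section \<open>Modules, tensors and their evaluation\<close>

lemma module_groundD: "is_module M ==> Module.module ground_ring M" by (simp add: is_module_def)

lemma carrier_ground [simp]: "x : carrier ground_ring" by (simp add: ground_ring_def)

lemma ground_ops [simp]: "\<one>`ground_ring` = 1" "\<zero>`ground_ring` = 0"
  "x \<otimes>`ground_ring` y = x * y" "x \<oplus>`ground_ring` y = x + y" by (simp_all add: ground_ring_def)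

lemma ground_cring: "cring (ground_ring :: 'r::comm_ring_1 ring)"
proof (rule cringI)
 show "abelian_group (ground_ring :: 'r ring)" by (rule abelian_groupI) (auto simp: algebra_simps intro: bexI[of _ "- _"])
 show "Group.comm_monoid (ground_ring :: 'r ring)" by (rule comm_monoidI) (auto simp: algebra_simps)
qed (auto simp: algebra_simps)

lemma is_moduleI:
 fixes M :: "('r::comm_ring_1, 'm) module"
 assumes "abelian_group M" and "!!r x. x : carrier M ==> r \<odot>`M` x : carrier M"
  and "!!r s x. x : carrier M ==> (r + s) \<odot>`M` x = r \<odot>`M` x \<oplus>`M` s \<odot>`M` x"
  and "!!r x y. x : carrier M ==> y : carrier M ==>
   r \<odot>`M` (x \<oplus>`M` y) = r \<odot>`M` x \<oplus>`M` r \<odot>`M` y"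
  and "!!r s x. x : carrier M ==> (r * s) \<odot>`M` x = r \<odot>`M` (s \<odot>`M` x)"
  and "!!x. x : carrier M ==> 1 \<odot>`M` x = x"
 shows "is_module M" unfolding is_module_def by (rule moduleI[OF ground_cring]) (simp_all add: assms)

context
 fixes M :: "('r::comm_ring_1, 'm) module" (structure)
 assumes M: "is_module M"
begin

interpretation Module.module ground_ring M by (rule module_groundD[OF M])

lemma mod_closed:
 "x : carrier M ==> y : carrier M ==> x \<oplus> y : carrier M" "\<zero> : carrier M"
 "x : carrier M ==> r \<odot> x : carrier M" "x : carrier M ==> \<ominus> x : carrier M" by auto

lemma mod_laws:
 "x : carrier M ==> y : carrier M ==> x \<oplus> y = y \<oplus> x"
 "x : carrier M ==> y : carrier M ==> z : carrier M ==> (x \<oplus> y) \<oplus> z = x \<oplus> (y \<oplus> z)"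
 "x : carrier M ==> \<zero> \<oplus> x = x" "x : carrier M ==> x \<oplus> \<zero> = x"
 "x : carrier M ==> x \<oplus> \<ominus> x = \<zero>" "x : carrier M ==> \<ominus> x \<oplus> x = \<zero>"
 "x : carrier M ==> (r + s) \<odot> x = r \<odot> x \<oplus> s \<odot> x"
 "x : carrier M ==> y : carrier M ==> r \<odot> (x \<oplus> y) = r \<odot> x \<oplus> r \<odot> y"
 "x : carrier M ==> (r * s) \<odot> x = r \<odot> (s \<odot> x)"
 "x : carrier M ==> 1 \<odot> x = x" "x : carrier M ==> 0 \<odot> x = \<zero>" "r \<odot> \<zero> = \<zero>"
 "x : carrier M ==> (- r) \<odot> x = \<ominus> (r \<odot> x)" "x : carrier M ==> \<ominus> (\<ominus> x) = x"
 "x : carrier M ==> y : carrier M ==> \<ominus> (x \<oplus> y) = \<ominus> x \<oplus> \<ominus> y" "\<ominus> \<zero> = \<zero>"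
 "x : carrier M ==> y : carrier M ==> z : carrier M ==> x \<oplus> (y \<oplus> z) = y \<oplus> (x \<oplus> z)"
 using smult_l_distr[of r s x] smult_assoc1[of r s x] smult_one[of x] smult_l_null[of x] smult_r_null[of r]
  smult_l_distr[of "- r" r x] M.minus_equality[of "(- r) \<odot> x" "r \<odot> x"]
 by (simp_all add: M.a_ac M.r_neg M.l_neg smult_r_distr M.minus_add)

lemma mod_cancel:
 assumes "x : carrier M" "y : carrier M" "z : carrier M"
 shows "x \<oplus> y = x \<oplus> z \<longleftrightarrow> y = z" and "y \<oplus> x = z \<oplus> x \<longleftrightarrow> y = z"
 using assms by auto

end

lemma linear_mapD:
 assumes "linear_map M N f"
 shows "x : carrier M ==> f x : carrier N"
  and "x : carrier M ==> y : carrier M ==> f (x \<oplus>`M` y) = f x \<oplus>`N` f y"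
  and "x : carrier M ==> f (r \<odot>`M` x) = r \<odot>`N` f x"
 using assms by (auto simp: linear_map_def)

lemma linear_map_zero:
 assumes "is_module M" "is_module N" "linear_map M N f"
 shows "f \<zero>`M` = \<zero>`N`"
 using linear_mapD(3)[OF assms(3), of "\<zero>`M`" 0] linear_mapD(1)[OF assms(3), of "\<zero>`M`"]
  mod_laws(11,12)[OF assms(1)] mod_laws(11)[OF assms(2)] mod_closed(2)[OF assms(1)] by simp

lemma linear_map_neg:
 assumes "is_module M" "is_module N" "linear_map M N f" "x : carrier M"
 shows "f (\<ominus>`M` x) = \<ominus>`N` f x"
 using linear_mapD(3)[OF assms(3,4), of "- 1"] linear_mapD(1)[OF assms(3,4)] assms(4)
 by (simp add: mod_laws(13)[OF assms(1)] mod_laws(13)[OF assms(2)] mod_laws(10)[OF assms(1)] mod_laws(10)[OF assms(2)])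

lemma sgn_pow_add: "ksg (a + b) = ksg a * ksg b" by (simp add: sgn_pow_def)

lemma sgn_pow_simps [simp]: "ksg 0 = 1" "ksg 1 = - 1" "ksg a * ksg a = 1"
 "ksg a * (ksg a * t) = t" by (simp_all add: sgn_pow_def)

lemma sgn_pow_cong: "even a = even b ==> ksg a = ksg b" by (simp add: sgn_pow_def)

lemma sgn_pow_opp: "even a ~= even b ==> ksg a = - ksg b" by (auto simp add: sgn_pow_def)

subsection \<open>Evaluation of formal combinations\<close>

text \<open>A functional on formal combinations that need not be linear over the ground ring: the
  coefficient is passed to it together with the basis element.\<close>

definition EV :: "('r::comm_ring_1 => 'k => 't::ab_group_add) => ('k \<Rightarrow>\<^sub>0 'r) => 't" where
 "EV F p = (\<Sum>k\<in>keys p. F (lookup p k) k)"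

definition coef_add :: "('r::comm_ring_1 => 'k => 't::ab_group_add) => bool" where
 "coef_add F \<longleftrightarrow> (\<forall>r s k. F (r + s) k = F r k + F s k)"

lemma coef_add_zero: "coef_add F ==> F 0 k = 0" unfolding coef_add_def by (metis add.right_neutral add_left_cancel)

lemma EV_superset:
 assumes "coef_add F" "finite K" "keys p \<subseteq> K"
 shows "EV F p = (\<Sum>k\<in>K. F (lookup p k) k)" unfolding EV_def
 by (rule sum.mono_neutral_left) (use assms in \<open>auto simp: in_keys_iff coef_add_zero\<close>)

lemma EV_add:
 assumes "coef_add F"
 shows "EV F (p + q) = EV F p + EV F q"
proof -
 let ?K = "keys p \<union> keys q"
 have "EV F (p + q) = (\<Sum>k\<in>?K. F (lookup (p + q) k) k)"
  by (rule EV_superset) (use assms Poly_Mapping.keys_add[of p q] in auto)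
 also have "... = (\<Sum>k\<in>?K. F (lookup p k) k) + (\<Sum>k\<in>?K. F (lookup q k) k)"
  using assms by (simp add: lookup_add coef_add_def sum.distrib)
 also have "... = EV F p + EV F q" using assms by (simp add: EV_superset[of F ?K])
 finally show ?thesis .
qed

lemma EV_zero [simp]: "EV F 0 = 0" by (simp add: EV_def)

lemma EV_neg: "coef_add F ==> EV F (- p) = - EV F p" using EV_add[of F p "- p"] by (simp add: add_eq_0_iff)

lemma EV_diff: "coef_add F ==> EV F (p - q) = EV F p - EV F q" using EV_add[of F p "- q"] by (simp add: EV_neg)

lemma EV_sum: "coef_add F ==> EV F (\<Sum>i\<in>I. g i) = (\<Sum>i\<in>I. EV F (g i))"
 by (induction I rule: infinite_finite_induct) (simp_all add: EV_add)

lemma EV_sum_list: "coef_add F ==> EV F (\<Sum>i\<leftarrow>I. g i) = (\<Sum>i\<leftarrow>I. EV F (g i))"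
 by (induction I) (simp_all add: EV_add)

lemma EV_single [simp]: "coef_add F ==> EV F (single k r) = F r k"
 by (cases "r = 0") (simp_all add: EV_def coef_add_zero)

lemma lookup_pm_scale [simp]: "lookup (pm_scale r p) k = r * lookup p k"
 by (simp add: pm_scale_def Poly_Mapping.map.rep_eq when_def)

lemma pm_scale_single [simp]: "pm_scale r (single k s) = single k (r * s)"
 by (rule poly_mapping_eqI) (simp add: lookup_single when_def)

lemma keys_pm_scale: "keys (pm_scale r p) \<subseteq> keys p" by (auto simp: in_keys_iff)

lemma pm_scale_simps: "pm_scale r (p + q) = pm_scale r p + pm_scale r q"
  "pm_scale (r + s) p = pm_scale r p + pm_scale s p"
  "pm_scale r (pm_scale s p) = pm_scale (r * s) p" "pm_scale 1 p = p" "pm_scale 0 p = 0"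
  "pm_scale r 0 = 0" "pm_scale (- r) p = - pm_scale r p" by (rule poly_mapping_eqI; simp add: lookup_add algebra_simps)+

lemma pm_module: "Modules.module (pm_scale :: 'r::comm_ring_1 => ('k \<Rightarrow>\<^sub>0 'r) => _)"
 by unfold_locales (simp_all add: pm_scale_simps)

lemma EV_pm_scale:
 assumes "coef_add F"
 shows "EV F (pm_scale s p) = EV (%r. F (s * r)) p"
proof -
 have "EV F (pm_scale s p) = (\<Sum>k\<in>keys p. F (lookup (pm_scale s p) k) k)"
  by (rule EV_superset) (use assms keys_pm_scale[of s p] in auto)
 then show ?thesis by (simp add: EV_def)
qed

lemma EV_lin_ext:
 assumes "coef_add F"
 shows "EV F (lin_ext g p) = EV (%r k. EV (%s. F (r * s)) (g k)) p"
 by (simp add: lin_ext_def EV_sum[OF assms] EV_pm_scale[OF assms]) (simp add: EV_def)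

lemma coef_add_scale: "coef_add F ==> coef_add (%r. F (s * r))" by (simp add: coef_add_def distrib_left)

lemma EV_cong: "(!!k. k : keys p ==> F (lookup p k) k = G (lookup p k) k)
  ==> EV F p = EV G p" by (simp add: EV_def)

lemma EV_mult_right: "EV (%r k. F r k * (t :: 't::comm_ring_1)) p = EV F p * t" by (simp add: EV_def sum_distrib_right)

lemma EV_mult_left: "EV (%r k. t * F r k) p = (t :: 't::comm_ring_1) * EV F p" by (simp add: EV_def sum_distrib_left)

lemma EV_distrib: "EV (%r k. F r k + G r k) p = EV F p + EV G p" by (simp add: EV_def sum.distrib)

lemma lin_ext_single [simp]: "lin_ext g (single k r) = pm_scale r (g k)"
 by (cases "r = 0") (simp_all add: lin_ext_def pm_scale_simps)

lemma lin_ext_zero [simp]: "lin_ext g 0 = 0" by (simp add: lin_ext_def)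

lemma pm_expand: "p = (\<Sum>k\<in>keys p. pm_scale (lookup p k) (pt k))"
 by (simp add: poly_mapping_eqI lookup_sum lookup_single when_def in_keys_iff)

lemma hlists_simps [simp]: "[] : hlists M" "(a # as) : hlists M \<longleftrightarrow> snd a : carrier (M (fst a)) & as : hlists M"
  "as @ bs : hlists M \<longleftrightarrow> as : hlists M & bs : hlists M" by (auto simp: hlists_def split: prod.splits)

text \<open>The functionals that are well defined on tensors.\<close>

definition balanced ::
 "(int => ('r::comm_ring_1, 'm) module) => ('r => 'm helem list => 't::ab_group_add) => bool" where
 "balanced M F \<longleftrightarrow> coef_add F &
  (\<forall>as bs d x y r. as : hlists M & bs : hlists M & x : carrier (M d) & y : carrier (M d) -->
    F r (as @ [(d, x \<oplus>`M d` y)] @ bs) = F r (as @ [(d, x)] @ bs) + F r (as @ [(d, y)] @ bs)) &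
  (\<forall>as bs d x r s. as : hlists M & bs : hlists M & x : carrier (M d) -->
    F r (as @ [(d, s \<odot>`M d` x)] @ bs) = F (r * s) (as @ [(d, x)] @ bs))"

lemma balanced_coef_add: "balanced M F ==> coef_add F" by (simp add: balanced_def)

lemma EV_tensor_gens:
 assumes "balanced M F" "g : tensor_gens M"
 shows "EV F g = 0"
 using assms(1) assms(2) by (auto simp: tensor_gens_def balanced_def EV_diff)

text \<open>The tensor relations are combinations of generators, so that a functional which kills the generators kills them.\<close>

lemma EV_span:
 fixes F :: "'r::comm_ring_1 => 'm helem list => 't::ab_group_add"
 assumes "p : Modules.module.span pm_scale (tensor_gens M)"
 shows "balanced M F ==> EV F p = 0"
proof -
 have "\<forall>F :: 'r => 'm helem list => 't. balanced M F --> EV F p = 0" using assms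
 proof (induction rule: Modules.module.span_induct_alt[OF pm_module, consumes 1])
  case 1
  then show ?case by simp
 next
  case (2 c x y)
  show ?case
  proof (intro allI impI)
   fix F :: "'r => 'm helem list => 't"
   assume F: "balanced M F"
   have "balanced M (%r. F (c * r))" using F unfolding balanced_def by (auto simp: coef_add_scale mult.assoc)
   then have "EV (%r. F (c * r)) x = 0" using 2(1) by (rule EV_tensor_gens)
   then show "EV F (pm_scale c x + y) = 0" using F 2 balanced_coef_add[OF F] by (simp add: EV_add EV_pm_scale)
  qed
 qed
 then show "balanced M F ==> EV F p = 0" by blast
qed

lemma teq_EV: "teq M p q ==> balanced M F ==> EV F p = EV F q"
 unfolding teq_def using EV_span[of "p - q" M F] balanced_coef_add[of M F] by (simp add: EV_diff)

lemma teq_refl [simp]: "teq M p p" by (simp add: teq_def Modules.module.span_zero[OF pm_module])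

lemma teq_sym: "teq M p q ==> teq M q p" unfolding teq_def using Modules.module.span_neg[OF pm_module, of "p - q"] by simp

lemma teq_trans: "teq M p q ==> teq M q r ==> teq M p r"
 unfolding teq_def using Modules.module.span_add[OF pm_module, of "p - q" _ "q - r"] by simp

lemma teq_add: "teq M p q ==> teq M p' q' ==> teq M (p + p') (q + q')"
 unfolding teq_def using Modules.module.span_add[OF pm_module, of "p - q" _ "p' - q'"] by (simp add: algebra_simps)

lemma teq_scale: "teq M p q ==> teq M (pm_scale r p) (pm_scale r q)"
proof -
 have "pm_scale r p - pm_scale r q = pm_scale r (p - q)" by (rule poly_mapping_eqI) (simp add: lookup_minus algebra_simps)
 then show "teq M p q ==> teq M (pm_scale r p) (pm_scale r q)"
  unfolding teq_def using Modules.module.span_scale[OF pm_module, of "p - q" _ r] by simp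
qed

lemma teq_pt_add:
 assumes "as : hlists M" "bs : hlists M" "x : carrier (M d)" "y : carrier (M d)"
 shows "teq M (pt (as @ [(d, x \<oplus>`M d` y)] @ bs)) (pt (as @ [(d, x)] @ bs) + pt (as @ [(d, y)] @ bs))"
 unfolding teq_def diff_diff_eq[symmetric]
 by (rule Modules.module.span_base[OF pm_module]) (use assms in \<open>unfold tensor_gens_def, blast\<close>)

lemma teq_pt_smult:
 assumes "as : hlists M" "bs : hlists M" "x : carrier (M d)"
 shows "teq M (pt (as @ [(d, r \<odot>`M d` x)] @ bs)) (pm_scale r (pt (as @ [(d, x)] @ bs)))" unfolding teq_def
 by (rule Modules.module.span_base[OF pm_module]) (use assms in \<open>unfold tensor_gens_def, blast\<close>)

lemma keys_span:
 assumes "p : Modules.module.span pm_scale (tensor_gens M)" "!!i. is_module (M i)"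
 shows "keys p \<subseteq> hlists M" using assms(1)
proof (induction rule: Modules.module.span_induct_alt[OF pm_module, consumes 1])
 case 1
 then show ?case by simp
next
 case (2 c x y)
 have x: "keys x \<subseteq> hlists M"
 proof -
  consider as bs d u v where "as : hlists M" "bs : hlists M" "u : carrier (M d)" "v : carrier (M d)"
    "x = pt (as @ [(d, u \<oplus>`M d` v)] @ bs) - pt (as @ [(d, u)] @ bs) - pt (as @ [(d, v)] @ bs)"
   | as bs d r u where "as : hlists M" "bs : hlists M" "u : carrier (M d)"
    "x = pt (as @ [(d, r \<odot>`M d` u)] @ bs) - pm_scale r (pt (as @ [(d, u)] @ bs))"
   using 2(1) unfolding tensor_gens_def by blast
  then show ?thesis
  proof cases
   case 1
   then have "\<forall>k. k \<notin> hlists M --> lookup x k = 0" using mod_closed(1)[OF assms(2)]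
    by (auto simp: lookup_minus lookup_single when_def)
   then show ?thesis by (auto simp: in_keys_iff)
  next
   case 2
   then have "\<forall>k. k \<notin> hlists M --> lookup x k = 0" using mod_closed(3)[OF assms(2)]
    by (auto simp: lookup_minus lookup_single when_def)
   then show ?thesis by (auto simp: in_keys_iff)
  qed
 qed
 then show ?case using 2 keys_pm_scale[of c x] Poly_Mapping.keys_add[of "pm_scale c x" y] by blast
qed

section \<open>The residue field at a minimal prime and rank one functionals\<close>

definition mult_set :: "'r::comm_ring_1 set => bool" where
 "mult_set S \<longleftrightarrow> 1 : S & 0 \<notin> S & (\<forall>a\<in>S. \<forall>b\<in>S. a * b : S)"

text \<open>A maximal multiplicative set is the complement of a minimal prime; zero is excluded, so that the ring must be nontrivial,
  as it is by the class of commutative rings with one.\<close>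

definition maxmult :: "'r::comm_ring_1 set" where
 "maxmult = (SOME S. mult_set S & (\<forall>T. mult_set T --> S \<subseteq> T --> T = S))"

lemma maxmult_exists: "\<exists>S :: 'r::comm_ring_1 set. mult_set S & (\<forall>T. mult_set T --> S \<subseteq> T --> T = S)"
proof -
 let ?\<A> = "{S :: 'r set. mult_set S}"
 have "\<exists>S\<in>?\<A>. \<forall>T\<in>?\<A>. S \<subseteq> T --> T = S"
 proof (rule subset_Zorn_nonempty)
  have "{1::'r} : ?\<A>" by (simp add: mult_set_def)
  then show "?\<A> ~= {}" by blast
 next
  fix \<C> assume c: "\<C> ~= {}" "subset.chain ?\<A> \<C>"
  have m: "mult_set S" if "S : \<C>" for S using c(2) that unfolding subset_chain_def by blast
  have "a * b : \<Union>\<C>" if ab: "a : \<Union>\<C>" "b : \<Union>\<C>" for a b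
  proof -
   obtain S T where S: "S : \<C>" "a : S" "T : \<C>" "b : T" using ab by blast
   then have "S \<subseteq> T \<or> T \<subseteq> S" using c(2) unfolding subset_chain_def by blast
   then show ?thesis using S m unfolding mult_set_def by blast
  qed
  then show "\<Union>\<C> : ?\<A>" using c(1) m unfolding mult_set_def by blast
 qed
 then show ?thesis by blast
qed

lemma maxmult_props: "mult_set (maxmult :: 'r::comm_ring_1 set)"
  "mult_set T ==> maxmult \<subseteq> T ==> T = (maxmult :: 'r set)"
 using someI_ex[OF maxmult_exists, folded maxmult_def] by blast+

lemma maxmult_closed [simp]: "1 : maxmult" "0 \<notin> maxmult" "a : maxmult ==> b : maxmult ==> a * b : maxmult"
 using maxmult_props(1) by (auto simp: mult_set_def)

text \<open>By maximality the multiplicative set generated by \<open>a\<close> and \<open>maxmult\<close> contains zero: elements of a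
  minimal prime are nilpotent in the localization.\<close>

lemma maxmult_nil:
 assumes "a \<notin> (maxmult :: 'r::comm_ring_1 set)"
 shows "\<exists>t\<in>maxmult. \<exists>k. t * a ^ k = 0"
proof (rule ccontr)
 assume n: "~ (\<exists>t\<in>maxmult. \<exists>k. t * a ^ k = 0)"
 let ?T = "{t * a ^ k | t k. t : maxmult}"
 have "mult_set ?T" unfolding mult_set_def
 proof (intro conjI ballI)
  show "1 : ?T" by (rule CollectI, rule exI[of _ 1], rule exI[of _ 0]) simp
  show "0 \<notin> ?T" using n by auto
  fix x y assume "x : ?T" "y : ?T"
  then obtain t k t' k' where "x = t * a ^ k" "t : maxmult" "y = t' * a ^ k'" "t' : maxmult" by blast
  then have "x * y = (t * t') * a ^ (k + k')" "t * t' : maxmult" by (simp_all add: power_add algebra_simps)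
  then show "x * y : ?T" by blast
 qed
 moreover have "maxmult \<subseteq> ?T"
 proof
  fix t :: 'r assume "t : maxmult"
  then show "t : ?T" by (intro CollectI exI[of _ t] exI[of _ 0]) simp
 qed
 ultimately have "?T = maxmult" by (rule maxmult_props(2))
 moreover have "a : ?T" by (rule CollectI, rule exI[of _ 1], rule exI[of _ 1]) simp
 ultimately show False using assms by simp
qed

lemma np_mult: "a \<notin> maxmult ==> r * a \<notin> maxmult"
proof
 assume a: "a \<notin> maxmult" and r: "r * a : maxmult"
 obtain t k where t: "t : maxmult" "t * a ^ k = 0" using maxmult_nil[OF a] by blast
 have "(r * a) ^ k : maxmult" by (induction k) (use r in auto)
 then have "t * (r * a) ^ k : maxmult" using t by simp
 moreover have "t * (r * a) ^ k = r ^ k * (t * a ^ k)" by (simp add: power_mult_distrib algebra_simps)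
 ultimately show False using t by simp
qed

lemma np_add: "a \<notin> maxmult ==> b \<notin> maxmult ==> a + b \<notin> maxmult"
proof
 assume a: "a \<notin> maxmult" and b: "b \<notin> maxmult" and ab: "a + b : maxmult"
 obtain t k where t: "t : maxmult" "t * a ^ k = 0" using maxmult_nil[OF a] by blast
 obtain u l where u: "u : maxmult" "u * b ^ l = 0" using maxmult_nil[OF b] by blast
 have z: "t * u * (of_nat (k + l choose i) * a ^ i * b ^ (k + l - i)) = 0" for i
 proof (cases "k \<le> i")
  case True
  then have "a ^ i = a ^ k * a ^ (i - k)" by (simp flip: power_add)
  then have "t * u * (of_nat (k + l choose i) * a ^ i * b ^ (k + l - i))
   = (t * a ^ k) * (u * (of_nat (k + l choose i) * a ^ (i - k) * b ^ (k + l - i)))" by (simp add: algebra_simps)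
  then show ?thesis using t by simp
 next
  case False
  then have "k + l - i = l + (k - i)" by simp
  then have "b ^ (k + l - i) = b ^ l * b ^ (k - i)" by (simp only: power_add)
  then have "t * u * (of_nat (k + l choose i) * a ^ i * b ^ (k + l - i))
   = (u * b ^ l) * (t * (of_nat (k + l choose i) * a ^ i * b ^ (k - i)))" by (simp add: algebra_simps)
  then show ?thesis using u by simp
 qed
 have "t * u * (a + b) ^ (k + l) = 0" by (simp only: binomial_ring sum_distrib_left z sum.neutral_const)
 moreover have "(a + b) ^ j : maxmult" for j by (induction j) (use ab in auto)
 ultimately show False using t u maxmult_closed(2,3) by metis
qed

lemma np_uminus: "- a \<notin> maxmult \<longleftrightarrow> a \<notin> maxmult" using np_mult[of a "- 1"] np_mult[of "- a" "- 1"] by auto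

lemma np_prime: "t : maxmult ==> t * a \<notin> maxmult ==> a \<notin> maxmult"
 using maxmult_closed(3) by blast

text \<open>Fractions with denominators in a maximal multiplicative set, modulo the maximal ideal of the
  localization: the residue field at a minimal prime.\<close>

definition frac_rel :: "'r::comm_ring_1 \<times> 'r => 'r \<times> 'r => bool" where
 "frac_rel x y \<longleftrightarrow> snd x : maxmult & snd y : maxmult & fst x * snd y - fst y * snd x \<notin> maxmult"

lemma frac_rel_simp [simp]: "frac_rel (a, s) (b, t) \<longleftrightarrow> s : maxmult & t : maxmult & a * t - b * s \<notin> maxmult"
 by (simp add: frac_rel_def)

quotient_type (overloaded) 'r residue_field = "'r::comm_ring_1 \<times> 'r" / partial: frac_rel
proof (rule part_equivpI)
 show "\<exists>x :: 'r \<times> 'r. frac_rel x x" by (rule exI[of _ "(0, 1)"]) simp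
 show "symp (frac_rel :: 'r \<times> 'r => _)"
 proof (rule sympI)
  fix x y :: "'r \<times> 'r" assume "frac_rel x y"
  then show "frac_rel y x" using np_uminus[of "fst x * snd y - fst y * snd x"] by (simp add: frac_rel_def)
 qed
 show "transp (frac_rel :: 'r \<times> 'r => _)"
 proof (rule transpI)
  fix x y z :: "'r \<times> 'r" assume xy: "frac_rel x y" and yz: "frac_rel y z"
  have "snd z * (fst x * snd y - fst y * snd x) + snd x * (fst y * snd z - fst z * snd y) \<notin> maxmult"
   by (rule np_add) (use xy yz in \<open>simp_all add: frac_rel_def np_mult\<close>)
  then have "snd y * (fst x * snd z - fst z * snd x) \<notin> maxmult" by (simp add: algebra_simps)
  then show "frac_rel x z" using xy yz np_prime[of "snd y" "fst x * snd z - fst z * snd x"] by (simp add: frac_rel_def)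
 qed
qed

instantiation residue_field :: (comm_ring_1) comm_ring_1

begin

lift_definition zero_residue_field :: "'a residue_field" is "(0, 1)" by simp

lift_definition one_residue_field :: "'a residue_field" is "(1, 1)" by simp

lift_definition plus_residue_field :: "'a residue_field => 'a residue_field => 'a residue_field"
 is "%x y. (fst x * snd y + fst y * snd x, snd x * snd y)"
proof -
 fix x x' y y' :: "'a \<times> 'a" assume x: "frac_rel x x'" and y: "frac_rel y y'"
 have "(snd y * snd y') * (fst x * snd x' - fst x' * snd x) + (snd x * snd x') * (fst y * snd y' - fst y' * snd y) \<notin> maxmult"
  by (rule np_add) (use x y in \<open>simp_all add: frac_rel_def np_mult\<close>)
 then show "frac_rel (fst x * snd y + fst y * snd x, snd x * snd y) (fst x' * snd y' + fst y' * snd x', snd x' * snd y')"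
  using x y by (simp add: frac_rel_def algebra_simps)
qed

lift_definition uminus_residue_field :: "'a residue_field => 'a residue_field" is "%x. (- fst x, snd x)"
 subgoal for x y using np_uminus[of "fst x * snd y - fst y * snd x"] by (simp add: frac_rel_def)
 done

definition minus_residue_field :: "'a residue_field => 'a residue_field => 'a residue_field" where
 "minus_residue_field x y = x + - y"

lift_definition times_residue_field :: "'a residue_field => 'a residue_field => 'a residue_field"
 is "%x y. (fst x * fst y, snd x * snd y)"
proof -
 fix x x' y y' :: "'a \<times> 'a" assume x: "frac_rel x x'" and y: "frac_rel y y'"
 have "(fst y * snd y') * (fst x * snd x' - fst x' * snd x) + (fst x' * snd x) * (fst y * snd y' - fst y' * snd y) \<notin> maxmult"
  by (rule np_add) (use x y in \<open>simp_all add: frac_rel_def np_mult\<close>)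
 then show "frac_rel (fst x * fst y, snd x * snd y) (fst x' * fst y', snd x' * snd y')" using x y by (simp add: frac_rel_def algebra_simps)
qed

instance
proof
 fix a b c :: "'a residue_field"
 show "a * b * c = a * (b * c)" by transfer (simp add: frac_rel_def algebra_simps)
 show "a * b = b * a" by transfer (simp add: frac_rel_def algebra_simps)
 show "1 * a = a" by transfer (simp add: frac_rel_def algebra_simps)
 show "a + b + c = a + (b + c)" by transfer (simp add: frac_rel_def algebra_simps)
 show "a + b = b + a" by transfer (simp add: frac_rel_def algebra_simps)
 show "0 + a = a" by transfer (simp add: frac_rel_def algebra_simps)
 show "- a + a = 0" by transfer (simp add: frac_rel_def algebra_simps)
 show "a - b = a + - b" by (simp add: minus_residue_field_def)
 show "(a + b) * c = a * c + b * c" by transfer (simp add: frac_rel_def algebra_simps)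
 show "(0 :: 'a residue_field) ~= 1" by transfer (simp add: frac_rel_def np_uminus)
qed

end

definition fraction :: "'r::comm_ring_1 => 'r => 'r residue_field" where
 "fraction a s = abs_residue_field (a, s)"

definition res :: "'r::comm_ring_1 => 'r residue_field" where "res r = fraction r 1"

lemma fraction_eq:
 "s : maxmult ==> t : maxmult ==> fraction a s = fraction b t \<longleftrightarrow> a * t - b * s \<notin> maxmult"
 using Quotient3_rel[OF Quotient3_residue_field, of "(a, s)" "(b, t)"] by (simp add: fraction_def)

lemma fraction_add:
 "s : maxmult ==> t : maxmult ==> fraction a s + fraction b t = fraction (a * t + b * s) (s * t)"
 using plus_residue_field.abs_eq[of "(a, s)" "(b, t)"] by (simp add: fraction_def)

lemma fraction_mult:
 "s : maxmult ==> t : maxmult ==> fraction a s * fraction b t = fraction (a * b) (s * t)"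
 using times_residue_field.abs_eq[of "(a, s)" "(b, t)"] by (simp add: fraction_def)

lemma res_simps [simp]: "res (a + b) = res a + res b" "res (a * b) = res a * res b" "res 0 = 0" "res 1 = 1"
proof -
 show "res (a + b) = res a + res b" by (simp add: res_def fraction_add)
 show "res (a * b) = res a * res b" by (simp add: res_def fraction_mult)
 show "res 0 = 0" by (simp add: res_def fraction_def zero_residue_field_def)
 show "res 1 = 1" by (simp add: res_def fraction_def one_residue_field_def)
qed

lemma res_uminus [simp]: "res (- a) = - res a" using res_simps(1)[of a "- a"] by (simp add: add_eq_0_iff)

lemma res_sgn_pow [simp]: "res (ksg k) = ksg k" by (simp add: sgn_pow_def)

text \<open>Every element \<open>a\<close> of the prime is nilpotent in the localization. To add it to \<open>F\<close>, multiply the annihilator of \<open>F\<close> by the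
  highest power of \<open>a\<close> that leaves it different from zero there.\<close>

lemma common_annihilator:
 assumes "finite F" "F \<inter> (maxmult :: 'r::comm_ring_1 set) = {}"
 shows "\<exists>s. (\<forall>a\<in>F. s * a = 0) & (\<forall>t\<in>maxmult. t * s ~= 0)" using assms
proof (induction F rule: finite_induct)
 case empty
 have "\<forall>t\<in>maxmult. t * (1::'r) ~= 0" using maxmult_closed(2) by (metis mult_1_right)
 then show ?case by blast
next
 case (insert a F)
 then have "F \<inter> maxmult = {}" and a: "a \<notin> maxmult" by auto
 then obtain s where s: "\<forall>b\<in>F. s * b = 0" "\<forall>t\<in>maxmult. t * s ~= 0" using insert.IH by blast
 let ?P = "%j. \<exists>t\<in>maxmult. t * s * a ^ j = 0"
 obtain t k where t: "t : maxmult" "t * a ^ k = 0" using maxmult_nil[OF a] by blast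
 have "t * s * a ^ k = s * (t * a ^ k)" by (simp add: algebra_simps)
 then have "\<exists>j. ?P j" using t by (intro exI[of _ k] bexI[of _ t]) simp_all
 then have P: "?P (LEAST j. ?P j)" by (rule LeastI_ex)
 define j where "j = (LEAST j. ?P j)"
 have j0: "j ~= 0"
 proof
  assume "j = 0"
  then have "?P 0" using P unfolding j_def by simp
  then show False using s(2) by simp
 qed
 obtain u where u: "u : maxmult" "u * s * a ^ j = 0" using P unfolding j_def[symmetric] by blast
 define s' where "s' = u * s * a ^ (j - 1)"
 have "a ^ j = a ^ (j - 1) * a" using j0 by (cases j) (simp_all add: mult.commute)
 then have "s' * a = 0" using u(2) by (simp add: s'_def mult.assoc)
 moreover have "s' * b = 0" if "b : F" for b
 proof -
  have "s' * b = u * a ^ (j - 1) * (s * b)" by (simp add: s'_def algebra_simps)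
  then show ?thesis using s(1) that by simp
 qed
 moreover have "t' * s' ~= 0" if "t' : maxmult" for t'
 proof
  assume "t' * s' = 0"
  then have "?P (j - 1)" using u(1) that by (intro bexI[of _ "t' * u"]) (simp_all add: s'_def mult.assoc)
  then show False using not_less_Least[of "j - 1" ?P] j0 unfolding j_def by simp
 qed
 ultimately show ?case by blast
qed

definition additive_endo :: "('r::comm_ring_1 => 'r) => bool" where
 "additive_endo h \<longleftrightarrow> (\<forall>x y. h (x + y) = h x + h y)"

definition endo_submodule :: "('r::comm_ring_1 => 'r) set => bool" where
 "endo_submodule N \<longleftrightarrow> N \<subseteq> Collect additive_endo & (%_. 0) : N &
  (\<forall>h\<in>N. \<forall>k\<in>N. (%x. h x + k x) : N) & (\<forall>r. \<forall>h\<in>N. (%x. h (x * r)) : N)"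

text \<open>A functional of rank one on the additive endomorphisms of \<open>R\<close>, on which \<open>R\<close> acts by
  precomposition. The kernel is a submodule maximal among those which contain \<open>p E\<close> and do not meet the
  multiples of the identity by elements outside \<open>p\<close>.\<close>

lemma rank_one_functional:
 "\<exists>lam :: ('r::comm_ring_1 => 'r) => 'r residue_field.
  (\<forall>h k. additive_endo h --> additive_endo k --> lam (%x. h x + k x) = lam h + lam k) &
  (\<forall>r h. additive_endo h --> lam (%x. h (x * r)) = res r * lam h) & lam (%x. x) = 1"
proof -
 (* This set takes the place of p E: endomorphisms that vanish on the annihilator of finitely many elements of p. *)
 define N0 :: "('r => 'r) set" where "N0 = {h. additive_endo h &
  (\<exists>F. finite F & F \<inter> maxmult = {} & (\<forall>s. (\<forall>a\<in>F. s * a = 0) --> h s = 0))}"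
 let ?good = "%N. endo_submodule N & N0 \<subseteq> N & (\<forall>r\<in>maxmult. (%x. x * r) \<notin> N)"
 have N0: "?good N0"
 proof (intro conjI)
  show "endo_submodule N0" unfolding endo_submodule_def
  proof (intro conjI ballI allI)
   show "N0 \<subseteq> Collect additive_endo" by (auto simp: N0_def)
   show "(%_. 0) : N0" unfolding N0_def by (auto simp: additive_endo_def intro: exI[of _ "{}"])
  next
   fix h k assume "h : N0" "k : N0"
   then obtain F G where "additive_endo h" "additive_endo k" "finite F" "F \<inter> maxmult = {}" "finite G"
     "G \<inter> maxmult = {}" "\<forall>s. (\<forall>a\<in>F. s * a = 0) --> h s = 0" "\<forall>s. (\<forall>a\<in>G. s * a = 0) --> k s = 0"
    unfolding N0_def by blast
   then show "(%x. h x + k x) : N0" unfolding N0_def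
    by (auto simp: additive_endo_def algebra_simps intro!: exI[of _ "F \<union> G"])
  next
   fix r h assume "h : N0"
   then obtain F where F: "additive_endo h" "finite F" "F \<inter> maxmult = {}"
     "\<forall>s. (\<forall>a\<in>F. s * a = 0) --> h s = 0" unfolding N0_def by blast
   have "h (s * r) = 0" if "\<forall>a\<in>F. s * a = 0" for s
   proof -
    have "s * r * a = 0" if "a : F" for a
    proof -
     have "s * r * a = (s * a) * r" by (simp add: algebra_simps)
     then show ?thesis using \<open>\<forall>a\<in>F. s * a = 0\<close> that by simp
    qed
    then have "\<forall>a\<in>F. (s * r) * a = 0" by blast
    then show ?thesis using F(4) by blast
   qed
   then show "(%x. h (x * r)) : N0" unfolding N0_def using F by (auto simp: additive_endo_def distrib_right intro!: exI[of _ F])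
  qed
  show "\<forall>r\<in>maxmult. (%x. x * r) \<notin> N0"
  proof (intro ballI notI)
   fix r :: 'r assume r: "r : maxmult" "(%x. x * r) : N0"
   then obtain F where F: "finite F" "F \<inter> maxmult = {}" "\<forall>s. (\<forall>a\<in>F. s * a = 0) --> s * r = 0"
    unfolding N0_def by blast
   obtain s where "\<forall>a\<in>F. s * a = 0" "\<forall>t\<in>maxmult. t * s ~= 0" using common_annihilator[OF F(1,2)] by blast
   then show False using F(3) r(1) by (metis mult.commute)
  qed
 qed simp
 have "\<exists>N\<in>Collect ?good. \<forall>M\<in>Collect ?good. N \<subseteq> M --> M = N"
 proof (rule subset_Zorn_nonempty)
  show "Collect ?good ~= {}" using N0 by blast
 next
  fix \<C> assume c: "\<C> ~= {}" "subset.chain (Collect ?good) \<C>"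
  have m: "?good N" if "N : \<C>" for N using c(2) that unfolding subset_chain_def by blast
  have ex2: "\<exists>N\<in>\<C>. h : N & k : N" if hk: "h : \<Union>\<C>" "k : \<Union>\<C>" for h k
  proof -
   obtain S T where S: "S : \<C>" "h : S" "T : \<C>" "k : T" using hk by blast
   then have "S \<subseteq> T \<or> T \<subseteq> S" using c(2) unfolding subset_chain_def by blast
   then show ?thesis using S by blast
  qed
  have "endo_submodule (\<Union>\<C>)" unfolding endo_submodule_def
  proof (intro conjI ballI allI)
   show "\<Union>\<C> \<subseteq> Collect additive_endo" using m unfolding endo_submodule_def by blast
   show "(%_. 0) : \<Union>\<C>" using m c(1) unfolding endo_submodule_def by blast
   fix h k assume "h : \<Union>\<C>" "k : \<Union>\<C>"
   then obtain N where "N : \<C>" "h : N" "k : N" using ex2 by blast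
   then show "(%x. h x + k x) : \<Union>\<C>" using m[of N] unfolding endo_submodule_def by blast
  next
   fix r h assume "h : \<Union>\<C>"
   then obtain N where "N : \<C>" "h : N" by blast
   then show "(%x. h (x * r)) : \<Union>\<C>" using m[of N] unfolding endo_submodule_def by blast
  qed
  moreover have "N0 \<subseteq> \<Union>\<C>" using m c(1) by blast
  moreover have "\<forall>r\<in>maxmult. (%x. x * r) \<notin> \<Union>\<C>" using m by blast
  ultimately show "\<Union>\<C> : Collect ?good" by blast
 qed
 then obtain N where good: "?good N" and maxN: "\<forall>M\<in>Collect ?good. N \<subseteq> M --> M = N" by (elim bexE) simp
 have N: "endo_submodule N" "N0 \<subseteq> N" "\<forall>r\<in>maxmult. (%x. x * r) \<notin> N" using good by simp_all
 have max: "M = N" if "?good M" "N \<subseteq> M" for M using maxN that by simp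
 have Nz: "(%_. 0) : N" and Nadd: "!!h k. h : N ==> k : N ==> (%x. h x + k x) : N"
  and Nsc: "!!r h. h : N ==> (%x. h (x * r)) : N" and Nae: "!!h. h : N ==> additive_endo h"
  using N(1) unfolding endo_submodule_def by blast+
 have ae0: "h 0 = 0" if "additive_endo h" for h :: "'r => 'r"
  using that unfolding additive_endo_def by (metis add.right_neutral add_left_cancel)
 have aem: "h (- x) = - h x" if "additive_endo h" for h :: "'r => 'r" and x
  using that ae0[OF that] unfolding additive_endo_def by (metis add.right_inverse add_eq_0_iff)
 have Nneg: "(%x. - h x) : N" if "h : N" for h using Nsc[OF that, of "- 1"] aem[OF Nae[OF that]] by simp
 have pN: "(%x. h (x * a)) : N" if "additive_endo h" "a \<notin> maxmult" for h a
 proof -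
  have "(%x. h (x * a)) : N0" unfolding N0_def
   using that ae0[OF that(1)] by (auto simp: additive_endo_def distrib_right intro!: exI[of _ "{a}"])
  then show ?thesis using N(2) by blast
 qed
 text \<open>\<open>h \<mapsto> r / t\<close> if \<open>t h - r id\<close> lies in \<open>N\<close>\<close>
 let ?R = "%h r t. t : maxmult & (%x. h (x * t) - x * r) : N"
 have ex: "\<exists>r t. ?R h r t" if h: "additive_endo h" for h
 proof (cases "h : N")
  case True
  then show ?thesis by (intro exI[of _ 0] exI[of _ 1]) simp
 next
  case False
  let ?M = "{%x. k x + h (x * t) | k t. k : N}"
  have "endo_submodule ?M" unfolding endo_submodule_def
  proof (intro conjI ballI allI)
   show "?M \<subseteq> Collect additive_endo" using h Nae by (auto simp: additive_endo_def algebra_simps)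
   show "(%_. 0) : ?M" by (rule CollectI, rule exI[of _ "%_. 0"], rule exI[of _ 0]) (simp add: Nz ae0[OF h])
   fix k l assume "k : ?M" "l : ?M"
   then obtain k' t l' u where *: "k = (%x. k' x + h (x * t))" "k' : N" "l = (%x. l' x + h (x * u))" "l' : N"
    by blast
   then have "(%x. k x + l x) = (%x. (k' x + l' x) + h (x * (t + u)))"
    using h by (simp add: additive_endo_def algebra_simps)
   then show "(%x. k x + l x) : ?M" using Nadd[OF *(2,4)]
    by (intro CollectI exI[of _ "%x. k' x + l' x"] exI[of _ "t + u"] conjI)
  next
   fix r k assume "k : ?M"
   then obtain k' t where *: "k = (%x. k' x + h (x * t))" "k' : N" by blast
   then have "(%x. k (x * r)) = (%x. k' (x * r) + h (x * (r * t)))" by (simp add: mult.assoc)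
   then show "(%x. k (x * r)) : ?M" using Nsc[OF *(2), of r]
    by (intro CollectI exI[of _ "%x. k' (x * r)"] exI[of _ "r * t"] conjI)
  qed
  moreover have NM: "N \<subseteq> ?M"
  proof
   fix k assume "k : N"
   then show "k : ?M" by (intro CollectI exI[of _ k] exI[of _ 0]) (simp add: ae0[OF h])
  qed
  moreover have "h : ?M" by (rule CollectI, rule exI[of _ "%_. 0"], rule exI[of _ 1]) (simp add: Nz)
  ultimately have "~ (\<forall>r\<in>maxmult. (%x. x * r) \<notin> ?M)" using max[of ?M] False N(2) by blast
  then obtain r k t where r: "r : maxmult" "k : N" and eq: "(%x. x * r) = (%x. k x + h (x * t))" by blast
  have "t : maxmult"
  using Nadd r pN h N(3) by (fastforce simp: eq)
  moreover have "(%x. h (x * t) - x * r) = (%x. - k x)" using eq by (metis add_diff_cancel_right' minus_diff_eq)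
  ultimately show ?thesis using Nneg[OF r(2)] by (intro exI[of _ r] exI[of _ t]) simp
 qed
 have un: "fraction r t = fraction r' t'" if "?R h r t" "?R h r' t'" "additive_endo h" for h r t r' t'
 proof -
  have "(%x. (h (x * t' * t) - x * t' * r) + - (h (x * t * t') - x * t * r')) : N"
   by (rule Nadd[OF Nsc[of "%x. h (x * t) - x * r"] Nneg[OF Nsc[of "%x. h (x * t') - x * r'"]]]) (use that in auto)
  also have "(%x. (h (x * t' * t) - x * t' * r) + - (h (x * t * t') - x * t * r')) = (%x. x * (r' * t - r * t'))"
   by (simp add: algebra_simps)
  finally have "r' * t - r * t' \<notin> maxmult" using N(3) by blast
  then show ?thesis using that np_uminus[of "r' * t - r * t'"] by (simp add: fraction_eq)
 qed
 define lam where "lam h = (SOME q. \<exists>r t. ?R h r t & q = fraction r t)" for h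
 have lam: "lam h = fraction r t" if "?R h r t" "additive_endo h" for h r t
 proof -
  have "\<exists>r t. ?R h r t & lam h = fraction r t" unfolding lam_def by (rule someI_ex) (use that in blast)
  then show ?thesis using un[OF _ that(1) that(2)] by auto
 qed
 show ?thesis
 proof (intro exI[of _ lam] conjI allI impI)
  fix h k :: "'r => 'r" assume h: "additive_endo h" and k: "additive_endo k"
  obtain r t where r: "?R h r t" using ex[OF h] by blast
  obtain r' t' where r': "?R k r' t'" using ex[OF k] by blast
  have "(%x. (h (x * t' * t) - x * t' * r) + (k (x * t * t') - x * t * r')) : N"
   by (rule Nadd[OF Nsc[of "%x. h (x * t) - x * r"] Nsc[of "%x. k (x * t') - x * r'"]]) (use r r' in auto)
  also have "(%x. (h (x * t' * t) - x * t' * r) + (k (x * t * t') - x * t * r'))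
    = (%x. (h (x * (t * t')) + k (x * (t * t'))) - x * (r * t' + r' * t))" by (simp add: algebra_simps)
  finally have "lam (%x. h x + k x) = fraction (r * t' + r' * t) (t * t')"
   by (intro lam) (use r r' h k in \<open>auto simp: additive_endo_def algebra_simps\<close>)
  also have "... = lam h + lam k" using lam[OF r h] lam[OF r' k] r r' by (simp add: fraction_add)
  finally show "lam (%x. h x + k x) = lam h + lam k" .
 next
  fix s and h :: "'r => 'r" assume h: "additive_endo h"
  obtain r t where r: "?R h r t" using ex[OF h] by blast
  have "(%x. h (x * s * t) - x * s * r) : N" by (rule Nsc[of "%x. h (x * t) - x * r"]) (use r in auto)
  also have "(%x. h (x * s * t) - x * s * r) = (%x. h (x * t * s) - x * (s * r))" by (simp add: algebra_simps)
  finally have "lam (%x. h (x * s)) = fraction (s * r) t"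
   by (intro lam) (use r h in \<open>auto simp: additive_endo_def algebra_simps\<close>)
  then show "lam (%x. h (x * s)) = res s * lam h" using lam[OF r h] r by (simp add: res_def fraction_mult)
 next
  have "lam (%x. x) = fraction 1 1" by (rule lam) (simp_all add: Nz additive_endo_def)
  then show "lam (%x. x) = 1" using res_simps(4) by (simp add: res_def)
 qed
qed

definition lam :: "('r::comm_ring_1 => 'r) => 'r residue_field" where
 "lam = (SOME lam.
  (\<forall>h k. additive_endo h --> additive_endo k --> lam (%x. h x + k x) = lam h + lam k) &
  (\<forall>r h. additive_endo h --> lam (%x. h (x * r)) = res r * lam h) & lam (%x. x) = 1)"

lemma lam_props:
 shows lam_add: "additive_endo h ==> additive_endo k ==> lam (%x. h x + k x) = lam h + lam k"
  and lam_smult: "additive_endo h ==> lam (%x. h (x * r)) = res r * lam h" and lam_id: "lam (%x. x) = 1"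
 using someI_ex[OF rank_one_functional, folded lam_def] by blast+

section \<open>Rational splittings\<close>

text \<open>The rational numbers as a subring of the ground ring. They form a field inside a rational algebra, so that linear
  algebra over them provides complements and contractions which need not exist over the ring itself.\<close>

definition rationals :: "'r::comm_ring_1 set" where
 "rationals = {r. \<exists>k>0. \<exists>a::int. of_nat k * r = of_int a}"

lemma rational_unit:
 assumes "rational_algebra TYPE('r::comm_ring_1)" "0 < k"
 obtains b :: "'r::comm_ring_1" where "of_nat k * b = 1" using assms unfolding rational_algebra_def dvd_def by metis

lemma rationals_closed:
 fixes r s :: "'r::comm_ring_1"
 shows "0 : (rationals :: 'r set)" "1 : (rationals :: 'r set)"
  and "r : rationals ==> s : rationals ==> r + s : (rationals :: 'r set)"
  and "r : rationals ==> s : rationals ==> r * s : (rationals :: 'r set)"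
  and "r : rationals ==> - r : (rationals :: 'r set)"
proof -
 show "0 : (rationals :: 'r set)" unfolding rationals_def by (intro CollectI exI[of _ 1] conjI exI[of _ 0]) simp_all
 show "1 : (rationals :: 'r set)" unfolding rationals_def by (intro CollectI exI[of _ 1] conjI exI[of _ 1]) simp_all
next
 assume "r : rationals" "s : rationals"
 then obtain k a l b where k: "0 < k" "of_nat k * r = of_int a" and l: "0 < l" "of_nat l * s = of_int b" unfolding rationals_def by blast
 have "of_nat (k * l) * (r + s) = of_nat l * (of_nat k * r) + of_nat k * (of_nat l * s)" by (simp add: algebra_simps)
 also have "... = of_int (int l * a + int k * b)" by (simp only: k l) simp
 finally show "r + s : rationals" unfolding rationals_def using k(1) l(1)
  by (intro CollectI exI[of _ "k * l"] conjI exI[of _ "int l * a + int k * b"]) simp_all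
 have "of_nat (k * l) * (r * s) = (of_nat k * r) * (of_nat l * s)" by (simp add: algebra_simps)
 also have "... = of_int (a * b)" by (simp only: k l) simp
 finally show "r * s : rationals" unfolding rationals_def using k(1) l(1)
  by (intro CollectI exI[of _ "k * l"] conjI exI[of _ "a * b"]) simp_all
next
 assume "r : rationals"
 then obtain k a where k: "0 < k" "of_nat k * r = of_int a" unfolding rationals_def by blast
 then have "of_nat k * - r = of_int (- a)" by simp
 then show "- r : rationals" unfolding rationals_def using k(1) by (intro CollectI exI[of _ k] conjI exI[of _ "- a"])
qed

lemma rationals_inverse:
 assumes R: "rational_algebra TYPE('r::comm_ring_1)" and r: "r : (rationals :: 'r::comm_ring_1 set)" "r ~= 0"
 shows "\<exists>q\<in>rationals. q * r = 1"
proof -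
 obtain k a where k: "0 < k" "of_nat k * r = of_int a" using r unfolding rationals_def by blast
 obtain c :: 'r where c: "of_nat k * c = 1" using rational_unit[OF R k(1)] .
 have a0: "a ~= 0"
 proof
  assume "a = 0"
  then have "c * (of_nat k * r) = 0" using k by simp
  moreover have "c * (of_nat k * r) = (of_nat k * c) * r" by (simp add: algebra_simps)
  ultimately show False using c r(2) by simp
 qed
 define e :: int where "e = (if 0 < a then 1 else - 1)"
 define j where "j = nat (e * a)"
 have j: "0 < j" "int j = e * a" "e * e = 1" using a0 by (auto simp: j_def e_def)
 obtain d :: 'r where d: "of_nat j * d = 1" using rational_unit[OF R j(1)] .
 define q where "q = of_int e * d * of_nat k"
 have "(of_nat j :: 'r) = of_int (e * a)" using j(2) by (metis of_int_of_nat_eq)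
 then have 1: "of_int a * (of_int e * d) = 1" using d by (simp add: algebra_simps)
 have "q * r = (of_int e * d) * (of_nat k * r)" by (simp add: q_def algebra_simps)
 then have "q * r = 1" unfolding k(2) using 1 by (simp only: mult.commute)
 moreover have "of_nat j * q = of_int (e * int k)"
 proof -
  have "of_nat j * q = of_int e * (of_nat j * d) * of_nat k" by (simp add: q_def algebra_simps)
  then show ?thesis using d by simp
 qed
 then have "q : rationals" unfolding rationals_def using j(1) by (intro CollectI exI[of _ j] conjI exI[of _ "e * int k"])
 ultimately show ?thesis by blast
qed

definition qsubspace :: "('r::comm_ring_1, 'm) module => 'm set => bool" where
 "qsubspace M Y \<longleftrightarrow> Y \<subseteq> carrier M & \<zero>`M` : Y & (\<forall>x\<in>Y. \<forall>y\<in>Y. x \<oplus>`M` y : Y) &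
  (\<forall>q\<in>rationals. \<forall>x\<in>Y. q \<odot>`M` x : Y)"

lemma qsubspaceD:
 assumes "qsubspace M Y"
 shows "x : Y ==> x : carrier M" "\<zero>`M` : Y" "x : Y ==> y : Y ==> x \<oplus>`M` y : Y"
  "q : rationals ==> x : Y ==> q \<odot>`M` x : Y"
 using assms by (auto simp: qsubspace_def)

lemma qsubspace_neg:
 assumes "is_module M" "qsubspace M Y" "x : Y"
 shows "\<ominus>`M` x : Y" using qsubspaceD(4)[OF assms(2) rationals_closed(5)[OF rationals_closed(2)] assms(3)]
  qsubspaceD(1)[OF assms(2,3)] by (simp add: mod_laws(13)[OF assms(1)] mod_laws(10)[OF assms(1)])

lemma mod_add4:
 assumes "is_module M" "a : carrier M" "b : carrier M" "c : carrier M" "d : carrier M"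
 shows "(a \<oplus>`M` b) \<oplus>`M` (c \<oplus>`M` d) = (a \<oplus>`M` c) \<oplus>`M` (b \<oplus>`M` d)"
 using assms by (simp add: mod_laws(2,17) mod_closed)

lemma mod_split_diff:
 assumes M: "is_module M" and x: "a : carrier M" "b : carrier M" "c : carrier M" "d : carrier M"
  and eq: "a \<oplus>`M` b = c \<oplus>`M` d"
 shows "a \<oplus>`M` \<ominus>`M` c = d \<oplus>`M` \<ominus>`M` b"
 by (metis eq mod_add4[OF M x(3,4) mod_closed(4)[OF M x(3)] mod_closed(4)[OF M x(2)]] x mod_add4[OF M x(1,2) mod_closed(4)[OF M x(3)] mod_closed(4)[OF M x(2)]] mod_closed[OF M] mod_laws(3,4,5)[OF M])

lemma mod_diff_zero:
 assumes M: "is_module M" and x: "a : carrier M" "c : carrier M" "a \<oplus>`M` \<ominus>`M` c = \<zero>`M`"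
 shows "a = c"
proof -
 have "(a \<oplus>`M` \<ominus>`M` c) \<oplus>`M` c = \<zero>`M` \<oplus>`M` c" using x by simp
 then show ?thesis using x(1,2) by (simp add: mod_laws(2,3,4,6)[OF M] mod_closed[OF M])
qed

definition additive_map :: "('r::comm_ring_1, 'm) module => ('r, 'k) module => ('m => 'k) => bool" where
 "additive_map M N h \<longleftrightarrow> (\<forall>x\<in>carrier M. h x : carrier N & (\<forall>y\<in>carrier M. h (x \<oplus>`M` y) = h x \<oplus>`N` h y))"

lemma additive_mapD:
 assumes "additive_map M N h"
 shows "x : carrier M ==> h x : carrier N" "x : carrier M ==> y : carrier M ==> h (x \<oplus>`M` y) = h x \<oplus>`N` h y"
 using assms by (auto simp: additive_map_def)

lemma additive_map_zero:
 assumes "is_module M" "is_module N" "additive_map M N h"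
 shows "h \<zero>`M` = \<zero>`N`"
 using mod_cancel(1)[OF assms(2), of "h \<zero>`M`" "h \<zero>`M`" "\<zero>`N`"] additive_mapD(1)[OF assms(3), of "\<zero>`M`"]
  additive_mapD(2)[OF assms(3), of "\<zero>`M`" "\<zero>`M`"]
 by (simp add: mod_closed mod_laws(3,4) assms)

lemma additive_map_neg:
 assumes "is_module M" "is_module N" "additive_map M N h" and x: "x : carrier M"
 shows "h (\<ominus>`M` x) = \<ominus>`N` h x"
 by (rule mod_diff_zero[OF assms(2)]) (use additive_mapD(2)[OF assms(3) mod_closed(4)[OF assms(1) x] x]
   additive_map_zero[OF assms(1-3)] x in \<open>simp_all add: mod_closed[OF assms(1)] mod_closed[OF assms(2)]
   mod_laws(6)[OF assms(1)] mod_laws(14)[OF assms(2)] additive_mapD(1)[OF assms(3)]\<close>)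

text \<open>A subspace maximal among those that meet \<open>Z\<close> in zero only is a complement, because any vector outside of
  the sum could be adjoined to it.\<close>

lemma rational_complement:
 fixes M :: "('r::comm_ring_1, 'm) module"
 assumes R: "rational_algebra TYPE('r)" and M: "is_module M" and Z: "qsubspace M Z"
 shows "\<exists>Y. qsubspace M Y & Y \<inter> Z = {\<zero>`M`} & (\<forall>x\<in>carrier M. \<exists>z\<in>Z. \<exists>y\<in>Y. x = z \<oplus>`M` y)"
proof -
 let ?\<A> = "{Y. qsubspace M Y & Y \<inter> Z = {\<zero>`M`}}"
 have "\<exists>Y\<in>?\<A>. \<forall>T\<in>?\<A>. Y \<subseteq> T --> T = Y"
 proof (rule subset_Zorn_nonempty)
  have "{\<zero>`M`} : ?\<A>" using qsubspaceD(2)[OF Z] by (simp add: qsubspace_def mod_closed[OF M] mod_laws[OF M])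
  then show "?\<A> ~= {}" by blast
 next
  fix \<C> assume c: "\<C> ~= {}" "subset.chain ?\<A> \<C>"
  have m: "qsubspace M Y & Y \<inter> Z = {\<zero>`M`}" if "Y : \<C>" for Y
   using c(2) that unfolding subset_chain_def by blast
  have ex2: "\<exists>Y\<in>\<C>. h : Y & k : Y" if hk: "h : \<Union>\<C>" "k : \<Union>\<C>" for h k
  proof -
   obtain S T where S: "S : \<C>" "h : S" "T : \<C>" "k : T" using hk by blast
   then have "S \<subseteq> T \<or> T \<subseteq> S" using c(2) unfolding subset_chain_def by blast
   then show ?thesis using S by blast
  qed
  have "qsubspace M (\<Union>\<C>)" unfolding qsubspace_def
  proof (intro conjI ballI)
   show "\<Union>\<C> \<subseteq> carrier M" using m unfolding qsubspace_def by blast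
   show "\<zero>`M` : \<Union>\<C>" using m c(1) by blast
   fix x y assume "x : \<Union>\<C>" "y : \<Union>\<C>"
   then obtain Y where "Y : \<C>" "x : Y" "y : Y" using ex2 by blast
   then show "x \<oplus>`M` y : \<Union>\<C>" using m[of Y] qsubspaceD(3)[of M Y] by blast
  next
   fix q x assume "q : (rationals :: 'r set)" "x : \<Union>\<C>"
   then show "q \<odot>`M` x : \<Union>\<C>" using m qsubspaceD(4)[of M] by blast
  qed
  moreover have "\<Union>\<C> \<inter> Z = {\<zero>`M`}" using m c(1) by blast
  ultimately show "\<Union>\<C> : ?\<A>" by blast
 qed
 then obtain Y where good: "Y : ?\<A>" and max: "\<forall>T\<in>?\<A>. Y \<subseteq> T --> T = Y" by (elim bexE)
 have Y: "qsubspace M Y" and YZ: "Y \<inter> Z = {\<zero>`M`}" using good by simp_all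
 have "\<exists>z\<in>Z. \<exists>y\<in>Y. x = z \<oplus>`M` y" if x: "x : carrier M" for x
 proof (cases "x : Y")
  case True
  then show ?thesis using qsubspaceD(2)[OF Z] x by (metis mod_laws(3)[OF M])
 next
  case False
  let ?T = "{y \<oplus>`M` q \<odot>`M` x | y q. y : Y & q : rationals}"
  have c: "y : carrier M" if "y : Y" for y using that qsubspaceD(1)[OF Y] by blast
  have "qsubspace M ?T" unfolding qsubspace_def
  proof (intro conjI ballI)
   show "?T \<subseteq> carrier M" using c x by (auto simp: mod_closed[OF M])
   show "\<zero>`M` : ?T" by (rule CollectI, rule exI[of _ "\<zero>`M`"], rule exI[of _ 0])
     (use x qsubspaceD(2)[OF Y] in \<open>simp add: rationals_closed mod_laws[OF M] mod_closed[OF M]\<close>)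
   fix u v assume "u : ?T" "v : ?T"
   then obtain y q y' q' where u: "u = y \<oplus>`M` q \<odot>`M` x" "v = y' \<oplus>`M` q' \<odot>`M` x"
    and q: "y : Y" "q : rationals" "y' : Y" "q' : rationals" by blast
   have "u \<oplus>`M` v = (y \<oplus>`M` y') \<oplus>`M` (q + q') \<odot>`M` x"
    unfolding u using q c x mod_add4[OF M c[OF q(1)] mod_closed(3)[OF M x] c[OF q(3)] mod_closed(3)[OF M x]]
    by (simp add: mod_laws(7)[OF M])
   then show "u \<oplus>`M` v : ?T" using q qsubspaceD(3)[OF Y] rationals_closed(3) by blast
  next
   fix r u assume r: "r : (rationals :: 'r set)" and "u : ?T"
   then obtain y q where u: "u = y \<oplus>`M` q \<odot>`M` x" and q: "y : Y" "q : rationals" by blast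
   have "r \<odot>`M` u = r \<odot>`M` y \<oplus>`M` (r * q) \<odot>`M` x"
    unfolding u using q c x by (simp add: mod_closed[OF M] mod_laws(8,9)[OF M])
   then show "r \<odot>`M` u : ?T" using q r qsubspaceD(4)[OF Y] rationals_closed(4) by blast
  qed
  moreover have YT: "Y \<subseteq> ?T"
  proof
   fix y assume "y : Y"
   then show "y : ?T" by (intro CollectI exI[of _ y] exI[of _ 0]) (use x c in \<open>simp add: rationals_closed mod_laws[OF M]\<close>)
  qed
  moreover have "x : ?T" by (rule CollectI, rule exI[of _ "\<zero>`M`"], rule exI[of _ 1])
    (use x qsubspaceD(2)[OF Y] in \<open>simp add: rationals_closed mod_laws[OF M]\<close>)
  ultimately have "?T \<inter> Z ~= {\<zero>`M`}" using max False by blast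
  moreover have "\<zero>`M` : ?T \<inter> Z" using YT qsubspaceD(2)[OF Y] qsubspaceD(2)[OF Z] by blast
  ultimately obtain w where "w : ?T" "w : Z" "w ~= \<zero>`M`" by blast
  then obtain y q where w: "y \<oplus>`M` q \<odot>`M` x : Z" "y \<oplus>`M` q \<odot>`M` x ~= \<zero>`M`"
   and y: "y : Y" and q: "q : rationals" by blast
  have "q ~= 0"
  using w x c[OF y] YZ y by (fastforce simp: mod_laws[OF M])
  then obtain p where p: "p : rationals" "p * q = 1" using rationals_inverse[OF R q] by blast
  define z where "z = p \<odot>`M` (y \<oplus>`M` q \<odot>`M` x)"
  have z: "z : Z" unfolding z_def using qsubspaceD(4)[OF Z p(1) w(1)] .
  have "z = p \<odot>`M` y \<oplus>`M` x" unfolding z_def using x c[OF y] p(2)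
   by (simp add: mod_laws(8,10)[OF M] mod_closed[OF M] mod_laws(9)[OF M, symmetric])
  moreover have py: "p \<odot>`M` y : Y" using qsubspaceD(4)[OF Y p(1) y] .
  ultimately have "x = z \<oplus>`M` \<ominus>`M` (p \<odot>`M` y)" using x c[OF py]
   by (simp add: mod_closed[OF M] mod_laws(1)[OF M, of "p \<odot>`M` y" x] mod_laws(2,4,5)[OF M])
  then show ?thesis using z qsubspace_neg[OF M Y py] by blast
 qed
 then show ?thesis using Y YZ by blast
qed

lemma rational_retraction:
 fixes M :: "('r::comm_ring_1, 'm) module"
 assumes R: "rational_algebra TYPE('r)" and M: "is_module M" and Z: "qsubspace M Z"
 obtains p where "!!x. x : carrier M ==> p x : Z"
  and "!!x y. x : carrier M ==> y : carrier M ==> p (x \<oplus>`M` y) = p x \<oplus>`M` p y"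
  and "!!z. z : Z ==> p z = z"
proof -
 obtain Y where Y: "qsubspace M Y" and YZ: "Y \<inter> Z = {\<zero>`M`}"
  and ex: "\<forall>x\<in>carrier M. \<exists>z\<in>Z. \<exists>y\<in>Y. x = z \<oplus>`M` y"
  using rational_complement[OF R M Z] by blast
 have cZ: "z : carrier M" if "z : Z" for z using that qsubspaceD(1)[OF Z] by blast
 have cY: "z : carrier M" if "z : Y" for z using that qsubspaceD(1)[OF Y] by blast
 define p where "p x = (SOME z. z : Z & (\<exists>y\<in>Y. x = z \<oplus>`M` y))" for x
 have pp: "p x : Z & (\<exists>y\<in>Y. x = p x \<oplus>`M` y)" if "x : carrier M" for x
  unfolding p_def by (rule someI_ex) (use ex that in blast)
 have un: "p (z \<oplus>`M` y) = z" if z: "z : Z" "y : Y" for z y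
 proof -
  have "z \<oplus>`M` y : carrier M" using z cZ cY by (simp add: mod_closed[OF M])
  from pp[OF this] obtain y' where y': "p (z \<oplus>`M` y) : Z" "y' : Y" "z \<oplus>`M` y = p (z \<oplus>`M` y) \<oplus>`M` y'"
   by blast
  have "p (z \<oplus>`M` y) \<oplus>`M` \<ominus>`M` z = y \<oplus>`M` \<ominus>`M` y'"
   by (rule mod_split_diff[OF M]) (use y' z cZ cY in auto)
  moreover have "p (z \<oplus>`M` y) \<oplus>`M` \<ominus>`M` z : Z"
   using qsubspaceD(3)[OF Z y'(1) qsubspace_neg[OF M Z z(1)]] .
  moreover have "y \<oplus>`M` \<ominus>`M` y' : Y" using qsubspaceD(3)[OF Y z(2) qsubspace_neg[OF M Y y'(2)]] .
  ultimately have "p (z \<oplus>`M` y) \<oplus>`M` \<ominus>`M` z : Y \<inter> Z" by simp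
  then have "p (z \<oplus>`M` y) \<oplus>`M` \<ominus>`M` z = \<zero>`M`" unfolding YZ by simp
  then show ?thesis by (rule mod_diff_zero[OF M cZ[OF y'(1)] cZ[OF z(1)]])
 qed
 show thesis
 proof (rule that)
  show "p x : Z" if "x : carrier M" for x using pp[OF that] by simp
  show "p z = z" if "z : Z" for z using un[OF that qsubspaceD(2)[OF Y]] cZ[OF that] by (simp add: mod_laws[OF M])
  fix x x' assume x: "x : carrier M" "x' : carrier M"
  obtain y where y: "y : Y" "x = p x \<oplus>`M` y" "p x : Z" using pp[OF x(1)] by blast
  obtain y' where y': "y' : Y" "x' = p x' \<oplus>`M` y'" "p x' : Z" using pp[OF x(2)] by blast
  have "x \<oplus>`M` x' = (p x \<oplus>`M` y) \<oplus>`M` (p x' \<oplus>`M` y')" using y(2) y'(2) by simp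
  also have "... = (p x \<oplus>`M` p x') \<oplus>`M` (y \<oplus>`M` y')"
   by (rule mod_add4[OF M]) (use y y' cZ cY in auto)
  finally show "p (x \<oplus>`M` x') = p x \<oplus>`M` p x'"
   using un[OF qsubspaceD(3)[OF Z y(3) y'(3)] qsubspaceD(3)[OF Y y(1) y'(1)]] by simp
 qed
qed

text \<open>Retract the module onto the rational multiples of \<open>x\<close> and take the coefficient.\<close>

lemma additive_separating:
 fixes M :: "('r::comm_ring_1, 'm) module"
 assumes R: "rational_algebra TYPE('r)" and M: "is_module M" and x: "x : carrier M" "x ~= \<zero>`M`"
 obtains h :: "'m => 'r" where "h x = 1"
  and "!!u v. u : carrier M ==> v : carrier M ==> h (u \<oplus>`M` v) = h u + h v"
proof -
 let ?Z = "{q \<odot>`M` x | q. q : rationals}"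
 have Z: "qsubspace M ?Z" unfolding qsubspace_def
 proof (intro conjI ballI)
  show "?Z \<subseteq> carrier M" using x by (auto simp: mod_closed[OF M])
  show "\<zero>`M` : ?Z"
   by (rule CollectI, rule exI[of _ 0]) (use x in \<open>simp add: rationals_closed mod_laws[OF M]\<close>)
  fix u v assume "u : ?Z" "v : ?Z"
  then obtain p q where "u = p \<odot>`M` x" "v = q \<odot>`M` x" "p : rationals" "q : rationals" by blast
  then show "u \<oplus>`M` v : ?Z" using x
   by (intro CollectI exI[of _ "p + q"]) (simp add: rationals_closed mod_laws(7)[OF M])
 next
  fix r u assume "r : (rationals :: 'r set)" "u : ?Z"
  moreover then obtain p where "u = p \<odot>`M` x" "p : rationals" by blast
  ultimately show "r \<odot>`M` u : ?Z" using x
   by (intro CollectI exI[of _ "r * p"]) (simp add: rationals_closed mod_laws(9)[OF M])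
 qed
 obtain p where p: "!!y. y : carrier M ==> p y : ?Z"
  "!!y z. y : carrier M ==> z : carrier M ==> p (y \<oplus>`M` z) = p y \<oplus>`M` p z"
  "!!z. z : ?Z ==> p z = z" by (rule rational_retraction[OF R M Z]) blast
 have inj: "q = r" if "q \<odot>`M` x = r \<odot>`M` x" "q : rationals" "r : rationals" for q r
 proof (rule ccontr)
  assume "q ~= r"
  moreover have "q - r : rationals" using rationals_closed(3)[OF that(2) rationals_closed(5)[OF that(3)]] by simp
  ultimately obtain t where "t * (q - r) = 1" using rationals_inverse[OF R, of "q - r"] by auto
  moreover have "(q - r) \<odot>`M` x = \<zero>`M`" using that x mod_laws(7)[OF M x(1), of q "- r"]
   by (simp add: mod_laws(13)[OF M] mod_laws(5)[OF M] mod_closed[OF M])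
  ultimately have "1 \<odot>`M` x = t \<odot>`M` \<zero>`M`" using mod_laws(9)[OF M x(1), of t "q - r"] by simp
  then show False using x by (simp add: mod_laws[OF M])
 qed
 define h where "h y = (THE q. q : rationals & p y = q \<odot>`M` x)" for y
 have h: "h y = q" if "q : rationals" "p y = q \<odot>`M` x" for y q
  unfolding h_def by (rule the_equality) (use that inj in auto)
 show thesis
 proof (rule that)
  have "1 \<odot>`M` x = x" using x by (simp add: mod_laws[OF M])
  moreover have "x : ?Z" by (rule CollectI, rule exI[of _ 1]) (use x in \<open>simp add: rationals_closed mod_laws[OF M]\<close>)
  ultimately show "h x = 1" using h[of 1 x] p(3)[of x] by (simp add: rationals_closed)
  fix u v assume u: "u : carrier M" "v : carrier M"
  obtain q where q: "q : rationals" "p u = q \<odot>`M` x" using p(1)[OF u(1)] by blast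
  obtain r where r: "r : rationals" "p v = r \<odot>`M` x" using p(1)[OF u(2)] by blast
  have "p (u \<oplus>`M` v) = (q + r) \<odot>`M` x" using p(2)[OF u] q r x by (simp add: mod_laws(7)[OF M])
  then show "h (u \<oplus>`M` v) = h u + h v"
   using h[of q u] h[of r v] h[of "q + r" "u \<oplus>`M` v"] q r by (simp add: rationals_closed)
 qed
qed

text \<open>Split off the cycles of every module by a retraction \<open>p\<close>. The contraction sends \<open>x\<close> to the preimage of \<open>p x\<close> in the
  complement of the cycles.\<close>

lemma rational_contraction:
 fixes C :: "int => ('r::comm_ring_1, 'c) module"
 assumes R: "rational_algebra TYPE('r)" and C: "!!i. is_module (C i)" and D: "!!i. linear_map (C i) (C (i - 1)) (D i)"
  and DD: "!!i x. x : carrier (C i) ==> D (i - 1) (D i x) = \<zero>`C (i - 2)`"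
  and ex: "!!i x. x : carrier (C i) ==> D i x = \<zero>`C (i - 1)` ==> \<exists>y\<in>carrier (C (i + 1)). D (i + 1) y = x"
 obtains s where "!!i. additive_map (C i) (C (i + 1)) (s i)"
  and "!!i x. x : carrier (C i) ==> D (i + 1) (s i x) \<oplus>`C i` s (i - 1) (D i x) = x"
proof -
 let ?Z = "%i. {x : carrier (C i). D i x = \<zero>`C (i - 1)`}"
 have Z: "qsubspace (C i) (?Z i)" for i using linear_map_zero[OF C C D, of i]
  by (auto simp: qsubspace_def mod_closed[OF C] mod_laws[OF C] linear_mapD[OF D])
 let ?P = "%i p. (\<forall>x\<in>carrier (C i). p x : ?Z i) &
  (\<forall>x\<in>carrier (C i). \<forall>y\<in>carrier (C i). p (x \<oplus>`C i` y) = p x \<oplus>`C i` p y) & (\<forall>z\<in>?Z i. p z = z)"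
 have "\<exists>p. ?P i p" for i by (rule rational_retraction[OF R C Z, of i]) blast
 then have "\<forall>i. \<exists>p. ?P i p" ..
 from choice[OF this] obtain p where P: "\<forall>i. ?P i (p i)" ..
 have p: "!!i x. x : carrier (C i) ==> p i x : ?Z i"
  "!!i x y. x : carrier (C i) ==> y : carrier (C i) ==> p i (x \<oplus>`C i` y) = p i x \<oplus>`C i` p i y"
  "!!i z. z : ?Z i ==> p i z = z" using P by blast+
 have pC: "p i x : carrier (C i)" if "x : carrier (C i)" for i x using p(1)[OF that] by simp
 define r where "r i y = y \<oplus>`C i` \<ominus>`C i` p i y" for i y
 have rC: "r i x : carrier (C i)" if "x : carrier (C i)" for i x using that pC by (simp add: r_def mod_closed[OF C])
 have radd: "r i (x \<oplus>`C i` y) = r i x \<oplus>`C i` r i y" if "x : carrier (C i)" "y : carrier (C i)" for i x y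
  using that pC mod_add4[OF C that(1) that(2) mod_closed(4)[OF C pC[OF that(1)]] mod_closed(4)[OF C pC[OF that(2)]]]
  by (simp add: r_def p(2) mod_laws(15)[OF C])
 have Dneg: "D i (\<ominus>`C i` x) = \<ominus>`C (i - 1)` D i x" if "x : carrier (C i)" for i x
  using linear_map_neg[OF C C D that] .
 have r0: "r i z = \<zero>`C i`" if "z : ?Z i" for i z using that p(3)[OF that] by (simp add: r_def mod_laws[OF C])
 have req: "r i x = r i y" if "x : carrier (C i)" "y : carrier (C i)" "D i x = D i y" for i x y
 proof -
  have "x \<oplus>`C i` \<ominus>`C i` y : ?Z i"
   using that by (simp add: mod_closed[OF C] linear_mapD[OF D] Dneg mod_laws(5)[OF C])
  then have z: "r i (x \<oplus>`C i` \<ominus>`C i` y) = \<zero>`C i`" by (rule r0)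
  have "r i x = r i ((x \<oplus>`C i` \<ominus>`C i` y) \<oplus>`C i` y)"
   using that by (simp add: mod_laws(2,4,6)[OF C] mod_closed[OF C])
  also have "... = \<zero>`C i` \<oplus>`C i` r i y" using that z by (simp add: radd mod_closed[OF C])
  also have "... = r i y" using that rC by (simp add: mod_laws[OF C])
  finally show ?thesis .
 qed
 define q where "q i x = (SOME y. y : carrier (C (i + 1)) & D (i + 1) y = p i x)" for i x
 have q: "q i x : carrier (C (i + 1)) & D (i + 1) (q i x) = p i x" if "x : carrier (C i)" for i x
  unfolding q_def by (rule someI_ex) (use p(1)[OF that] ex[of "p i x" i] in auto)
 define s where "s i x = r (i + 1) (q i x)" for i x
 have Dr: "D i (r i y) = D i y" if "y : carrier (C i)" for i y
 using p(1)[OF that] that by (simp add: r_def linear_mapD[OF D] mod_closed[OF C] Dneg mod_laws(4,16)[OF C])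
 show thesis
 proof (rule that)
  have "s i (x \<oplus>`C i` y) = s i x \<oplus>`C (i + 1)` s i y" if x: "x : carrier (C i)" and y: "y : carrier (C i)" for i x y
  proof -
   have xy: "x \<oplus>`C i` y : carrier (C i)" using x y by (simp add: mod_closed[OF C])
   have "D (i + 1) (q i x \<oplus>`C (i + 1)` q i y) = p i x \<oplus>`C i` p i y"
    using q[OF x] q[OF y] linear_mapD(2)[OF D, of "q i x" "i + 1" "q i y"] by simp
   then have "r (i + 1) (q i (x \<oplus>`C i` y)) = r (i + 1) (q i x \<oplus>`C (i + 1)` q i y)"
    by (intro req) (use q[OF xy] q[OF x] q[OF y] p(2)[OF x y] in \<open>simp_all add: mod_closed[OF C]\<close>)
   then show ?thesis using q[OF x] q[OF y] by (simp add: s_def radd)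
  qed
  moreover have "s i x : carrier (C (i + 1))" if "x : carrier (C i)" for i x using q[OF that] rC by (simp add: s_def)
  ultimately show "additive_map (C i) (C (i + 1)) (s i)" for i by (simp add: additive_map_def)
  show "D (i + 1) (s i x) \<oplus>`C i` s (i - 1) (D i x) = x" if x: "x : carrier (C i)" for i x
  proof -
   have 1: "D (i + 1) (s i x) = p i x" using q[OF x] Dr by (simp add: s_def)
   have Dx: "D i x : carrier (C (i - 1))" using linear_mapD(1)[OF D x] .
   have "p (i - 1) (D i x) = D i x" by (rule p(3)) (use Dx DD[OF x] in simp)
   then have "s (i - 1) (D i x) = r i x" using q[OF Dx] x req[of "q (i - 1) (D i x)" i x] by (simp add: s_def)
   then have "D (i + 1) (s i x) \<oplus>`C i` s (i - 1) (D i x) = p i x \<oplus>`C i` (\<ominus>`C i` p i x \<oplus>`C i` x)"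
    using 1 mod_laws(1)[OF C x mod_closed(4)[OF C pC[OF x]]] by (simp add: r_def)
   also have "... = x" using mod_laws(2)[OF C pC[OF x] mod_closed(4)[OF C pC[OF x]] x] mod_laws(5)[OF C pC[OF x]]
     mod_laws(3)[OF C x] by simp
   finally show ?thesis .
  qed
 qed
qed

definition cone_module ::
 "(int => ('r::comm_ring_1, 'm) module) => (int => ('r, 'k) module) => int => ('r, 'm \<times> 'k) module" where
 "cone_module M N i = \<lparr>carrier = carrier (M (i - 1)) \<times> carrier (N i), mult = undefined, one = undefined,
  zero = (\<zero>`M (i - 1)`, \<zero>`N i`),
  add = (%x y. (fst x \<oplus>`M (i - 1)` fst y, snd x \<oplus>`N i` snd y)),
  smult = (%r x. (r \<odot>`M (i - 1)` fst x, r \<odot>`N i` snd x))\<rparr>"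

lemma cone_module_is_module:
 assumes M: "!!i. is_module (M i)" and N: "!!i. is_module (N i)"
 shows "is_module (cone_module M N i)"
proof (rule is_moduleI)
 show "abelian_group (cone_module M N i)"
 proof (rule abelian_groupI)
  fix x assume x: "x : carrier (cone_module M N i)"
  show "\<exists>y\<in>carrier (cone_module M N i). y \<oplus>`cone_module M N i` x = \<zero>`cone_module M N i`"
   by (rule bexI[of _ "(\<ominus>`M (i - 1)` fst x, \<ominus>`N i` snd x)"])
    (use x in \<open>auto simp: cone_module_def mod_laws(6)[OF M] mod_laws(6)[OF N] mod_closed[OF M] mod_closed[OF N]\<close>)
 next
  fix x y assume "x : carrier (cone_module M N i)" "y : carrier (cone_module M N i)"
  then show "x \<oplus>`cone_module M N i` y = y \<oplus>`cone_module M N i` x"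
   by (auto simp: cone_module_def intro: mod_laws(1)[OF M] mod_laws(1)[OF N])
 qed (auto simp: cone_module_def mod_closed[OF M] mod_closed[OF N] mod_laws(2,3)[OF M] mod_laws(2,3)[OF N])
qed (auto simp: cone_module_def mod_closed[OF M] mod_closed[OF N] mod_laws(7,8,9,10)[OF M] mod_laws(7,8,9,10)[OF N])

lemma cone_module_simps:
 "carrier (cone_module M N i) = carrier (M (i - 1)) \<times> carrier (N i)"
 "\<zero>`cone_module M N i` = (\<zero>`M (i - 1)`, \<zero>`N i`)"
 "x \<oplus>`cone_module M N i` y = (fst x \<oplus>`M (i - 1)` fst y, snd x \<oplus>`N i` snd y)"
 "r \<odot>`cone_module M N i` x = (r \<odot>`M (i - 1)` fst x, r \<odot>`N i` snd x)"
 by (simp_all add: cone_module_def)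

text \<open>Homotopy inverses are read off from a contraction of the mapping cone. As the contraction is only additive, so are
  they.\<close>

locale additive_homotopy_inverse =
 fixes M :: "int => ('r::comm_ring_1, 'm) module" and d :: "int => 'm => 'm"
  and N :: "int => ('r, 'k) module" and e :: "int => 'k => 'k" and f :: "int => 'm => 'k"
  and g :: "int => 'k => 'm" and h :: "int => 'k => 'k" and k :: "int => 'm => 'm"
 assumes g: "additive_map (N i) (M i) (g i)" and h: "additive_map (N i) (N (i + 1)) (h i)"
  and k: "additive_map (M i) (M (i + 1)) (k i)" and g_chain: "y : carrier (N i) ==> d i (g i y) = g (i - 1) (e i y)"
  and h_homotopy: "y : carrier (N i) ==> (f i (g i y) \<oplus>`N i` e (i + 1) (h i y)) \<oplus>`N i` h (i - 1) (e i y) = y"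
  and k_homotopy: "x : carrier (M i) ==> (g i (f i x) \<oplus>`M i` d (i + 1) (k i x)) \<oplus>`M i` k (i - 1) (d i x) = x"

lemma additive_homotopy_inverse_exists:
 fixes M :: "int => ('r::comm_ring_1, 'm) module" and N :: "int => ('r, 'k) module"
 assumes R: "rational_algebra TYPE('r)" and M: "!!i. is_module (M i)" and N: "!!i. is_module (N i)"
  and d: "!!i. linear_map (M i) (M (i - 1)) (d i)" and e: "!!i. linear_map (N i) (N (i - 1)) (e i)"
  and dd: "!!i x. x : carrier (M i) ==> d (i - 1) (d i x) = \<zero>`M (i - 2)`"
  and ee: "!!i x. x : carrier (N i) ==> e (i - 1) (e i x) = \<zero>`N (i - 2)`"
  and f: "!!i. linear_map (M i) (N i) (f i)"
  and fd: "!!i x. x : carrier (M i) ==> f (i - 1) (d i x) = e i (f i x)"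
  and inj: "!!i x. x : cycles M d i ==> f i x : boundaries N e i ==> x : boundaries M d i"
  and surj: "!!i y. y : cycles N e i ==>
   \<exists>x\<in>cycles M d i. \<exists>w\<in>boundaries N e i. y = f i x \<oplus>`N i` w"
 obtains g h k where "additive_homotopy_inverse M d N e f g h k"
proof -
 let ?C = "cone_module M N"
 define D where "D i x = (\<ominus>`M (i - 2)` d (i - 1) (fst x), f (i - 1) (fst x) \<oplus>`N (i - 1)` e i (snd x))" for i x
 note dc = linear_mapD(1)[OF d] and ec = linear_mapD(1)[OF e] and fc = linear_mapD(1)[OF f]
 have dc1: "d (i - 1) x : carrier (M (i - 2))" if "x : carrier (M (i - 1))" for i x using dc[OF that] by (simp add: algebra_simps)
 have dc2: "d (i + 1) x : carrier (M i)" if "x : carrier (M (i + 1))" for i x using dc[OF that] by simp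
 have ec2: "e (i + 1) x : carrier (N i)" if "x : carrier (N (i + 1))" for i x using ec[OF that] by simp
 have mc[simp]: "!!i. is_module (M i)" "!!i. is_module (N i)" using M N by auto
 have dadd: "d (i - 1) (x \<oplus>`M (i - 1)` y) = d (i - 1) x \<oplus>`M (i - 2)` d (i - 1) y"
  if "x : carrier (M (i - 1))" "y : carrier (M (i - 1))" for i x y using linear_mapD(2)[OF d that] by (simp add: algebra_simps)
 have dsm: "d (i - 1) (r \<odot>`M (i - 1)` x) = r \<odot>`M (i - 2)` d (i - 1) x"
  if "x : carrier (M (i - 1))" for i x r using linear_mapD(3)[OF d that] by (simp add: algebra_simps)
 have smneg: "r \<odot>`M i` (\<ominus>`M i` x) = \<ominus>`M i` (r \<odot>`M i` x)" if "x : carrier (M i)" for i r x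
  using mod_laws(9)[OF M that, of r "- 1"] mod_laws(13)[OF M that, of r] mod_laws(13)[OF M that, of 1]
   mod_laws(10)[OF M that] by simp
 have Dlin: "linear_map (?C i) (?C (i - 1)) (D i)" for i unfolding linear_map_def
 proof (intro conjI ballI allI)
  show "D i : carrier (?C i) \<rightarrow> carrier (?C (i - 1))" by (auto simp: cone_module_simps D_def mod_closed dc1 ec fc)
  fix x y assume x: "x : carrier (?C i)" and y: "y : carrier (?C i)"
  then show "D i (x \<oplus>`?C i` y) = D i x \<oplus>`?C (i - 1)` D i y"
   using mod_add4[OF N, of "f (i - 1) (fst x)" "i - 1" "f (i - 1) (fst y)" "e i (snd x)" "e i (snd y)"]
   by (auto simp: cone_module_simps D_def dadd linear_mapD(2)[OF f] linear_mapD(2)[OF e] mod_laws(15) dc1 ec fc)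
 next
  fix r x assume x: "x : carrier (?C i)"
  then show "D i (r \<odot>`?C i` x) = r \<odot>`?C (i - 1)` D i x"
   by (auto simp: cone_module_simps D_def dsm linear_mapD(3)[OF f] linear_mapD(3)[OF e] mod_laws(8) dc1 ec fc smneg)
 qed
 have d0: "d i \<zero>`M i` = \<zero>`M (i - 1)`" for i using linear_map_zero[OF M M d] .
 have f0: "f i \<zero>`M i` = \<zero>`N i`" for i using linear_map_zero[OF M N f] .
 have e0: "e i \<zero>`N i` = \<zero>`N (i - 1)`" for i using linear_map_zero[OF N N e] .
 have DD: "D (i - 1) (D i x) = \<zero>`?C (i - 2)`" if x: "x : carrier (?C i)" for i x
 proof -
  obtain v w where xv: "x = (v, w)" and v: "v : carrier (M (i - 1))" and w: "w : carrier (N i)"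
   using x by (auto simp: cone_module_simps)
  have 1: "d (i - 2) (d (i - 1) v) = \<zero>`M (i - 3)`" using dd[OF v] by (simp add: algebra_simps)
  have 2: "d (i - 2) (\<ominus>`M (i - 2)` d (i - 1) v) = \<zero>`M (i - 3)`"
   using linear_map_neg[OF M M d dc1[OF v]] 1 by (simp add: algebra_simps mod_laws(16))
  have 3: "f (i - 2) (d (i - 1) v) = e (i - 1) (f (i - 1) v)" using fd[OF v] by (simp add: algebra_simps)
  have 4: "f (i - 2) (\<ominus>`M (i - 2)` d (i - 1) v) = \<ominus>`N (i - 2)` e (i - 1) (f (i - 1) v)"
   using linear_map_neg[OF M N f dc1[OF v]] 3 by simp
  have 5: "e (i - 1) (f (i - 1) v \<oplus>`N (i - 1)` e i w) = e (i - 1) (f (i - 1) v)"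
   using linear_mapD(2)[OF e fc[OF v] ec[OF w]] ee[OF w] ec[OF fc[OF v]] by (simp add: algebra_simps mod_laws(4))
  have 6: "e (i - 1) (f (i - 1) v) : carrier (N (i - 2))" using ec[OF fc[OF v]] by (simp add: algebra_simps)
  have a: "i - 1 - 1 = i - 2" "i - 1 - 2 = i - 3" "i - 2 - 1 = i - 3" by auto
  show ?thesis unfolding D_def xv cone_module_simps fst_conv snd_conv a 2 4 5 using 6 by (simp add: mod_laws(6,16))
 qed
 have ex: "\<exists>y\<in>carrier (?C (i + 1)). D (i + 1) y = x"
  if x: "x : carrier (?C i)" and Dx: "D i x = \<zero>`?C (i - 1)`" for i x
 proof -
  obtain v w where xv: "x = (v, w)" and v: "v : carrier (M (i - 1))" and w: "w : carrier (N i)"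
   using x by (auto simp: cone_module_simps)
  have 1: "\<ominus>`M (i - 2)` d (i - 1) v = \<zero>`M (i - 2)`" and 2: "f (i - 1) v \<oplus>`N (i - 1)` e i w = \<zero>`N (i - 1)`"
   using Dx by (simp_all add: D_def xv cone_module_simps algebra_simps)
  have "d (i - 1) v = \<ominus>`M (i - 2)` (\<ominus>`M (i - 2)` d (i - 1) v)" using dc1[OF v] by (simp add: mod_laws(14))
  then have dv: "d (i - 1) v = \<zero>`M (i - 2)`" using 1 by (simp add: mod_laws(16))
  then have vc: "v : cycles M d (i - 1)" using v by (simp add: cycles_def algebra_simps)
  have "f (i - 1) v = e i (\<ominus>`N i` w)"
   using mod_diff_zero[OF N fc[OF v], of "\<ominus>`N (i - 1)` e i w"] 2 ec[OF w]
   by (simp add: mod_laws(14) mod_closed linear_map_neg[OF N N e w])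
  then have "f (i - 1) v : boundaries N e (i - 1)"
   unfolding boundaries_def using w by (auto simp: mod_closed intro!: image_eqI[of _ _ "\<ominus>`N i` w"])
  from inj[OF vc this] obtain u where u: "u : carrier (M i)" "v = d i u" by (auto simp: boundaries_def)
  have "e i (f i u \<oplus>`N i` w) = \<zero>`N (i - 1)`"
   using linear_mapD(2)[OF e fc[OF u(1)] w] fd[OF u(1)] 2 u(2) by simp
  then have "f i u \<oplus>`N i` w : cycles N e i" using fc[OF u(1)] w by (simp add: cycles_def mod_closed)
  from surj[OF this] obtain z t where z: "z : cycles M d i" and t: "t : carrier (N (i + 1))"
   and zt: "f i u \<oplus>`N i` w = f i z \<oplus>`N i` e (i + 1) t" by (auto simp: boundaries_def)
  have zc: "z : carrier (M i)" "d i z = \<zero>`M (i - 1)`" using z by (auto simp: cycles_def)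
  let ?v = "z \<oplus>`M i` \<ominus>`M i` u"
  have A: "\<ominus>`M (i - 1)` d i ?v = v"
   using linear_mapD(2)[OF d zc(1) mod_closed(4)[OF M u(1)]] zc(2) linear_map_neg[OF M M d u(1)] u(2) v
   by (simp add: mod_laws(3,14) mod_closed)
  have "f i ?v \<oplus>`N i` e (i + 1) t = (f i z \<oplus>`N i` \<ominus>`N i` f i u) \<oplus>`N i` e (i + 1) t"
   using linear_mapD(2)[OF f zc(1) mod_closed(4)[OF M u(1)]] linear_map_neg[OF M N f u(1)] by simp
  also have "... = \<ominus>`N i` f i u \<oplus>`N i` (f i z \<oplus>`N i` e (i + 1) t)"
   using fc[OF zc(1)] fc[OF u(1)] ec2[OF t]
   by (simp add: mod_closed mod_laws(2)[OF N] mod_laws(17)[OF N, of "\<ominus>`N i` f i u"])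
  also have "... = w" unfolding zt[symmetric] using fc[OF u(1)] w by (simp add: mod_closed mod_laws(2)[OF N, symmetric] mod_laws(3,6))
  finally have B: "f i ?v \<oplus>`N i` e (i + 1) t = w" .
  show ?thesis by (rule bexI[of _ "(?v, t)"]) (use A B zc(1) u(1) t xv in \<open>simp_all add: D_def cone_module_simps mod_closed\<close>)
 qed
 obtain s where s: "!!i. additive_map (?C i) (?C (i + 1)) (s i)"
  and s3: "!!i x. x : carrier (?C i) ==> D (i + 1) (s i x) \<oplus>`?C i` s (i - 1) (D i x) = x"
  using rational_contraction[OF R cone_module_is_module[OF M N] Dlin DD ex] by blast
 note s1 = additive_mapD(1)[OF s] and s2 = additive_mapD(2)[OF s]
 define g where "g i y = fst (s i (\<zero>`M (i - 1)`, y))" for i y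
 define h where "h i y = snd (s i (\<zero>`M (i - 1)`, y))" for i y
 define k where "k i x = \<ominus>`M (i + 1)` fst (s (i + 1) (x, \<zero>`N (i + 1)`))" for i x
 have inN: "(\<zero>`M (i - 1)`, y) : carrier (?C i)" if "y : carrier (N i)" for i y
  using that by (simp add: cone_module_simps mod_closed)
 have inM: "(x, \<zero>`N (i + 1)`) : carrier (?C (i + 1))" if "x : carrier (M i)" for i x
  using that by (simp add: cone_module_simps mod_closed)
 have gc: "g i y : carrier (M i)" and hc: "h i y : carrier (N (i + 1))" if "y : carrier (N i)" for i y
  using s1[OF inN[OF that]] by (auto simp: cone_module_simps g_def h_def)
 have g: "additive_map (N i) (M i) (g i)" and h: "additive_map (N i) (N (i + 1)) (h i)" for i
  unfolding additive_map_def using gc hc s2[OF inN inN]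
  by (auto simp: cone_module_simps g_def h_def mod_closed mod_laws(3))
 have kc: "k i x : carrier (M (i + 1))" and kc': "fst (s (i + 1) (x, \<zero>`N (i + 1)`)) : carrier (M (i + 1))"
  if "x : carrier (M i)" for i x using s1[OF inM[OF that], unfolded cone_module_simps mem_Times_iff add_diff_cancel_right']
  by (simp_all add: k_def mod_closed)
 have ga: "g i (x \<oplus>`N i` y) = g i x \<oplus>`M i` g i y"
  and ha: "h i (x \<oplus>`N i` y) = h i x \<oplus>`N (i + 1)` h i y"
  if "x : carrier (N i)" "y : carrier (N i)" for i x y using s2[OF inN[OF that(1)] inN[OF that(2)]]
  by (simp_all add: cone_module_simps g_def h_def mod_closed mod_laws(3))
 have "k i (x \<oplus>`M i` y) = k i x \<oplus>`M (i + 1)` k i y" if "x : carrier (M i)" "y : carrier (M i)" for i x y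
  using s2[OF inM[OF that(1)] inM[OF that(2)], unfolded cone_module_simps fst_conv snd_conv
    add_diff_cancel_right' mod_laws(3)[OF N mod_closed(2)[OF N]]]
   kc'[OF that(1)] kc'[OF that(2)] by (simp only: k_def fst_conv mod_laws(15)[OF M])
 then have k: "additive_map (M i) (M (i + 1)) (k i)" for i using kc by (simp add: additive_map_def)
 note kn = additive_map_neg[OF M M k]
 have E1: "\<ominus>`M (i - 1)` d i (g i y) \<oplus>`M (i - 1)` g (i - 1) (e i y) = \<zero>`M (i - 1)`
   & (f i (g i y) \<oplus>`N i` e (i + 1) (h i y)) \<oplus>`N i` h (i - 1) (e i y) = y"
  if y: "y : carrier (N i)" for i y
 using d0 f0 ec[OF y] s3[OF inN[OF y]] by (simp add: D_def mod_laws(3,16) cone_module_simps g_def h_def)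
 have E2: "(g i (f i x) \<oplus>`M i` d (i + 1) (k i x)) \<oplus>`M i` k (i - 1) (d i x) = x" if x: "x : carrier (M i)" for i x
 proof -
  have Dx: "D (i + 1) (x, \<zero>`N (i + 1)`) = (\<ominus>`M (i - 1)` d i x, f i x)"
   using e0[of "i + 1"] fc[OF x] by (simp add: D_def mod_laws(4))
  have dx: "\<ominus>`M (i - 1)` d i x : carrier (M (i - 1))" using dc[OF x] by (simp add: mod_closed)
  have "s i (\<ominus>`M (i - 1)` d i x, f i x) = s i ((\<ominus>`M (i - 1)` d i x, \<zero>`N i`) \<oplus>`?C i` (\<zero>`M (i - 1)`, f i x))"
   using dx fc[OF x] by (simp add: cone_module_simps mod_laws(3,4))
  also have "... = s i (\<ominus>`M (i - 1)` d i x, \<zero>`N i`) \<oplus>`?C (i + 1)` s i (\<zero>`M (i - 1)`, f i x)"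
   by (rule s2) (use inM[OF dx] inN[OF fc[OF x]] in simp_all)
  finally have "fst (s i (\<ominus>`M (i - 1)` d i x, f i x))
    = fst (s i (\<ominus>`M (i - 1)` d i x, \<zero>`N i`)) \<oplus>`M i` g i (f i x)"
   by (simp add: cone_module_simps g_def)
  also have "fst (s i (\<ominus>`M (i - 1)` d i x, \<zero>`N i`)) = \<ominus>`M i` k (i - 1) (\<ominus>`M (i - 1)` d i x)"
   using kc'[OF dx] by (simp add: k_def mod_laws(14))
  also have "... = k (i - 1) (d i x)" using kn[OF dc[OF x]] kc[OF dc[OF x]] by (simp add: mod_laws(14))
  finally have 1: "fst (s i (\<ominus>`M (i - 1)` d i x, f i x)) = k (i - 1) (d i x) \<oplus>`M i` g i (f i x)" .
  have c: "k (i - 1) (d i x) : carrier (M i)" "g i (f i x) : carrier (M i)" "d (i + 1) (k i x) : carrier (M i)"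
   using kc[OF dc[OF x]] gc[OF fc[OF x]] dc2[OF kc[OF x]] by simp_all
  have 2: "\<ominus>`M i` d (i + 1) (fst (s (i + 1) (x, \<zero>`N (i + 1)`))) = d (i + 1) (k i x)"
   using linear_map_neg[OF M M d kc'[OF x]] by (simp add: k_def)
  have a: "i + 1 + 1 - 2 = i" by simp
  have "fst (D (i + 1 + 1) (s (i + 1) (x, \<zero>`N (i + 1)`))) \<oplus>`M i` fst (s i (D (i + 1) (x, \<zero>`N (i + 1)`))) = x"
   using s3[OF inM[OF x]] by (simp add: cone_module_simps prod_eq_iff)
  then have "d (i + 1) (k i x) \<oplus>`M i` (k (i - 1) (d i x) \<oplus>`M i` g i (f i x)) = x"
   unfolding Dx 1 by (simp only: D_def fst_conv add_diff_cancel_right' a 2)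
  then show ?thesis using c by (simp add: mod_laws(1,17) mod_closed)
 qed
 have dg: "d i (g i y) = g (i - 1) (e i y)" if y: "y : carrier (N i)" for i y
 proof -
  have a: "d i (g i y) : carrier (M (i - 1))" "g (i - 1) (e i y) : carrier (M (i - 1))"
   using dc[OF gc[OF y]] gc[OF ec[OF y]] by simp_all
  then have "g (i - 1) (e i y) \<oplus>`M (i - 1)` \<ominus>`M (i - 1)` d i (g i y) = \<zero>`M (i - 1)`"
   using E1[OF y] mod_laws(1)[OF M a(2) mod_closed(4)[OF M a(1)]] by simp
  from mod_diff_zero[OF M a(2,1) this] show ?thesis by simp
 qed
 show thesis by (rule that, unfold_locales) (use g h k dg E1 E2 in auto)
qed

section \<open>Decompositions of words\<close>

text \<open>Relations of \<open>A\<^sub>\<infinity>\<close>-type are sums over all ways to cut a word into two or three pieces. These sums are written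
  \<open>\<Sum>x@y=w. t\<close> and \<open>\<Sum>x@y@z=w. t\<close>.\<close>

definition sp2 :: "'l list => ('l list \<times> 'l list) set" where
 "sp2 w = {(x, y). x @ y = w}"

definition sp3 :: "'l list => ('l list \<times> 'l list \<times> 'l list) set" where
 "sp3 w = {(x, y, z). x @ y @ z = w}"

syntax
 "_splits2" :: "pttrn => pttrn => 'l list => 't => 't" ("(\<Sum>_@_=_./ _)" [1000, 1000, 51, 10] 10)
 "_splits3" :: "pttrn => pttrn => pttrn => 'l list => 't => 't" ("(\<Sum>_@_@_=_./ _)" [1000, 1000, 1000, 51, 10] 10)

translations
 "\<Sum>x@y=w. t" => "CONST sum (%(x, y). t) (CONST sp2 w)"
 "\<Sum>x@y@z=w. t" => "CONST sum (%(x, y, z). t) (CONST sp3 w)"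

lemma sp2_iff [simp]: "(x, y) : sp2 w \<longleftrightarrow> x @ y = w" by (simp add: sp2_def)

lemma sp3_iff [simp]: "(x, y, z) : sp3 w \<longleftrightarrow> x @ y @ z = w" by (simp add: sp3_def)

lemma sp2_image: "sp2 w = (%i. (take i w, drop i w)) ` {..length w}"
proof (intro equalityI subsetI)
 fix t assume "t : sp2 w"
 then obtain x y where t: "t = (x, y)" "w = x @ y" by (cases t) auto
 show "t : (%i. (take i w, drop i w)) ` {..length w}" by (rule image_eqI[of _ _ "length x"]) (simp_all add: t)
qed auto

lemma sp3_image:
 "sp3 w = (%(j, i). (take i w, drop i (take j w), drop j w)) ` (SIGMA j:{..length w}. {..j})"
proof (intro equalityI subsetI)
 fix t assume "t : sp3 w"
 then obtain x y z where t: "t = (x, y, z)" "w = x @ y @ z" by (cases t) auto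
 show "t : (%(j, i). (take i w, drop i (take j w), drop j w)) ` (SIGMA j:{..length w}. {..j})"
  by (rule image_eqI[of _ _ "(length x + length y, length x)"]) (simp_all add: t)
next
 fix t assume "t : (%(j, i). (take i w, drop i (take j w), drop j w)) ` (SIGMA j:{..length w}. {..j})"
 then obtain i j where "i \<le> j" "j \<le> length w" "t = (take i w, drop i (take j w), drop j w)" by auto
 moreover have "take i w @ drop i (take j w) @ drop j w = w" if "i \<le> j"
  using append_take_drop_id[of i "take j w"] append_take_drop_id[of j w] that by (simp add: min_def flip: append_assoc)
 ultimately show "t : sp3 w" by simp
qed

lemma finite_sp [simp]: "finite (sp2 w)" "finite (sp3 w)" by (simp_all add: sp2_image sp3_image)

lemma sum_sp2: "(\<Sum>x@y=w. f x y) = (\<Sum>i\<le>length w. f (take i w) (drop i w))"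
proof -
 have "inj_on (%i. (take i w, drop i w)) {..length w}"
 proof (rule inj_onI)
  fix i j assume *: "i : {..length w}" "j : {..length w}" "(take i w, drop i w) = (take j w, drop j w)"
  then have "length (take i w) = length (take j w)" by simp
  then show "i = j" using * by simp
 qed
 then show ?thesis unfolding sp2_image by (subst sum.reindex) (simp_all add: o_def)
qed

lemma sum_sp3:
 "(\<Sum>x@y@z=w. f x y z) = (\<Sum>j\<le>length w. \<Sum>i\<le>j. f (take i w) (drop i (take j w)) (drop j w))"
proof -
 have "inj_on (%(j, i). (take i w, drop i (take j w), drop j w)) (SIGMA j:{..length w}. {..j})"
 proof (rule inj_onI, clarsimp)
  fix j i j' i' :: nat
  assume *: "j \<le> length w" "i \<le> j" "j' \<le> length w" "i' \<le> j'" "take i w = take i' w" "drop j w = drop j' w"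
  have "length w - j = length w - j'" using arg_cong[OF *(6), of length] by (simp only: length_drop)
  moreover have "min (length w) i = min (length w) i'" using arg_cong[OF *(5), of length] by (simp only: length_take)
  ultimately show "j = j' & i = i'" using *(1-4) by linarith
 qed
 then show ?thesis unfolding sp3_image by (subst sum.reindex) (auto simp: o_def sum.Sigma split_beta)
qed

lemma sum_list_concat_conc: "sum_list (concat xss) = (\<Sum>xs\<leftarrow>xss. sum_list xs)" by (induction xss) simp_all

lemma sum_splits1:
 "(\<Sum>s\<leftarrow>splits 1 (D0 # D). f s) = (\<Sum>x@y@z=D0. f (x, [y], z))"
proof -
 have "(\<Sum>s\<leftarrow>splits 1 (D0 # D). f s)
   = (\<Sum>j\<leftarrow>[0..<Suc (length D0)]. \<Sum>i\<leftarrow>[0..<Suc j]. f (take i D0, [drop i (take j D0)], drop j D0))"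
  by (simp add: splits_def map_concat o_def sum_list_concat_conc del: upt_Suc)
 also have "... = (\<Sum>j\<le>length D0. \<Sum>i\<le>j. f (take i D0, [drop i (take j D0)], drop j D0))"
  by (simp add: interv_sum_list_conv_sum_set_nat atLeast0LessThan lessThan_Suc_atMost del: upt_Suc)
 finally show ?thesis by (simp add: sum_sp3)
qed

lemma sum_splits2_left:
 "(\<Sum>s\<leftarrow>splits 2 [[], b]. f s) = (\<Sum>x@y=b. f ([], [[], x], y))"
proof -
 have "(\<Sum>s\<leftarrow>splits 2 [[], b]. f s) = (\<Sum>j\<leftarrow>[0..<Suc (length b)]. f ([], [[], take j b], drop j b))"
  by (simp add: splits_def map_concat o_def sum_list_concat_conc del: upt_Suc) (simp add: o_def)
 also have "... = (\<Sum>j\<le>length b. f ([], [[], take j b], drop j b))"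
  by (simp add: interv_sum_list_conv_sum_set_nat atLeast0LessThan lessThan_Suc_atMost del: upt_Suc)
 finally show ?thesis by (simp add: sum_sp2)
qed

lemma sum_splits2_right:
 "(\<Sum>s\<leftarrow>splits 2 [b, []]. f s) = (\<Sum>x@y=b. f (x, [y, []], []))"
proof -
 have "(\<Sum>s\<leftarrow>splits 2 [b, []]. f s) = (\<Sum>j\<leftarrow>[0..<Suc (length b)]. f (take j b, [drop j b, []], []))"
  by (simp add: splits_def map_concat o_def sum_list_concat_conc del: upt_Suc) (simp add: o_def)
 also have "... = (\<Sum>j\<le>length b. f (take j b, [drop j b, []], []))"
  by (simp add: interv_sum_list_conv_sum_set_nat atLeast0LessThan lessThan_Suc_atMost del: upt_Suc)
 finally show ?thesis by (simp add: sum_sp2)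
qed

section \<open>The structure operations as elements of modules\<close>

lemma sdeg_simps [simp]: "sdeg [] = 0" "sdeg (a # as) = fst a + 1 + sdeg as" "sdeg (as @ bs) = sdeg as + sdeg bs"
 by (simp_all add: sdeg_def deg_def)

lemma bdeg_simps [simp]: "bdeg [] = 0" "bdeg (b # bl) = sdeg b + bdeg bl" by (simp_all add: bdeg_def)

text \<open>An additive functional of one element, extended to formal tensors: it only sees tensors with one factor, of degree \<open>e\<close>.\<close>

definition AF :: "(int => ('r::comm_ring_1, 'm) module) => int => ('m => 't::ab_group_add) => 'r => 'm helem list => 't" where
 "AF M e h r us = (if us : hlists M & length us = 1 & fst (hd us) = e then h (r \<odot>`M e` snd (hd us)) else 0)"

definition additive_on :: "('r::comm_ring_1, 'm) module => ('m => 't::ab_group_add) => bool" where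
 "additive_on M h \<longleftrightarrow> (\<forall>x\<in>carrier M. \<forall>y\<in>carrier M. h (x \<oplus>`M` y) = h x + h y)"

lemma additive_onD: "additive_on M h ==> x : carrier M ==> y : carrier M ==> h (x \<oplus>`M` y) = h x + h y"
 by (simp add: additive_on_def)

lemma additive_on_zero: "is_module M ==> additive_on M h ==> h \<zero>`M` = 0"
 using additive_onD[of M h "\<zero>`M`" "\<zero>`M`"] by (simp add: mod_closed mod_laws(3))

lemma additive_on_neg: "is_module M ==> additive_on M h ==> x : carrier M ==> h (\<ominus>`M` x) = - h x"
 using additive_onD[of M h x "\<ominus>`M` x"] additive_on_zero[of M h] by (simp add: mod_closed mod_laws(5) add_eq_0_iff)

lemma AF_balanced:
 assumes M: "!!i. is_module (M i)" and h: "additive_on (M e) h"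
 shows "balanced M (AF M e h)" unfolding balanced_def
proof (intro conjI allI impI)
 show "coef_add (AF M e h)" unfolding coef_add_def AF_def
 proof (intro allI, goal_cases)
  case (1 r s us)
  show ?case
   by (cases us) (auto simp: mod_laws(7)[OF M] additive_onD[OF h] mod_closed[OF M])
 qed
next
 fix as bs d x y r
 assume *: "as : hlists M & bs : hlists M & x : carrier (M d) & y : carrier (M d)"
 show "AF M e h r (as @ [(d, x \<oplus>`M d` y)] @ bs) = AF M e h r (as @ [(d, x)] @ bs) + AF M e h r (as @ [(d, y)] @ bs)"
  using * by (cases as; cases bs) (auto simp: AF_def mod_laws(8)[OF M] additive_onD[OF h] mod_closed[OF M])
next
 fix as bs d x r s
 assume *: "as : hlists M & bs : hlists M & x : carrier (M d)"
 show "AF M e h r (as @ [(d, s \<odot>`M d` x)] @ bs) = AF M e h (r * s) (as @ [(d, x)] @ bs)"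
  using * by (cases as; cases bs) (auto simp: AF_def mod_laws(9)[OF M] mod_closed[OF M])
qed

text \<open>Operations take values in formal tensors. A tensor with one factor is equivalent to a single element, which makes it
  possible to evaluate operations with one output as elements of a module.\<close>

lemma homogeneous_tensor_rep:
 fixes M :: "int => ('r::comm_ring_1, 'm) module"
 assumes M: "!!i. is_module (M i)" and keys: "keys p \<subseteq> {us : hlists M. length us = 1 & sdeg us = e + 1}"
 shows "\<exists>x\<in>carrier (M e). teq M p (pt [(e, x)])"
proof -
 have "\<exists>x\<in>carrier (M e). teq M (\<Sum>k\<in>K. pm_scale (c k) (pt k)) (pt [(e, x)])"
  if "finite K" "K \<subseteq> {us : hlists M. length us = 1 & sdeg us = e + 1}" for K and c :: "'m helem list => 'r"
  using that
 proof (induction K rule: finite_induct)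
  case empty
  have "teq M (pt [(e, 0 \<odot>`M e` \<zero>`M e`)]) (pm_scale 0 (pt [(e, \<zero>`M e`)]))"
   using teq_pt_smult[of "[]" M "[]" "\<zero>`M e`" e 0] mod_closed(2)[OF M] by simp
  then show ?case using mod_closed(2)[OF M] mod_laws(11)[OF M]
   by (intro bexI[of _ "\<zero>`M e`"]) (simp_all add: pm_scale_simps teq_sym)
 next
  case (insert k K)
  obtain x where x: "x : carrier (M e)" "teq M (\<Sum>k\<in>K. pm_scale (c k) (pt k)) (pt [(e, x)])" using insert by auto
  obtain y where y: "k = [(e, y)]" "y : carrier (M e)" using insert.prems by (auto simp: length_Suc_conv)
  have "teq M (pm_scale (c k) (pt k)) (pt [(e, c k \<odot>`M e` y)])"
   using teq_pt_smult[of "[]" M "[]" y e "c k"] y by (simp add: teq_sym)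
  from teq_add[OF this x(2)]
  have "teq M (\<Sum>k\<in>insert k K. pm_scale (c k) (pt k)) (pt [(e, c k \<odot>`M e` y)] + pt [(e, x)])"
   using insert by simp
  moreover have "teq M (pt [(e, c k \<odot>`M e` y \<oplus>`M e` x)]) (pt [(e, c k \<odot>`M e` y)] + pt [(e, x)])"
   using teq_pt_add[of "[]" M "[]" "c k \<odot>`M e` y" e x] x y by (simp add: mod_closed[OF M])
  ultimately have "teq M (\<Sum>k\<in>insert k K. pm_scale (c k) (pt k)) (pt [(e, c k \<odot>`M e` y \<oplus>`M e` x)])"
   using teq_trans teq_sym by blast
  then show ?case using x y by (intro bexI[of _ "c k \<odot>`M e` y \<oplus>`M e` x"]) (simp_all add: mod_closed[OF M])
 qed
 from this[OF _ keys, of "lookup p"] show ?thesis using pm_expand[of p] by simp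
qed

text \<open>Tensors with one factor are separated by additive functionals.\<close>

lemma teq_pt_inj:
 fixes M :: "int => ('r::comm_ring_1, 'm) module"
 assumes R: "rational_algebra TYPE('r)" and M: "!!i. is_module (M i)"
  and x: "x : carrier (M e)" "y : carrier (M e)" "teq M (pt [(e, x)]) (pt [(e, y)])"
 shows "x = y"
proof (rule ccontr)
 assume "x ~= y"
 let ?z = "x \<oplus>`M e` \<ominus>`M e` y"
 have z: "?z : carrier (M e)" using x by (simp add: mod_closed[OF M])
 have "?z ~= \<zero>`M e`" using mod_diff_zero[OF M x(1,2)] \<open>x \<noteq> y\<close> by blast
 then obtain h :: "'m => 'r" where h: "h ?z = 1"
  "!!u v. u : carrier (M e) ==> v : carrier (M e) ==> h (u \<oplus>`M e` v) = h u + h v"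
  using additive_separating[OF R M z] by blast
 have ha: "additive_on (M e) h" using h(2) by (simp add: additive_on_def)
 have b: "balanced M (AF M e h)" by (rule AF_balanced[where M = M, OF M ha])
 have "h x = h y" using teq_EV[OF x(3) b] x(1,2) balanced_coef_add[OF b] by (simp add: AF_def mod_laws(10)[OF M])
 then have "h ?z = 0" using h(2) x additive_on_neg[OF M ha] by (simp add: mod_closed[OF M])
 then show False using h(1) by simp
qed

text \<open>The value of the \<open>A\<^sub>\<infinity>\<close>-operation on one block; \<open>mh\<close> adds its degree. A block of \<open>k\<close> elements has
  degree \<open>sdeg b\<close> in the suspension, and every \<open>A\<^sub>\<infinity>\<close>-operation lowers it by one; the value has degree
  \<open>sdeg b - 2\<close> in the algebra itself.\<close>

definition mval :: "('r::comm_ring_1, 'm) vinf => 'm helem list => 'm" where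
 "mval V b = (SOME x. x : carrier (mods V (sdeg b - 2)) & teq (mods V) (ops V [b]) (pt [(sdeg b - 2, x)]))"

definition mh :: "('r::comm_ring_1, 'm) vinf => 'm helem list => 'm helem" where
 "mh V b = (sdeg b - 2, mval V b)"

text \<open>Bilinear forms are what can be evaluated on the two outputs of an operation with values in tensors over the ring.\<close>

definition bilin :: "(int => ('r::comm_ring_1, 'm) module) => ('m helem => 'm helem => 'r residue_field) => bool" where
 "bilin M \<beta> \<longleftrightarrow>
  (\<forall>d x y v. x : carrier (M d) & y : carrier (M d) & [v] : hlists M -->
    \<beta> (d, x \<oplus>`M d` y) v = \<beta> (d, x) v + \<beta> (d, y) v & \<beta> v (d, x \<oplus>`M d` y) = \<beta> v (d, x) + \<beta> v (d, y)) &
  (\<forall>d x r v. x : carrier (M d) & [v] : hlists M -->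
    \<beta> (d, r \<odot>`M d` x) v = res r * \<beta> (d, x) v & \<beta> v (d, r \<odot>`M d` x) = res r * \<beta> v (d, x))"

definition BF :: "(int => ('r::comm_ring_1, 'm) module) => ('m helem => 'm helem => 'r residue_field)
  => 'r => 'm helem list => 'r residue_field" where
 "BF M \<beta> r us = (if us : hlists M & length us = 2 then res r * \<beta> (us ! 0) (us ! 1) else 0)"

lemma BF_coef_add: "coef_add (BF M \<beta>)" by (simp add: coef_add_def BF_def algebra_simps)

lemma length2: "length us = 2 \<longleftrightarrow> (\<exists>a b. us = [a, b])" by (auto simp: numeral_2_eq_2 length_Suc_conv)

lemma BF_balanced:
 assumes M: "!!i. is_module (M i)" and b: "bilin M \<beta>"
 shows "balanced M (BF M \<beta>)" unfolding balanced_def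
proof (intro conjI allI impI)
 show "coef_add (BF M \<beta>)" by (rule BF_coef_add)
next
 fix as bs d x y r
 assume *: "as : hlists M & bs : hlists M & x : carrier (M d) & y : carrier (M d)"
 consider "length as + length bs ~= 1" | a where "as = [a]" "bs = []" | a where "as = []" "bs = [a]"
  by (cases as; cases bs) (auto simp: length_Suc_conv)
 then show "BF M \<beta> r (as @ [(d, x \<oplus>`M d` y)] @ bs) = BF M \<beta> r (as @ [(d, x)] @ bs) + BF M \<beta> r (as @ [(d, y)] @ bs)"
  by cases (use * b in \<open>auto simp: BF_def bilin_def mod_closed[OF M] algebra_simps\<close>)
next
 fix as bs d x r s
 assume *: "as : hlists M & bs : hlists M & x : carrier (M d)"
 consider "length as + length bs ~= 1" | a where "as = [a]" "bs = []" | a where "as = []" "bs = [a]"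
  by (cases as; cases bs) (auto simp: length_Suc_conv)
 then show "BF M \<beta> r (as @ [(d, s \<odot>`M d` x)] @ bs) = BF M \<beta> (r * s) (as @ [(d, x)] @ bs)"
  by cases (use * b in \<open>auto simp: BF_def bilin_def mod_closed[OF M] algebra_simps\<close>)
qed

lemma sum_sp3_cong:
 "(!!x y z. x @ y @ z = w ==> f x y z = g x y z) ==> (\<Sum>x@y@z=w. f x y z) = (\<Sum>x@y@z=w. g x y z)"
 by (rule sum.cong) auto

lemma sum_sp2_cong:
 "(!!x y. x @ y = w ==> f x y = g x y) ==> (\<Sum>x@y=w. f x y) = (\<Sum>x@y=w. g x y)"
 by (rule sum.cong) auto

lemma mod_smult_commute: "is_module M ==> x : carrier M ==> r \<odot>`M` (s \<odot>`M` x) = s \<odot>`M` (r \<odot>`M` x)"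
 by (metis mod_laws(9) mult.commute)

lemma balanced_scale: "balanced M F ==> balanced M (%s. F (c * s))"
 unfolding balanced_def by (auto simp: coef_add_scale mult.assoc)

locale valg =
 fixes n :: int and V :: "('r::comm_ring_1, 'm) vinf"
 assumes alg: "vinf_algebra n V" and R: "rational_algebra TYPE('r)"

begin

abbreviation M where "M \<equiv> mods V"

abbreviation \<delta> where "\<delta> \<equiv> diff V"

lemma M: "is_module (M i)" and d_lin: "linear_map (M i) (M (i - 1)) (\<delta> i)"
 and dd: "x : carrier (M i) ==> \<delta> (i - 1) (\<delta> i x) = \<zero>`M (i - 2)`"
 and sCH: "sCH M n (- 1) (ops V)" and ops_nil: "teq M (ops V [[]]) 0"
 and ops_single: "x : carrier (M i) ==> teq M (ops V [[(i, x)]]) (pt [(i - 1, \<delta> i x)])"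
 and nec_zero: "1 \<le> l ==> bl : blocks M l ==> teq M (nec n (- 1) (- 1) (ops V) (ops V) bl) 0"
 using alg unfolding vinf_algebra_def by blast+

lemma ops1:
 assumes "b : hlists M"
 shows "keys (ops V [b]) \<subseteq> {us : hlists M. length us = 1 & sdeg us = sdeg b - 1}"
proof -
 have "multi_op M 1 (- 1 - (n - 3) * (int 1 - 1)) (ops V)" using sCH unfolding sCH_def by (metis order_refl)
 moreover have "[b] : blocks M 1" using assms by (simp add: blocks_def)
 ultimately have "keys (ops V [b]) \<subseteq>
   {us : hlists M. length us = 1 & sdeg us = bdeg [b] + (- 1 - (n - 3) * (int 1 - 1))}" unfolding multi_op_def by blast
 then show ?thesis by simp
qed

lemma ops1_key:
 assumes "b : hlists M" "w : keys (ops V [b])"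
 obtains u where "w = [(sdeg b - 2, u)]" "u : carrier (M (sdeg b - 2))"
proof -
 have w: "w : hlists M & length w = 1 & sdeg w = sdeg b - 1" using ops1[OF assms(1)] assms(2) by blast
 then obtain e u where eu: "w = [(e, u)]" by (cases w) auto
 moreover have "e = sdeg b - 2" using w eu by simp
 ultimately show thesis using that[of u] w by simp
qed

lemma ops2:
 assumes "b : hlists M" "c : hlists M"
 shows "keys (ops V [b, c]) \<subseteq> {us : hlists M. length us = 2 & sdeg us = sdeg b + sdeg c + 2 - n}"
proof -
 have "multi_op M 2 (- 1 - (n - 3) * (int 2 - 1)) (ops V)" using sCH unfolding sCH_def by (metis one_le_numeral)
 moreover have "[b, c] : blocks M 2" using assms by (simp add: blocks_def)
 ultimately have "keys (ops V [b, c]) \<subseteq>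
   {us : hlists M. length us = 2 & sdeg us = bdeg [b, c] + (- 1 - (n - 3) * (int 2 - 1))}" unfolding multi_op_def by blast
 then show ?thesis by (simp add: algebra_simps)
qed

lemma ops_multilinear:
 assumes "1 \<le> l" "Bs @ [P @ [(d, x)] @ Q] @ Cs : blocks M l" "y : carrier (M d)"
 shows "teq M (ops V (Bs @ [P @ [(d, x \<oplus>`M d` y)] @ Q] @ Cs))
   (ops V (Bs @ [P @ [(d, x)] @ Q] @ Cs) + ops V (Bs @ [P @ [(d, y)] @ Q] @ Cs))"
  and "teq M (ops V (Bs @ [P @ [(d, r \<odot>`M d` x)] @ Q] @ Cs)) (pm_scale r (ops V (Bs @ [P @ [(d, x)] @ Q] @ Cs)))"
 using sCH assms unfolding sCH_def multi_op_def Let_def by blast+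

lemma ops1_add:
 assumes "P : hlists M" "Q : hlists M" "x : carrier (M d)" "y : carrier (M d)"
 shows "teq M (ops V [P @ [(d, x \<oplus>`M d` y)] @ Q]) (ops V [P @ [(d, x)] @ Q] + ops V [P @ [(d, y)] @ Q])"
  and "teq M (ops V [P @ [(d, r \<odot>`M d` x)] @ Q]) (pm_scale r (ops V [P @ [(d, x)] @ Q]))"
 using ops_multilinear[of 1 "[]" P d x Q "[]" y] assms by (simp_all add: blocks_def)

lemma ops2_add:
 assumes "P : hlists M" "Q : hlists M" "c : hlists M" "x : carrier (M d)" "y : carrier (M d)"
 shows "teq M (ops V [P @ [(d, x \<oplus>`M d` y)] @ Q, c]) (ops V [P @ [(d, x)] @ Q, c] + ops V [P @ [(d, y)] @ Q, c])"
  and "teq M (ops V [P @ [(d, r \<odot>`M d` x)] @ Q, c]) (pm_scale r (ops V [P @ [(d, x)] @ Q, c]))"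
  and "teq M (ops V [c, P @ [(d, x \<oplus>`M d` y)] @ Q]) (ops V [c, P @ [(d, x)] @ Q] + ops V [c, P @ [(d, y)] @ Q])"
  and "teq M (ops V [c, P @ [(d, r \<odot>`M d` x)] @ Q]) (pm_scale r (ops V [c, P @ [(d, x)] @ Q]))"
 using ops_multilinear[of 2 "[]" P d x Q "[c]" y] ops_multilinear[of 2 "[c]" P d x Q "[]" y] assms by (simp_all add: blocks_def)

lemma mval:
 assumes "b : hlists M"
 shows mval_closed: "mval V b : carrier (M (sdeg b - 2))" and mval_teq: "teq M (ops V [b]) (pt [mh V b])"
proof -
 have "\<exists>x. x : carrier (M (sdeg b - 2)) & teq M (ops V [b]) (pt [(sdeg b - 2, x)])"
  using homogeneous_tensor_rep[where M = M and p = "ops V [b]" and e = "sdeg b - 2", OF M] ops1[OF assms] by auto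
 from someI_ex[OF this, folded mval_def]
 show "mval V b : carrier (M (sdeg b - 2))" "teq M (ops V [b]) (pt [mh V b])" by (simp_all add: mh_def)
qed

lemma mval_eq:
 assumes "b : hlists M" "sdeg b - 2 = e" "x : carrier (M e)" "teq M (ops V [b]) (pt [(e, x)])"
 shows "mval V b = x" using teq_pt_inj[where M = M and x = "mval V b" and e = e and y = x, OF R M] mval_closed[OF assms(1)]
  teq_trans[OF teq_sym[OF mval_teq[OF assms(1)]] assms(4)] assms(2,3) by (simp add: mh_def)

lemma mh_hlists [simp]: "b : hlists M ==> [mh V b] : hlists M" by (simp add: mh_def mval_closed)

lemma fst_mh [simp]: "fst (mh V b) = sdeg b - 2" by (simp add: mh_def)

lemma snd_mh [simp]: "snd (mh V b) = mval V b" by (simp add: mh_def)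

lemma mval_add:
 assumes "P : hlists M" "Q : hlists M" "x : carrier (M d)" "y : carrier (M d)" and "e = sdeg P + d + sdeg Q - 1"
 shows "mval V (P @ [(d, x \<oplus>`M d` y)] @ Q) = mval V (P @ [(d, x)] @ Q) \<oplus>`M e` mval V (P @ [(d, y)] @ Q)"
  and "mval V (P @ [(d, r \<odot>`M d` x)] @ Q) = r \<odot>`M e` mval V (P @ [(d, x)] @ Q)"
proof -
 have e: "sdeg (P @ [(d, z)] @ Q) - 2 = e" for z using assms(5) by simp
 have h: "P @ [(d, z)] @ Q : hlists M" if "z : carrier (M d)" for z using assms that by simp
 have c: "mval V (P @ [(d, z)] @ Q) : carrier (M e)" if "z : carrier (M d)" for z using mval_closed[OF h[OF that]] unfolding e .
 have t: "teq M (ops V [P @ [(d, z)] @ Q]) (pt [(e, mval V (P @ [(d, z)] @ Q))])" if "z : carrier (M d)" for z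
  using mval_teq[OF h[OF that]] unfolding mh_def e .
 show "mval V (P @ [(d, x \<oplus>`M d` y)] @ Q) = mval V (P @ [(d, x)] @ Q) \<oplus>`M e` mval V (P @ [(d, y)] @ Q)"
 proof (rule mval_eq[OF h e])
  show "teq M (ops V [P @ [(d, x \<oplus>`M d` y)] @ Q])
    (pt [(e, mval V (P @ [(d, x)] @ Q) \<oplus>`M e` mval V (P @ [(d, y)] @ Q))])"
   using teq_trans[OF ops1_add(1)[OF assms(1-4)] teq_trans[OF teq_add[OF t[OF assms(3)] t[OF assms(4)]]
     teq_sym[OF teq_pt_add[of "[]" M "[]" _ e, simplified, OF c[OF assms(3)] c[OF assms(4)]]]]] by simp
 qed (use assms c in \<open>simp_all add: mod_closed[OF M]\<close>)
 show "mval V (P @ [(d, r \<odot>`M d` x)] @ Q) = r \<odot>`M e` mval V (P @ [(d, x)] @ Q)"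
 proof (rule mval_eq[OF h e])
  show "teq M (ops V [P @ [(d, r \<odot>`M d` x)] @ Q]) (pt [(e, r \<odot>`M e` mval V (P @ [(d, x)] @ Q))])"
   using teq_trans[OF ops1_add(2)[OF assms(1-4)] teq_trans[OF teq_scale[OF t[OF assms(3)]]
     teq_sym[OF teq_pt_smult[of "[]" M "[]" _ e, unfolded append_Nil append_Nil2, OF _ _ c[OF assms(3)]]]]] by simp
 qed (use assms c in \<open>simp_all add: mod_closed[OF M]\<close>)
qed

lemma mval_zero:
 assumes "P : hlists M" "Q : hlists M" "e = sdeg P + d + sdeg Q - 1"
 shows "mval V (P @ [(d, \<zero>`M d`)] @ Q) = \<zero>`M e`"
proof -
 have e: "sdeg (P @ [(d, \<zero>`M d`)] @ Q) - 2 = e" using assms(3) by simp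
 have "P @ [(d, \<zero>`M d`)] @ Q : hlists M" using assms by (simp add: mod_closed[OF M])
 then have "mval V (P @ [(d, \<zero>`M d`)] @ Q) : carrier (M e)" using mval_closed unfolding e[symmetric] by blast
 then show ?thesis using mval_add(2)[OF assms(1,2) _ _ assms(3), of "\<zero>`M d`" "\<zero>`M d`" 0]
  by (simp add: mod_laws(11)[OF M] mod_closed[OF M])
qed

lemma mval_nil: "mval V [] = \<zero>`M (- 2)`"
proof (rule mval_eq)
 have "teq M (pt [(- 2, 0 \<odot>`M (- 2)` \<zero>`M (- 2)`)]) (pm_scale 0 (pt [(- 2, \<zero>`M (- 2)`)]))"
  using teq_pt_smult[of "[]" M "[]" "\<zero>`M (- 2)`" "- 2" 0] mod_closed(2)[OF M] by simp
 then have "teq M (pt [(- 2, \<zero>`M (- 2)`)]) 0" by (simp add: pm_scale_simps mod_laws[OF M] mod_closed[OF M])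
 then show "teq M (ops V [[]]) (pt [(- 2, \<zero>`M (- 2)`)])" using teq_trans[OF ops_nil teq_sym] by blast
qed (simp_all add: mod_closed[OF M])

lemma mval_single: "x : carrier (M i) ==> mval V [(i, x)] = \<delta> i x"
 by (rule mval_eq[OF _ _ _ ops_single]) (simp_all add: linear_mapD(1)[OF d_lin])

lemma coef_add_scale2: "coef_add F ==> coef_add (%s. F ((r :: 'r) * (t * s)))"
 by (simp add: coef_add_def distrib_left)

lemma EV_mh:
 fixes F :: "'r => 'm helem list => 't::ab_group_add"
 assumes "balanced M F" "b : hlists M"
 shows "EV F (ops V [b]) = F 1 [mh V b]" using teq_EV[OF mval_teq[OF assms(2)] assms(1)] balanced_coef_add[OF assms(1)] by simp

text \<open>The quadratic relation for one block: the \<open>A\<^sub>\<infinity>\<close>-relation.\<close>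

lemma A_infinity_relation:
 fixes h :: "'m => 't::comm_ring_1"
 assumes b: "b : hlists M" and h: "additive_on (M (sdeg b - 3)) h"
 shows "(\<Sum>x@y@z=b. ksg (sdeg x) * h (mval V (x @ [mh V y] @ z))) = 0"
proof -
 let ?e = "sdeg b - 3"
 let ?F = "AF M ?e h"
 have F: "balanced M ?F" by (rule AF_balanced[where M = M, OF M h])
 have Fc: "coef_add ?F" by (rule balanced_coef_add[OF F])
 have tm: "EV ?F (nec_term n (- 1) (- 1) (ops V) (ops V) 1 [b] (x, [y], z))
   = ksg (sdeg x) * h (mval V (x @ [mh V y] @ z))" if "x @ y @ z = b" for x y z
 proof -
  have xyz: "x : hlists M" "y : hlists M" "z : hlists M" using b that by auto
  define sg :: 'r where "sg = ksg (sdeg x)"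
  define h' where "h' u = h (sg \<odot>`M ?e` mval V (x @ [(sdeg y - 2, u)] @ z))" for u
  have e: "?e = sdeg x + (sdeg y - 2) + sdeg z - 1" using that by auto
  have mc: "mval V (x @ [(sdeg y - 2, u)] @ z) : carrier (M ?e)" if "u : carrier (M (sdeg y - 2))" for u
   using mval_closed[of "x @ [(sdeg y - 2, u)] @ z"] xyz that e by (simp add: algebra_simps)
  have h': "additive_on (M (sdeg y - 2)) h'" unfolding additive_on_def h'_def using mval_add(1)[OF xyz(1,3) _ _ e] mc additive_onD[OF h]
   by (simp add: mod_laws(8)[OF M] mod_closed[OF M])
  have "EV ?F (nec_term n (- 1) (- 1) (ops V) (ops V) 1 [b] (x, [y], z))
   = EV (%r w. EV (%s w'. ?F (r * (s * ksg ((- 1 + (n - 1) * (int 1 - 1)) * sdeg x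
      + sdeg (tl w) * (sdeg z + bdeg (drop 1 [b])) + sdeg (tl w) * sdeg (tl w') + (n - 1) * (- 1) * (int 1 - 1)))) (hd w' # tl w @ tl w'))
     (ops V ((x @ [hd w] @ z) # drop 1 [b]))) (ops V [y])" unfolding nec_term_def prod.case
   by (simp add: EV_lin_ext Fc coef_add_scale coef_add_scale2)
  also have "... = EV (AF M (sdeg y - 2) h') (ops V [y])"
  proof (rule EV_cong, goal_cases)
   case (1 w)
   from 1 obtain u where w: "w = [(sdeg y - 2, u)]" and u: "u : carrier (M (sdeg y - 2))" by (rule ops1_key[OF xyz(2)])
   let ?r = "lookup (ops V [y]) w"
   let ?u = "(sdeg y - 2, u)"
   have b': "x @ [?u] @ z : hlists M" using xyz u by simp
   have "EV (%s w'. ?F (?r * (s * ksg ((- 1 + (n - 1) * (int 1 - 1)) * sdeg x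
      + sdeg (tl w) * (sdeg z + bdeg (drop 1 [b])) + sdeg (tl w) * sdeg (tl w')
      + (n - 1) * (- 1) * (int 1 - 1)))) (hd w' # tl w @ tl w')) (ops V ((x @ [hd w] @ z) # drop 1 [b]))
     = EV (%s w'. ?F ((?r * sg) * s) w') (ops V [x @ [?u] @ z])" unfolding w list.sel drop_Suc_Cons drop_0
   proof (simp only: drop_Suc_Cons drop_0 One_nat_def list.sel, rule EV_cong)
    fix w' assume "w' : keys (ops V [x @ [?u] @ z])"
    then obtain v where "w' = [(sdeg (x @ [?u] @ z) - 2, v)]" by (rule ops1_key[OF b'])
    then show "?F (lookup (ops V [y]) [?u] * (lookup (ops V [x @ [?u] @ z]) w'
      * ksg ((- 1 + (n - 1) * (int (Suc 0) - 1)) * sdeg x + sdeg [] * (sdeg z + bdeg []) + sdeg [] * sdeg (tl w')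
      + (n - 1) * (- 1) * (int (Suc 0) - 1)))) (hd w' # [] @ tl w')
     = ?F (lookup (ops V [y]) [?u] * sg * lookup (ops V [x @ [?u] @ z]) w') w'"
     by (simp add: sg_def sgn_pow_def algebra_simps)
   qed
   also have "... = ?F (?r * sg) [mh V (x @ [?u] @ z)]"
   proof -
    have "balanced M (%s. ?F ((?r * sg) * s))" by (rule balanced_scale[OF F])
    from EV_mh[OF this b'] show ?thesis by simp
   qed
   also have "... = AF M (sdeg y - 2) h' ?r w"
   proof -
    have "sdeg (x @ [?u] @ z) - 2 = ?e" using e by simp
    then show ?thesis using xyz u mc[OF u] mval_add(2)[OF xyz(1,3) u u e, of ?r] e
     by (simp add: AF_def w h'_def mh_def mod_laws(9)[OF M] mod_smult_commute[OF M, of _ _ sg])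
   qed
   finally show ?case .
  qed
  also have "... = h' (mval V y)" using EV_mh[OF AF_balanced[where M = M, OF M h'] xyz(2)] mval_closed[OF xyz(2)] mod_laws(10)[OF M]
   by (simp add: AF_def)
  also have "... = ksg (sdeg x) * h (mval V (x @ [mh V y] @ z))" using mc[OF mval_closed[OF xyz(2)]] additive_on_neg[OF M h]
   by (simp add: h'_def sg_def sgn_pow_def mh_def mod_laws(10,13)[OF M])
  finally show ?thesis .
 qed
 have rot: "EV ?F (lin_ext (%us. let k = length [b] - 0 in single (rotate k us)
   (ksg (bdeg (take 0 [b]) * bdeg (drop 0 [b]) + sdeg (take k us) * sdeg (drop k us)
    + (n - 1) * (int (length [b]) - 1) * int 0))) t) = EV ?F t" for t
 proof -
  have "(%r us. EV (%s. ?F (r * s)) (let k = length [b] - 0 in single (rotate k us)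
   (ksg (bdeg (take 0 [b]) * bdeg (drop 0 [b]) + sdeg (take k us) * sdeg (drop k us)
    + (n - 1) * (int (length [b]) - 1) * int 0)))) = ?F"
  by (fastforce simp: Fc coef_add_scale AF_def)
  then show ?thesis by (simp add: EV_lin_ext Fc del: length_Cons)
 qed
 have "EV ?F (nec n (- 1) (- 1) (ops V) (ops V) [b]) = (\<Sum>s\<leftarrow>splits 1 [b]. EV ?F (nec_term n (- 1) (- 1) (ops V) (ops V) 1 [b] s))"
  unfolding nec_def EV_sum[OF Fc] EV_sum_list[OF Fc] using rot by simp
 also have "... = (\<Sum>x@y@z=b. EV ?F (nec_term n (- 1) (- 1) (ops V) (ops V) 1 [b] (x, [y], z)))" by (rule sum_splits1)
 also have "... = (\<Sum>x@y@z=b. ksg (sdeg x) * h (mval V (x @ [mh V y] @ z)))" by (rule sum_sp3_cong, rule tm)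
 finally show ?thesis using teq_EV[OF nec_zero[of 1 "[b]"] F] b by (simp add: blocks_def)
qed

end

lemma BF_mult: "BF M \<beta> (c * s) us = res c * BF M \<beta> s us" by (simp add: BF_def algebra_simps)

lemma EV_BF_scale: "EV (%s. BF M \<beta> (c * s)) t = res c * EV (BF M \<beta>) t" by (simp add: EV_def BF_mult sum_distrib_left)

lemma bilinD:
 assumes "bilin M \<beta>"
 shows "x : carrier (M d) ==> y : carrier (M d) ==> [v] : hlists M ==> \<beta> (d, x \<oplus>`M d` y) v = \<beta> (d, x) v + \<beta> (d, y) v"
  and "x : carrier (M d) ==> y : carrier (M d) ==> [v] : hlists M ==> \<beta> v (d, x \<oplus>`M d` y) = \<beta> v (d, x) + \<beta> v (d, y)"
  and "x : carrier (M d) ==> [v] : hlists M ==> \<beta> (d, r \<odot>`M d` x) v = res r * \<beta> (d, x) v"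
  and "x : carrier (M d) ==> [v] : hlists M ==> \<beta> v (d, r \<odot>`M d` x) = res r * \<beta> v (d, x)"
 using assms unfolding bilin_def by blast+

lemma bilinI:
 assumes "!!d x y v. x : carrier (M d) ==> y : carrier (M d) ==> [v] : hlists M ==> \<beta> (d, x \<oplus>`M d` y) v = \<beta> (d, x) v + \<beta> (d, y) v"
  and "!!d x y v. x : carrier (M d) ==> y : carrier (M d) ==> [v] : hlists M ==> \<beta> v (d, x \<oplus>`M d` y) = \<beta> v (d, x) + \<beta> v (d, y)"
  and "!!d x r v. x : carrier (M d) ==> [v] : hlists M ==> \<beta> (d, r \<odot>`M d` x) v = res r * \<beta> (d, x) v"
  and "!!d x r v. x : carrier (M d) ==> [v] : hlists M ==> \<beta> v (d, r \<odot>`M d` x) = res r * \<beta> v (d, x)"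
 shows "bilin M \<beta>" using assms unfolding bilin_def by blast

lemma bilin_sign:
 assumes "bilin M \<beta>"
 shows "bilin M (%u v. ksg (\<sigma> (fst u) (fst v)) * \<beta> u v)"
 by (rule bilinI) (simp_all add: bilinD[OF assms] algebra_simps)

lemma bilin_flip: "bilin M \<beta> ==> bilin M (%u v. \<beta> v u)" unfolding bilin_def by blast

text \<open>The form obtained by exchanging the two outputs, with the sign of the cyclic symmetry.\<close>

definition swap_form :: "int => ('m helem => 'm helem => 't::comm_ring_1) => 'm helem => 'm helem => 't" where
 "swap_form n \<beta> u v = ksg ((fst u + 1) * (fst v + 1) + (n - 1)) * \<beta> v u"

lemma swap_form_bilin: "bilin M \<beta> ==> bilin M (swap_form n \<beta>)" unfolding swap_form_def[abs_def]
 by (rule bilin_sign[where \<sigma> = "%i j. (i + 1) * (j + 1) + (n - 1)"], rule bilin_flip)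

context valg

begin

lemma mval_closed': "b : hlists M ==> sdeg b - 2 = e ==> mval V b : carrier (M e)"
 using mval_closed by blast

lemma ops2_key:
 assumes "b : hlists M" "c : hlists M" "w : keys (ops V [b, c])"
 obtains u v where "w = [u, v]" "[u] : hlists M" "[v] : hlists M" "fst u + fst v = sdeg b + sdeg c - n"
 using ops2[OF assms(1,2)] assms(3) by (auto simp: length2)

text \<open>The quadratic relation composes an operation with one output and one with two outputs. Here the value of the first is
  plugged into the copairing; in the next lemma one of the outputs of the copairing is plugged into the first.\<close>

lemma nec_term_single:
 assumes P: "P : hlists M" and Y: "Y : hlists M" and Q: "Q : hlists M" and D: "D1 : hlists M" and b: "bilin M \<beta>"
 shows "EV (BF M \<beta>) (nec_term n (- 1) (- 1) (ops V) (ops V) 1 [D0, D1] (P, [Y], Q))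
  = ksg (sdeg P) * EV (BF M \<beta>) (ops V [P @ [mh V Y] @ Q, D1])"
proof -
 let ?F = "BF M \<beta>"
 let ?e = "sdeg Y - 2"
 have F: "balanced M ?F" by (rule BF_balanced[OF M b])
 have Fc: "coef_add ?F" by (rule BF_coef_add)
 define h where "h u = ksg (sdeg P) * EV ?F (ops V [P @ [(?e, u)] @ Q, D1])" for u
 have h: "additive_on (M ?e) h" unfolding additive_on_def h_def
  using teq_EV[OF ops2_add(1)[OF P Q D] F] by (simp add: EV_add[OF Fc] distrib_left)
 have hs: "h (r \<odot>`M ?e` u) = res r * h u" if "u : carrier (M ?e)" for r u unfolding h_def
  using teq_EV[OF ops2_add(2)[OF P Q D that that] F] by (simp add: EV_pm_scale[OF Fc] EV_BF_scale)
 let ?sg = "%w w'. ksg ((- 1 + (n - 1) * (int 1 - 1)) * sdeg P + sdeg (tl w) * (sdeg Q + bdeg (drop 1 [D0, D1]))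
      + sdeg (tl w) * sdeg (tl w') + (n - 1) * (- 1) * (int 1 - 1)) :: 'r"
 have "EV ?F (nec_term n (- 1) (- 1) (ops V) (ops V) 1 [D0, D1] (P, [Y], Q))
   = EV (%r w. EV (%s w'. ?F (r * (s * ?sg w w')) (hd w' # tl w @ tl w'))
     (ops V ((P @ [hd w] @ Q) # drop 1 [D0, D1]))) (ops V [Y])" unfolding nec_term_def prod.case
  by (simp add: EV_lin_ext Fc coef_add_scale coef_add_scale2)
 also have "... = EV (AF M ?e h) (ops V [Y])"
 proof (rule EV_cong, goal_cases)
  case (1 w)
  from 1 obtain u where w: "w = [(?e, u)]" and u: "u : carrier (M ?e)" by (rule ops1_key[OF Y])
  let ?r = "lookup (ops V [Y]) w"
  let ?t = "ops V [P @ [(?e, u)] @ Q, D1]"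
  have b': "P @ [(?e, u)] @ Q : hlists M" using P Q u by simp
  have "EV (%s w'. ?F (?r * (s * ?sg w w')) (hd w' # tl w @ tl w')) (ops V ((P @ [hd w] @ Q) # drop 1 [D0, D1]))
    = EV (%s w'. ?F ((?r * ksg (sdeg P)) * s) w') ?t"
  proof -
   have "(P @ [hd w] @ Q) # drop 1 [D0, D1] = [P @ [(?e, u)] @ Q, D1]" by (simp add: w)
   moreover have "EV (%s w'. ?F (?r * (s * ?sg w w')) (hd w' # tl w @ tl w')) ?t
    = EV (%s w'. ?F ((?r * ksg (sdeg P)) * s) w') ?t"
   proof (rule EV_cong, goal_cases)
    case (1 w')
    from 1 obtain v v' where w': "w' = [v, v']" by (rule ops2_key[OF b' D])
    have "?sg w w' = ksg (sdeg P)" by (simp add: w sgn_pow_def)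
    then show ?case by (simp add: w w' BF_mult algebra_simps)
   qed
   ultimately show ?thesis by simp
  qed
  also have "... = AF M ?e h ?r w" unfolding EV_BF_scale using u hs[OF u] by (simp add: AF_def w h_def algebra_simps)
  finally show ?case .
 qed
 also have "... = h (mval V Y)" using EV_mh[OF AF_balanced[where M = M, OF M h] Y] mval_closed[OF Y] mod_laws(10)[OF M]
  by (simp add: AF_def)
 finally show ?thesis by (simp add: h_def mh_def)
qed

lemma nec_term_double:
 assumes P: "P : hlists M" and C: "C : hlists M" "C' : hlists M" and Q: "Q : hlists M" and b: "bilin M \<beta>"
 shows "EV (BF M \<beta>) (nec_term n (- 1) (- 1) (ops V) (ops V) 2 [D0, D1] (P, [C, C'], Q))
  = EV (BF M (%a v. ksg (n * sdeg P + (fst v + 1) * sdeg Q + (n - 1)) * \<beta> (mh V (P @ [a] @ Q)) v)) (ops V [C, C'])"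
proof -
 let ?F = "BF M \<beta>"
 have Fc: "coef_add ?F" by (rule BF_coef_add)
 let ?sg = "%w w'. ksg ((- 1 + (n - 1) * (int 2 - 1)) * sdeg P + sdeg (tl w) * (sdeg Q + bdeg (drop 2 [D0, D1]))
      + sdeg (tl w) * sdeg (tl w') + (n - 1) * (- 1) * (int 2 - 1)) :: 'r"
 let ?\<beta> = "%a v. ksg (n * sdeg P + (fst v + 1) * sdeg Q + (n - 1)) * \<beta> (mh V (P @ [a] @ Q)) v"
 have "EV ?F (nec_term n (- 1) (- 1) (ops V) (ops V) 2 [D0, D1] (P, [C, C'], Q))
   = EV (%r w. EV (%s w'. ?F (r * (s * ?sg w w')) (hd w' # tl w @ tl w'))
     (ops V ((P @ [hd w] @ Q) # drop 2 [D0, D1]))) (ops V [C, C'])" unfolding nec_term_def prod.case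
  by (simp add: EV_lin_ext Fc coef_add_scale coef_add_scale2)
 also have "... = EV (BF M ?\<beta>) (ops V [C, C'])"
 proof (rule EV_cong, goal_cases)
  case (1 w)
  from 1 obtain a v where w: "w = [a, v]" and a: "[a] : hlists M" and v: "[v] : hlists M" by (rule ops2_key[OF C])
  let ?r = "lookup (ops V [C, C']) w"
  let ?t = "ops V [P @ [a] @ Q]"
  have b': "P @ [a] @ Q : hlists M" using P Q a by simp
  let ?s = "ksg (n * sdeg P + (fst v + 1) * sdeg Q + (n - 1)) :: 'r"
  let ?G = "%s w'. if length w' = 1 then ?F s [hd w', v] else 0"
  have G: "balanced M ?G" unfolding balanced_def
  by (auto simp: coef_add_def BF_def bilinD[OF b] mod_closed[OF M] algebra_simps)
  have "EV (%s w'. ?F (?r * (s * ?sg w w')) (hd w' # tl w @ tl w')) (ops V ((P @ [hd w] @ Q) # drop 2 [D0, D1]))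
    = EV (%s w'. res (?r * ?s) * ?G s w') ?t"
  proof -
   have "(P @ [hd w] @ Q) # drop 2 [D0, D1] = [P @ [a] @ Q]" by (simp add: w)
   moreover have "EV (%s w'. ?F (?r * (s * ?sg w w')) (hd w' # tl w @ tl w')) ?t = EV (%s w'. res (?r * ?s) * ?G s w') ?t"
   proof (rule EV_cong, goal_cases)
    case (1 w')
    from 1 obtain u where w': "w' = [(sdeg (P @ [a] @ Q) - 2, u)]" by (rule ops1_key[OF b'])
    have "?sg w w' = ?s" by (simp add: w w' sgn_pow_def)
    then show ?case
     by (simp add: w w' BF_def algebra_simps)
   qed
   ultimately show ?thesis by simp
  qed
  also have "... = res (?r * ?s) * ?F 1 [mh V (P @ [a] @ Q), v]" unfolding EV_mult_left using EV_mh[OF G b'] by simp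
  also have "... = BF M ?\<beta> ?r w" using a v mh_hlists[OF b'] by (simp add: BF_def w algebra_simps)
  finally show ?case .
 qed
 finally show ?thesis .
qed

text \<open>Cyclic symmetry exchanges the blocks \<open>[[], y]\<close> and \<open>[y, []]\<close>, so that one of them is enough.\<close>

lemma ops_swap:
 assumes B: "B : hlists M" and b: "bilin M \<beta>"
 shows "EV (BF M \<beta>) (ops V [B, []]) = EV (BF M (swap_form n \<beta>)) (ops V [[], B])"
proof -
 let ?t = "ops V [[], B]"
 have "cyclic_op M n 2 (ops V)" using sCH unfolding sCH_def by (metis one_le_numeral)
 moreover have "[[], B] : blocks M 2" using B by (simp add: blocks_def)
 ultimately have "teq M (ops V (rotate1 [[], B])) (lin_ext (%us. single (rotate1 us)
     (ksg (sdeg (hd [[], B]) * bdeg (tl [[], B]) + sdeg [hd us] * sdeg (tl us) + (n - 1) * (int 2 - 1)))) ?t)"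
  unfolding cyclic_op_def by blast
 then have "teq M (ops V [B, []]) (lin_ext (%us. single (rotate1 us)
     (ksg (sdeg [hd us] * sdeg (tl us) + (n - 1)))) ?t)" by simp
 from teq_EV[OF this BF_balanced[OF M b]]
 have "EV (BF M \<beta>) (ops V [B, []]) = EV (%r us. BF M \<beta> (r * ksg (sdeg [hd us] * sdeg (tl us) + (n - 1))) (rotate1 us)) ?t"
  by (simp add: EV_lin_ext BF_coef_add coef_add_scale)
 also have "... = EV (BF M (swap_form n \<beta>)) ?t"
 proof (rule EV_cong, goal_cases)
  case (1 w)
  from 1 obtain u v where w: "w = [u, v]" and uv: "[u] : hlists M" "[v] : hlists M" by (rule ops2_key[OF hlists_simps(1) B])
  then show ?case by (simp add: BF_def swap_form_def algebra_simps)
 qed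
 finally show ?thesis .
qed

text \<open>A bilinear form applied to the two outputs of the copairing on the block \<open>y\<close>.\<close>

definition pairing :: "'m helem list => ('m helem => 'm helem => 'r residue_field) => 'r residue_field" where
 "pairing y \<beta> = EV (BF M \<beta>) (ops V [[], y])"

lemma pairing_cong:
 assumes "y : hlists M"
  and "!!u v. [u] : hlists M ==> [v] : hlists M ==> fst u + fst v = sdeg y - n ==> \<beta> u v = \<gamma> u v"
 shows "pairing y \<beta> = pairing y \<gamma>" unfolding pairing_def
proof (rule EV_cong, goal_cases)
 case (1 w)
 from 1 obtain u v where w: "w = [u, v]" and uv: "[u] : hlists M" "[v] : hlists M" "fst u + fst v = sdeg ([] :: 'm helem list) + sdeg y - n"
  by (rule ops2_key[OF hlists_simps(1) assms(1)])
 then show ?case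
  using assms(2)[of u v] by (simp add: BF_def)
qed

lemma bilin_mh:
 assumes "bilin M \<beta>" "P : hlists M" "Q : hlists M"
 shows "bilin M (%u v. \<beta> (mh V (P @ [u] @ Q)) v)"
proof (rule bilinI)
 fix d x y v
 assume x: "x : carrier (M d)" "y : carrier (M d)" and v: "[v] : hlists M"
 define e where "e = sdeg P + d + sdeg Q - 1"
 have mh: "mh V (P @ [(d, z)] @ Q) = (e, mval V (P @ [(d, z)] @ Q))" for z by (simp add: mh_def e_def)
 have c: "mval V (P @ [(d, z)] @ Q) : carrier (M e)" if "z : carrier (M d)" for z
  by (rule mval_closed') (use assms that in \<open>simp_all add: e_def\<close>)
 show "\<beta> (mh V (P @ [(d, x \<oplus>`M d` y)] @ Q)) v = \<beta> (mh V (P @ [(d, x)] @ Q)) v + \<beta> (mh V (P @ [(d, y)] @ Q)) v"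
  unfolding mh mval_add(1)[OF assms(2,3) x e_def] by (rule bilinD(1)[OF assms(1) c[OF x(1)] c[OF x(2)] v])
 have "mh V (P @ [v] @ Q) = mh V (P @ [v] @ Q)" "[mh V (P @ [v] @ Q)] : hlists M" using mh_hlists[of "P @ [v] @ Q"] assms v by simp_all
 then show "\<beta> (mh V (P @ [v] @ Q)) (d, x \<oplus>`M d` y) = \<beta> (mh V (P @ [v] @ Q)) (d, x) + \<beta> (mh V (P @ [v] @ Q)) (d, y)"
  using bilinD(2)[OF assms(1) x] by blast
next
 fix d x r v
 assume x: "x : carrier (M d)" and v: "[v] : hlists M"
 define e where "e = sdeg P + d + sdeg Q - 1"
 have mh: "mh V (P @ [(d, z)] @ Q) = (e, mval V (P @ [(d, z)] @ Q))" for z by (simp add: mh_def e_def)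
 have c: "mval V (P @ [(d, z)] @ Q) : carrier (M e)" if "z : carrier (M d)" for z
  by (rule mval_closed') (use assms that in \<open>simp_all add: e_def\<close>)
 show "\<beta> (mh V (P @ [(d, r \<odot>`M d` x)] @ Q)) v = res r * \<beta> (mh V (P @ [(d, x)] @ Q)) v"
  unfolding mh mval_add(2)[OF assms(2,3) x x e_def] by (rule bilinD(3)[OF assms(1) c[OF x] v])
 have "[mh V (P @ [v] @ Q)] : hlists M" using mh_hlists[of "P @ [v] @ Q"] assms v by simp
 then show "\<beta> (mh V (P @ [v] @ Q)) (d, r \<odot>`M d` x) = res r * \<beta> (mh V (P @ [v] @ Q)) (d, x)"
  using bilinD(4)[OF assms(1) x] by blast
qed

text \<open>The quadratic relation for two blocks, one of which is empty: \<open>y \<mapsto> \<phi>([], y)\<close> is a Hochschild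
  cocycle with values in \<open>A \<otimes> A\<close>.\<close>

lemma copairing_relation:
 assumes b: "b : hlists M" and \<beta>: "bilin M \<beta>"
 shows "(\<Sum>x@y@z=b. ksg (sdeg x) * pairing (x @ [mh V y] @ z) \<beta>)
  + (\<Sum>y@z=b. pairing y (%u v. ksg ((fst v + 1) * sdeg z + (n - 1)) * \<beta> (mh V (u # z)) v))
  + (\<Sum>x@y=b. pairing y (%u v. ksg ((fst u + 1) * sdeg x + (fst u + 1) + n * sdeg x + (n - 1))
    * \<beta> u (mh V (x @ [v])))) = 0"
proof -
 let ?F = "BF M \<beta>"
 let ?\<gamma> = "swap_form n \<beta>"
 have F: "balanced M ?F" by (rule BF_balanced[OF M \<beta>])
 have Fc: "coef_add ?F" by (rule BF_coef_add)
 have \<gamma>: "bilin M ?\<gamma>" by (rule swap_form_bilin[OF \<beta>])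
 let ?T = "%q D s. nec_term n (- 1) (- 1) (ops V) (ops V) q D s"
 have ll: "length [[], b] = 2" by simp
 let ?rot = "%p us. let k = length [[], b] - p in single (rotate k us)
     (ksg (bdeg (take p [[], b]) * bdeg (drop p [[], b]) + sdeg (take k us) * sdeg (drop k us)
      + (n - 1) * (int (length [[], b]) - 1) * int p)) :: 'm helem list \<Rightarrow>\<^sub>0 'r"
 have rot0: "EV ?F (lin_ext (?rot 0) t) = EV ?F t" for t
 proof -
  have "(%r us. EV (%s. ?F (r * s)) (?rot 0 us)) = ?F"
  proof (intro ext)
   fix r us
   show "EV (%s. ?F (r * s)) (?rot 0 us) = ?F r us"
   proof (cases "length us = 2")
    case True
    then obtain u v where "us = [u, v]" unfolding length2 by blast
    then show ?thesis by (simp add: Let_def Fc coef_add_scale numeral_2_eq_2)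
   next
    case False
    then show ?thesis by (simp add: Let_def Fc coef_add_scale BF_def)
   qed
  qed
  then show ?thesis by (simp only: EV_lin_ext[OF Fc])
 qed
 have rot1: "EV ?F (lin_ext (?rot 1) t) = EV (BF M ?\<gamma>) t" for t
 proof -
  have "(%r us. EV (%s. ?F (r * s)) (?rot 1 us)) = BF M ?\<gamma>"
  by (fastforce simp: length2 Fc coef_add_scale BF_def swap_form_def)
  then show ?thesis by (simp only: EV_lin_ext[OF Fc])
 qed
 have swap2: "swap_form n ?\<gamma> = \<beta>"
 proof (intro ext)
  fix u v :: "'m helem"
  have e: "ksg ((fst v + 1) * (fst u + 1) + (n - 1)) = (ksg ((fst u + 1) * (fst v + 1) + (n - 1)) :: 'r residue_field)"
   by (simp only: mult.commute)
  show "swap_form n ?\<gamma> u v = \<beta> u v" by (simp only: swap_form_def e sgn_pow_simps)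
 qed
 have mval0: "pairing' = (0 :: 'r residue_field)"
  if "pairing' = EV ?F (ops V [P @ [mh V []] @ Q, c])" "P : hlists M" "Q : hlists M" "c : hlists M" for pairing' P Q c
  using teq_EV[OF ops2_add(2)[OF that(2,3,4), of "\<zero>`M (- 2)`" "- 2" "\<zero>`M (- 2)`" 0] F] that(1)
  by (simp add: mh_def mval_nil mod_closed[OF M] mod_laws(12)[OF M] pm_scale_simps)
 have t01: "(\<Sum>s\<leftarrow>splits 1 [[], b]. EV ?F (?T 1 [[], b] s)) = 0" unfolding sum_splits1
 proof (rule sum.neutral, clarify)
  fix x y z :: "'m helem list" assume "(x, y, z) : sp3 []"
  then have [simp]: "x = []" "y = []" "z = []" by simp_all
  show "EV ?F (?T 1 [[], b] (x, [y], z)) = 0"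
   using nec_term_single[of "[]" "[]" "[]" b \<beta> "[]"] b \<beta> mval0[OF refl, of "[]" "[]" b] by simp
 qed
 have t02: "(\<Sum>s\<leftarrow>splits 2 [[], b]. EV ?F (?T 2 [[], b] s))
  = (\<Sum>y@z=b. pairing y (%u v. ksg ((fst v + 1) * sdeg z + (n - 1)) * \<beta> (mh V (u # z)) v))"
  unfolding sum_splits2_left pairing_def
 proof (rule sum_sp2_cong, goal_cases)
  case (1 y z)
  from 1 have "y : hlists M" "z : hlists M" using b by auto
  then show ?case
   using nec_term_double[of "[]" "[]" y z \<beta> "[]" b] \<beta> by simp
 qed
 have t11: "(\<Sum>s\<leftarrow>splits 1 [b, []]. EV (BF M ?\<gamma>) (?T 1 [b, []] s))
  = (\<Sum>x@y@z=b. ksg (sdeg x) * pairing (x @ [mh V y] @ z) \<beta>)" unfolding sum_splits1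
 proof (rule sum_sp3_cong, goal_cases)
  case (1 x y z)
  from 1 have xyz: "x : hlists M" "y : hlists M" "z : hlists M" using b by auto
  then have "x @ [mh V y] @ z : hlists M" using mh_hlists[of y] by simp
  from ops_swap[OF this \<gamma>]
  show ?case
   using nec_term_single[OF xyz _ \<gamma>, of "[]" b] by (simp add: swap2 pairing_def)
 qed
 have t12: "(\<Sum>s\<leftarrow>splits 2 [b, []]. EV (BF M ?\<gamma>) (?T 2 [b, []] s))
  = (\<Sum>x@y=b. pairing y (%u v. ksg ((fst u + 1) * sdeg x + (fst u + 1) + n * sdeg x + (n - 1))
    * \<beta> u (mh V (x @ [v]))))" unfolding sum_splits2_right
 proof (rule sum_sp2_cong, goal_cases)
  case (1 x y)
  from 1 have xy: "x : hlists M" "y : hlists M" using b by auto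
  let ?\<eta> = "%a v. ksg (n * sdeg x + (fst v + 1) * sdeg ([] :: 'm helem list) + (n - 1)) * ?\<gamma> (mh V (x @ [a] @ [])) v"
  have \<eta>: "bilin M ?\<eta>"
   using bilin_sign[OF bilin_mh[OF \<gamma> xy(1) hlists_simps(1)], of "%i j. n * sdeg x + (j + 1) * sdeg ([] :: 'm helem list) + (n - 1)"]
   by simp
  have "EV (BF M ?\<gamma>) (?T 2 [b, []] (x, [y, []], [])) = EV (BF M (swap_form n ?\<eta>)) (ops V [[], y])"
   using nec_term_double[OF xy(1,2) hlists_simps(1) hlists_simps(1) \<gamma>, of b "[]"] ops_swap[OF xy(2) \<eta>] by simp
  also have "swap_form n ?\<eta> = (%u v. ksg ((fst u + 1) * sdeg x + (fst u + 1) + n * sdeg x + (n - 1))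
    * \<beta> u (mh V (x @ [v])))"
  proof (intro ext, goal_cases)
   case (1 u v)
   let ?a = "(fst u + 1) * (fst v + 1) + (n - 1)" and ?b = "n * sdeg x + (fst u + 1) * sdeg ([] :: 'm helem list) + (n - 1)"
    and ?c = "(sdeg (x @ [v]) - 2 + 1) * (fst u + 1) + (n - 1)"
   have "swap_form n ?\<eta> u v = ksg (?a + (?b + ?c)) * \<beta> u (mh V (x @ [v]))"
    by (simp only: swap_form_def fst_mh append_Nil2 sgn_pow_add[of ?a] sgn_pow_add[of ?b] mult.assoc)
   also have "ksg (?a + (?b + ?c)) = (ksg ((fst u + 1) * sdeg x + (fst u + 1) + n * sdeg x + (n - 1)) :: 'r residue_field)"
    by (rule sgn_pow_cong) (cases "even n"; cases "even (sdeg x)"; cases "even (fst u)"; simp add: algebra_simps)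
   finally show ?case .
  qed
  finally show ?case
   by (simp add: pairing_def)
 qed
 have sets: "{..<length [[], b]} = {0, 1}" "{1..length [[], b]} = {1, 2}" by auto
 have r01: "rotate 0 [[], b] = [[], b]" "rotate 1 [[], b] = [b, []]" by simp_all
 have "EV ?F (nec n (- 1) (- 1) (ops V) (ops V) [[], b])
   = (\<Sum>p\<in>{0, 1}. \<Sum>q\<in>{1, 2}. \<Sum>s\<leftarrow>splits q (rotate p [[], b]). EV ?F (lin_ext (?rot p) (?T q (rotate p [[], b]) s)))"
  unfolding nec_def EV_sum[OF Fc] EV_sum_list[OF Fc] sets ..
 also have "... = (\<Sum>q\<in>{1, 2}. \<Sum>s\<leftarrow>splits q [[], b]. EV ?F (?T q [[], b] s))
   + (\<Sum>q\<in>{1, 2}. \<Sum>s\<leftarrow>splits q [b, []]. EV (BF M ?\<gamma>) (?T q [b, []] s))"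
  using rot0 rot1 r01 by (simp del: length_Cons rotate0 rotate_Suc)
 also have "... = (\<Sum>s\<leftarrow>splits 1 [[], b]. EV ?F (?T 1 [[], b] s)) + (\<Sum>s\<leftarrow>splits 2 [[], b]. EV ?F (?T 2 [[], b] s))
  + ((\<Sum>s\<leftarrow>splits 1 [b, []]. EV (BF M ?\<gamma>) (?T 1 [b, []] s)) + (\<Sum>s\<leftarrow>splits 2 [b, []]. EV (BF M ?\<gamma>) (?T 2 [b, []] s)))"
  by simp
 finally have "EV ?F (nec n (- 1) (- 1) (ops V) (ops V) [[], b])
  = (\<Sum>x@y@z=b. ksg (sdeg x) * pairing (x @ [mh V y] @ z) \<beta>)
  + (\<Sum>y@z=b. pairing y (%u v. ksg ((fst v + 1) * sdeg z + (n - 1)) * \<beta> (mh V (u # z)) v))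
  + (\<Sum>x@y=b. pairing y (%u v. ksg ((fst u + 1) * sdeg x + (fst u + 1) + n * sdeg x + (n - 1))
    * \<beta> u (mh V (x @ [v]))))" unfolding t01 t02 t11 t12 by simp
 moreover have "EV ?F (nec n (- 1) (- 1) (ops V) (ops V) [[], b]) = 0"
  using teq_EV[OF nec_zero[of 2 "[[], b]"] F] b by (simp add: blocks_def)
 ultimately show ?thesis by simp
qed

end

section \<open>Sums over decompositions\<close>

lemma sp2_Nil: "sp2 [] = {([], [])}" by (auto simp: sp2_def)

lemma sp3_Nil: "sp3 [] = {([], [], [])}" by (auto simp: sp3_def)

lemma sum_sp2_Nil [simp]: "(\<Sum>(x, y)\<in>sp2 []. f x y) = f [] []" by (simp add: sp2_Nil)

lemma sum_sp3_Nil [simp]: "(\<Sum>(x, y, z)\<in>sp3 []. f x y z) = f [] [] []" by (simp add: sp3_Nil)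

lemma sum_sp2_Cons:
 "(\<Sum>x@y=(a # w). f x y) = f [] (a # w) + (\<Sum>x@y=w. f (a # x) y)"
proof -
 have "sp2 (a # w) = insert ([], a # w) ((%(x, y). (a # x, y)) ` sp2 w)"
 proof (intro equalityI subsetI)
  fix t assume "t : sp2 (a # w)"
  then obtain x y where t: "t = (x, y)" "x @ y = a # w" by (cases t) auto
  then show "t : insert ([], a # w) ((%(x, y). (a # x, y)) ` sp2 w)" by (cases x) (auto intro!: image_eqI[of _ _ "(tl x, y)"])
 qed auto
 moreover have "([], a # w) \<notin> (%(x, y). (a # x, y)) ` sp2 w" by auto
 moreover have "inj_on (%(x, y). (a # x, y)) (sp2 w)" by (auto intro: inj_onI)
 ultimately have "(\<Sum>x@y=(a # w). f x y)
   = f [] (a # w) + (\<Sum>(x, y)\<in>(%(x, y). (a # x, y)) ` sp2 w. f x y)" and i: "inj_on (%(x, y). (a # x, y)) (sp2 w)"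
  by (simp_all only: sum.insert finite_imageI finite_sp prod.case not_False_eq_True)
 then show ?thesis by (simp only: sum.reindex[OF i]) (simp add: o_def split_beta)
qed

lemma sum_sp3_Cons:
 "(\<Sum>x@y@z=(a # w). f x y z) = (\<Sum>y@z=(a # w). f [] y z) + (\<Sum>x@y@z=w. f (a # x) y z)"
proof -
 have "sp3 (a # w) = Pair [] ` sp2 (a # w) \<union> (%(x, y, z). (a # x, y, z)) ` sp3 w"
 proof (intro equalityI subsetI)
  fix t assume "t : sp3 (a # w)"
  then obtain x y z where t: "t = (x, y, z)" "x @ y @ z = a # w" by (cases t) auto
  show "t : Pair [] ` sp2 (a # w) \<union> (%(x, y, z). (a # x, y, z)) ` sp3 w"
  proof (cases x)
   case Nil
   then show ?thesis using t by (intro UnI1 image_eqI[of _ _ "(y, z)"]) simp_all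
  next
   case (Cons b x')
   then show ?thesis using t by (intro UnI2 image_eqI[of _ _ "(x', y, z)"]) simp_all
  qed
 qed auto
 moreover have "Pair [] ` sp2 (a # w) \<inter> (%(x, y, z). (a # x, y, z)) ` sp3 w = {}" by auto
 moreover have "inj_on (%(x, y, z). (a # x, y, z)) (sp3 w)" "inj_on (Pair []) (sp2 (a # w))" by (auto intro: inj_onI)
 ultimately have "(\<Sum>x@y@z=(a # w). f x y z) = (\<Sum>(x, y, z)\<in>Pair [] ` sp2 (a # w). f x y z)
   + (\<Sum>(x, y, z)\<in>(%(x, y, z). (a # x, y, z)) ` sp3 w. f x y z)"
  and i: "inj_on (%(x, y, z). (a # x, y, z)) (sp3 w)" "inj_on (Pair []) (sp2 (a # w))"
  by (simp_all only: sum.union_disjoint finite_imageI finite_sp)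
 then show ?thesis by (simp only: sum.reindex[OF i(1)] sum.reindex[OF i(2)]) (simp add: o_def split_beta)
qed

lemma sum_sp2_insert:
 "(\<Sum>x@y=(X @ t # Z). f x y) = (\<Sum>x@x'=X. f x (x' @ t # Z)) + (\<Sum>z'@z=Z. f (X @ t # z') z)"
proof (induction X arbitrary: f)
 case Nil
 then show ?case by (simp add: sum_sp2_Cons)
next
 case (Cons a X)
 show ?case using Cons.IH[of "%x. f (a # x)"] by (simp add: sum_sp2_Cons[of _ a] algebra_simps)
qed

lemma sum_sp3_insert:
 "(\<Sum>x@y@z=(X @ t # Z). f x y z) = (\<Sum>z'@y@z=Z. f (X @ t # z') y z)
  + (\<Sum>x@x'=X. \<Sum>z'@z=Z. f x (x' @ t # z') z) + (\<Sum>x@y@x'=X. f x y (x' @ t # Z))"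
proof (induction X arbitrary: f)
 case Nil
 then show ?case by (simp add: sum_sp3_Cons sum_sp2_Cons algebra_simps)
next
 case (Cons a X)
 show ?case using Cons.IH[of "%x. f (a # x)"] sum_sp2_insert[of "%y z. f [] y z" "a # X" t Z]
  by (simp add: sum_sp3_Cons[of _ a] sum_sp2_Cons[of _ a X] algebra_simps)
qed

lemma sum_sp2_add: "(\<Sum>x@y=w. g x y + h x y) = (\<Sum>x@y=w. g x y) + (\<Sum>x@y=w. h x y)"
 by (simp add: split_beta sum.distrib)

lemma sum_sp3_nest:
 "(\<Sum>x@y@z=w. f x y z) = (\<Sum>x@r=w. \<Sum>y@z=r. f x y z)"
proof (induction w arbitrary: f)
 case Nil
 then show ?case by simp
next
 case (Cons a w)
 show ?case using Cons.IH[of "%x. f (a # x)"] by (simp add: sum_sp3_Cons sum_sp2_Cons[of "%x r. \<Sum>y@z=r. f x y z"])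
qed

lemma sum_sp3_nest':
 "(\<Sum>x@y@z=w. f x y z) = (\<Sum>l@z=w. \<Sum>x@y=l. f x y z)"
proof (induction w arbitrary: f)
 case Nil
 then show ?case by simp
next
 case (Cons a w)
 show ?case using Cons.IH[of "%x. f (a # x)"] by (simp add: sum_sp3_Cons sum_sp2_Cons[of _ a] sum_sp2_add algebra_simps)
qed

lemma sum_sp2_assoc:
 "(\<Sum>l@z=w. \<Sum>x@y=l. f x y z) = (\<Sum>x@r=w. \<Sum>y@z=r. f x y z)"
 using sum_sp3_nest[of f w] sum_sp3_nest'[of f w] by simp

lemma sum_sp2_swap:
 "(\<Sum>x@y=w. \<Sum>u@v=w'. f x y u v) = (\<Sum>u@v=w'. \<Sum>x@y=w. f x y u v)"
 unfolding split_beta by (rule sum.swap)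

lemma sum_sp3_disjoint:
 "(\<Sum>x@y@z=w. \<Sum>a@b@c=z. f x y a b c) = (\<Sum>x@y@z=w. \<Sum>a@b@c=x. f a b c y z)"
proof -
 let ?g = "%a s r. \<Sum>y@z=r. \<Sum>b@c=s. f a b c y z"
 have "(\<Sum>x@y@z=w. \<Sum>a@b@c=x. f a b c y z)
   = (\<Sum>x@r=w. \<Sum>y@z=r. \<Sum>a@s=x. \<Sum>b@c=s. f a b c y z)"
  by (simp only: sum_sp3_nest)
 also have "... = (\<Sum>x@r=w. \<Sum>a@s=x. ?g a s r)" by (subst sum_sp2_swap) (rule refl)
 also have "... = (\<Sum>a@q=w. \<Sum>s@r=q. ?g a s r)" by (rule sum_sp2_assoc)
 also have "... = (\<Sum>a@q=w. \<Sum>s@r=q. \<Sum>b@c=s. \<Sum>y@z=r. f a b c y z)"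
  by (subst sum_sp2_swap) (rule refl)
 also have "... = (\<Sum>a@q=w. \<Sum>b@q'=q. \<Sum>c@r=q'. \<Sum>y@z=r. f a b c y z)"
  by (subst sum_sp2_assoc) (rule refl)
 also have "... = (\<Sum>x@y@z=w. \<Sum>a@b@c=z. f x y a b c)" by (simp only: sum_sp3_nest)
 finally show ?thesis ..
qed

lemma sum_sp3_inner:
 "(\<Sum>x@y@z=w. \<Sum>a@b=x. \<Sum>c@d=z. f a b y c d)
  = (\<Sum>a@u@d=w. \<Sum>b@y@c=u. f a b y c d)"
proof -
 have "(\<Sum>x@y@z=w. \<Sum>a@b=x. \<Sum>c@d=z. f a b y c d)
   = (\<Sum>x@r=w. \<Sum>y@z=r. \<Sum>a@b=x. \<Sum>c@d=z. f a b y c d)"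
  by (simp only: sum_sp3_nest)
 also have "... = (\<Sum>x@r=w. \<Sum>a@b=x. \<Sum>y@z=r. \<Sum>c@d=z. f a b y c d)"
  by (subst sum_sp2_swap) (rule refl)
 also have "... = (\<Sum>a@q=w. \<Sum>b@r=q. \<Sum>y@z=r. \<Sum>c@d=z. f a b y c d)"
  by (rule sum_sp2_assoc)
 also have "... = (\<Sum>a@q=w. \<Sum>b@r=q. \<Sum>s@d=r. \<Sum>y@c=s. f a b y c d)"
  by (subst sum_sp2_assoc) (rule refl)
 also have "... = (\<Sum>a@q=w. \<Sum>u@d=q. \<Sum>b@s=u. \<Sum>y@c=s. f a b y c d)"
  by (rule sum_sp2_cong) (rule sum_sp2_assoc[symmetric])
 also have "... = (\<Sum>a@u@d=w. \<Sum>b@y@c=u. f a b y c d)" by (simp only: sum_sp3_nest)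
 finally show ?thesis .
qed

lemma sum_sp3_map:
 "(\<Sum>x@y@z=(map h w). f x y z) = (\<Sum>x@y@z=w. f (map h x) (map h y) (map h z))"
 by (simp add: sum_sp3 take_map drop_map)

lemma sum_sp2_map:
 "(\<Sum>x@y=(map h w). f x y) = (\<Sum>x@y=w. f (map h x) (map h y))" by (simp add: sum_sp2 take_map drop_map)

section \<open>Words with ends\<close>

text \<open>A word is an element \<open>a\<^sub>1 \<dots> a\<^sub>k\<close> of the bar construction between two ends. An end is either an
  element of \<open>A\<close>, seen as a module over itself, or a scalar, on which \<open>A\<close> acts through the augmentation.\<close>

datatype ('r, 'm) letter = Gnd int 'r | Elt int 'm | Mid int 'm

type_synonym ('r, 'm) word = "('r, 'm) letter list"

fun ldeg :: "('r, 'm) letter => int" where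
 "ldeg (Gnd i r) = i + 1"
| "ldeg (Elt i x) = i + 1"
| "ldeg (Mid i x) = i + 1"

definition wdeg :: "('r, 'm) word => int" where
 "wdeg w = (\<Sum>l\<leftarrow>w. ldeg l)"

lemma wdeg_simps [simp]: "wdeg [] = 0" "wdeg (l # w) = ldeg l + wdeg w" "wdeg (w @ w') = wdeg w + wdeg w'" by (simp_all add: wdeg_def)

fun isGnd :: "('r, 'm) letter => bool" where
 "isGnd (Gnd i r) = True" | "isGnd _ = False"

fun isElt :: "('r, 'm) letter => bool" where
 "isElt (Elt i x) = True" | "isElt _ = False"

fun isMid :: "('r, 'm) letter => bool" where
 "isMid (Mid i x) = True" | "isMid _ = False"

fun hel :: "('r, 'm) letter => 'm helem" where
 "hel (Gnd i r) = undefined" | "hel (Elt i x) = (i, x)" | "hel (Mid i x) = (i, x)"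

abbreviation mL where "mL V u b == mh V (u # map hel b)"
abbreviation mR where "mR V b v == mh V (map hel b @ [v])"

fun same :: "('r, 'm) letter => ('r, 'm) letter => bool" where
 "same (Gnd i r) (Gnd j s) = (i = j)"
| "same (Elt i x) (Elt j y) = (i = j)"
| "same (Mid i x) (Mid j y) = (i = j)"
| "same _ _ = False"

text \<open>The kinds of letters. The shape of a word depends on the list of kinds only: two ends, and letters of kind 2 between
  them.\<close>

definition kd :: "('r, 'm) letter => nat" where
 "kd l = (case l of Gnd i r => 0 | Elt i x => 1 | Mid i x => 2)"

lemma kd_simps [simp]: "kd (Gnd i r) = 0" "kd (Elt i x) = 1" "kd (Mid i x) = 2" by (simp_all add: kd_def)

definition wdk :: "nat list => bool" where
 "wdk ks \<longleftrightarrow> (\<exists>e as e'. ks = e # as @ [e'] & e ~= 2 & e' ~= 2 & (\<forall>a\<in>set as. a = 2))"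

definition wd :: "('r, 'm) word => bool" where
 "wd w \<longleftrightarrow> wdk (map kd w)"

lemma isMid_kd: "isMid l \<longleftrightarrow> kd l = 2" by (cases l) auto

lemma wd_iff: "wd w \<longleftrightarrow> (\<exists>e as e'. w = e # as @ [e'] & ~ isMid e & ~ isMid e' & (\<forall>a\<in>set as. isMid a))"
proof
 assume "wd w"
 then obtain k ks k' where k: "map kd w = k # ks @ [k']" "k ~= 2" "k' ~= 2" "\<forall>a\<in>set ks. a = 2"
  unfolding wd_def wdk_def by (elim exE conjE)
 then obtain e w' where w: "w = e # w'" "kd e = k" "map kd w' = ks @ [k']" by (cases w) auto
 then obtain as e' where "w' = as @ [e']" "map kd as = ks" "kd e' = k'" by (cases w' rule: rev_cases) auto
 then show "\<exists>e as e'. w = e # as @ [e'] & ~ isMid e & ~ isMid e' & (\<forall>a\<in>set as. isMid a)"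
  using w k by (intro exI[of _ e] exI[of _ as] exI[of _ e']) (auto simp: isMid_kd)
next
 assume "\<exists>e as e'. w = e # as @ [e'] & ~ isMid e & ~ isMid e' & (\<forall>a\<in>set as. isMid a)"
 then obtain e as e' where "w = e # as @ [e']" "~ isMid e" "~ isMid e'" "\<forall>a\<in>set as. isMid a" by blast
 then show "wd w" unfolding wd_def wdk_def by (intro exI[of _ "kd e"] exI[of _ "map kd as"] exI[of _ "kd e'"]) (auto simp: isMid_kd)
qed

lemma wd_replace: "kd l = kd l' ==> wd (X @ [l] @ Z) \<longleftrightarrow> wd (X @ [l'] @ Z)" by (simp add: wd_def)

text \<open>A proper subword lies strictly between the ends, or contains exactly one of them. The differential never merges both ends.\<close>

lemma wd_subword_cases:
 assumes "wd (X @ U @ Z)" "U ~= []" "X ~= [] \<or> Z ~= []"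
 obtains (left) e as bs e' where "X = []" "U = e # as" "Z = bs @ [e']" "~ isMid e" "~ isMid e'"
   "\<forall>a\<in>set as. isMid a" "\<forall>a\<in>set bs. isMid a"
  | (right) e as bs e' where "Z = []" "U = as @ [e']" "X = e # bs" "~ isMid e" "~ isMid e'"
   "\<forall>a\<in>set as. isMid a" "\<forall>a\<in>set bs. isMid a"
  | (mid) e bs cs e' where "X = e # bs" "Z = cs @ [e']" "~ isMid e" "~ isMid e'"
   "\<forall>a\<in>set U. isMid a" "\<forall>a\<in>set bs. isMid a" "\<forall>a\<in>set cs. isMid a"
proof -
 obtain e as e' where w: "X @ U @ Z = e # as @ [e']" "~ isMid e" "~ isMid e'" "\<forall>a\<in>set as. isMid a"
  using assms(1) unfolding wd_iff by blast
 show thesis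
 proof (cases X)
  case Nil
  then have "Z ~= []" using assms(3) by simp
  then obtain Z' z where Z: "Z = Z' @ [z]" by (cases Z rule: rev_cases) auto
  obtain u U' where U: "U = u # U'" using assms(2) by (cases U) auto
  have "u = e" "U' @ Z' = as" "z = e'" using w(1) Nil U Z by auto
  then show thesis using left[OF Nil U Z] w by auto
 next
  case (Cons x X')
  show thesis
  proof (cases Z rule: rev_cases)
   case Nil
   obtain U' u where U: "U = U' @ [u]" using assms(2) by (cases U rule: rev_cases) auto
   have "x = e" "X' @ U' = as" "u = e'" using w(1) Nil U Cons by auto
   then show thesis using right[OF Nil U Cons] w by auto
  next
   case (snoc Z' z)
   have "x = e" "X' @ U @ Z' = as" "z = e'" using w(1) snoc Cons by auto
   then show thesis using mid[OF Cons snoc] w by auto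
  qed
 qed
qed

lemma sum_sp3_add: "(\<Sum>x@y@z=w. g x y z + h x y z) = (\<Sum>x@y@z=w. g x y z) + (\<Sum>x@y@z=w. h x y z)"
 by (simp add: split_beta sum.distrib)

section \<open>Cochains on words\<close>

text \<open>An augmentation: a set \<open>A0\<close> of cycles of degree zero, containing the boundaries and closed under
  products, with a multiplicative functional vanishing on boundaries. Together with the elements of
  positive degree, \<open>A0\<close> forms an \<open>A\<^sub>\<infinity>\<close>-subalgebra, which is augmented by \<open>eps\<close>.\<close>

locale aug = valg n V for n :: int and V :: "('r::comm_ring_1, 'm) vinf" +
 fixes A0 :: "'m set" and eps :: "'m => 'r"
 assumes A0_sub: "qsubspace (M 0) A0" and A0_cycles: "A0 \<subseteq> cycles M \<delta> 0"
  and A0_bd: "boundaries M \<delta> 0 \<subseteq> A0"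
  and eps_add: "[|x : A0; y : A0|] ==> eps (x \<oplus>`M 0` y) = eps x + eps y"
  and eps_bd: "x : boundaries M \<delta> 0 ==> eps x = 0"
  and A0_mult: "[|x : A0; y : A0|] ==> mval V [(0, x), (0, y)] : A0"
  and eps_mult: "[|x : A0; y : A0|] ==> eps (mval V [(0, x), (0, y)]) = eps x * eps y"

begin

text \<open>The augmented subalgebra. Since it is zero in negative degrees, only the product of two elements of degree zero
  and the differential of an element of degree one take values in degree zero.\<close>

definition Cc :: "int => 'm set" where
 "Cc e = {x : carrier (M e). (e = 0 --> x : A0) & (e < 0 --> x = \<zero>`M e`)}"

lemma Cc_sub: "qsubspace (M e) (Cc e)" using A0_sub unfolding qsubspace_def Cc_def
 by (cases e "0 :: int" rule: linorder_cases) (auto simp: mod_closed[OF M] mod_laws[OF M])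

lemma Cc_carrier: "x : Cc e ==> x : carrier (M e)" by (simp add: Cc_def)

lemma Cc_zero: "\<zero>`M e` : Cc e" by (rule qsubspaceD(2)[OF Cc_sub])

lemma eps_zero: "eps \<zero>`M 0` = 0"
proof (rule eps_bd)
 have "\<delta> 1 \<zero>`M 1` = \<zero>`M 0`" using linear_map_zero[OF M M d_lin, of 1] by simp
 then show "\<zero>`M 0` : boundaries M \<delta> 0"
  unfolding boundaries_def using mod_closed(2)[OF M, of 1] by (metis add_0 image_eqI)
qed

fun vl :: "('r, 'm) letter => bool" where
 "vl (Gnd i r) \<longleftrightarrow> i = 0 \<or> r = 0"
| "vl (Elt i x) \<longleftrightarrow> x : carrier (M i)"
| "vl (Mid i x) \<longleftrightarrow> x : Cc i"

fun ladd :: "('r, 'm) letter => ('r, 'm) letter => ('r, 'm) letter" where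
 "ladd (Gnd i r) (Gnd j s) = Gnd i (r + s)"
| "ladd (Elt i x) (Elt j y) = Elt i (x \<oplus>`M i` y)"
| "ladd (Mid i x) (Mid j y) = Mid i (x \<oplus>`M i` y)"
| "ladd l _ = l"

abbreviation valid :: "('r, 'm) word => bool" where
 "valid w \<equiv> (\<forall>l\<in>set w. vl l)"

definition ok :: "('r, 'm) word => bool" where
 "ok w \<longleftrightarrow> wd w & valid w"

text \<open>Multiadditive cochains, extended by zero to lists that are not words. Letters in the middle run through the augmented
  subalgebra only.\<close>

definition MC :: "(('r, 'm) word => 't::comm_ring_1) => bool" where
 "MC c \<longleftrightarrow> (\<forall>w. ~ ok w --> c w = 0) &
  (\<forall>X l l' Z. vl l & vl l' & same l l' --> c (X @ [ladd l l'] @ Z) = c (X @ [l] @ Z) + c (X @ [l'] @ Z))"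

text \<open>The action of \<open>A\<close> on a scalar end has only one operation, the multiplication by \<open>eps\<close>; the higher ones
  are zero.\<close>

fun gval :: "('r, 'm) word => 'r" where
 "gval [Gnd i r, Mid j x] = (if i = 0 & j = 0 then r * eps x else 0)"
| "gval [Mid j x, Gnd i r] = (if i = 0 & j = 0 then r * eps x else 0)"
| "gval _ = 0"

text \<open>The result of merging the letters of a subword. A subword with a scalar end yields a scalar, and one which contains a
  nonscalar end yields a nonscalar end.\<close>

definition mul :: "('r, 'm) word => ('r, 'm) letter" where
 "mul Y = (if list_ex isGnd Y then Gnd (wdeg Y - 2) (gval Y) else if list_ex isElt Y then Elt (wdeg Y - 2) (mval V (map hel Y))
  else Mid (wdeg Y - 2) (mval V (map hel Y)))"

definition D :: "(('r, 'm) word => 't::comm_ring_1) => ('r, 'm) word => 't" where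
 "D c w = (if ok w then \<Sum>x@y@z=w. if y = [] \<or> y = w then 0 else ksg (wdeg x) * c (x @ [mul y] @ z) else 0)"

lemma same_ladd: "same l l' ==> same (ladd l l') l & ldeg (ladd l l') = ldeg l & ldeg l' = ldeg l & kd (ladd l l') = kd l & kd l' = kd l"
 by (cases l; cases l') auto

lemma vl_ladd: "same l l' ==> vl l ==> vl l' ==> vl (ladd l l')"
 by (cases l; cases l') (auto simp: mod_closed[OF M] intro: qsubspaceD(3)[OF Cc_sub])

lemma MC_ok: "MC c ==> ~ ok w ==> c w = 0" by (simp add: MC_def)

lemma MC_add: "MC c ==> vl l ==> vl l' ==> same l l' ==> c (X @ [ladd l l'] @ Z) = c (X @ [l] @ Z) + c (X @ [l'] @ Z)"
 unfolding MC_def by blast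

lemma MC_zero_Gnd: "MC c ==> c (X @ [Gnd i 0] @ Z) = 0" using MC_add[of c "Gnd i 0" "Gnd i 0" X Z] by simp

lemma hlists_hel: "valid w ==> ~ list_ex isGnd w ==> map hel w : hlists M"
proof (induction w)
 case (Cons l w)
 then show ?case by (cases l) (auto simp: Cc_carrier)
qed simp

lemma sdeg_hel: "~ list_ex isGnd w ==> sdeg (map hel w) = wdeg w"
proof (induction w)
 case (Cons l w)
 then show ?case by (cases l) auto
qed simp

lemma isMid_simp: "isMid l \<longleftrightarrow> ~ isGnd l & ~ isElt l" by (cases l) auto

lemma mids_ex: "\<forall>a\<in>set w. isMid a ==> ~ list_ex isGnd w & ~ list_ex isElt w"
 by (auto simp: list_ex_iff isMid_simp)

lemma ldeg_mul [simp]: "ldeg (mul Y) = wdeg Y - 1" by (simp add: mul_def)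

text \<open>As the letters in the middle have nonnegative degree, up to zeroes, few words of low degree matter.\<close>

lemma low_degree_word:
 assumes "\<forall>a\<in>set w. isMid a" "valid w" "wdeg w < int (length w)"
 obtains X i Z where "w = X @ [Mid i \<zero>`M i`] @ Z" "i < 0"
proof -
 have "\<exists>l\<in>set w. ldeg l < 1"
 proof (rule ccontr)
  assume "~ (\<exists>l\<in>set w. ldeg l < 1)"
  then have "\<forall>l\<in>set w. 1 \<le> ldeg l" by auto
  then have "int (length w) \<le> wdeg w" by (induction w) auto
  then show False using assms(3) by simp
 qed
 then obtain l where l: "l : set w" "ldeg l < 1" by blast
 obtain X Z where w': "w = X @ l # Z" using split_list[OF l(1)] by blast
 then have w: "w = X @ [l] @ Z" by simp
 have "isMid l" using assms(1) l(1) by blast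
 then obtain i x where i: "l = Mid i x" by (cases l) auto
 then have "x = \<zero>`M i`" "i < 0" using assms(2) l by (auto simp: Cc_def)
 then show thesis using that w i by blast
qed

lemma mval_low_degree:
 assumes "\<forall>a\<in>set w. isMid a" "valid w" "wdeg w < int (length w)"
 shows "mval V (map hel w) = \<zero>`M (wdeg w - 2)`"
proof -
 obtain X i Z where w: "w = X @ [Mid i \<zero>`M i`] @ Z" using low_degree_word[OF assms] by blast
 have g: "~ list_ex isGnd X" "~ list_ex isGnd Z" using assms(1) w by (auto simp: list_ex_iff isMid_simp)
 then have "map hel X : hlists M" "map hel Z : hlists M" using assms(2) w hlists_hel[of X] hlists_hel[of Z] by auto
 then have "mval V (map hel X @ [(i, \<zero>`M i`)] @ map hel Z) = \<zero>`M (wdeg w - 2)`"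
  by (rule mval_zero) (simp add: w sdeg_hel[OF g(1)] sdeg_hel[OF g(2)])
 then show ?thesis by (simp add: w)
qed

text \<open>The subalgebra is closed under all operations. In degree zero the value is a product of two elements of \<open>A0\<close>, a boundary
  or zero.\<close>

lemma vl_mul_Mid:
 assumes "Y ~= []" "\<forall>a\<in>set Y. isMid a" "valid Y"
 shows "vl (mul Y)"
proof -
 let ?x = "mval V (map hel Y)" and ?e = "wdeg Y - 2"
 have nex: "~ list_ex isGnd Y" "~ list_ex isElt Y" using mids_ex[OF assms(2)] by auto
 have m: "mul Y = Mid ?e ?x" by (simp add: mul_def nex)
 have hl: "map hel Y : hlists M" by (rule hlists_hel[OF assms(3) nex(1)])
 have "?x : Cc ?e"
 proof (cases "wdeg Y < int (length Y)")
  case True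
  then show ?thesis using mval_low_degree[OF assms(2,3)] Cc_zero by simp
 next
  case False
  have c: "?x : carrier (M ?e)" by (rule mval_closed'[OF hl]) (simp add: sdeg_hel[OF nex(1)])
  obtain l Y' where Y: "Y = l # Y'" using assms(1) by (cases Y) auto
  obtain i x where l: "l = Mid i x" using assms(2) Y by (cases l) auto
  have x: "x : Cc i" using assms(3) Y l by simp
  show ?thesis
  proof (cases "0 < ?e")
   case True
   then show ?thesis using c by (simp add: Cc_def)
  next
   case nonpos: False
   then have len: "length Y' \<le> 1" using False Y by auto
   show ?thesis
   proof (cases Y')
    case Nil
    have v: "?x = \<delta> i x" "?e = i - 1" using mval_single[OF Cc_carrier[OF x]] by (simp_all add: Y Nil l)
    have "i = 0 \<or> i = 1" using False nonpos by (auto simp: Y Nil l)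
    then show ?thesis
    using x A0_cycles A0_bd c by (auto simp: Cc_def cycles_def v boundaries_def)
   next
    case (Cons l' Y'')
    then have Y'': "Y'' = []" using len by simp
    obtain j y where l': "l' = Mid j y" using assms(2) Y Cons by (cases l') auto
    have y: "y : Cc j" using assms(3) Y Cons l' by simp
    have ij: "i + j = 0" using False nonpos by (simp add: Y Cons Y'' l l')
    show ?thesis
    proof (cases "i = 0")
     case True
     then show ?thesis using x y ij A0_mult[of x y] c by (simp add: Y Cons Y'' l l' Cc_def)
    next
     case False
     have hx: "[(i, x)] : hlists M" "[(j, y)] : hlists M" using Cc_carrier[OF x] Cc_carrier[OF y] by simp_all
     have "?x = \<zero>`M 0`"
     proof (cases "i < 0")
      case True
      then have "x = \<zero>`M i`" using x by (simp add: Cc_def)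
      then show ?thesis using mval_zero[of "[]" "[(j, y)]" 0 i] hx ij by (simp add: Y Cons Y'' l l')
     next
      case ge: False
      then have "y = \<zero>`M j`" using y ij False by (simp add: Cc_def)
      then show ?thesis using mval_zero[of "[(i, x)]" "[]" 0 j] hx ij by (simp add: Y Cons Y'' l l')
     qed
     then show ?thesis using Cc_zero[of 0] ij by (simp add: Y Cons Y'' l l')
    qed
   qed
  qed
 qed
 then show ?thesis by (simp add: m)
qed

lemma gval_degree:
 assumes "wdeg Y ~= 2"
 shows "gval Y = 0"
proof (rule ccontr)
 assume "gval Y ~= 0"
 then show False using assms by (cases Y rule: gval.cases) (auto split: if_splits)
qed

lemma vl_mul_Gnd: "list_ex isGnd Y ==> vl (mul Y)" using gval_degree[of Y] by (auto simp: mul_def)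

lemma vl_mul_Elt:
 assumes "list_ex isElt Y" "~ list_ex isGnd Y" "valid Y"
 shows "vl (mul Y)" using mval_closed'[OF hlists_hel[OF assms(3,2)], of "wdeg Y - 2"] sdeg_hel[OF assms(2)] assms by (simp add: mul_def)

lemma vl_mul: "Y ~= [] ==> valid Y ==> vl (mul Y)"
 using vl_mul_Gnd[of Y] vl_mul_Elt[of Y] vl_mul_Mid[of Y] by (auto simp: list_ex_iff isMid_simp)

lemma isX_mul: "isGnd (mul Y) = list_ex isGnd Y" "isElt (mul Y) = (list_ex isElt Y & ~ list_ex isGnd Y)"
  "isMid (mul Y) = (~ list_ex isElt Y & ~ list_ex isGnd Y)" by (simp_all add: mul_def)

lemma wd_mul:
 assumes "wd (X @ U @ Z)" "U ~= []" "X ~= [] \<or> Z ~= []"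
 shows "wd (X @ [mul U] @ Z)" using assms
proof (cases rule: wd_subword_cases)
 case (left e as bs e')
 then have "~ isMid (mul U)" by (auto simp: isX_mul isMid_simp)
 then show ?thesis using left unfolding wd_iff by (intro exI[of _ "mul U"] exI[of _ bs] exI[of _ e']) simp
next
 case (right e as bs e')
 then have "~ isMid (mul U)" by (auto simp: isX_mul isMid_simp)
 then show ?thesis using right unfolding wd_iff by (intro exI[of _ e] exI[of _ bs] exI[of _ "mul U"]) simp
next
 case (mid e bs cs e')
 then have "isMid (mul U)" using mids_ex[of U] by (auto simp: isX_mul)
 then show ?thesis using mid unfolding wd_iff by (intro exI[of _ e] exI[of _ "bs @ [mul U] @ cs"] exI[of _ e']) auto
qed

lemma ok_mul:
 assumes "ok (X @ U @ Z)" "U ~= []" "X ~= [] \<or> Z ~= []"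
 shows "ok (X @ [mul U] @ Z)" using wd_mul[OF _ assms(2,3)] vl_mul[OF assms(2)] assms(1) by (auto simp: ok_def)

lemma mul_ladd:
 assumes "same l l'" "vl l" "vl l'" "valid P" "valid Q"
 shows "mul (P @ [ladd l l'] @ Q) = ladd (mul (P @ [l] @ Q)) (mul (P @ [l'] @ Q))" and "same (mul (P @ [l] @ Q)) (mul (P @ [l'] @ Q))"
proof -
 have dg: "wdeg (P @ [ladd l l'] @ Q) = wdeg (P @ [l] @ Q)" "wdeg (P @ [l'] @ Q) = wdeg (P @ [l] @ Q)" using same_ladd[OF assms(1)] by auto
 have k: "isGnd l' = isGnd l" "isGnd (ladd l l') = isGnd l" "isElt l' = isElt l" "isElt (ladd l l') = isElt l"
  using assms(1) by (cases l; cases l'; auto)+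
 show "same (mul (P @ [l] @ Q)) (mul (P @ [l'] @ Q))" using dg k by (simp add: mul_def)
 show "mul (P @ [ladd l l'] @ Q) = ladd (mul (P @ [l] @ Q)) (mul (P @ [l'] @ Q))"
 proof (cases "list_ex isGnd (P @ [l] @ Q)")
  case True
  have "gval (P @ [ladd l l'] @ Q) = gval (P @ [l] @ Q) + gval (P @ [l'] @ Q)"
  proof -
   consider "length P + length Q ~= 1" | p where "P = [p]" "Q = []" | q where "P = []" "Q = [q]" by (cases P; cases Q) auto
   then show ?thesis
   proof cases
    case 1
    have z: "gval w = 0" if "length w ~= 2" for w using that by (cases w rule: gval.cases) auto
    show ?thesis using 1 by (simp add: z)
   next
    case 2
    then show ?thesis using assms by (cases p; cases l; cases l') (auto simp: distrib_right distrib_left eps_add Cc_def)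
   next
    case 3
    then show ?thesis using assms by (cases q; cases l; cases l') (auto simp: distrib_right distrib_left eps_add Cc_def)
   qed
  qed
  then show ?thesis using True k dg by (simp add: mul_def)
 next
  case False
  then obtain i x y where l: "hel l = (i, x)" "hel l' = (i, y)" "hel (ladd l l') = (i, x \<oplus>`M i` y)"
   and xy: "x : carrier (M i)" "y : carrier (M i)" and "ldeg l = i + 1" using assms by (cases l; cases l') (auto simp: Cc_carrier)
  have PQ: "map hel P : hlists M" "map hel Q : hlists M" using False hlists_hel[OF assms(4)] hlists_hel[OF assms(5)] by auto
  have "mval V (map hel P @ [(i, x \<oplus>`M i` y)] @ map hel Q)
   = mval V (map hel P @ [(i, x)] @ map hel Q) \<oplus>`M (wdeg (P @ [l] @ Q) - 2)` mval V (map hel P @ [(i, y)] @ map hel Q)"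
   by (rule mval_add(1)[OF PQ xy]) (use False sdeg_hel[of P] sdeg_hel[of Q] \<open>ldeg l = i + 1\<close> in auto)
  then show ?thesis using False k dg l by (simp add: mul_def)
 qed
qed

lemma MC_mul:
 assumes "MC c" "same l l'" "vl l" "vl l'" "valid P" "valid Q"
 shows "c (X @ [mul (P @ [ladd l l'] @ Q)] @ Z) = c (X @ [mul (P @ [l] @ Q)] @ Z) + c (X @ [mul (P @ [l'] @ Q)] @ Z)"
 unfolding mul_ladd(1)[OF assms(2-6)] by (rule MC_add[OF assms(1) vl_mul vl_mul mul_ladd(2)[OF assms(2-6)]]) (use assms in auto)

lemma ok_ladd: "same l l' ==> vl l ==> vl l' ==> ok (X @ [ladd l l'] @ Z) = ok (X @ [l] @ Z) & ok (X @ [l'] @ Z) = ok (X @ [l] @ Z)"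
 using same_ladd[of l l'] vl_ladd[of l l'] wd_replace[of "ladd l l'" l X Z] wd_replace[of l' l X Z] by (auto simp: ok_def)

lemma MC_D:
 assumes c: "MC c"
 shows "MC (D c)" unfolding MC_def
proof (intro conjI allI impI)
 show "D c w = 0" if "~ ok w" for w using that by (simp add: D_def)
 fix X l l' Z assume l: "vl l & vl l' & same l l'"
 note ol = ok_ladd[of l l' X Z] and sl = same_ladd[of l l']
 show "D c (X @ [ladd l l'] @ Z) = D c (X @ [l] @ Z) + D c (X @ [l'] @ Z)"
 proof (cases "ok (X @ [l] @ Z)")
  case False
  then show ?thesis using ol l by (simp add: D_def)
 next
  case True
  then have v: "valid X" "valid Z" by (auto simp: ok_def)
  let ?g = "%t x y z. if y = [] \<or> y = X @ t # Z then 0 else ksg (wdeg x) * c (x @ [mul y] @ z)"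
  have sp: "D c (X @ [t] @ Z) = (\<Sum>z'@y@z=Z. ?g t (X @ t # z') y z)
    + (\<Sum>x@x'=X. \<Sum>z'@z=Z. ?g t x (x' @ t # z') z)
    + (\<Sum>x@y@x'=X. ?g t x y (x' @ t # Z))" if "ok (X @ [t] @ Z)" for t
   using that sum_sp3_insert[of "?g t" X t Z] by (simp add: D_def)
  have 1: "(\<Sum>z'@y@z=Z. ?g (ladd l l') (X @ ladd l l' # z') y z)
    = (\<Sum>z'@y@z=Z. ?g l (X @ l # z') y z) + (\<Sum>z'@y@z=Z. ?g l' (X @ l' # z') y z)"
   unfolding sum_sp3_add[symmetric]
  proof (rule sum_sp3_cong, goal_cases)
   case (1 z' y z)
   note Z = 1
   have ne: "y ~= X @ t # Z" for t
   using Z by auto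
   show ?case
    using MC_add[OF c, of l l' X "z' @ mul y # z"] l sl by (cases "y = []") (simp_all add: ne distrib_left)
  qed
  have 2: "(\<Sum>x@x'=X. \<Sum>z'@z=Z. ?g (ladd l l') x (x' @ ladd l l' # z') z)
    = (\<Sum>x@x'=X. \<Sum>z'@z=Z. ?g l x (x' @ l # z') z)
    + (\<Sum>x@x'=X. \<Sum>z'@z=Z. ?g l' x (x' @ l' # z') z)" unfolding sum_sp2_add[symmetric]
  proof (rule sum_sp2_cong, rule sum_sp2_cong)
   fix x x' z' z assume X: "x @ x' = X" and Z: "z' @ z = Z"
   have w: "x' @ t # z' = X @ t # Z \<longleftrightarrow> x = [] & z = []" for t
   proof
    assume e: "x' @ t # z' = X @ t # Z"
    have "length x + length z = 0" using arg_cong[OF e, of length] X[symmetric] Z[symmetric] by simp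
    then show "x = [] & z = []" by simp
   qed (use X Z in auto)
   show "?g (ladd l l') x (x' @ ladd l l' # z') z = ?g l x (x' @ l # z') z + ?g l' x (x' @ l' # z') z"
    unfolding w using MC_mul[OF c, of l l' x' z' x z] l v X Z by (auto simp: distrib_left)
  qed
  have 3: "(\<Sum>x@y@x'=X. ?g (ladd l l') x y (x' @ ladd l l' # Z))
    = (\<Sum>x@y@x'=X. ?g l x y (x' @ l # Z)) + (\<Sum>x@y@x'=X. ?g l' x y (x' @ l' # Z))"
   unfolding sum_sp3_add[symmetric]
  proof (rule sum_sp3_cong, goal_cases)
   case (1 x y x')
   note X = 1
   have ne: "y ~= X @ t # Z" for t
   using X by auto
   show ?case
    using MC_add[OF c, of l l' "x @ mul y # x'" Z] l by (cases "y = []") (simp_all add: ne distrib_left)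
  qed
  show ?thesis using sp[of l] sp[of l'] sp[of "ladd l l'"] ol l True 1 2 3 by simp
 qed
qed

end

context aug

begin

lemma A_infinity_words_no_scalar:
 fixes c :: "('r, 'm) word => 't::comm_ring_1"
 assumes c: "MC c" and okw: "ok (X @ U @ Z)" and U: "U ~= []" "X ~= [] \<or> Z ~= []" and G: "~ list_ex isGnd U"
 shows "(\<Sum>x@y@z=U. if y = [] then 0 else ksg (wdeg x) * c (X @ [mul (x @ [mul y] @ z)] @ Z)) = 0"
proof -
 let ?b = "map hel U" and ?e = "wdeg U - 3"
 have vU: "valid U" using okw by (auto simp: ok_def)
 have b: "?b : hlists M" by (rule hlists_hel[OF vU G])
 have sb: "sdeg ?b - 3 = ?e" using sdeg_hel[OF G] by simp
 have parts: "~ list_ex isGnd x & ~ list_ex isGnd y & ~ list_ex isGnd z & valid x & valid y & valid z"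
  if "x @ y @ z = U" for x y z using that G vU by auto
 have hm: "hel (mul y) = mh V (map hel y)" if "~ list_ex isGnd y" for y using that sdeg_hel[OF that] by (simp add: mul_def mh_def)
 have key: "mul (x @ [mul y] @ z) = (if list_ex isElt U then Elt ?e else Mid ?e) (mval V (map hel x @ [mh V (map hel y)] @ map hel z))"
  if "x @ y @ z = U" for x y z
 using parts[OF that] that hm by (fastforce simp: mul_def)
 obtain h :: "'m => 't" where h: "additive_on (M ?e) h"
  and hc: "!!x y z. x @ y @ z = U ==> y ~= [] ==>
   h (mval V (map hel x @ [mh V (map hel y)] @ map hel z)) = c (X @ [mul (x @ [mul y] @ z)] @ Z)"
 proof (cases "list_ex isElt U")
  case True
  define h where "h u = c (X @ [Elt ?e u] @ Z)" for u
  have "additive_on (M ?e) h" unfolding additive_on_def h_def using MC_add[OF c, of "Elt ?e _" "Elt ?e _" X Z] by auto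
  moreover have "h (mval V (map hel x @ [mh V (map hel y)] @ map hel z)) = c (X @ [mul (x @ [mul y] @ z)] @ Z)"
   if "x @ y @ z = U" for x y z using key[OF that] True by (simp add: h_def)
  ultimately show thesis using that by blast
 next
  case False
  obtain p where p: "!!u. u : carrier (M ?e) ==> p u : Cc ?e"
    "!!u v. u : carrier (M ?e) ==> v : carrier (M ?e) ==> p (u \<oplus>`M ?e` v) = p u \<oplus>`M ?e` p v"
    "!!u. u : Cc ?e ==> p u = u" using rational_retraction[OF R M Cc_sub] by blast
  define h where "h u = c (X @ [Mid ?e (p u)] @ Z)" for u
  have "additive_on (M ?e) h" unfolding additive_on_def h_def
  proof (intro ballI, goal_cases)
   case (1 u v)
   note uv = 1(1-2)
   show ?case
    using MC_add[OF c, of "Mid ?e (p u)" "Mid ?e (p v)" X Z] p(1)[OF uv(1)] p(1)[OF uv(2)] p(2)[OF uv] by simp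
  qed
  moreover have "h (mval V (map hel x @ [mh V (map hel y)] @ map hel z)) = c (X @ [mul (x @ [mul y] @ z)] @ Z)"
   if xyz: "x @ y @ z = U" and y: "y ~= []" for x y z
  proof -
   have "vl (mul (x @ [mul y] @ z))" by (rule vl_mul) (use vl_mul[OF y] parts[OF xyz] in auto)
   then have "mval V (map hel x @ [mh V (map hel y)] @ map hel z) : Cc ?e" unfolding key[OF xyz] using False by simp
   from p(3)[OF this] show ?thesis using key[OF xyz] False by (simp add: h_def)
  qed
  ultimately show thesis using that by blast
 qed
 have "0 = (\<Sum>x@y@z=U. ksg (sdeg (map hel x)) * h (mval V (map hel x @ [mh V (map hel y)] @ map hel z)))"
  using A_infinity_relation[OF b h[folded sb]] unfolding sum_sp3_map by simp
 also have "... = (\<Sum>x@y@z=U. if y = [] then 0 else ksg (wdeg x) * c (X @ [mul (x @ [mul y] @ z)] @ Z))"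
 proof (rule sum_sp3_cong, goal_cases)
  case (1 x y z)
  note xyz = 1
  note p = parts[OF xyz]
  show ?case
  proof (cases "y = []")
   case True
   have "mval V (map hel x @ [(- 2, \<zero>`M (- 2)`)] @ map hel z) = \<zero>`M ?e`"
    by (rule mval_zero) (use p xyz True hlists_hel[of x] hlists_hel[of z] sdeg_hel[of x] sdeg_hel[of z] in auto)
   then show ?thesis using True additive_on_zero[OF M h] by (simp add: mh_def mval_nil)
  next
   case False
   then show ?thesis using hc[OF xyz] sdeg_hel[of x] p by simp
  qed
 qed
 finally show ?thesis by simp
qed

lemma gval_length: "length w ~= 2 ==> gval w = 0" by (cases w rule: gval.cases) auto

lemma eps_mval_zero:
 assumes as: "\<forall>a\<in>set as. isMid a" "valid as" "wdeg as = 2" "as ~= []" "length as ~= 2"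
 shows "eps (mval V (map hel as)) = 0"
proof (cases "length as = 1")
 case True
 then obtain l where l: "as = [l]" by (auto simp: length_Suc_conv)
 then obtain j a where a: "l = Mid j a" using as(1) by (cases l) auto
 have "j = 1" using as(3) l a by simp
 moreover then have "a : carrier (M 1)" using as(2) l a by (simp add: Cc_carrier)
 ultimately show ?thesis using eps_bd[of "\<delta> 1 a"] by (simp add: l a mval_single boundaries_def)
next
 case False
 have "3 \<le> length as" using False as(4,5) by (cases as) (auto simp: neq_Nil_conv Suc_le_eq)
 then show ?thesis using mval_low_degree[OF as(1,2)] as(3) eps_zero by simp
qed

lemma eps_mval_pair:
 assumes "a : Cc j" "b : Cc k" "j + k = 0"
 shows "eps (mval V [(j, a), (k, b)]) = (if j = 0 then eps a * eps b else 0)"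
proof (cases "j = 0")
 case True
 then show ?thesis using assms eps_mult[of a b] by (simp add: Cc_def)
next
 case False
 then have "wdeg [Mid j a, Mid k b] < int (length [Mid j a, Mid k b]) \<or> j + k = 0" using assms by simp
 consider "j < 0" | "k < 0" using False assms(3) by linarith
 then have "mval V [(j, a), (k, b)] = \<zero>`M 0`"
 proof cases
  case 1
  then show ?thesis using assms mval_zero[of "[]" "[(k, b)]" 0 j] by (simp add: Cc_def)
 next
  case 2
  then show ?thesis using assms mval_zero[of "[(j, a)]" "[]" 0 k] by (simp add: Cc_def)
 qed
 then show ?thesis using False eps_zero by simp
qed

lemma mul_Gnd: "list_ex isGnd Y ==> mul Y = Gnd (wdeg Y - 2) (gval Y)" by (simp add: mul_def)

lemma mul_Mids: "\<forall>a\<in>set Y. isMid a ==> mul Y = Mid (wdeg Y - 2) (mval V (map hel Y))"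
 using mids_ex[of Y] by (simp add: mul_def)

text \<open>For a subword with a scalar end the relation says that \<open>eps\<close> is multiplicative and vanishes on boundaries: by degree,
  only a scalar next to two letters of degree zero, or next to one letter of degree one, can contribute.\<close>

lemma A_infinity_words_scalar:
 fixes c :: "('r, 'm) word => 't::comm_ring_1"
 assumes c: "MC c" and vU: "valid U" and g: "list_ex isGnd U"
  and U: "U = Gnd i r # as \<or> U = as @ [Gnd i r]" and as: "\<forall>a\<in>set as. isMid a"
 shows "(\<Sum>x@y@z=U. if y = [] then 0 else ksg (wdeg x) * c (X @ [mul (x @ [mul y] @ z)] @ Z)) = 0"
proof -
 let ?e = "wdeg U - 3"
 define h where "h s = c (X @ [Gnd ?e s] @ Z)" for s
 have h0: "h 0 = 0" unfolding h_def by (rule MC_zero_Gnd[OF c])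
 have ghas: "list_ex isGnd (x @ [mul y] @ z)" if "x @ y @ z = U" for x y z using that g by (auto simp: isX_mul)
 have m: "c (X @ [mul (x @ [mul y] @ z)] @ Z) = h (gval (x @ [mul y] @ z))" if "x @ y @ z = U" for x y z
 using that mul_Gnd[OF ghas[OF that]] by (auto simp: h_def)
 have eq: "(\<Sum>x@y@z=U. if y = [] then 0 else ksg (wdeg x) * c (X @ [mul (x @ [mul y] @ z)] @ Z))
   = (\<Sum>x@y@z=U. if y = [] then 0 else ksg (wdeg x) * h (gval (x @ [mul y] @ z)))" by (rule sum_sp3_cong) (simp only: m)
 have vas: "valid as" using vU U by auto
 show ?thesis
 proof (cases "length as = 2 & ?e = 0")
  case False
  have "gval (x @ [mul y] @ z) = 0" if xyz: "x @ y @ z = U" and y: "y ~= []" for x y z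
  proof (cases "?e = 0 & length (x @ [mul y] @ z) = 2")
   case False
   then show ?thesis using gval_degree[of "x @ [mul y] @ z"] gval_length[of "x @ [mul y] @ z"] xyz by auto
  next
   case True
   then have las: "length as ~= 2" using False by blast
   have e3: "wdeg U = 3" using True by simp
   consider a where "x = [a]" "z = []" | a where "x = []" "z = [a]" using True by (cases x; cases z) auto
   then show ?thesis
   proof cases
    case 1
    show ?thesis
    proof (cases a)
     case (Gnd k s)
     then have "U = Gnd i r # as" "y = as" "k = i" "s = r" using U xyz 1 as y by (cases as; auto simp: Cons_eq_append_conv)+
     then have w: "U = Gnd i r # as" "y = as" "a = Gnd i r" using Gnd by auto
     show ?thesis
     proof (cases "i = 0")
      case i0: True
      then have "wdeg as = 2" using e3 w by simp
      then show ?thesis using eps_mval_zero[OF as vas _ _ las] y w 1 i0 by (simp add: mul_Mids[OF as])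
     next
      case False
      then show ?thesis using w 1 by (simp add: mul_Mids[OF as])
     qed
    next
     case (Mid k s)
     then have "list_ex isGnd y" using ghas[OF xyz] 1 by (simp add: isX_mul)
     moreover have "length y ~= 2" using las U arg_cong[OF xyz, of length] 1 by auto
     ultimately show ?thesis using 1 Mid gval_length[of y] by (simp add: mul_Gnd)
    next
     case (Elt k s)
     then show ?thesis using 1 by (cases "mul y") simp_all
    qed
   next
    case 2
    show ?thesis
    proof (cases a)
     case (Gnd k s)
     then have "U = as @ [Gnd i r]" "y = as" "a = Gnd i r"
      using U xyz 2 as y by (cases as rule: rev_cases; auto simp: Cons_eq_append_conv append_eq_Cons_conv)+
     note w = this
     show ?thesis
     proof (cases "i = 0")
      case i0: True
      then have "wdeg as = 2" using e3 w by simp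
      then show ?thesis using eps_mval_zero[OF as vas _ _ las] y w 2 i0 by (simp add: mul_Mids[OF as])
     next
      case False
      then show ?thesis using w 2 by (simp add: mul_Mids[OF as])
     qed
    next
     case (Mid k s)
     then have "list_ex isGnd y" using ghas[OF xyz] 2 by (simp add: isX_mul)
     moreover have "length y ~= 2" using las U arg_cong[OF xyz, of length] 2 by auto
     ultimately show ?thesis using 2 Mid gval_length[of y] by (simp add: mul_Gnd)
    next
     case (Elt k s)
     then show ?thesis using 2 by (cases "mul y") simp_all
    qed
   qed
  qed
  then have "(\<Sum>x@y@z=U. if y = [] then 0 else ksg (wdeg x) * h (gval (x @ [mul y] @ z))) = 0"
   by (intro sum.neutral) (auto simp: h0)
  then show ?thesis using eq by simp
 next
  case True
  then obtain l l' where ll: "as = [l, l']" by (auto simp: numeral_2_eq_2 length_Suc_conv)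
  obtain j a where a: "l = Mid j a" using as ll by (cases l) auto
  obtain k b where b: "l' = Mid k b" using as ll by (cases l') auto
  have ab: "a : Cc j" "b : Cc k" using vas ll a b by auto
  have hneg: "h (- s) = - h s" for s
  proof -
   have "h (s + - s) = h s + h (- s)" unfolding h_def using MC_add[OF c, of "Gnd ?e s" "Gnd ?e (- s)" X Z] True by simp
   then show ?thesis using h0 by (simp add: add_eq_0_iff)
  qed
  have mab: "mul [Mid j a, Mid k b] = Mid (j + k) (mval V [(j, a), (k, b)])" using mul_Mids[of "[Mid j a, Mid k b]"] by simp
  have g0: "gval [u, v, w] = 0" "gval [u] = 0" for u v w by (cases u; cases v; simp)+
  from U show ?thesis
  using eps_mval_pair[OF ab] eq by (auto simp: mul_Gnd ll sum_sp3_Cons sum_sp2_Cons h0 a b mab algebra_simps)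
 qed
qed

lemma A_infinity_words:
 fixes c :: "('r, 'm) word => 't::comm_ring_1"
 assumes c: "MC c" and okw: "ok (X @ U @ Z)" and U: "U ~= []" "X ~= [] \<or> Z ~= []"
 shows "(\<Sum>x@y@z=U. if y = [] then 0 else ksg (wdeg x) * c (X @ [mul (x @ [mul y] @ z)] @ Z)) = 0"
proof (cases "list_ex isGnd U")
 case False
 then show ?thesis by (rule A_infinity_words_no_scalar[OF c okw U])
next
 case True
 have v: "valid U" and w: "wd (X @ U @ Z)" using okw by (auto simp: ok_def)
 obtain i r as where as: "\<forall>a\<in>set as. isMid a" "U = Gnd i r # as \<or> U = as @ [Gnd i r]" using w U
 proof (cases rule: wd_subword_cases)
  case (left e as bs e')
  then have "isGnd e" using True mids_ex[of as] by auto
  then obtain i r where "e = Gnd i r" by (cases e) auto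
  then show ?thesis using left that[of as i r] by blast
 next
  case (right e as bs e')
  then have "isGnd e'" using True mids_ex[of as] by auto
  then obtain i r where "e' = Gnd i r" by (cases e') auto
  then show ?thesis using right that[of as i r] by blast
 next
  case (mid e bs cs e')
  then show ?thesis using True mids_ex[of U] by blast
 qed
 show ?thesis by (rule A_infinity_words_scalar[OF c v True as(2,1)])
qed

text \<open>Two disjoint merges cancel in pairs, and nested ones cancel by the relation for subwords.\<close>

lemma D_D:
 fixes c :: "('r, 'm) word => 't::comm_ring_1"
 assumes c: "MC c"
 shows "D (D c) w = 0"
proof (cases "ok w")
 case False
 then show ?thesis by (simp add: D_def)
next
 case True
 define F where "F x y a b z = (if y = [] \<or> b = [] then 0 else ksg (wdeg x + (wdeg x + wdeg y + wdeg a - 1)) * c (x @ [mul y] @ a @ [mul b] @ z))"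
  for x y a b z
 define H where "H a b y e d = (if y = [] \<or> (a = [] & d = []) then 0
   else ksg (wdeg b) * c (a @ [mul (b @ [mul y] @ e)] @ d))" for a b y e d
 have step: "(if y = [] \<or> y = w then 0 else ksg (wdeg x) * D c (x @ [mul y] @ z)) = (\<Sum>z'@b@d=z. F x y z' b d)
   + (\<Sum>a@b=x. \<Sum>e@d=z. H a b y e d)
   + (\<Sum>a@b@x'=x. - F a b x' y z)" if xyz: "x @ y @ z = w" for x y z
 proof (cases "y = [] \<or> y = w")
  case True
  have yy: "y = [] \<or> (x = [] & z = [])"
  proof (cases "y = []")
   case False
   then have "length x + length z = 0" using True arg_cong[OF xyz, of length] by simp
   then show ?thesis by simp
  qed simp
  have 1: "F x y z' b d = 0" if "z' @ b @ d = z" for z' b d using yy that by (auto simp: F_def)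
  have 2: "H a b y e d = 0" if "a @ b = x" "e @ d = z" for a b e d using yy that by (auto simp: H_def)
  have 3: "- F a b x' y z = 0" if "a @ b @ x' = x" for a b x' using yy that by (auto simp: F_def)
  have "(\<Sum>z'@b@d=z. F x y z' b d) = (\<Sum>z'@b@d=z. 0)" by (rule sum_sp3_cong) (rule 1)
  moreover have "(\<Sum>a@b=x. \<Sum>e@d=z. H a b y e d) = (\<Sum>a@b=x. \<Sum>e@d=z. 0)"
   by (rule sum_sp2_cong, rule sum_sp2_cong) (rule 2)
  moreover have "(\<Sum>a@b@x'=x. - F a b x' y z) = (\<Sum>a@b@x'=x. 0)" by (rule sum_sp3_cong) (rule 3)
  ultimately show ?thesis using True by simp
 next
  case False
  then have xz: "x ~= [] \<or> z ~= []" using xyz by auto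
  have oky: "ok (x @ [mul y] @ z)" using ok_mul[of x y z] True xyz False xz by simp
  let ?g = "%a b d. if b = [] \<or> b = x @ mul y # z then 0 else ksg (wdeg a) * c (a @ [mul b] @ d)"
  have "D c (x @ [mul y] @ z) = (\<Sum>z'@b@d=z. ?g (x @ mul y # z') b d)
    + (\<Sum>a@b=x. \<Sum>e@d=z. ?g a (b @ mul y # e) d) + (\<Sum>a@b@x'=x. ?g a b (x' @ mul y # z))"
   using oky sum_sp3_insert[of ?g x "mul y" z] by (simp add: D_def)
  moreover have "ksg (wdeg x) * (\<Sum>z'@b@d=z. ?g (x @ mul y # z') b d) = (\<Sum>z'@b@d=z. F x y z' b d)"
   unfolding sum_distrib_left prod.case_distrib
  proof (rule sum_sp3_cong)
   fix z' b d assume z: "z' @ b @ d = z"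
   have "b ~= x @ mul y # z"
   using z by auto
   moreover have "ksg (wdeg x) * ksg (wdeg (x @ mul y # z')) = (ksg (wdeg x + (wdeg x + wdeg y + wdeg z' - 1)) :: 't)"
    unfolding sgn_pow_add[symmetric] by (rule sgn_pow_cong) auto
   ultimately show "ksg (wdeg x) * ?g (x @ mul y # z') b d = F x y z' b d" using False by (simp add: F_def mult.assoc[symmetric])
  qed
  moreover have "ksg (wdeg x) * (\<Sum>a@b=x. \<Sum>e@d=z. ?g a (b @ mul y # e) d)
    = (\<Sum>a@b=x. \<Sum>e@d=z. H a b y e d)" unfolding sum_distrib_left prod.case_distrib
  proof (rule sum_sp2_cong, rule sum_sp2_cong)
   fix a b e d assume x: "a @ b = x" and z: "e @ d = z"
   have w: "b @ mul y # e = x @ mul y # z \<longleftrightarrow> a = [] & d = []"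
   proof
    assume q: "b @ mul y # e = x @ mul y # z"
    have "length a + length d = 0" using arg_cong[OF q, of length] x[symmetric] z[symmetric] by simp
    then show "a = [] & d = []" by simp
   qed (use x z in auto)
   have sg: "ksg (wdeg x) * ksg (wdeg a) = (ksg (wdeg b) :: 't)"
    unfolding sgn_pow_add[symmetric] x[symmetric] by (rule sgn_pow_cong) simp
   show "ksg (wdeg x) * ?g a (b @ mul y # e) d = H a b y e d" unfolding w H_def using False by (simp add: mult.assoc[symmetric] sg)
  qed
  moreover have "ksg (wdeg x) * (\<Sum>a@b@x'=x. ?g a b (x' @ mul y # z)) = (\<Sum>a@b@x'=x. - F a b x' y z)"
   unfolding sum_distrib_left prod.case_distrib
  proof (rule sum_sp3_cong)
   fix a b x' assume x: "a @ b @ x' = x"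
   have "b ~= x @ mul y # z"
   using x by auto
   moreover have "ksg (wdeg x) * ksg (wdeg a) = (- ksg (wdeg a + (wdeg a + wdeg b + wdeg x' - 1)) :: 't)"
    unfolding sgn_pow_add[symmetric] x[symmetric] by (rule sgn_pow_opp) auto
   ultimately show "ksg (wdeg x) * ?g a b (x' @ mul y # z) = - F a b x' y z" using False by (simp add: F_def mult.assoc[symmetric])
  qed
  ultimately show ?thesis using False by (simp add: distrib_left)
 qed
 have "D (D c) w = (\<Sum>x@y@z=w. if y = [] \<or> y = w then 0 else ksg (wdeg x) * D c (x @ [mul y] @ z))"
  using True by (simp add: D_def[of "D c"])
 also have "... = (\<Sum>x@y@z=w. (\<Sum>z'@b@d=z. F x y z' b d)
   + (\<Sum>a@b=x. \<Sum>e@d=z. H a b y e d) + (\<Sum>a@b@x'=x. - F a b x' y z))"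
  by (rule sum_sp3_cong) (rule step)
 also have "... = (\<Sum>x@y@z=w. \<Sum>z'@b@d=z. F x y z' b d)
   + (\<Sum>x@y@z=w. \<Sum>a@b=x. \<Sum>e@d=z. H a b y e d)
   + (\<Sum>x@y@z=w. \<Sum>a@b@x'=x. - F a b x' y z)" by (simp only: sum_sp3_add)
 also have "(\<Sum>x@y@z=w. \<Sum>a@b@x'=x. - F a b x' y z) = - (\<Sum>x@y@z=w. \<Sum>z'@b@d=z. F x y z' b d)"
  unfolding sum_sp3_disjoint[of "%x y z' b d. F x y z' b d" w] by (simp add: sum_negf split_beta)
 also have "(\<Sum>x@y@z=w. \<Sum>a@b=x. \<Sum>e@d=z. H a b y e d)
   = (\<Sum>a@u@d=w. \<Sum>b@y@e=u. H a b y e d)" by (rule sum_sp3_inner)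
 also have "... = (\<Sum>a@u@d=w. 0)"
 proof (rule sum_sp3_cong)
  fix a u d assume w: "a @ u @ d = w"
  show "(\<Sum>b@y@e=u. H a b y e d) = 0"
  proof (cases "u = [] \<or> (a = [] & d = [])")
   case True
   then show ?thesis by (intro sum.neutral) (auto simp: H_def)
  next
   case False
   have "(\<Sum>b@y@e=u. H a b y e d)
    = (\<Sum>x@y@z=u. if y = [] then 0 else ksg (wdeg x) * c (a @ [mul (x @ [mul y] @ z)] @ d))"
    by (rule sum_sp3_cong) (use False in \<open>auto simp: H_def\<close>)
   also have "... = 0" by (rule A_infinity_words[OF c]) (use True w False in auto)
   finally show ?thesis .
  qed
 qed
 finally show ?thesis by simp
qed

end

section \<open>The cochain on scalar words defined by the copairing\<close>

lemma additive_endo_zero: "additive_endo (%_. 0)" by (simp add: additive_endo_def)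

lemma additive_endo_sgn: "additive_endo h ==> additive_endo (%t. ksg k * h t)"
 by (simp add: additive_endo_def distrib_left)

lemma additive_endo_sum: "(!!i. i : I ==> additive_endo (h i)) ==> additive_endo (%t. \<Sum>i\<in>I. h i t)"
 by (induction I rule: infinite_finite_induct) (auto simp: additive_endo_def algebra_simps)

lemma lam_zero: "lam (%_. 0) = 0" using lam_smult[OF additive_endo_zero, of 0] by simp

lemma lam_neg: "additive_endo h ==> lam (%t. - h t) = - lam h"
proof -
 assume h: "additive_endo h"
 then have "h 0 = 0" unfolding additive_endo_def by (metis add.right_neutral add_left_cancel)
 then have "h (- t) = - h t" for t using h unfolding additive_endo_def by (metis add.right_inverse add_eq_0_iff)
 then show ?thesis using lam_smult[OF h, of "- 1"] by simp
qed

lemma lam_sgn: "additive_endo h ==> lam (%t. ksg k * h t) = ksg k * lam h"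
 using lam_neg[of h] by (simp add: sgn_pow_def)

lemma lam_sum:
 "finite I ==> (!!i. i : I ==> additive_endo (h i)) ==> lam (%t. \<Sum>i\<in>I. h i t) = (\<Sum>i\<in>I. lam (h i))"
proof (induction I rule: finite_induct)
 case empty
 then show ?case by (simp add: lam_zero)
next
 case (insert i I)
 then show ?case using lam_add[of "h i" "%t. \<Sum>i\<in>I. h i t"] additive_endo_sum[of I h] by simp
qed

context aug

begin

text \<open>The cochain \<open>G\<close> as a function of its left end (\<open>gl\<close>) or right end (\<open>gr\<close>). Composition with \<open>lam\<close> makes it
  linear over the ring in this argument, as it must be to be applied to an output of the copairing.\<close>

definition gl :: "(('r, 'm) word => 'r) => 'm helem => ('r, 'm) word => 'r residue_field" where
 "gl G u z = lam (%t. G (Elt (fst u) (t \<odot>`M (fst u)` snd u) # z))"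

definition gr :: "(('r, 'm) word => 'r) => ('r, 'm) word => 'm helem => 'r residue_field" where
 "gr G x v = lam (%t. G (x @ [Elt (fst v) (t \<odot>`M (fst v)` snd v)]))"

lemma MC_smult_additive:
 assumes "MC G" "x : carrier (M d)"
 shows "additive_endo (%t. G (X @ [Elt d (t \<odot>`M d` x)] @ Z))" unfolding additive_endo_def
 using MC_add[OF assms(1), of "Elt d (_ \<odot>`M d` x)" "Elt d (_ \<odot>`M d` x)" X Z] assms(2)
 by (simp add: mod_closed[OF M] mod_laws(7)[OF M])

lemma gl_endo: "MC G ==> [u] : hlists M ==> additive_endo (%t. G (Elt (fst u) (t \<odot>`M (fst u)` snd u) # z))"
 using MC_smult_additive[of G "snd u" "fst u" "[]" z] by simp

lemma gr_endo: "MC G ==> [v] : hlists M ==> additive_endo (%t. G (x @ [Elt (fst v) (t \<odot>`M (fst v)` snd v)]))"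
 using MC_smult_additive[of G "snd v" "fst v" x "[]"] by simp

lemma gl_linear:
 assumes "MC G" "x : carrier (M d)" "y : carrier (M d)"
 shows "gl G (d, x \<oplus>`M d` y) z = gl G (d, x) z + gl G (d, y) z" "gl G (d, r \<odot>`M d` x) z = res r * gl G (d, x) z"
proof -
 have "(%t. G (Elt d (t \<odot>`M d` (x \<oplus>`M d` y)) # z)) = (%t. G (Elt d (t \<odot>`M d` x) # z) + G (Elt d (t \<odot>`M d` y) # z))"
  using MC_add[OF assms(1), of "Elt d (_ \<odot>`M d` x)" "Elt d (_ \<odot>`M d` y)" "[]" z] assms
  by (simp add: mod_closed[OF M] mod_laws(8)[OF M])
 then show "gl G (d, x \<oplus>`M d` y) z = gl G (d, x) z + gl G (d, y) z"
  using lam_add[OF gl_endo[OF assms(1), of "(d, x)" z] gl_endo[OF assms(1), of "(d, y)" z]] assms by (simp add: gl_def)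
 have "(%t. G (Elt d (t \<odot>`M d` (r \<odot>`M d` x)) # z)) = (%t. G (Elt d ((t * r) \<odot>`M d` x) # z))"
  using assms by (simp add: mod_laws(9)[OF M])
 then show "gl G (d, r \<odot>`M d` x) z = res r * gl G (d, x) z"
  using lam_smult[OF gl_endo[OF assms(1), of "(d, x)" z], of r] assms by (simp add: gl_def)
qed

lemma gr_linear:
 assumes "MC G" "x : carrier (M d)" "y : carrier (M d)"
 shows "gr G z (d, x \<oplus>`M d` y) = gr G z (d, x) + gr G z (d, y)" "gr G z (d, r \<odot>`M d` x) = res r * gr G z (d, x)"
proof -
 have "(%t. G (z @ [Elt d (t \<odot>`M d` (x \<oplus>`M d` y))])) = (%t. G (z @ [Elt d (t \<odot>`M d` x)]) + G (z @ [Elt d (t \<odot>`M d` y)]))"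
  using MC_add[OF assms(1), of "Elt d (_ \<odot>`M d` x)" "Elt d (_ \<odot>`M d` y)" z "[]"] assms
  by (simp add: mod_closed[OF M] mod_laws(8)[OF M])
 then show "gr G z (d, x \<oplus>`M d` y) = gr G z (d, x) + gr G z (d, y)"
  using lam_add[OF gr_endo[OF assms(1), of "(d, x)" z] gr_endo[OF assms(1), of "(d, y)" z]] assms by (simp add: gr_def)
 have "(%t. G (z @ [Elt d (t \<odot>`M d` (r \<odot>`M d` x))])) = (%t. G (z @ [Elt d ((t * r) \<odot>`M d` x)]))"
  using assms by (simp add: mod_laws(9)[OF M])
 then show "gr G z (d, r \<odot>`M d` x) = res r * gr G z (d, x)"
  using lam_smult[OF gr_endo[OF assms(1), of "(d, x)" z], of r] assms by (simp add: gr_def)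
qed

text \<open>The right output of the copairing becomes the right end of the left part of a word, and the left output becomes the
  left end of the right part. The sign makes the product rule below hold.\<close>

definition form where
 "form G G' x z u v = ksg ((fst u + 1) * (fst v + 1) + n * wdeg x) * (gr G' x v * gl G u z)"

lemma form_bilin: "MC G ==> MC G' ==> bilin M (form G G' x z)"
 by (rule bilinI) (simp_all add: form_def gl_linear gr_linear algebra_simps)

text \<open>The word \<open>e, \<dots>, e'\<close> between scalar ends is cut into \<open>x y z\<close> in all ways; \<open>y\<close> is fed to the copairing,
  whose outputs are closed up by \<open>G'\<close> on \<open>x\<close> and by \<open>G\<close> on \<open>z\<close>.\<close>

definition cc :: "(('r, 'm) word => 'r) => (('r, 'm) word => 'r) => ('r, 'm) word => 'r residue_field" where
 "cc G G' w = (if ok w & isGnd (hd w) & isGnd (last w) then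
  \<Sum>x@y@z=w. if x = [] \<or> z = [] then 0 else pairing (map hel y) (form G G' x z) else 0)"

lemma pairing_add: "pairing y (%u v. \<beta> u v + \<gamma> u v) = pairing y \<beta> + pairing y \<gamma>"
proof -
 have "BF M (%u v. \<beta> u v + \<gamma> u v) = (%r k. BF M \<beta> r k + BF M \<gamma> r k)"
  by (intro ext) (simp add: BF_def distrib_left)
 then show ?thesis by (simp add: pairing_def EV_distrib)
qed

lemma pairing_scale: "pairing y (%u v. s * \<beta> u v) = s * pairing y \<beta>"
proof -
 have "BF M (%u v. s * \<beta> u v) = (%r k. s * BF M \<beta> r k)" by (intro ext) (simp add: BF_def)
 then show ?thesis by (simp add: pairing_def EV_mult_left)
qed

lemma pairing_zero: "pairing y (%u v. 0) = 0" using pairing_scale[of y 0 "%u v. 0"] by simp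

lemma pairing_sum: "pairing y (%u v. \<Sum>i\<in>I. \<beta> i u v) = (\<Sum>i\<in>I. pairing y (\<beta> i))"
 by (induction I rule: infinite_finite_induct) (simp_all add: pairing_zero pairing_add)

lemma pairing_linear:
 assumes "bilin M \<beta>" "P : hlists M" "Q : hlists M" "x : carrier (M d)" "y : carrier (M d)"
 shows "pairing (P @ [(d, x \<oplus>`M d` y)] @ Q) \<beta> = pairing (P @ [(d, x)] @ Q) \<beta> + pairing (P @ [(d, y)] @ Q) \<beta>"
 using teq_EV[OF ops2_add(3)[OF assms(2,3) hlists_simps(1) assms(4,5)] BF_balanced[OF M assms(1)]]
 by (simp add: pairing_def EV_add[OF BF_coef_add])

lemma pairing_zero_entry:
 assumes "bilin M \<beta>" "P : hlists M" "Q : hlists M"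
 shows "pairing (P @ [(d, \<zero>`M d`)] @ Q) \<beta> = 0"
 using pairing_linear[OF assms, of "\<zero>`M d`" d "\<zero>`M d`"] by (simp add: mod_closed[OF M] mod_laws(3)[OF M])

lemma ok_parts:
 assumes "ok (x @ y @ z)" "x ~= []" "z ~= []"
 shows "\<forall>a\<in>set y. isMid a" "valid y" "map hel y : hlists M" "wdeg y = sdeg (map hel y)"
proof -
 show m: "\<forall>a\<in>set y. isMid a"
 proof (cases "y = []")
  case False
  have w: "wd (x @ y @ z)" using assms by (simp add: ok_def)
  have xz: "x ~= [] \<or> z ~= []" using assms by simp
  from w False xz show ?thesis
  using wd_subword_cases assms  by blast
 qed simp
 show v: "valid y" using assms(1) by (auto simp: ok_def)
 show "map hel y : hlists M" "wdeg y = sdeg (map hel y)" using hlists_hel[OF v] sdeg_hel[of y] mids_ex[OF m] by auto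
qed

lemma MC_cc:
 assumes G: "MC G" and G': "MC G'"
 shows "MC (cc G G')" unfolding MC_def
proof (intro conjI allI impI)
 show "cc G G' w = 0" if "~ ok w" for w using that by (simp add: cc_def)
 fix X l l' Z assume l: "vl l & vl l' & same l l'"
 note ol = ok_ladd[of l l' X Z] and sl = same_ladd[of l l']
 have ends: "isGnd (hd (X @ [ladd l l'] @ Z)) = isGnd (hd (X @ [l] @ Z))" "isGnd (hd (X @ [l'] @ Z)) = isGnd (hd (X @ [l] @ Z))"
  "isGnd (last (X @ [ladd l l'] @ Z)) = isGnd (last (X @ [l] @ Z))" "isGnd (last (X @ [l'] @ Z)) = isGnd (last (X @ [l] @ Z))"
  using l by (cases X; cases Z; cases l; cases l'; simp)+
 show "cc G G' (X @ [ladd l l'] @ Z) = cc G G' (X @ [l] @ Z) + cc G G' (X @ [l'] @ Z)"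
 proof (cases "ok (X @ [l] @ Z) & isGnd (hd (X @ [l] @ Z)) & isGnd (last (X @ [l] @ Z))")
  case False
  then show ?thesis using ol l ends by (auto simp: cc_def)
 next
  case True
  let ?g = "%x y z. if x = [] \<or> z = [] then 0 else pairing (map hel y) (form G G' x z)"
  have sp: "cc G G' (X @ [t] @ Z) = (\<Sum>z'@y@z=Z. ?g (X @ t # z') y z)
    + (\<Sum>x@x'=X. \<Sum>z'@z=Z. ?g x (x' @ t # z') z) + (\<Sum>x@y@x'=X. ?g x y (x' @ t # Z))"
   if "ok (X @ [t] @ Z)" "isGnd (hd (X @ [t] @ Z))" "isGnd (last (X @ [t] @ Z))" for t
   using that sum_sp3_insert[of ?g X t Z] by (simp add: cc_def)
  have okl: "ok (X @ [l] @ Z)" using True by simp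
  have 1: "(\<Sum>z'@y@z=Z. ?g (X @ ladd l l' # z') y z)
    = (\<Sum>z'@y@z=Z. ?g (X @ l # z') y z) + (\<Sum>z'@y@z=Z. ?g (X @ l' # z') y z)"
   unfolding sum_sp3_add[symmetric]
  proof (rule sum_sp3_cong, goal_cases)
   case (1 z' y z)
   note Z = 1
   show ?case
   proof (cases "z = []")
    case False
    have hy: "map hel y : hlists M" using ok_parts(3)[of "X @ l # z'" y z] okl Z False by auto
    have "gr G' (X @ ladd l l' # z') v = gr G' (X @ l # z') v + gr G' (X @ l' # z') v" if "[v] : hlists M" for v
    proof -
     have "(%t. G' ((X @ ladd l l' # z') @ [Elt (fst v) (t \<odot>`M (fst v)` snd v)]))
      = (%t. G' ((X @ l # z') @ [Elt (fst v) (t \<odot>`M (fst v)` snd v)]) + G' ((X @ l' # z') @ [Elt (fst v) (t \<odot>`M (fst v)` snd v)]))"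
      using MC_add[OF G', of l l' X "z' @ [Elt (fst v) (_ \<odot>`M (fst v)` snd v)]"] l by simp
     then show ?thesis unfolding gr_def using lam_add[OF gr_endo[OF G' that, of "X @ l # z'"] gr_endo[OF G' that, of "X @ l' # z'"]] by simp
    qed
    then have "pairing (map hel y) (form G G' (X @ ladd l l' # z') z)
     = pairing (map hel y) (%u v. form G G' (X @ l # z') z u v + form G G' (X @ l' # z') z u v)"
     using l sl by (intro pairing_cong[OF hy]) (simp add: form_def algebra_simps)
    then show ?thesis using False by (simp add: pairing_add)
   qed simp
  qed
  have 2: "(\<Sum>x@x'=X. \<Sum>z'@z=Z. ?g x (x' @ ladd l l' # z') z)
    = (\<Sum>x@x'=X. \<Sum>z'@z=Z. ?g x (x' @ l # z') z)
    + (\<Sum>x@x'=X. \<Sum>z'@z=Z. ?g x (x' @ l' # z') z)" unfolding sum_sp2_add[symmetric]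
  proof (rule sum_sp2_cong, rule sum_sp2_cong)
   fix x x' z' z assume X: "x @ x' = X" and Z: "z' @ z = Z"
   show "?g x (x' @ ladd l l' # z') z = ?g x (x' @ l # z') z + ?g x (x' @ l' # z') z"
   proof (cases "x = [] \<or> z = []")
    case False
    have ok': "ok (x @ (x' @ [l] @ z') @ z)" using okl X Z by auto
    have mids: "\<forall>a\<in>set (x' @ [l] @ z'). isMid a" "map hel (x' @ [l] @ z') : hlists M" using ok_parts[OF ok'] False by auto
    then obtain i a where a: "l = Mid i a" by (cases l) auto
    then obtain b where b: "l' = Mid i b" using l by (cases l') auto
    show ?thesis using False pairing_linear[OF form_bilin[OF G G', of x z], of "map hel x'" "map hel z'" a i b] mids(2) l a b
     by (auto simp: Cc_carrier)
   qed auto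
  qed
  have 3: "(\<Sum>x@y@x'=X. ?g x y (x' @ ladd l l' # Z))
    = (\<Sum>x@y@x'=X. ?g x y (x' @ l # Z)) + (\<Sum>x@y@x'=X. ?g x y (x' @ l' # Z))"
   unfolding sum_sp3_add[symmetric]
  proof (rule sum_sp3_cong, goal_cases)
   case (1 x y x')
   note X = 1
   show ?case
   proof (cases "x = []")
    case False
    have hy: "map hel y : hlists M" using ok_parts(3)[of x y "x' @ l # Z"] okl X False by auto
    have "gl G u (x' @ ladd l l' # Z) = gl G u (x' @ l # Z) + gl G u (x' @ l' # Z)" if "[u] : hlists M" for u
    proof -
     have "(%t. G (Elt (fst u) (t \<odot>`M (fst u)` snd u) # x' @ ladd l l' # Z))
      = (%t. G (Elt (fst u) (t \<odot>`M (fst u)` snd u) # x' @ l # Z) + G (Elt (fst u) (t \<odot>`M (fst u)` snd u) # x' @ l' # Z))"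
      using MC_add[OF G, of l l' "Elt (fst u) (_ \<odot>`M (fst u)` snd u) # x'" Z] l by simp
     then show ?thesis unfolding gl_def using lam_add[OF gl_endo[OF G that, of "x' @ l # Z"] gl_endo[OF G that, of "x' @ l' # Z"]] by simp
    qed
    then have "pairing (map hel y) (form G G' x (x' @ ladd l l' # Z))
     = pairing (map hel y) (%u v. form G G' x (x' @ l # Z) u v + form G G' x (x' @ l' # Z) u v)"
     by (intro pairing_cong[OF hy]) (simp add: form_def algebra_simps)
    then show ?thesis using False by (simp add: pairing_add)
   qed simp
  qed
  show ?thesis using sp[of l] sp[of l'] sp[of "ladd l l'"] ol ends l True 1 2 3 by simp
 qed
qed

text \<open>In \<open>D G\<close> a merged subword either avoids the distinguished end or contains it. In the second case the result of the merge
  is the new end.\<close>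

lemma gl_D:
 assumes G: "MC G" and u: "[u] : hlists M" and okz: "ok (Elt (fst u) (snd u) # z)"
 shows "gl (D G) u z = (\<Sum>z'@y@z''=z. if y = [] then 0 else ksg (fst u + 1 + wdeg z') * gl G u (z' @ [mul y] @ z''))
  + (\<Sum>b@z'=z. if z' = [] then 0 else gl G (mL V u b) z')"
proof -
 let ?u = "%t. Elt (fst u) (t \<odot>`M (fst u)` snd u)"
 have uc: "snd u : carrier (M (fst u))" using u by simp
 have okt: "ok (?u t # z)" for t using okz uc wd_replace[of "?u t" "Elt (fst u) (snd u)" "[]" z] by (simp add: ok_def mod_closed[OF M])
 have vz: "valid z" using okz by (simp add: ok_def)
 let ?A = "%(z', y, z'') t. if y = [] then 0 else ksg (fst u + 1 + wdeg z') * G (?u t # z' @ [mul y] @ z'')"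
 let ?B = "%(b, z') t. if z' = [] then 0 else G (mul (?u t # b) # z')"
 have "D G (?u t # z) = (\<Sum>i\<in>sp3 z. ?A i t) + (\<Sum>i\<in>sp2 z. ?B i t)" for t
 proof -
  let ?g = "%x y z'. if y = [] \<or> y = ?u t # z then 0 else ksg (wdeg x) * G (x @ [mul y] @ z')"
  have "D G (?u t # z) = (\<Sum>x@y@z'=([] @ ?u t # z). ?g x y z')" using okt by (simp add: D_def)
  also have "... = (\<Sum>z'@y@z''=z. ?g (?u t # z') y z'') + (\<Sum>b@z'=z. ?g [] (?u t # b) z')"
   unfolding sum_sp3_insert sum_sp2_Nil sum_sp3_Nil by (simp, intro arg_cong2[where f = "(+)"] sum_sp3_cong sum_sp2_cong) auto
  also have "(\<Sum>z'@y@z''=z. ?g (?u t # z') y z'') = (\<Sum>i\<in>sp3 z. ?A i t)"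
  proof (rule sum.cong[OF refl])
   fix i assume "i : sp3 z"
   then obtain z' y z'' where i: "i = (z', y, z'')" "z' @ y @ z'' = z" by (cases i) auto
   have "y ~= ?u t # z"
   using i by auto
   then show "(case i of (z', y, z'') => ?g (?u t # z') y z'') = ?A i t" by (simp add: i)
  qed
  also have "(\<Sum>b@z'=z. ?g [] (?u t # b) z') = (\<Sum>i\<in>sp2 z. ?B i t)" by (rule sum.cong[OF refl]) auto
  finally show ?thesis .
 qed
 then have "gl (D G) u z = lam (%t. (\<Sum>i\<in>sp3 z. ?A i t) + (\<Sum>i\<in>sp2 z. ?B i t))" by (simp add: gl_def)
 also have "... = (\<Sum>i\<in>sp3 z. lam (?A i)) + (\<Sum>i\<in>sp2 z. lam (?B i))"
 proof -
  have A: "additive_endo (?A i)" for i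
  proof (cases i)
   case (fields a b c)
   then show ?thesis using additive_endo_sgn[OF gl_endo[OF G u, of "a @ [mul b] @ c"], of "fst u + 1 + wdeg a"]
    by (cases "b = []") (simp_all add: additive_endo_zero)
  qed
  have Bm: "mul (?u t # b) = Elt (fst (mL V u b)) (t \<odot>`M (fst (mL V u b))` snd (mL V u b))
    & [mL V u b] : hlists M" if b: "b @ z' = z" "z' ~= []" for b z' t
  proof -
   have ok': "ok ([?u t] @ b @ z')" using okt[of t] b by simp
   note p = ok_parts[OF ok' _ b(2), simplified]
   have nex: "~ list_ex isGnd b" "~ list_ex isElt b" using mids_ex[of b] p(1) by auto
   have e: "fst (mL V u b) = wdeg (?u t # b) - 2" using p(4) by simp
   have "mval V (map hel (?u t # b)) = t \<odot>`M (fst (mL V u b))` mval V (u # map hel b)"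
    using mval_add(2)[of "[]" "map hel b" "snd u" "fst u" "snd u" "fst (mL V u b)" t] p(3) uc by simp
   moreover have "[mL V u b] : hlists M" by (rule mh_hlists) (use u p(3) in simp)
   ultimately show ?thesis using nex e by (simp add: mul_def)
  qed
  have B: "additive_endo (?B i)" if "i : sp2 z" for i
  proof (cases i)
   case (Pair b z')
   have bz: "b @ z' = z" using that Pair by simp
   show ?thesis
   proof (cases "z' = []")
    case False
    show ?thesis using Bm[OF bz False] gl_endo[OF G, of "mL V u b" z'] by (simp add: Pair False)
   qed (simp add: Pair additive_endo_zero)
  qed
  show ?thesis using lam_add[OF additive_endo_sum[of "sp3 z" ?A] additive_endo_sum[of "sp2 z" ?B]] A B
    lam_sum[of "sp3 z" ?A] lam_sum[of "sp2 z" ?B] by simp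
 qed
 also have "(\<Sum>i\<in>sp3 z. lam (?A i)) = (\<Sum>z'@y@z''=z. if y = [] then 0
    else ksg (fst u + 1 + wdeg z') * gl G u (z' @ [mul y] @ z''))"
  by (rule sum.cong[OF refl]) (auto simp: gl_def lam_zero lam_sgn[OF gl_endo[OF G u]])
 also have "(\<Sum>i\<in>sp2 z. lam (?B i)) = (\<Sum>b@z'=z. if z' = [] then 0 else gl G (mL V u b) z')"
 proof (rule sum.cong[OF refl], goal_cases)
  case (1 i)
  from 1 obtain b z' where i: "i = (b, z')" "b @ z' = z" by (cases i) auto
  show ?case
  proof (cases "z' = []")
   case False
   have ok': "ok ([?u 1] @ b @ z')" using okt[of 1] i by simp
   note p = ok_parts[OF ok' _ False, simplified]
   have nex: "~ list_ex isGnd b" "~ list_ex isElt b" using mids_ex[of b] p(1) by auto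
   have "mul (?u t # b) = Elt (fst (mL V u b)) (t \<odot>`M (fst (mL V u b))` snd (mL V u b))" for t
    using mval_add(2)[of "[]" "map hel b" "snd u" "fst u" "snd u" "fst (mL V u b)" t] p(3,4) uc nex by (simp add: mul_def)
   then show ?thesis using False by (simp add: i gl_def)
  qed (simp add: i lam_zero)
 qed
 finally show ?thesis .
qed

lemma gr_D:
 assumes G: "MC G" and v: "[v] : hlists M" and okx: "ok (x @ [Elt (fst v) (snd v)])"
 shows "gr (D G) x v = (\<Sum>x'@y@x''=x. if y = [] then 0 else ksg (wdeg x') * gr G (x' @ [mul y] @ x'') v)
  + (\<Sum>x'@b=x. if x' = [] then 0 else ksg (wdeg x') * gr G x' (mR V b v))"
proof -
 let ?v = "%t. Elt (fst v) (t \<odot>`M (fst v)` snd v)"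
 have vc: "snd v : carrier (M (fst v))" using v by simp
 have okt: "ok (x @ [?v t])" for t using okx vc wd_replace[of "?v t" "Elt (fst v) (snd v)" x "[]"] by (simp add: ok_def mod_closed[OF M])
 let ?A = "%(x', y, x'') t. if y = [] then 0 else ksg (wdeg x') * G ((x' @ [mul y] @ x'') @ [?v t])"
 let ?B = "%(x', b) t. if x' = [] then 0 else ksg (wdeg x') * G (x' @ [mul (b @ [?v t])])"
 have "D G (x @ [?v t]) = (\<Sum>i\<in>sp3 x. ?A i t) + (\<Sum>i\<in>sp2 x. ?B i t)" for t
 proof -
  let ?g = "%a y z'. if y = [] \<or> y = x @ [?v t] then 0 else ksg (wdeg a) * G (a @ [mul y] @ z')"
  have "D G (x @ [?v t]) = (\<Sum>a@y@z'=(x @ ?v t # []). ?g a y z')" using okt by (simp add: D_def)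
  also have "... = (\<Sum>x'@b=x. ?g x' (b @ [?v t]) []) + (\<Sum>x'@y@x''=x. ?g x' y (x'' @ [?v t]))"
   unfolding sum_sp3_insert sum_sp2_Nil sum_sp3_Nil by simp
  also have "(\<Sum>x'@y@x''=x. ?g x' y (x'' @ [?v t])) = (\<Sum>i\<in>sp3 x. ?A i t)"
  proof (rule sum.cong[OF refl])
   fix i assume "i : sp3 x"
   then obtain z' y z'' where i: "i = (z', y, z'')" "z' @ y @ z'' = x" by (cases i) auto
   have "y ~= x @ [?v t]"
   using i by auto
   then show "(case i of (x', y, x'') => ?g x' y (x'' @ [?v t])) = ?A i t" by (simp add: i)
  qed
  also have "(\<Sum>x'@b=x. ?g x' (b @ [?v t]) []) = (\<Sum>i\<in>sp2 x. ?B i t)" by (rule sum.cong[OF refl]) auto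
  finally show ?thesis by simp
 qed
 then have 0: "gr (D G) x v = lam (%t. (\<Sum>i\<in>sp3 x. ?A i t) + (\<Sum>i\<in>sp2 x. ?B i t))" by (simp add: gr_def)
 have Bm: "mul (b @ [?v t]) = Elt (fst (mR V b v)) (t \<odot>`M (fst (mR V b v))` snd (mR V b v))
    & [mR V b v] : hlists M" if b: "x' @ b = x" "x' ~= []" for b x' t
 proof -
  have ok': "ok (x' @ b @ [?v t])" using okt[of t] b by auto
  note p = ok_parts[OF ok' b(2), simplified]
  have nex: "~ list_ex isGnd b" "~ list_ex isElt b" using mids_ex[of b] p(1) by auto
  have e: "fst (mR V b v) = wdeg (b @ [?v t]) - 2" using p(4) by simp
  have "mval V (map hel (b @ [?v t])) = t \<odot>`M (fst (mR V b v))` mval V (map hel b @ [v])"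
   using mval_add(2)[of "map hel b" "[]" "snd v" "fst v" "snd v" "fst (mR V b v)" t] p(3) vc by simp
  moreover have "[mR V b v] : hlists M" by (rule mh_hlists) (use v p(3) in simp)
  ultimately show ?thesis using nex e by (simp add: mul_def)
 qed
 have "lam (%t. (\<Sum>i\<in>sp3 x. ?A i t) + (\<Sum>i\<in>sp2 x. ?B i t)) = (\<Sum>i\<in>sp3 x. lam (?A i)) + (\<Sum>i\<in>sp2 x. lam (?B i))"
 proof -
  have A: "additive_endo (?A i)" for i
  proof (cases i)
   case (fields a b c)
   then show ?thesis using additive_endo_sgn[OF gr_endo[OF G v, of "a @ [mul b] @ c"], of "wdeg a"]
    by (cases "b = []") (simp_all add: additive_endo_zero)
  qed
  have B: "additive_endo (?B i)" if "i : sp2 x" for i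
  proof (cases i)
   case (Pair x' b)
   have bz: "x' @ b = x" using that Pair by simp
   show ?thesis
   proof (cases "x' = []")
    case False
    show ?thesis using Bm[OF bz False] additive_endo_sgn[OF gr_endo[OF G, of "mR V b v" x'], of "wdeg x'"]
     by (simp add: Pair False)
   qed (simp add: Pair additive_endo_zero)
  qed
  show ?thesis using lam_add[OF additive_endo_sum[of "sp3 x" ?A] additive_endo_sum[of "sp2 x" ?B]] A B
    lam_sum[of "sp3 x" ?A] lam_sum[of "sp2 x" ?B] by simp
 qed
 also have "(\<Sum>i\<in>sp3 x. lam (?A i)) = (\<Sum>x'@y@x''=x. if y = [] then 0
    else ksg (wdeg x') * gr G (x' @ [mul y] @ x'') v)"
  by (rule sum.cong[OF refl]) (auto simp: gr_def lam_zero simp del: append_assoc simp: lam_sgn[OF gr_endo[OF G v]])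
 also have "(\<Sum>i\<in>sp2 x. lam (?B i)) = (\<Sum>x'@b=x. if x' = [] then 0 else ksg (wdeg x') * gr G x' (mR V b v))"
 proof (rule sum.cong[OF refl], goal_cases)
  case (1 i)
  from 1 obtain x' b where i: "i = (x', b)" "x' @ b = x" by (cases i) auto
  show ?case
  proof (cases "x' = []")
   case False
   then show ?thesis using Bm[OF i(2) False] lam_sgn[OF gr_endo[OF G, of "mR V b v" x'], of "wdeg x'"]
    by (simp add: i gr_def del: fst_mh)
  qed (simp add: i lam_zero)
 qed
 finally show ?thesis using 0 by simp
qed

end

context aug

begin

text \<open>The twist by the degree of a word anticommutes with \<open>D\<close>; it carries the Koszul sign of the product rule.\<close>

definition tw :: "(('r, 'm) word => 't::comm_ring_1) => ('r, 'm) word => 't" where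
 "tw c w = ksg (wdeg w) * c w"

lemma MC_tw:
 assumes "MC c"
 shows "MC (tw c)" unfolding MC_def
proof (intro conjI allI impI)
 show "tw c w = 0" if "~ ok w" for w using MC_ok[OF assms that] by (simp add: tw_def)
 fix X l l' Z assume l: "vl l & vl l' & same l l'"
 then show "tw c (X @ [ladd l l'] @ Z) = tw c (X @ [l] @ Z) + tw c (X @ [l'] @ Z)"
  using MC_add[OF assms, of l l' X Z] same_ladd[of l l'] by (simp add: tw_def distrib_left)
qed

lemma D_tw:
 fixes c :: "('r, 'm) word => 't::comm_ring_1"
 shows "D (tw c) w = - tw (D c) w"
proof (cases "ok w")
 case True
 have "D (tw c) w = (\<Sum>x@y@z=w. - ksg (wdeg w) * (if y = [] \<or> y = w then 0 else ksg (wdeg x) * c (x @ [mul y] @ z)))"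
  unfolding D_def if_P[OF True]
 proof (rule sum_sp3_cong, goal_cases)
  case (1 x y z)
  from 1 have "ksg (wdeg (x @ [mul y] @ z)) = (- ksg (wdeg w) :: 't)" by (intro sgn_pow_opp) auto
  then show ?case by (simp add: tw_def del: wdeg_simps)
 qed
 then show ?thesis using True by (simp add: tw_def D_def sum_distrib_left sum_negf split_beta)
qed (simp add: tw_def D_def)

lemma gr_tw:
 assumes "MC G" "[v] : hlists M"
 shows "gr (tw G) x v = ksg (wdeg x + fst v + 1) * gr G x v"
proof -
 have "(%t. tw G (x @ [Elt (fst v) (t \<odot>`M (fst v)` snd v)]))
   = (%t. ksg (wdeg x + fst v + 1) * G (x @ [Elt (fst v) (t \<odot>`M (fst v)` snd v)]))"
  by (simp add: tw_def add.assoc)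
 then show ?thesis unfolding gr_def using lam_sgn[OF gr_endo[OF assms], of "wdeg x + fst v + 1" x] by simp
qed

lemma Gnd_ends_mul:
 assumes "ok w" "isGnd (hd w)" "isGnd (last w)" "x @ y @ z = w" "y ~= []" "y ~= w"
 shows "ok (x @ [mul y] @ z) & isGnd (hd (x @ [mul y] @ z)) & isGnd (last (x @ [mul y] @ z))"
proof (intro conjI)
 have xz: "x ~= [] \<or> z ~= []" using assms by auto
 show "ok (x @ [mul y] @ z)" by (rule ok_mul[OF _ assms(5) xz]) (use assms in simp)
 show "isGnd (hd (x @ [mul y] @ z))"
 proof (cases x)
  case Nil
  then have "hd w = hd y" using assms by auto
  then have "list_ex isGnd y" using assms by (auto simp: list_ex_iff intro!: bexI[of _ "hd y"])
  then show ?thesis using Nil by (simp add: isX_mul)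
 qed (use assms in auto)
 show "isGnd (last (x @ [mul y] @ z))"
 using assms list_ex_iff by (fastforce simp: isX_mul)
qed

lemma D_cc_zero:
 assumes "~ (isGnd (hd w) & isGnd (last w))"
 shows "D (cc G G') w = 0"
proof (cases "ok w")
 case True
 show ?thesis unfolding D_def if_P[OF True]
 proof (rule sum.neutral, clarify)
  fix x y z assume s: "(x, y, z) : sp3 w"
  show "(if y = [] \<or> y = w then 0 else ksg (wdeg x) * cc G G' (x @ [mul y] @ z)) = 0"
  proof (cases "y = [] \<or> y = w")
   case False
   have w: "wd (x @ y @ z)" and y: "y ~= []" and xz: "x ~= [] \<or> z ~= []" using True s False by (auto simp: ok_def)
   have "~ (isGnd (hd (x @ [mul y] @ z)) & isGnd (last (x @ [mul y] @ z)))" using w y xz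
   proof (cases rule: wd_subword_cases)
    case (left e as bs e')
    then have "isGnd (hd (x @ [mul y] @ z)) = isGnd (hd w)" "last (x @ [mul y] @ z) = last w"
     using s mids_ex[OF left(6)] by (auto simp: isX_mul)
    then show ?thesis using assms by simp
   next
    case (right e as bs e')
    then have "isGnd (last (x @ [mul y] @ z)) = isGnd (last w)" "hd (x @ [mul y] @ z) = hd w"
     using s mids_ex[OF right(6)] by (auto simp: isX_mul)
    then show ?thesis using assms by simp
   next
    case (mid e bs cs e')
    then have "last (x @ [mul y] @ z) = last w" "hd (x @ [mul y] @ z) = hd w" using s by auto
    then show ?thesis using assms by simp
   qed
   then have "cc G G' (x @ [mul y] @ z) = 0" unfolding cc_def by meson
   then show ?thesis by simp
  qed simp
 qed
qed (simp add: D_def)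

text \<open>In \<open>D (cc G G')\<close> merging comes first and cutting second. In the opposite order, the merged subword lies inside one of
  the three parts.\<close>

lemma D_cc_split:
 assumes w: "ok w" "isGnd (hd w)" "isGnd (last w)"
 shows "D (cc G G') w = (\<Sum>x@y@z=w. if x = [] \<or> z = [] then 0 else
   (\<Sum>x'@b@x''=x. if b = [] then 0 else ksg (wdeg x') * pairing (map hel y) (form G G' (x' @ [mul b] @ x'') z))
  + (\<Sum>x'@b@x''=y. if b = [] then 0 else ksg (wdeg x + wdeg x') * pairing (map hel (x' @ [mul b] @ x'')) (form G G' x z))
  + (\<Sum>x'@b@x''=z. if b = [] then 0 else ksg (wdeg x + wdeg y + wdeg x') * pairing (map hel y) (form G G' x (x' @ [mul b] @ x''))))"
proof -
 define P where "P x y z = (if x = [] \<or> z = [] then 0 else pairing (map hel y) (form G G' x z))" for x y z :: "('r, 'm) word"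
 define s :: "('r, 'm) word => ('r, 'm) word => 'r residue_field" where "s y X = (if y = [] \<or> y = w then 0 else ksg (wdeg X))" for y X :: "('r, 'm) word"
 have cc: "cc G G' v = (\<Sum>x@y@z=v. P x y z)" if "ok v & isGnd (hd v) & isGnd (last v)" for v
  using that by (simp add: cc_def P_def)
 have "D (cc G G') w = (\<Sum>X@Y@Z=w. (\<Sum>a@b@c=Z. s Y X * P (X @ Y' Y # a) b c)
   + (\<Sum>a@b=X. \<Sum>c@d=Z. s Y X * P a (b @ Y' Y # c) d)
   + (\<Sum>a@b@c=X. s Y X * P a b (c @ Y' Y # Z)))" if "Y' = mul" for Y' unfolding D_def if_P[OF w(1)]
 proof (rule sum_sp3_cong, goal_cases)
  case (1 X Y Z)
  note XYZ = 1
  show ?case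
  using cc[OF Gnd_ends_mul[OF w XYZ]] sum_sp3_insert that by (fastforce simp: s_def sum_distrib_left split_beta)
 qed
 from this[OF refl] have "D (cc G G') w = (\<Sum>X@Y@Z=w. \<Sum>a@b@c=Z. s Y X * P (X @ mul Y # a) b c)
   + (\<Sum>X@Y@Z=w. \<Sum>a@b=X. \<Sum>c@d=Z. s Y X * P a (b @ mul Y # c) d)
   + (\<Sum>X@Y@Z=w. \<Sum>a@b@c=X. s Y X * P a b (c @ mul Y # Z))" by (simp only: sum_sp3_add)
 also have "(\<Sum>X@Y@Z=w. \<Sum>a@b@c=Z. s Y X * P (X @ mul Y # a) b c)
   = (\<Sum>x@y@z=w. \<Sum>x'@b@x''=x. s b x' * P (x' @ mul b # x'') y z)" by (rule sum_sp3_disjoint)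
 also have "(\<Sum>X@Y@Z=w. \<Sum>a@b=X. \<Sum>c@d=Z. s Y X * P a (b @ mul Y # c) d)
   = (\<Sum>X@Y@Z=w. \<Sum>a@b=X. \<Sum>c@d=Z. s Y (a @ b) * P a (b @ mul Y # c) d)"
  by (intro sum_sp3_cong sum_sp2_cong) simp
 also have "... = (\<Sum>x@y@z=w. \<Sum>x'@b@x''=y. s b (x @ x') * P x (x' @ mul b # x'') z)"
  by (rule sum_sp3_inner)
 also have "(\<Sum>X@Y@Z=w. \<Sum>a@b@c=X. s Y X * P a b (c @ mul Y # Z))
   = (\<Sum>X@Y@Z=w. \<Sum>a@b@c=X. s Y (a @ b @ c) * P a b (c @ mul Y # Z))" by (intro sum_sp3_cong) simp
 also have "... = (\<Sum>x@y@z=w. \<Sum>x'@b@x''=z. s b (x @ y @ x') * P x y (x' @ mul b # x''))"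
  by (rule sum_sp3_disjoint[symmetric])
 finally have "D (cc G G') w = (\<Sum>x@y@z=w. (\<Sum>x'@b@x''=x. s b x' * P (x' @ mul b # x'') y z)
   + (\<Sum>x'@b@x''=y. s b (x @ x') * P x (x' @ mul b # x'') z)
   + (\<Sum>x'@b@x''=z. s b (x @ y @ x') * P x y (x' @ mul b # x'')))" by (simp only: sum_sp3_add)
 also have "... = (\<Sum>x@y@z=w. if x = [] \<or> z = [] then 0 else
   (\<Sum>x'@b@x''=x. if b = [] then 0 else ksg (wdeg x') * pairing (map hel y) (form G G' (x' @ [mul b] @ x'') z))
  + (\<Sum>x'@b@x''=y. if b = [] then 0 else ksg (wdeg x + wdeg x') * pairing (map hel (x' @ [mul b] @ x'')) (form G G' x z))
  + (\<Sum>x'@b@x''=z. if b = [] then 0 else ksg (wdeg x + wdeg y + wdeg x') * pairing (map hel y) (form G G' x (x' @ [mul b] @ x''))))"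
 proof (rule sum_sp3_cong, goal_cases)
  case (1 x y z)
  note xyz = 1
  have ne: "b ~= w" if "x' @ b @ x'' = x" "z ~= []" for x' b x''
  proof
   assume "b = w"
   then have "length b = length w" by simp
   moreover have "length w = length (x' @ b @ x'') + length y + length z" unfolding that xyz[symmetric] by simp
   ultimately show False using that(2) by simp
  qed
  have ne2: "b ~= w" if "x' @ b @ x'' = y" "z ~= []" for x' b x''
  proof
   assume "b = w"
   then have "length b = length w" by simp
   moreover have "length w = length x + length (x' @ b @ x'') + length z" unfolding that xyz[symmetric] by simp
   ultimately show False using that(2) by simp
  qed
  have ne3: "b ~= w" if "x' @ b @ x'' = z" "x ~= []" for x' b x''
  proof
   assume "b = w"
   then have "length b = length w" by simp
   moreover have "length w = length x + length y + length (x' @ b @ x'')" unfolding that xyz[symmetric] by simp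
   ultimately show False using that(2) by simp
  qed
  show ?case
  proof (cases "x = [] \<or> z = []")
   case True
   then show ?thesis
   by (auto simp: P_def s_def)
  next
   case False
   have "(\<Sum>x'@b@x''=x. s b x' * P (x' @ mul b # x'') y z)
    = (\<Sum>x'@b@x''=x. if b = [] then 0 else ksg (wdeg x') * pairing (map hel y) (form G G' (x' @ [mul b] @ x'') z))"
    by (rule sum_sp3_cong) (use False ne in \<open>simp add: s_def P_def\<close>)
   moreover have "(\<Sum>x'@b@x''=y. s b (x @ x') * P x (x' @ mul b # x'') z)
    = (\<Sum>x'@b@x''=y. if b = [] then 0 else ksg (wdeg x + wdeg x') * pairing (map hel (x' @ [mul b] @ x'')) (form G G' x z))"
    by (rule sum_sp3_cong) (use False ne2 in \<open>simp add: s_def P_def\<close>)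
   moreover have "(\<Sum>x'@b@x''=z. s b (x @ y @ x') * P x y (x' @ mul b # x''))
    = (\<Sum>x'@b@x''=z. if b = [] then 0 else ksg (wdeg x + wdeg y + wdeg x') * pairing (map hel y) (form G G' x (x' @ [mul b] @ x'')))"
    by (rule sum_sp3_cong) (use False ne3 in \<open>simp add: s_def P_def add.assoc\<close>)
   ultimately show ?thesis using False by simp
  qed
 qed
 finally show ?thesis .
qed

lemma sum_sp3_regroup_left:
 "(\<Sum>x@y@z=w. \<Sum>a@b=x. f a b y z) = (\<Sum>a@u@z=w. \<Sum>b@y=u. f a b y z)"
proof -
 have "(\<Sum>x@y@z=w. \<Sum>a@b=x. f a b y z)
   = (\<Sum>x@r=w. \<Sum>y@z=r. \<Sum>a@b=x. f a b y z)" by (simp only: sum_sp3_nest)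
 also have "... = (\<Sum>x@r=w. \<Sum>a@b=x. \<Sum>y@z=r. f a b y z)"
  by (subst sum_sp2_swap) (rule refl)
 also have "... = (\<Sum>a@q=w. \<Sum>b@r=q. \<Sum>y@z=r. f a b y z)" by (rule sum_sp2_assoc)
 also have "... = (\<Sum>a@q=w. \<Sum>u@z=q. \<Sum>b@y=u. f a b y z)"
  by (subst sum_sp2_assoc) (rule refl)
 also have "... = (\<Sum>a@u@z=w. \<Sum>b@y=u. f a b y z)" by (simp only: sum_sp3_nest)
 finally show ?thesis .
qed

lemma sum_sp3_regroup_right:
 "(\<Sum>x@y@z=w. \<Sum>b@c=z. f x y b c) = (\<Sum>x@u@c=w. \<Sum>y@b=u. f x y b c)"
 unfolding sum_sp3_nest by (subst sum_sp2_assoc) (rule refl)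

lemma sum_sp3_sub: "(\<Sum>x@y@z=w. g x y z - h x y z) = (\<Sum>x@y@z=w. g x y z) - (\<Sum>x@y@z=w. (h x y z :: 't::comm_ring_1))"
 by (simp add: split_beta sum_subtractf)

text \<open>The two ways in which the outputs of the copairing interact with the neighbouring letters.\<close>

definition QL :: "(('r, 'm) word => 'r) => (('r, 'm) word => 'r) => ('r, 'm) word => ('r, 'm) word => ('r, 'm) word => ('r, 'm) word => 'r residue_field" where
 "QL G G' x y b z = pairing (map hel y) (%u v. ksg (wdeg x + (fst v + 1) + n + (fst u + 1) * (fst v + 1) + n * wdeg x)
  * (gr G' x v * gl G (mL V u b) z))"

definition QR :: "(('r, 'm) word => 'r) => (('r, 'm) word => 'r) => ('r, 'm) word => ('r, 'm) word => ('r, 'm) word => ('r, 'm) word => 'r residue_field" where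
 "QR G G' x b y z = pairing (map hel y) (%u v. ksg (wdeg x + n * wdeg b + n + (fst u + 1) * (fst v + 1) + n * wdeg x)
  * (gr G' x (mR V b v) * gl G u z))"

lemma mult_regroup:
 fixes a :: "'t::comm_ring_1"
 shows "a * b = c * d ==> a * ((b * X) * Y) = c * (d * (X * Y))"
  and "a * (b * q) = c * d ==> a * ((b * X) * (q * Y)) = c * (d * (X * Y))"
 by (metis mult.assoc, metis (no_types, lifting) mult.assoc mult.left_commute)

lemma sgn_pow_neg3: "(- ksg a) * (ksg b * ksg c) = ksg (1 + a + b + c)" by (simp add: sgn_pow_add mult.assoc)

lemma mult_solve:
 fixes s :: "'t::comm_ring_1"
 assumes "S + L + R = 0"
 shows "s * S = (- s) * L + (- s) * R"
proof -
 have S: "S = - L - R" using assms by (simp add: eq_neg_iff_add_eq_0 algebra_simps)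
 show ?thesis unfolding S by (simp add: algebra_simps)
qed

lemma ok_end:
 assumes "ok (x @ y @ z)" "x ~= []" "z ~= []"
 shows "[v] : hlists M ==> ok (x @ [Elt (fst v) (snd v)])" "[u] : hlists M ==> ok (Elt (fst u) (snd u) # z)"
proof -
 obtain e as e' where w: "x @ y @ z = e # as @ [e']" "~ isMid e" "~ isMid e'" "\<forall>a\<in>set as. isMid a"
  using assms(1) unfolding ok_def wd_iff by blast
 obtain x' where x: "x = e # x'" using w(1) assms(2) by (cases x) auto
 obtain z' where z: "z = z' @ [e']" using w(1) assms(3) by (cases z rule: rev_cases) auto
 have as: "as = x' @ y @ z'" using w(1) x z by simp
 have "wd (x @ [Elt (fst v) (snd v)])" unfolding wd_iff
  by (intro exI[of _ e] exI[of _ x'] exI[of _ "Elt (fst v) (snd v)"]) (use w as x in simp)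
 then show "[v] : hlists M ==> ok (x @ [Elt (fst v) (snd v)])" using assms(1) by (auto simp: ok_def)
 have "wd (Elt (fst u) (snd u) # z)" unfolding wd_iff
  by (intro exI[of _ e'] exI[of _ z'] exI[of _ "Elt (fst u) (snd u)"]) (use w as z in simp)
 then show "[u] : hlists M ==> ok (Elt (fst u) (snd u) # z)" using assms(1) by (auto simp: ok_def)
qed

text \<open>By \<open>gr_D\<close>, merging inside \<open>x\<close> gives \<open>D G'\<close> up to the terms in which the output of the copairing is merged with
  the last letters of \<open>x\<close>.\<close>

lemma Leibniz_left:
 assumes G: "MC G" "MC G'" and w: "ok (x @ y @ z)" "x ~= []" "z ~= []"
 shows "(\<Sum>x'@b@x''=x. if b = [] then 0 else ksg (wdeg x') * pairing (map hel y) (form G G' (x' @ [mul b] @ x'') z))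
  = ksg n * pairing (map hel y) (form G (D G') x z) - (\<Sum>x'@b=x. if x' = [] then 0 else QR G G' x' b y z)"
proof -
 note p = ok_parts[OF w]
 define F where "F = (%(x' :: ('r, 'm) word, b :: ('r, 'm) word, x'' :: ('r, 'm) word) u v. if b = [] then 0 else (ksg (n + wdeg x') * form G G' (x' @ [mul b] @ x'') z u v))"
 define H where "H = (%(x' :: ('r, 'm) word, b :: ('r, 'm) word) u v. if x' = [] then 0 else ksg n * (ksg (wdeg x' + n * wdeg b + n + (fst u + 1) * (fst v + 1) + n * wdeg x')
  * (gr G' x' (mR V b v) * gl G u z)))"
 have "pairing (map hel y) (form G (D G') x z) = pairing (map hel y) (%u v. (\<Sum>i\<in>sp3 x. F i u v) + (\<Sum>i\<in>sp2 x. H i u v))"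
 proof (rule pairing_cong[OF p(3)], goal_cases)
  case (1 u v)
  note u = 1(1) and v = 1(2)
  let ?s = "ksg ((fst u + 1) * (fst v + 1) + n * wdeg x) :: 'r residue_field"
  have a: "?s * ((\<Sum>x'@b@x''=x. if b = [] then 0 else ksg (wdeg x') * gr G' (x' @ [mul b] @ x'') v) * gl G u z)
   = (\<Sum>i\<in>sp3 x. F i u v)" unfolding sum_distrib_left sum_distrib_right
  proof (rule sum.cong[OF refl], goal_cases)
   case (1 i)
   from 1 obtain x' b x'' where i: "i = (x', b, x'')" "x' @ b @ x'' = x" by (cases i) auto
   have e: "?s * ksg (wdeg x') = ksg (n + wdeg x') * ksg ((fst u + 1) * (fst v + 1) + n * wdeg (x' @ [mul b] @ x''))"
    unfolding i(2)[symmetric] sgn_pow_add[symmetric] by (rule sgn_pow_cong) (simp add: algebra_simps)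
   show ?case
    unfolding F_def i(1) prod.case form_def
    using mult_regroup(1)[OF e, of "gr G' (x' @ [mul b] @ x'') v" "gl G u z"] by (cases "b = []") (simp_all only: if_True if_False mult_zero_left mult_zero_right simp_thms)
  qed
  have b: "?s * ((\<Sum>x'@b=x. if x' = [] then 0 else ksg (wdeg x') * gr G' x' (mR V b v)) * gl G u z)
   = (\<Sum>i\<in>sp2 x. H i u v)" unfolding sum_distrib_left sum_distrib_right
  proof (rule sum.cong[OF refl], goal_cases)
   case (1 i)
   from 1 obtain x' b where i: "i = (x', b)" "x' @ b = x" by (cases i) auto
   have e: "?s * ksg (wdeg x') = ksg n * ksg (wdeg x' + n * wdeg b + n + (fst u + 1) * (fst v + 1) + n * wdeg x')"
    unfolding i(2)[symmetric] sgn_pow_add[symmetric] by (rule sgn_pow_cong) (simp add: algebra_simps)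
   show ?case
    unfolding H_def i(1) prod.case
    using mult_regroup(1)[OF e, of "gr G' x' (mR V b v)" "gl G u z"] by (cases "x' = []") (simp_all only: if_True if_False mult_zero_left mult_zero_right simp_thms)
  qed
  show ?case
   unfolding form_def gr_D[OF G(2) v ok_end(1)[OF w v]] using a b by (simp only: distrib_left distrib_right)
 qed
 also have "... = (\<Sum>i\<in>sp3 x. pairing (map hel y) (F i)) + (\<Sum>i\<in>sp2 x. pairing (map hel y) (H i))"
  by (simp add: pairing_add pairing_sum)
 also have "(\<Sum>i\<in>sp3 x. pairing (map hel y) (F i)) = ksg n * (\<Sum>x'@b@x''=x. if b = [] then 0 else
   ksg (wdeg x') * pairing (map hel y) (form G G' (x' @ [mul b] @ x'') z))" unfolding sum_distrib_left
  by (rule sum.cong[OF refl]) (auto simp: F_def pairing_zero pairing_scale sgn_pow_add)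
 also have "(\<Sum>i\<in>sp2 x. pairing (map hel y) (H i)) = ksg n * (\<Sum>x'@b=x. if x' = [] then 0 else QR G G' x' b y z)"
  unfolding sum_distrib_left by (rule sum.cong[OF refl]) (auto simp: H_def QR_def pairing_zero pairing_scale)
 finally show ?thesis by (simp add: distrib_left flip: mult.assoc)
qed

lemma Leibniz_right:
 assumes G: "MC G" "MC G'" and w: "ok (x @ y @ z)" "x ~= []" "z ~= []"
 shows "(\<Sum>x'@b@x''=z. if b = [] then 0 else ksg (wdeg x + wdeg y + wdeg x') * pairing (map hel y) (form G G' x (x' @ [mul b] @ x'')))
  = ksg n * pairing (map hel y) (form (D G) (tw G') x z) - (\<Sum>b@z'=z. if z' = [] then 0 else QL G G' x y b z')"
proof -
 note p = ok_parts[OF w]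
 define F where "F = (%(x' :: ('r, 'm) word, b :: ('r, 'm) word, x'' :: ('r, 'm) word) u v. if b = [] then 0 else (ksg (n + (wdeg x + wdeg y + wdeg x')) * form G G' x (x' @ [mul b] @ x'') u v))"
 define H where "H = (%(b :: ('r, 'm) word, z' :: ('r, 'm) word) u v. if z' = [] then 0 else ksg n * (ksg (wdeg x + (fst v + 1) + n + (fst u + 1) * (fst v + 1) + n * wdeg x)
  * (gr G' x v * gl G (mL V u b) z')))"
 have "pairing (map hel y) (form (D G) (tw G') x z) = pairing (map hel y) (%u v. (\<Sum>i\<in>sp3 z. F i u v) + (\<Sum>i\<in>sp2 z. H i u v))"
 proof (rule pairing_cong[OF p(3)], goal_cases)
  case (1 u v)
  note u = 1(1) and v = 1(2) and uv = 1(3)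
  have wy: "wdeg y = fst u + fst v + n" using uv p(4) by simp
  let ?s = "ksg ((fst u + 1) * (fst v + 1) + n * wdeg x) :: 'r residue_field" and ?t = "ksg (wdeg x + fst v + 1) :: 'r residue_field"
  have a: "?s * (?t * gr G' x v * (\<Sum>x'@b@x''=z. if b = [] then 0 else ksg (fst u + 1 + wdeg x') * gl G u (x' @ [mul b] @ x'')))
   = (\<Sum>i\<in>sp3 z. F i u v)" unfolding sum_distrib_left sum_distrib_right
  proof (rule sum.cong[OF refl], goal_cases)
   case (1 i)
   from 1 obtain x' b x'' where i: "i = (x', b, x'')" "x' @ b @ x'' = z" by (cases i) auto
   have e: "?s * (?t * ksg (fst u + 1 + wdeg x')) = ksg (n + (wdeg x + wdeg y + wdeg x')) * ?s" unfolding wy sgn_pow_add[symmetric]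
    by (rule sgn_pow_cong) (cases "even (fst u)"; cases "even (fst v)"; cases "even (wdeg x)"; cases "even (wdeg x')"; cases "even n"; simp)
   show ?case
    unfolding F_def i(1) prod.case form_def
    using mult_regroup(2)[OF e, of "gr G' x v" "gl G u (x' @ [mul b] @ x'')"] by (cases "b = []") (simp_all only: if_True if_False mult_zero_left mult_zero_right simp_thms)
  qed
  have b: "?s * (?t * gr G' x v * (\<Sum>b@z'=z. if z' = [] then 0 else gl G (mL V u b) z'))
   = (\<Sum>i\<in>sp2 z. H i u v)" unfolding sum_distrib_left sum_distrib_right
  proof (rule sum.cong[OF refl], goal_cases)
   case (1 i)
   from 1 obtain b z' where i: "i = (b, z')" "b @ z' = z" by (cases i) auto
   have e: "?s * ?t = ksg n * ksg (wdeg x + (fst v + 1) + n + (fst u + 1) * (fst v + 1) + n * wdeg x)"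
    unfolding sgn_pow_add[symmetric] by (rule sgn_pow_cong) (simp add: algebra_simps)
   show ?case
    unfolding H_def i(1) prod.case
    using mult_regroup(1)[OF e, of "gr G' x v" "gl G (mL V u b) z'"] by (cases "z' = []") (simp_all only: if_True if_False mult_zero_left mult_zero_right simp_thms)
  qed
  show ?case
   unfolding form_def gl_D[OF G(1) u ok_end(2)[OF w u]] gr_tw[OF G(2) v] using a b by (simp only: distrib_left distrib_right)
 qed
 also have "... = (\<Sum>i\<in>sp3 z. pairing (map hel y) (F i)) + (\<Sum>i\<in>sp2 z. pairing (map hel y) (H i))"
  by (simp add: pairing_add pairing_sum)
 also have "(\<Sum>i\<in>sp3 z. pairing (map hel y) (F i)) = ksg n * (\<Sum>x'@b@x''=z. if b = [] then 0 else
   ksg (wdeg x + wdeg y + wdeg x') * pairing (map hel y) (form G G' x (x' @ [mul b] @ x'')))" unfolding sum_distrib_left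
  by (rule sum.cong[OF refl]) (auto simp: F_def pairing_zero pairing_scale sgn_pow_add mult.assoc)
 also have "(\<Sum>i\<in>sp2 z. pairing (map hel y) (H i)) = ksg n * (\<Sum>b@z'=z. if z' = [] then 0 else QL G G' x y b z')"
  unfolding sum_distrib_left by (rule sum.cong[OF refl]) (auto simp: H_def QL_def pairing_zero pairing_scale)
 finally show ?thesis by (simp add: distrib_left flip: mult.assoc)
qed

text \<open>This is the relation of the copairing: merging inside \<open>y\<close> is the same as merging an output with letters next to it.\<close>

lemma Leibniz_middle:
 assumes G: "MC G" "MC G'" and w: "ok (x @ y @ z)" "x ~= []" "z ~= []"
 shows "(\<Sum>x'@b@x''=y. if b = [] then 0 else ksg (wdeg x + wdeg x') * pairing (map hel (x' @ [mul b] @ x'')) (form G G' x z))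
  = (\<Sum>y'@b=y. QL G G' x y' b z) + (\<Sum>b@y'=y. QR G G' x b y' z)"
proof -
 note p = ok_parts[OF w]
 have sub: "map hel y' : hlists M & wdeg y' = sdeg (map hel y')" if "set y' \<subseteq> set y" for y'
 proof -
  have "\<forall>a\<in>set y'. isMid a" "valid y'" using that p(1,2) by blast+
  then show ?thesis using hlists_hel[of y'] sdeg_hel[of y'] mids_ex[of y'] by simp
 qed
 have fb: "bilin M (form G G' x z)" by (rule form_bilin[OF G])
 let ?F = "form G G' x z" and ?s = "ksg (wdeg x) :: 'r residue_field"
 let ?S = "(\<Sum>x'@b@x''=y. ksg (wdeg x') * pairing (map hel x' @ [mh V (map hel b)] @ map hel x'') ?F)"
 let ?L = "\<Sum>y'@b=y. pairing (map hel y') (%u v. ksg ((fst v + 1) * wdeg b + (n - 1)) * ?F (mL V u b) v)"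
 let ?R = "\<Sum>b@y'=y. pairing (map hel y') (%u v. ksg ((fst u + 1) * wdeg b + (fst u + 1) + n * wdeg b + (n - 1)) * ?F u (mR V b v))"
 have rel: "?S + ?L + ?R = 0"
 proof -
  have "?S = (\<Sum>x'@b@x''=(map hel y). ksg (sdeg x') * pairing (x' @ [mh V b] @ x'') ?F)" unfolding sum_sp3_map
  proof (rule sum_sp3_cong, goal_cases)
   case (1 x' b x'')
   from 1 have "wdeg x' = sdeg (map hel x')" using sub[of x'] by auto
   then show ?case by simp
  qed
  moreover have "?L = (\<Sum>y'@b=(map hel y). pairing y' (%u v. ksg ((fst v + 1) * sdeg b + (n - 1)) * ?F (mh V (u # b)) v))"
   unfolding sum_sp2_map
  proof (rule sum_sp2_cong, goal_cases)
   case (1 y' b)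
   from 1 have "wdeg b = sdeg (map hel b)" using sub[of b] by auto
   then show ?case by simp
  qed
  moreover have "?R = (\<Sum>b@y'=(map hel y). pairing y' (%u v. ksg ((fst u + 1) * sdeg b + (fst u + 1) + n * sdeg b + (n - 1)) * ?F u (mh V (b @ [v]))))"
   unfolding sum_sp2_map
  proof (rule sum_sp2_cong, goal_cases)
   case (1 b y')
   from 1 have "wdeg b = sdeg (map hel b)" using sub[of b] by auto
   then show ?case by simp
  qed
  ultimately show ?thesis using copairing_relation[OF p(3) fb] by simp
 qed
 have "(\<Sum>x'@b@x''=y. if b = [] then 0 else ksg (wdeg x + wdeg x') * pairing (map hel (x' @ [mul b] @ x'')) ?F) = ?s * ?S"
  unfolding sum_distrib_left
 proof (rule sum.cong[OF refl], goal_cases)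
  case (1 i)
  from 1 obtain x' b x'' where i: "i = (x', b, x'')" "x' @ b @ x'' = y" by (cases i) auto
  have sx: "map hel x' : hlists M" "map hel x'' : hlists M" using i(2) by (auto intro!: conjunct1[OF sub])
  have mb: "\<forall>a\<in>set b. isMid a" using p(1) i(2) by auto
  have wb: "wdeg b = sdeg (map hel b)" using i(2) by (auto intro!: conjunct2[OF sub])
  show ?case
  proof (cases "b = []")
   case True
   then show ?thesis using pairing_zero_entry[OF fb sx, of "- 2"] by (simp add: i mh_def mval_nil)
  next
   case False
   have "hel (mul b) = mh V (map hel b)" using mul_Mids[OF mb] wb by (simp add: mh_def)
   then show ?thesis using False by (simp add: i sgn_pow_add mult.assoc)
  qed
 qed
 also have "... = (- ?s) * ?L + (- ?s) * ?R" by (rule mult_solve[OF rel])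
 also have "(- ?s) * ?L = (\<Sum>y'@b=y. QL G G' x y' b z)" unfolding sum_distrib_left
 proof (rule sum.cong[OF refl], goal_cases)
  case (1 i)
  from 1 obtain y' b where i: "i = (y', b)" "y' @ b = y" by (cases i) auto
  have sy: "map hel y' : hlists M" "wdeg b = sdeg (map hel b)" using i(2) by (auto intro!: conjunct1[OF sub] conjunct2[OF sub])
  have "(- ?s) * pairing (map hel y') (%u v. ksg ((fst v + 1) * wdeg b + (n - 1)) * ?F (mL V u b) v)
   = pairing (map hel y') (%u v. (- ?s) * (ksg ((fst v + 1) * wdeg b + (n - 1)) * ?F (mL V u b) v))"
   by (simp only: pairing_scale)
  also have "... = QL G G' x y' b z" unfolding QL_def
  proof (rule pairing_cong[OF sy(1)], goal_cases)
   case (1 u v)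
   have "(- ?s) * (ksg ((fst v + 1) * wdeg b + (n - 1)) * ksg ((fst (mL V u b) + 1) * (fst v + 1) + n * wdeg x))
    = ksg (1 + wdeg x + ((fst v + 1) * wdeg b + (n - 1)) + ((fst (mL V u b) + 1) * (fst v + 1) + n * wdeg x))"
    by (rule sgn_pow_neg3)
   also have "... = ksg (wdeg x + (fst v + 1) + n + (fst u + 1) * (fst v + 1) + n * wdeg x)"
    by (rule sgn_pow_cong) (simp add: sy(2) algebra_simps)
   finally show ?case
    unfolding form_def by (simp only: mult.assoc[symmetric])
  qed
  finally show ?case by (simp add: i)
 qed
 also have "(- ?s) * ?R = (\<Sum>b@y'=y. QR G G' x b y' z)" unfolding sum_distrib_left
 proof (rule sum.cong[OF refl], goal_cases)
  case (1 i)
  from 1 obtain b y' where i: "i = (b, y')" "b @ y' = y" by (cases i) auto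
  have sy: "map hel y' : hlists M" "wdeg b = sdeg (map hel b)" using i(2) by (auto intro!: conjunct1[OF sub] conjunct2[OF sub])
  have "(- ?s) * pairing (map hel y') (%u v. ksg ((fst u + 1) * wdeg b + (fst u + 1) + n * wdeg b + (n - 1)) * ?F u (mR V b v))
   = pairing (map hel y') (%u v. (- ?s) * (ksg ((fst u + 1) * wdeg b + (fst u + 1) + n * wdeg b + (n - 1)) * ?F u (mR V b v)))"
   by (simp only: pairing_scale)
  also have "... = QR G G' x b y' z" unfolding QR_def
  proof (rule pairing_cong[OF sy(1)], goal_cases)
   case (1 u v)
   let ?e = "(fst u + 1) * wdeg b + (fst u + 1) + n * wdeg b + (n - 1)"
   let ?e' = "(fst u + 1) * (fst (mR V b v) + 1) + n * wdeg x"
   have "(- ?s) * (ksg ?e * ksg ?e') = ksg (1 + wdeg x + ?e + ?e')" by (rule sgn_pow_neg3)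
   also have "... = ksg (wdeg x + n * wdeg b + n + (fst u + 1) * (fst v + 1) + n * wdeg x)"
    by (rule sgn_pow_cong) (simp add: sy(2) algebra_simps)
   finally show ?case
    unfolding form_def by (simp only: mult.assoc[symmetric])
  qed
  finally show ?case by (simp add: i)
 qed
 finally show ?thesis .
qed

text \<open>The terms in which an output meets the neighbouring letters of \<open>x\<close> and \<open>z\<close> cancel against those from \<open>y\<close>, after
  regrouping the decompositions of the word.\<close>

lemma cc_Leibniz:
 assumes G: "MC G" "MC G'"
 shows "D (cc G G') w = ksg n * (cc (D G) (tw G') w + cc G (D G') w)"
proof (cases "ok w & isGnd (hd w) & isGnd (last w)")
 case False
 then have "D (cc G G') w = 0" using D_cc_zero[of w G G'] by (cases "ok w") (simp_all add: D_def)
 moreover have "cc (D G) (tw G') w = 0" "cc G (D G') w = 0" using False unfolding cc_def by meson+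
 ultimately show ?thesis by simp
next
 case True
 then have w: "ok w" "isGnd (hd w)" "isGnd (last w)" by auto
 let ?N = "%x z t. if x = ([] :: ('r, 'm) word) \<or> z = ([] :: ('r, 'm) word) then 0 else t :: 'r residue_field"
 let ?A = "%x y z. ?N x z (ksg n * pairing (map hel y) (form (D G) (tw G') x z) + ksg n * pairing (map hel y) (form G (D G') x z))"
 let ?R = "%x b y z. ?N x z (QR G G' x b y z)" and ?L = "%x y b z. ?N x z (QL G G' x y b z)"
 have "D (cc G G') w = (\<Sum>x@y@z=w. (?A x y z + ((\<Sum>y'@b=y. ?L x y' b z) + (\<Sum>b@y'=y. ?R x b y' z)))
  - ((\<Sum>x'@b=x. ?R x' b y z) + (\<Sum>b@z'=z. ?L x y b z')))" unfolding D_cc_split[OF w]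
 proof (rule sum_sp3_cong, goal_cases)
  case (1 x y z)
  note xyz = 1
  show ?case
  proof (cases "x = [] \<or> z = []")
   case True
   then show ?thesis
   by auto
  next
   case False
   then have xz: "x ~= []" "z ~= []" by auto
   have ok: "ok (x @ y @ z)" using w xyz by simp
   have "(\<Sum>x'@b=x. ?R x' b y z) = (\<Sum>x'@b=x. if x' = [] then 0 else QR G G' x' b y z)"
    "(\<Sum>b@z'=z. ?L x y b z') = (\<Sum>b@z'=z. if z' = [] then 0 else QL G G' x y b z')" using xz by simp_all
   then show ?thesis unfolding Leibniz_left[OF G ok xz] Leibniz_middle[OF G ok xz] Leibniz_right[OF G ok xz] using xz by simp
  qed
 qed
 also have "... = (\<Sum>x@y@z=w. ?A x y z)" unfolding sum_sp3_sub sum_sp3_add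
  using sum_sp3_regroup_left[of ?R w] sum_sp3_regroup_right[of ?L w] by simp
 also have "... = ksg n * (cc (D G) (tw G') w + cc G (D G') w)"
 proof -
  have "(\<Sum>x@y@z=w. ?A x y z) = ksg n * (\<Sum>x@y@z=w. ?N x z (pairing (map hel y) (form (D G) (tw G') x z)) + ?N x z (pairing (map hel y) (form G (D G') x z)))"
   unfolding sum_distrib_left by (rule sum.cong[OF refl]) (auto simp: distrib_left)
  then show ?thesis using w by (simp only: sum_sp3_add cc_def) simp
 qed
 finally show ?thesis .
qed

end

section \<open>Homotopies on words\<close>

text \<open>A homotopy \<open>hk\<close> between the identity and an endomorphism \<open>ph\<close> of the complex \<open>A\<close>. It is extended to tensor
  powers in the usual way, one letter at a time.\<close>

locale letter_homotopy = aug n V A0 eps for n :: int and V :: "('r::comm_ring_1, 'm) vinf" and A0 eps +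
 fixes ph :: "int => 'm => 'm" and hk :: "int => 'm => 'm"
 assumes ph: "additive_map (M i) (M i) (ph i)" and hk: "additive_map (M i) (M (i + 1)) (hk i)"
  and ph_chain: "x : carrier (M i) ==> \<delta> i (ph i x) = ph (i - 1) (\<delta> i x)"
  and ph_Cc: "x : A0 ==> ph 0 x : A0"
  and hk_homotopy: "x : carrier (M i) ==> (ph i x \<oplus>`M i` \<delta> (i + 1) (hk i x)) \<oplus>`M i` hk (i - 1) (\<delta> i x) = x"
begin

lemmas ph_closed = additive_mapD(1)[OF ph] and ph_add = additive_mapD(2)[OF ph]
 and hk_closed = additive_mapD(1)[OF hk] and hk_add = additive_mapD(2)[OF hk]
 and ph_zero = additive_map_zero[OF M M ph] and hk_zero = additive_map_zero[OF M M hk]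

fun lph :: "('r, 'm) letter => ('r, 'm) letter" where
 "lph (Gnd i r) = Gnd i r"
| "lph (Elt i x) = Elt i (ph i x)"
| "lph (Mid i x) = Mid i (ph i x)"

fun lhk :: "('r, 'm) letter => ('r, 'm) letter" where
 "lhk (Gnd i r) = Gnd (i + 1) 0"
| "lhk (Elt i x) = Elt (i + 1) (hk i x)"
| "lhk (Mid i x) = Mid (i + 1) (hk i x)"

fun ld :: "('r, 'm) letter => ('r, 'm) letter" where
 "ld (Gnd i r) = Gnd (i - 1) 0"
| "ld (Elt i x) = Elt (i - 1) (\<delta> i x)"
| "ld (Mid i x) = Mid (i - 1) (\<delta> i x)"

lemma mul_single: "vl l ==> mul [l] = ld l" by (cases l) (simp_all add: mul_def mval_single Cc_carrier)

lemma kd_letters [simp]: "kd (lph l) = kd l" "kd (lhk l) = kd l" "kd (ld l) = kd l" by (cases l; simp)+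

lemma ldeg_letters [simp]: "ldeg (lph l) = ldeg l" "ldeg (lhk l) = ldeg l + 1" "ldeg (ld l) = ldeg l - 1" by (cases l; simp)+

lemma vl_lph: "vl l ==> vl (lph l)"
proof (cases l)
 case (Mid i x)
 assume "vl l"
 then have x: "x : Cc i" using Mid by simp
 then have "ph i x : Cc i" using ph_Cc ph_zero ph_closed by (auto simp: Cc_def)
 then show ?thesis by (simp add: Mid)
qed (auto simp: ph_closed)

lemma vl_ld: "vl l ==> vl (ld l)" using vl_mul[of "[l]"] by (simp add: mul_single)

lemma vl_lhk: "vl l ==> vl (lhk l)"
proof (cases l)
 case (Mid i x)
 assume "vl l"
 then have x: "x : Cc i" using Mid by simp
 have c: "hk i x : carrier (M (i + 1))" using hk_closed[OF Cc_carrier[OF x]] .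
 have "hk i x : Cc (i + 1)"
 using c x hk_zero Cc_zero by (simp add: Cc_def)
 then show ?thesis by (simp add: Mid)
qed (auto simp: hk_closed)

lemma lph_ladd: "vl l ==> vl l' ==> same l l' ==> lph (ladd l l') = ladd (lph l) (lph l') & same (lph l) (lph l')"
 by (cases l; cases l') (auto simp: ph_add Cc_carrier)

lemma lhk_ladd: "vl l ==> vl l' ==> same l l' ==> lhk (ladd l l') = ladd (lhk l) (lhk l') & same (lhk l) (lhk l')"
 by (cases l; cases l') (auto simp: hk_add Cc_carrier)

lemma ld_lph: "vl l ==> ld (lph l) = lph (ld l)" by (cases l) (auto simp: ph_chain Cc_carrier)

lemma D0_sum_step:
 "(\<Sum>y@z=v. if length y = 0 then g y z else (0::'t::comm_ring_1)) = g [] v"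
proof (cases v)
 case (Cons a v')
 show ?thesis unfolding Cons sum_sp2_Cons by (simp add: split_beta)
qed simp

definition multiadditive :: "(('r, 'm) word => 't::comm_ring_1) => bool" where
 "multiadditive c \<longleftrightarrow> (\<forall>X l l' Z. vl l & vl l' & same l l' --> c (X @ [ladd l l'] @ Z) = c (X @ [l] @ Z) + c (X @ [l'] @ Z))"

lemma multiadditiveD: "multiadditive c ==> vl l ==> vl l' ==> same l l' ==> c (X @ [ladd l l'] @ Z) = c (X @ [l] @ Z) + c (X @ [l'] @ Z)"
 by (simp add: multiadditive_def)

lemma multiadditive_MC: "MC c ==> multiadditive c" by (simp add: multiadditive_def MC_def)

lemma multiadditive_Cons: "multiadditive c ==> multiadditive (%v. c (l # v))"
 unfolding multiadditive_def by (metis append_Cons)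

lemma letter_decomposition:
 assumes c: "multiadditive c" and l: "vl l"
 shows "c (ld (lhk l) # Z) + c (lhk (ld l) # Z) = c (l # Z) - c (lph l # Z)"
proof -
 note a = multiadditiveD[OF c _ _ _, of _ _ "[]" Z, simplified]
 have v: "vl (lph l)" "vl (ld (lhk l))" "vl (lhk (ld l))" using l by (simp_all add: vl_lph vl_ld vl_lhk)
 have s: "same (lph l) (ld (lhk l))" by (cases l) simp_all
 have s': "same (ladd (lph l) (ld (lhk l))) (lhk (ld l))" by (cases l) simp_all
 have "ladd (ladd (lph l) (ld (lhk l))) (lhk (ld l)) = l" using l by (cases l) (simp_all add: hk_homotopy Cc_carrier)
 then show ?thesis using a[OF v(1,2) s] a[OF vl_ladd[OF s v(1,2)] v(3) s'] by simp
qed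

text \<open>\<open>D0\<close> is the part of the differential that merges single letters, and \<open>K\<close> is the homotopy for it: the homotopy is
  applied to one letter, and \<open>ph\<close> to all letters on its right.\<close>

fun D0 :: "(('r, 'm) word => 't::comm_ring_1) => ('r, 'm) word => 't" where
 "D0 c [] = 0"
| "D0 c (l # w) = c (ld l # w) + ksg (ldeg l) * D0 (%v. c (l # v)) w"

fun K :: "(('r, 'm) word => 't::comm_ring_1) => ('r, 'm) word => 't" where
 "K c [] = 0"
| "K c (l # w) = c (lhk l # map lph w) + ksg (ldeg l) * K (%v. c (l # v)) w"

lemma D0_linear: "D0 (%v. a v + s * b v) w = D0 a w + s * D0 b w" by (induction w arbitrary: a b) (simp_all add: algebra_simps)

lemma K_linear: "K (%v. a v + s * b v) w = K a w + s * K b w" by (induction w arbitrary: a b) (simp_all add: algebra_simps)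

lemma D0_lph: "valid w ==> D0 (%v. c (map lph v)) w = D0 c (map lph w)"
proof (induction w arbitrary: c)
 case (Cons a w)
 then show ?case using Cons.IH[of "%v. c (lph a # v)"] by (simp add: ld_lph)
qed simp

lemma K_homotopy:
 fixes c :: "('r, 'm) word => 't::comm_ring_1"
 assumes "multiadditive c" "valid w"
 shows "K (D0 c) w + D0 (K c) w = c w - c (map lph w)" using assms
proof (induction w arbitrary: c)
 case (Cons l w)
 have l: "vl l" and w: "valid w" using Cons.prems by auto
 let ?s = "ksg (ldeg l) :: 't"
 have E1: "K (%v. D0 c (l # v)) w = K (%v. c (ld l # v)) w + ?s * K (D0 (%v. c (l # v))) w" by (simp add: K_linear)
 have E2: "D0 (%v. K c (l # v)) w = D0 (%v. c (lhk l # v)) (map lph w) + ?s * D0 (K (%v. c (l # v))) w"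
  using D0_lph[OF w, of "%v. c (lhk l # v)"] by (simp add: D0_linear)
 have E3: "K (D0 (%v. c (l # v))) w = c (l # w) - c (l # map lph w) - D0 (K (%v. c (l # v))) w"
  using Cons.IH[OF multiadditive_Cons[OF Cons.prems(1)] w, of l] by (simp add: eq_diff_eq)
 have E4: "c (ld (lhk l) # map lph w) = c (l # map lph w) - c (lph l # map lph w) - c (lhk (ld l) # map lph w)"
  using letter_decomposition[OF Cons.prems(1) l, of "map lph w"] by (simp add: eq_diff_eq)
 have E5: "ksg (ldeg l + 1) = - ?s" "ksg (ldeg l - 1) = - ?s" by (rule sgn_pow_opp, simp)+
 show ?case unfolding K.simps(2)[of "D0 c"] D0.simps(2)[of "K c"] E1 E2 unfolding K.simps D0.simps ldeg_letters E3 E4 E5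
  by (simp add: algebra_simps flip: mult.assoc)
qed simp

lemma K_cong:
 assumes "valid w" "!!v. map kd v = map kd w ==> valid v ==> c v = c' v"
 shows "K c w = K c' w" using assms
proof (induction w arbitrary: c c')
 case (Cons l w)
 have "c (lhk l # map lph w) = c' (lhk l # map lph w)"
  by (rule Cons.prems(2)) (use Cons.prems(1) in \<open>auto simp: vl_lhk vl_lph\<close>)
 moreover have "K (%v. c (l # v)) w = K (%v. c' (l # v)) w" by (rule Cons.IH) (use Cons.prems in auto)
 ultimately show ?case by simp
qed simp

lemma K_multiadditive:
 assumes "multiadditive c"
 shows "multiadditive (K c)" unfolding multiadditive_def
proof (intro allI impI)
 fix X l l' Z assume l: "vl l & vl l' & same l l'"
 show "K c (X @ [ladd l l'] @ Z) = K c (X @ [l] @ Z) + K c (X @ [l'] @ Z)" using assms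
 proof (induction X arbitrary: c)
  case Nil
  have "(%v. c (ladd l l' # v)) = (%v. c (l # v) + 1 * c (l' # v))" using multiadditiveD[OF Nil, of l l' "[]"] l by simp
  then have "K (%v. c (ladd l l' # v)) Z = K (%v. c (l # v)) Z + K (%v. c (l' # v)) Z"
   using K_linear[of "%v. c (l # v)" 1 "%v. c (l' # v)" Z] by simp
  moreover have "c (lhk (ladd l l') # map lph Z) = c (lhk l # map lph Z) + c (lhk l' # map lph Z)"
   using multiadditiveD[OF Nil, of "lhk l" "lhk l'" "[]" "map lph Z"] lhk_ladd[of l l'] vl_lhk l by simp
  ultimately show ?case using same_ladd[of l l'] l by (simp add: algebra_simps)
 next
  case (Cons a X)
  have "c (lhk a # map lph X @ ladd (lph l) (lph l') # map lph Z)
   = c (lhk a # map lph X @ lph l # map lph Z) + c (lhk a # map lph X @ lph l' # map lph Z)"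
   using multiadditiveD[OF Cons.prems, of "lph l" "lph l'" "lhk a # map lph X" "map lph Z"] lph_ladd[of l l'] vl_lph l by simp
  then show ?case using Cons.IH[OF multiadditive_Cons[OF Cons.prems], of a] lph_ladd[of l l'] l by (simp add: algebra_simps)
 qed
qed

definition KK :: "(('r, 'm) word => 't::comm_ring_1) => ('r, 'm) word => 't" where
 "KK c w = (if ok w then K c w else 0)"

lemma MC_KK:
 assumes "MC c"
 shows "MC (KK c)" unfolding MC_def
proof (intro conjI allI impI)
 show "KK c w = 0" if "~ ok w" for w using that by (simp add: KK_def)
 fix X l l' Z assume l: "vl l & vl l' & same l l'"
 then show "KK c (X @ [ladd l l'] @ Z) = KK c (X @ [l] @ Z) + KK c (X @ [l'] @ Z)"
  using multiadditiveD[OF K_multiadditive[OF multiadditive_MC[OF assms]], of l l' X Z] ok_ladd[of l l' X Z] by (simp add: KK_def)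
qed

lemma ok_kd: "ok w ==> map kd v = map kd w ==> valid v ==> ok v" by (simp add: ok_def wd_def)

lemma D0_cong:
 assumes "valid w" "!!v. map kd v = map kd w ==> valid v ==> c v = c' v"
 shows "D0 c w = D0 c' w" using assms
proof (induction w arbitrary: c c')
 case (Cons l w)
 have "c (ld l # w) = c' (ld l # w)" by (rule Cons.prems(2)) (use Cons.prems(1) in \<open>auto simp: vl_ld\<close>)
 moreover have "D0 (%v. c (l # v)) w = D0 (%v. c' (l # v)) w" by (rule Cons.IH) (use Cons.prems in auto)
 ultimately show ?case by simp
qed simp

lemma D0_sum:
 fixes c :: "('r, 'm) word => 't::comm_ring_1"
 shows "valid w ==> D0 c w = (\<Sum>x@y@z=w. if length y = 1 then ksg (wdeg x) * c (x @ [mul y] @ z) else 0)"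
proof (induction w arbitrary: c)
 case (Cons l w)
 have m1: "(\<Sum>y@z=(l # w). if length y = 1 then ksg (wdeg []) * c ([] @ [mul y] @ z) else 0) = c (ld l # w)"
  using D0_sum_step[of "%y z. ksg (wdeg []) * c ([] @ [mul (l # y)] @ z)" w] mul_single[of l] Cons.prems by (simp add: sum_sp2_Cons)
 have m2: "(\<Sum>x@y@z=w. if length y = 1 then ksg (wdeg (l # x)) * c ((l # x) @ [mul y] @ z) else 0)
  = ksg (ldeg l) * D0 (%v. c (l # v)) w" using Cons.IH[of "%v. c (l # v)"] Cons.prems
  by (simp add: sum_distrib_left sgn_pow_add split_beta mult.assoc if_distrib cong: if_cong)
 show ?case unfolding D0.simps by (rule trans[OF arg_cong2[where f = "(+)", OF m1[symmetric] m2[symmetric]] sum_sp3_Cons[symmetric]])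
qed simp

text \<open>On the shortest words where a cochain does not vanish, merging two or more letters leads to words that are too short.\<close>

lemma D_leading:
 assumes "ok w" "!!v. length v < length w ==> c v = 0"
 shows "D c w = D0 c w"
proof -
 have v: "valid w" and l: "2 \<le> length w" using assms(1) by (auto simp: ok_def wd_iff)
 show ?thesis unfolding D_def if_P[OF assms(1)] D0_sum[OF v]
 proof (rule sum_sp3_cong, goal_cases)
  case (1 x y z)
  note xyz = 1
  show ?case
  proof (cases "length y \<le> 1")
   case True
   then show ?thesis using l by (cases y) auto
  next
   case False
   then have "c (x @ [mul y] @ z) = 0" by (intro assms(2)) (simp flip: xyz)
   then show ?thesis using False by simp
  qed
 qed
qed

end

context aug

begin

lemma D_linear:
 fixes a :: "('r, 'm) word => 't::comm_ring_1"
 shows "D (%v. a v + s * b v) w = D a w + s * D b w"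
proof (cases "ok w")
 case True
 have "D (%v. a v + s * b v) w = (\<Sum>x@y@z=w. (if y = [] \<or> y = w then 0 else ksg (wdeg x) * a (x @ [mul y] @ z))
  + s * (if y = [] \<or> y = w then 0 else ksg (wdeg x) * b (x @ [mul y] @ z)))"
  unfolding D_def if_P[OF True] by (rule sum_sp3_cong) (auto simp: algebra_simps)
 also have "... = D a w + s * D b w" unfolding sum_sp3_add using True by (simp add: D_def sum_distrib_left split_beta)
 finally show ?thesis .
qed (simp add: D_def)

lemma D_add: "D (%v. a v + b v) w = D a w + D b w" using D_linear[of a 1 b w] by simp

lemma D_diff: "D (%v. a v - b v) w = D a w - D b w" using D_linear[of a "- 1" b w] by simp

lemma D_zero: "D (%v. 0) w = 0" using D_diff[of "%v. 0" "%v. 0" w] by simp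

lemma D_sum: "D (%v. \<Sum>i\<in>I. a i v) w = (\<Sum>i\<in>I. D (a i) w)"
 by (induction I rule: infinite_finite_induct) (simp_all add: D_zero D_add)

lemma D_cong:
 assumes "!!v. length v \<le> length w ==> a v = b v"
 shows "D a w = D b w"
proof -
 have "a (x @ [mul y] @ z) = b (x @ [mul y] @ z)" if "x @ y @ z = w" "y ~= []" for x y z
  by (rule assms) (use that in \<open>cases y; auto\<close>)
 then show ?thesis unfolding D_def by (intro if_cong refl sum_sp3_cong) auto
qed

lemma MC_linear: "MC a ==> MC b ==> MC (%v. a v + s * b v)"
 unfolding MC_def by (simp add: algebra_simps)

lemma MC_plus: "MC a ==> MC b ==> MC (%v. a v + b v)" using MC_linear[of a b 1] by simp

lemma MC_diff: "MC a ==> MC b ==> MC (%v. a v - b v)" using MC_linear[of a b "- 1"] by simp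

lemma MC_null: "MC (%v. 0)" unfolding MC_def by simp

text \<open>The filtration of cochains by word length. The differential and the homotopies preserve it.\<close>

definition vanish :: "nat => (('r, 'm) word => 't::comm_ring_1) => bool" where
 "vanish p c \<longleftrightarrow> (\<forall>w. length w < p --> c w = 0)"

lemma vanishD: "vanish p c ==> length w < p ==> c w = 0" by (simp add: vanish_def)

lemma vanish_D: "vanish p c ==> vanish p (D c)"
 unfolding vanish_def using D_cong[of _ c "%v. 0"] by (simp add: D_zero)

end

context letter_homotopy

begin

lemma K_zero: "K (%v. 0) w = 0" by (induction w) simp_all

lemma vanish_KK:
 assumes "vanish p c"
 shows "vanish p (KK c)" unfolding vanish_def
proof (intro allI impI)
 fix w :: "('r, 'm) word" assume l: "length w < p"
 have "K c w = K (%v. 0) w" if "valid w"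
 by (metis K_cong[OF that] length_map vanishD[OF assms] l )
 then show "KK c w = 0" by (simp add: KK_def K_zero ok_def)
qed

lemma KK_leading:
 assumes c: "MC c" and v: "vanish p c" and Dc: "vanish (Suc p) (D c)" and w: "ok w" "length w = p"
 shows "D (KK c) w = c w - c (map lph w)"
proof -
 have val: "valid w" using w by (simp add: ok_def)
 have len: "length u = p" if "map kd u = map kd w" for u :: "('r, 'm) word" using that w(2) by (metis length_map)
 have "D (KK c) w = D0 (KK c) w" by (rule D_leading[OF w(1)]) (rule vanishD[OF vanish_KK[OF v]], simp add: w(2))
 also have "... = D0 (K c) w" by (rule D0_cong[OF val]) (simp add: KK_def ok_kd[OF w(1)])
 also have "... = c w - c (map lph w) - K (D0 c) w"
  using K_homotopy[OF multiadditive_MC[OF c] val] by (simp add: eq_diff_eq add.commute)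
 also have "K (D0 c) w = K (%v. 0) w"
 proof (rule K_cong[OF val])
  fix u :: "('r, 'm) word" assume u: "map kd u = map kd w" "valid u"
  have "D c u = D0 c u" by (rule D_leading[OF ok_kd[OF w(1) u]]) (rule vanishD[OF v], simp add: len[OF u(1)])
  then show "D0 c u = 0" using vanishD[OF Dc, of u] len[OF u(1)] by simp
 qed
 finally show ?thesis by (simp add: K_zero)
qed

end

section \<open>Quasi-isomorphisms\<close>

lemma hmap_simps [simp]: "fst (hmap f a) = fst a" "snd (hmap f a) = f (fst a) (snd a)" by (simp_all add: hmap_def)

lemma sdeg_hmap [simp]: "sdeg (map (hmap f) b) = sdeg b" by (induction b) simp_all

locale quasi_isomorphism = V: valg n V + W: valg n W for n :: int and V :: "('r::comm_ring_1, 'm) vinf" and W :: "('r, 'k) vinf" +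
 fixes f :: "int => 'm => 'k"
 assumes qi: "quasi_iso V W f"

begin

lemma f_lin: "linear_map (V.M i) (W.M i) (f i)"
 and f_chain: "x : carrier (V.M i) ==> f (i - 1) (V.\<delta> i x) = W.\<delta> i (f i x)"
 and f_ops: "1 \<le> l ==> bl : blocks V.M l ==>
    teq W.M (lin_ext (%us. pt (map (hmap f) us)) (ops V bl)) (ops W (map (map (hmap f)) bl))"
 and f_inj: "x : cycles V.M V.\<delta> i ==> f i x : boundaries W.M W.\<delta> i ==> x : boundaries V.M V.\<delta> i"
 and f_surj: "y : cycles W.M W.\<delta> i ==> \<exists>x\<in>cycles V.M V.\<delta> i. \<exists>w\<in>boundaries W.M W.\<delta> i. y = f i x \<oplus>`W.M i` w"
 using qi unfolding quasi_iso_def by blast+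

lemmas f_closed = linear_mapD(1)[OF f_lin] and f_add = linear_mapD(2)[OF f_lin] and f_smult = linear_mapD(3)[OF f_lin]

lemma hlists_hmap: "b : hlists V.M ==> map (hmap f) b : hlists W.M" by (induction b) (simp_all add: f_closed)

lemma f_mval:
 assumes b: "b : hlists V.M" and e: "e = sdeg b - 2"
 shows "f e (mval V b) = mval W (map (hmap f) b)"
proof (rule ccontr)
 let ?x = "f e (mval V b)" and ?y = "mval W (map (hmap f) b)"
 have x: "?x : carrier (W.M e)" by (rule f_closed) (rule V.mval_closed'[OF b e[symmetric]])
 have y: "?y : carrier (W.M e)" by (rule W.mval_closed'[OF hlists_hmap[OF b]]) (simp add: e)
 let ?z = "?x \<oplus>`W.M e` \<ominus>`W.M e` ?y"
 assume "?x ~= ?y"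
 have z: "?z : carrier (W.M e)" using x y by (simp add: mod_closed[OF W.M])
 have "?z ~= \<zero>`W.M e`" using mod_diff_zero[OF W.M x y] \<open>?x \<noteq> ?y\<close> by blast
 then obtain h :: "'k => 'r" where h: "h ?z = 1"
  "!!u v. u : carrier (W.M e) ==> v : carrier (W.M e) ==> h (u \<oplus>`W.M e` v) = h u + h v"
  using additive_separating[OF V.R W.M z] by blast
 have ha: "additive_on (W.M e) h" using h(2) by (simp add: additive_on_def)
 have hb: "additive_on (V.M e) (%x. h (f e x))" by (simp add: additive_on_def f_add f_closed h(2))
 have bW: "balanced W.M (AF W.M e h)" by (rule AF_balanced[where M = W.M, OF W.M ha])
 have bV: "balanced V.M (AF V.M e (%x. h (f e x)))" by (rule AF_balanced[where M = V.M, OF V.M hb])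
 note cW = balanced_coef_add[OF bW]
 have "teq W.M (lin_ext (%us. pt (map (hmap f) us)) (ops V [b])) (ops W [map (hmap f) b])"
  using f_ops[of 1 "[b]"] b by (simp add: blocks_def)
 from teq_EV[OF this bW]
 have "EV (%r us. AF W.M e h r (map (hmap f) us)) (ops V [b]) = AF W.M e h 1 [mh W (map (hmap f) b)]"
  using W.EV_mh[OF bW hlists_hmap[OF b]] by (simp add: EV_lin_ext cW coef_add_scale)
 moreover have "EV (%r us. AF W.M e h r (map (hmap f) us)) (ops V [b]) = EV (AF V.M e (%x. h (f e x))) (ops V [b])"
 proof (rule EV_cong, goal_cases)
  case (1 w)
  from 1 obtain u where "w = [(e, u)]" "u : carrier (V.M e)" unfolding e by (rule V.ops1_key[OF b])
  then show ?case by (simp add: AF_def f_closed f_smult)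
 qed
 moreover have "EV (AF V.M e (%x. h (f e x))) (ops V [b]) = AF V.M e (%x. h (f e x)) 1 [mh V b]" by (rule V.EV_mh[OF bV b])
 ultimately have "h ?x = h ?y" using x y V.mval_closed'[OF b e[symmetric]] e
  by (simp add: AF_def mh_def mod_laws(10)[OF W.M] mod_laws(10)[OF V.M])
 then have "h ?z = 0" using h(2)[OF x, of "\<ominus>`W.M e` ?y"] additive_on_neg[OF W.M ha y] y by (simp add: mod_closed[OF W.M])
 then show False using h(1) by simp
qed

lemma f_zero: "f i \<zero>`V.M i` = \<zero>`W.M i`" by (rule linear_map_zero[OF V.M W.M f_lin])

end

text \<open>A quasi-isomorphism that respects augmentations. The set \<open>A0\<close> is the full preimage of \<open>B0\<close>, so that a homotopy
  inverse also maps \<open>B0\<close> to \<open>A0\<close>.\<close>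

locale aug_map = V: aug n V A0 eps + W: aug n W B0 eta + quasi_isomorphism n V W f
 for n :: int and V :: "('r::comm_ring_1, 'm) vinf" and A0 eps and W :: "('r, 'k) vinf" and B0 eta f +
 assumes A0_eq: "A0 = {x : cycles (mods V) (diff V) 0. f 0 x : B0}" and eps_eq: "x : A0 ==> eps x = eta (f 0 x)"

begin

fun F :: "('r, 'm) letter => ('r, 'k) letter" where
 "F (Gnd i r) = Gnd i r"
| "F (Elt i x) = Elt i (f i x)"
| "F (Mid i x) = Mid i (f i x)"

lemma F_simps [simp]: "kd (F l) = kd l" "ldeg (F l) = ldeg l" "isGnd (F l) = isGnd l" "isElt (F l) = isElt l" by (cases l; simp)+

lemma wdeg_F [simp]: "wdeg (map F w) = wdeg w" by (induction w) simp_all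

lemma f_Cc: "x : V.Cc i ==> f i x : W.Cc i"
 using f_zero A0_eq V.Cc_def W.Cc_def f_closed by blast

lemma vl_F: "V.vl l ==> W.vl (F l)" by (cases l) (auto simp: f_closed f_Cc)

lemma F_ladd: "V.vl l ==> V.vl l' ==> same l l' ==> F (V.ladd l l') = W.ladd (F l) (F l') & same (F l) (F l')"
 by (cases l; cases l') (auto simp: f_add V.Cc_carrier)

lemma ok_F: "V.ok w ==> W.ok (map F w)" by (auto simp: V.ok_def W.ok_def wd_def o_def vl_F)

lemma list_ex_F: "list_ex isGnd (map F y) = list_ex isGnd y" "list_ex isElt (map F y) = list_ex isElt y" by (induction y) simp_all

lemma hel_F: "V.valid y ==> ~ list_ex isGnd y ==> map hel (map F y) = map (hmap f) (map hel y)"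
proof (induction y)
 case (Cons l y)
 then show ?case by (cases l) (simp_all add: hmap_def)
qed simp

lemma gval_F: "V.valid y ==> W.gval (map F y) = V.gval y"
proof (cases y rule: V.gval.cases)
 case (1 i r j x)
 assume "V.valid y"
 then show ?thesis using eps_eq[of x] by (auto simp: 1 V.Cc_def)
next
 case (2 j x i r)
 assume "V.valid y"
 then show ?thesis using eps_eq[of x] by (auto simp: 2 V.Cc_def)
qed simp_all

lemma F_mul: "V.valid y ==> F (V.mul y) = W.mul (map F y)"
proof -
 assume v: "V.valid y"
 show ?thesis
 proof (cases "list_ex isGnd y")
  case True
  then show ?thesis by (simp add: V.mul_def W.mul_def list_ex_F gval_F[OF v])
 next
  case False
  have "f (wdeg y - 2) (mval V (map hel y)) = mval W (map hel (map F y))"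
   unfolding hel_F[OF v False] by (rule f_mval[OF V.hlists_hel[OF v False]]) (simp add: V.sdeg_hel[OF False])
  then show ?thesis using False list_ex_F[of y] by (simp add: V.mul_def W.mul_def)
 qed
qed

definition pull :: "(('r, 'k) word => 't::comm_ring_1) => ('r, 'm) word => 't" where
 "pull c w = (if V.ok w then c (map F w) else 0)"

lemma MC_pull:
 assumes "W.MC c"
 shows "V.MC (pull c)" unfolding V.MC_def
proof (intro conjI allI impI)
 show "pull c w = 0" if "~ V.ok w" for w using that by (simp add: pull_def)
 fix X l l' Z assume l: "V.vl l & V.vl l' & same l l'"
 then show "pull c (X @ [V.ladd l l'] @ Z) = pull c (X @ [l] @ Z) + pull c (X @ [l'] @ Z)"
  using W.MC_add[OF assms, of "F l" "F l'" "map F X" "map F Z"] V.ok_ladd[of l l' X Z] F_ladd[of l l'] vl_F by (simp add: pull_def)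
qed

text \<open>A morphism is strict: it commutes with all operations, and hence with merging.\<close>

lemma D_pull: "V.D (pull c) w = pull (W.D c) w"
proof (cases "V.ok w")
 case True
 have "W.D c (map F w) = (\<Sum>x@y@z=w. if map F y = [] \<or> map F y = map F w then 0
   else ksg (wdeg (map F x)) * c (map F x @ [W.mul (map F y)] @ map F z))" unfolding W.D_def if_P[OF ok_F[OF True]] sum_sp3_map ..
 also have "... = V.D (pull c) w" unfolding V.D_def if_P[OF True]
 proof (rule sum_sp3_cong, goal_cases)
  case (1 x y z)
  note xyz = 1
  have eq: "map F y = map F w \<longleftrightarrow> y = w"
  proof
   assume "map F y = map F w"
   then have "length y = length w" by (metis length_map)
   then show "y = w" using xyz by auto
  qed simp
  show ?case
  proof (cases "y = [] \<or> y = w")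
   case False
   then have "V.ok (x @ [V.mul y] @ z)" using True xyz by (intro V.ok_mul) auto
   moreover have "V.valid y" using True xyz by (auto simp: V.ok_def)
   ultimately show ?thesis using False by (simp add: eq pull_def F_mul)
  qed (auto simp: eq)
 qed
 finally show ?thesis using True by (simp add: pull_def)
qed (simp add: pull_def V.D_def)

lemma vanish_pull: "W.vanish p c ==> V.vanish p (pull c)" by (simp add: V.vanish_def W.vanish_def pull_def)

lemma pull_diff: "pull (%v. a v - b v) w = pull a w - pull b w" by (simp add: pull_def)

lemma pull_sum: "pull (%v. \<Sum>i\<in>I. a i v) w = (\<Sum>i\<in>I. pull (a i) w)" by (simp add: pull_def)

end

locale aug_qi = aug_map n V A0 eps W B0 eta f
  + additive_homotopy_inverse "mods V" "diff V" "mods W" "diff W" f g h k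
 for n :: int and V :: "('r::comm_ring_1, 'm) vinf" and A0 eps and W :: "('r, 'k) vinf" and B0 eta f g h k
begin

lemmas g_closed = additive_mapD(1)[OF g] and g_add = additive_mapD(2)[OF g]
 and h_closed = additive_mapD(1)[OF h]
 and g_zero = additive_map_zero[OF W.M V.M g] and h_zero = additive_map_zero[OF W.M W.M h]

text \<open>The two elements differ by a boundary, and boundaries belong to \<open>B0\<close>.\<close>

lemma fg_B0:
 assumes y: "y : B0"
 shows "f 0 (g 0 y) : B0"
proof -
 have yc: "y : carrier (W.M 0)" by (rule qsubspaceD(1)[OF W.A0_sub y])
 have "W.\<delta> 0 y = \<zero>`W.M (0 - 1)`" using W.A0_cycles y by (auto simp: cycles_def)
 then have z: "h (0 - 1) (W.\<delta> 0 y) = \<zero>`W.M 0`" using h_zero[of "- 1"] by simp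
 let ?b = "W.\<delta> 1 (h 0 y)"
 have hc: "h 0 y : carrier (W.M 1)" using h_closed[OF yc] by simp
 then have bc: "?b : carrier (W.M 0)" using linear_mapD(1)[OF W.d_lin, of "h 0 y" 1] by simp
 have "?b : boundaries W.M W.\<delta> 0" using hc by (auto simp: boundaries_def)
 then have bB: "?b : B0" using W.A0_bd by blast
 have fgc: "f 0 (g 0 y) : carrier (W.M 0)" by (rule f_closed[OF g_closed[OF yc]])
 have fy: "f 0 (g 0 y) \<oplus>`W.M 0` ?b = y"
  using h_homotopy[OF yc] z bc fgc by (simp add: mod_closed[OF W.M] mod_laws(4)[OF W.M])
 have "(f 0 (g 0 y) \<oplus>`W.M 0` ?b) \<oplus>`W.M 0` \<ominus>`W.M 0` ?b = f 0 (g 0 y)"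
  using bc fgc by (simp add: mod_closed[OF W.M] mod_laws(2,4,5)[OF W.M])
 then have "y \<oplus>`W.M 0` \<ominus>`W.M 0` ?b = f 0 (g 0 y)" unfolding fy .
 then show ?thesis using qsubspaceD(3)[OF W.A0_sub y qsubspace_neg[OF W.M W.A0_sub bB]] by simp
qed

lemma g_B0:
 assumes y: "y : B0"
 shows "g 0 y : A0"
 using W.A0_cycles y g_chain g_zero fg_B0[OF y] g_closed by (auto simp: cycles_def A0_eq)

lemma f_A0: "x : A0 ==> f 0 x : B0" unfolding A0_eq by simp

sublocale HV: letter_homotopy n V A0 eps "%i x. g i (f i x)" k
 by unfold_locales (use g_B0 f_A0 k_homotopy in \<open>auto simp: additive_map_def f_closed g_closed f_add g_add g_chain f_chain additive_mapD[OF k]\<close>)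

sublocale HW: letter_homotopy n W B0 eta "%i y. f i (g i y)" h
 by unfold_locales (use fg_B0 h_homotopy in \<open>auto simp: additive_map_def f_closed g_closed f_add g_add f_chain[symmetric] g_chain[symmetric] additive_mapD[OF h]\<close>)

fun gL :: "('r, 'k) letter => ('r, 'm) letter" where
 "gL (Gnd i r) = Gnd i r"
| "gL (Elt i y) = Elt i (g i y)"
| "gL (Mid i y) = Mid i (g i y)"

lemma gL_simps [simp]: "kd (gL l) = kd l" "ldeg (gL l) = ldeg l" by (cases l; simp)+

lemma gL_F: "gL (F l) = HV.lph l" by (cases l) simp_all

lemma F_gL: "F (gL l) = HW.lph l" by (cases l) simp_all

lemma g_Cc: "y : W.Cc i ==> g i y : V.Cc i" using g_B0 g_zero by (auto simp: V.Cc_def W.Cc_def g_closed)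

lemma vl_gL: "W.vl l ==> V.vl (gL l)" by (cases l) (auto simp: g_closed g_Cc)

lemma gL_ladd: "W.vl l ==> W.vl l' ==> same l l' ==> gL (W.ladd l l') = V.ladd (gL l) (gL l') & same (gL l) (gL l')"
 by (cases l; cases l') (auto simp: g_add W.Cc_carrier)

lemma ok_gL: "W.ok w ==> V.ok (map gL w)" by (auto simp: V.ok_def W.ok_def wd_def o_def vl_gL)

lemma ld_gL: "W.vl l ==> HV.ld (gL l) = gL (HW.ld l)" by (cases l) (auto simp: g_chain W.Cc_carrier)

lemma D0_gL: "W.valid w ==> HW.D0 (%v. c (map gL v)) w = HV.D0 c (map gL w)"
proof (induction w arbitrary: c)
 case (Cons a w)
 then show ?case using Cons.IH[of "%v. c (gL a # v)"] by (simp add: ld_gL)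
qed simp

definition pullg :: "(('r, 'm) word => 't::comm_ring_1) => ('r, 'k) word => 't" where
 "pullg e w = (if W.ok w then e (map gL w) else 0)"

lemma MC_pullg:
 assumes "V.MC e"
 shows "W.MC (pullg e)" unfolding W.MC_def
proof (intro conjI allI impI)
 show "pullg e w = 0" if "~ W.ok w" for w using that by (simp add: pullg_def)
 fix X l l' Z assume l: "W.vl l & W.vl l' & same l l'"
 then show "pullg e (X @ [W.ladd l l'] @ Z) = pullg e (X @ [l] @ Z) + pullg e (X @ [l'] @ Z)"
  using V.MC_add[OF assms, of "gL l" "gL l'" "map gL X" "map gL Z"] W.ok_ladd[of l l' X Z] gL_ladd[of l l'] vl_gL by (simp add: pullg_def)
qed

lemma vanish_pullg: "V.vanish p e ==> W.vanish p (pullg e)" by (simp add: V.vanish_def W.vanish_def pullg_def)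

lemma pullg_leading:
 assumes v: "V.vanish p e" and w: "W.ok w" "length w = p"
 shows "W.D (pullg e) w = V.D e (map gL w)"
proof -
 have val: "W.valid w" using w by (simp add: W.ok_def)
 have "W.D (pullg e) w = HW.D0 (pullg e) w" by (rule HW.D_leading[OF w(1)]) (rule W.vanishD[OF vanish_pullg[OF v]], simp add: w(2))
 also have "... = HW.D0 (%u. e (map gL u)) w" by (rule HW.D0_cong[OF val]) (simp add: pullg_def HW.ok_kd[OF w(1)])
 also have "... = HV.D0 e (map gL w)" by (rule D0_gL[OF val])
 also have "... = V.D e (map gL w)" by (rule HV.D_leading[symmetric, OF ok_gL[OF w(1)]]) (rule V.vanishD[OF v], simp add: w(2))
 finally show ?thesis .
qed

section \<open>The cone of the pull-back of cochains is acyclic\<close>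

text \<open>The leading part of the contraction of the cone: pull back along the homotopy inverse, and add the homotopy.\<close>

definition hc :: "(('r, 'k) word => 't::comm_ring_1) => (('r, 'm) word => 't) => ('r, 'k) word => 't" where
 "hc c e w = pullg e w + HW.KK c w"

text \<open>The cone of the pull-back has pairs of cochains as elements. Subtracting the differential of the contraction from a
  cocycle raises its filtration by word length; \<open>next_c\<close> and \<open>next_e\<close> are the two components of the difference.\<close>

definition cone_cocycle :: "(('r, 'k) word => 't::comm_ring_1) => (('r, 'm) word => 't) => bool" where
 "cone_cocycle c e \<longleftrightarrow> W.MC c & V.MC e & (\<forall>w. W.D c w = 0) & (\<forall>w. V.D e w = pull c w)"

definition next_c where "next_c c e w = c w - W.D (hc c e) w"

definition next_e where "next_e c e w = (e w - pull (hc c e) w) - V.D (HV.KK e) w"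

lemma MC_hc: "W.MC c ==> V.MC e ==> W.MC (hc c e)"
 unfolding hc_def[abs_def] by (intro W.MC_plus MC_pullg HW.MC_KK)

lemma vanish_hc: "W.vanish p c ==> V.vanish p e ==> W.vanish p (hc c e)"
 using vanish_pullg[of p e] HW.vanish_KK[of p c] by (simp add: W.vanish_def hc_def)

lemma cone_cocycle_next:
 assumes "cone_cocycle c e"
 shows "cone_cocycle (next_c c e) (next_e c e)"
proof -
 have a: "W.MC c" "V.MC e" "!!w. W.D c w = 0" "!!w. V.D e w = pull c w" using assms by (simp_all add: cone_cocycle_def)
 note m = MC_hc[OF a(1,2)]
 have 1: "W.MC (next_c c e)" unfolding next_c_def[abs_def] by (intro W.MC_diff a W.MC_D m)
 have 2: "V.MC (next_e c e)" unfolding next_e_def[abs_def] by (intro V.MC_diff a V.MC_D MC_pull m HV.MC_KK)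
 have 3: "W.D (next_c c e) w = 0" for w unfolding next_c_def[abs_def] W.D_diff a(3) W.D_D[OF m] by simp
 have 4: "V.D (next_e c e) w = pull (next_c c e) w" for w unfolding next_e_def[abs_def] V.D_diff V.D_D[OF HV.MC_KK[OF a(2)]] D_pull a(4)
  by (simp add: next_c_def[abs_def] pull_diff)
 show ?thesis using 1 2 3 4 by (simp add: cone_cocycle_def)
qed

text \<open>On words of length \<open>p\<close>, the differential of \<open>K\<close> gives back \<open>c\<close> up to \<open>c \<circ> f \<circ> g\<close>, which is cancelled by the pull-back of \<open>D e\<close>.\<close>

lemma next_c_vanish:
 assumes cc: "cone_cocycle c e" and v: "W.vanish p c" "V.vanish p e"
 shows "W.vanish (Suc p) (next_c c e)" unfolding W.vanish_def
proof (intro allI impI)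
 fix w :: "('r, 'k) word" assume l: "length w < Suc p"
 have a: "W.MC c" "V.MC e" "!!w. W.D c w = 0" "!!w. V.D e w = pull c w" using cc by (simp_all add: cone_cocycle_def)
 consider "length w < p" | "length w = p" "~ W.ok w" | "length w = p" "W.ok w" using l by linarith
 then show "next_c c e w = 0"
 proof cases
  case 1
  then show ?thesis using W.vanishD[OF v(1)] W.vanishD[OF W.vanish_D[OF vanish_hc[OF v]]] by (simp add: next_c_def)
 next
  case 2
  then show ?thesis using W.MC_ok[OF a(1)] by (simp add: next_c_def W.D_def)
 next
  case 3
  have "W.D (hc c e) w = W.D (pullg e) w + W.D (HW.KK c) w" by (simp add: hc_def[abs_def] W.D_add)
  also have "W.D (pullg e) w = c (map HW.lph w)"
   unfolding pullg_leading[OF v(2) 3(2,1)] a(4) pull_def using ok_gL[OF 3(2)] by (simp add: o_def F_gL)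
  also have "W.D (HW.KK c) w = c w - c (map HW.lph w)" by (rule HW.KK_leading[OF a(1) v(1) _ 3(2,1)]) (simp add: W.vanish_def a(3))
  finally show ?thesis by (simp add: next_c_def)
 qed
qed

lemma next_e_vanish_weak:
 assumes v: "W.vanish p c" "V.vanish p e"
 shows "V.vanish p (next_e c e)" unfolding V.vanish_def next_e_def
 using V.vanishD[OF v(2)] V.vanishD[OF vanish_pull[OF vanish_hc[OF v]]] V.vanishD[OF V.vanish_D[OF HV.vanish_KK[OF v(2)]]] by simp

text \<open>The second component improves only once the first one vanishes on words of length \<open>p\<close>; so the filtration of each
  component goes up in every other step.\<close>

lemma next_e_vanish:
 assumes cc: "cone_cocycle c e" and v: "W.vanish (Suc p) c" "V.vanish p e"
 shows "V.vanish (Suc p) (next_e c e)" unfolding V.vanish_def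
proof (intro allI impI)
 fix w :: "('r, 'm) word" assume l: "length w < Suc p"
 have a: "W.MC c" "V.MC e" "!!w. W.D c w = 0" "!!w. V.D e w = pull c w" using cc by (simp_all add: cone_cocycle_def)
 have v': "W.vanish p c" using v(1) by (simp add: W.vanish_def)
 consider "length w < p" | "length w = p" "~ V.ok w" | "length w = p" "V.ok w" using l by linarith
 then show "next_e c e w = 0"
 proof cases
  case 1
  then show ?thesis using V.vanishD[OF next_e_vanish_weak[OF v' v(2)]] by simp
 next
  case 2
  then show ?thesis using V.MC_ok[OF a(2)] by (simp add: next_e_def V.D_def pull_def)
 next
  case 3
  have "V.D (HV.KK e) w = e w - e (map HV.lph w)"
  proof (rule HV.KK_leading[OF a(2) v(2) _ 3(2,1)])
   show "V.vanish (Suc p) (V.D e)" using vanish_pull[OF v(1)] a(4) by (simp add: V.vanish_def)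
  qed
  moreover have "pull (hc c e) w = e (map HV.lph w)" using 3 ok_F[OF 3(2)] W.vanishD[OF HW.vanish_KK[OF v(1)], of "map F w"]
   by (simp add: pull_def hc_def pullg_def o_def gL_F)
  ultimately show ?thesis by (simp add: next_e_def)
 qed
qed

primrec iter where
 "iter c e 0 = (c, e)"
| "iter c e (Suc j) = (next_c (fst (iter c e j)) (snd (iter c e j)), next_e (fst (iter c e j)) (snd (iter c e j)))"

lemma iter_cocycle:
 assumes "cone_cocycle c e"
 shows "cone_cocycle (fst (iter c e j)) (snd (iter c e j))
  & W.vanish (Suc j div 2) (fst (iter c e j)) & V.vanish (j div 2) (snd (iter c e j))"
proof (induction j)
 case 0
 then show ?case using assms by (simp add: W.vanish_def V.vanish_def)
next
 case (Suc j)
 let ?c = "fst (iter c e j)" and ?e = "snd (iter c e j)"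
 have cc: "cone_cocycle ?c ?e" and vc: "W.vanish (Suc j div 2) ?c" and ve: "V.vanish (j div 2) ?e" using Suc by auto
 have vc': "W.vanish (j div 2) ?c" using vc unfolding W.vanish_def by (meson Suc_n_not_le_n div_le_mono le_SucI less_le_trans order_refl)
 have s: "Suc (Suc j) div 2 = Suc (j div 2)" by simp
 show ?case
 proof (cases "even j")
  case True
  then have "Suc j div 2 = j div 2" by simp
  then show ?thesis using cone_cocycle_next[OF cc] next_c_vanish[OF cc vc' ve] next_e_vanish_weak[OF vc' ve] unfolding s by simp
 next
  case False
  then have "Suc j div 2 = Suc (j div 2)" by (auto elim!: oddE)
  then show ?thesis using cone_cocycle_next[OF cc] next_c_vanish[OF cc vc' ve] next_e_vanish[OF cc _ ve] vc unfolding s by simp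
 qed
qed

text \<open>The corrections are summed up. On a word of a given length only finitely many of them are not zero, so that the
  infinite sum is well defined, and the remainder vanishes on every word.\<close>

theorem cone_acyclic':
 fixes c :: "('r, 'k) word => 't::comm_ring_1"
 assumes "cone_cocycle c e"
 shows "\<exists>c' e'. W.MC c' & V.MC e' & (\<forall>w. W.D c' w = c w) & (\<forall>w. e w = pull c' w + V.D e' w)"
proof -
 define C where "C j = fst (iter c e j)" for j
 define E where "E j = snd (iter c e j)" for j
 have cc: "cone_cocycle (C j) (E j)" and vC: "W.vanish (j div 2) (C j)" and vE: "V.vanish (j div 2) (E j)" for j
 proof -
  show "cone_cocycle (C j) (E j)" "V.vanish (j div 2) (E j)" using iter_cocycle[OF assms, of j] by (simp_all add: C_def E_def)
  have "W.vanish (Suc j div 2) (C j)" using iter_cocycle[OF assms, of j] by (simp add: C_def)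
  moreover have "j div 2 \<le> Suc j div 2" by (simp add: div_le_mono)
  ultimately show "W.vanish (j div 2) (C j)" by (simp add: W.vanish_def)
 qed
 have m: "W.MC (C j)" "V.MC (E j)" for j using cc[of j] by (simp_all add: cone_cocycle_def)
 have C0: "C 0 = c" "E 0 = e" by (simp_all add: C_def E_def)
 have CS: "W.D (hc (C j) (E j)) w = C j w - C (Suc j) w" for j w by (simp add: C_def E_def next_c_def)
 have ES: "pull (hc (C j) (E j)) w + V.D (HV.KK (E j)) w = E j w - E (Suc j) w" for j w by (simp add: C_def E_def next_e_def)
 (* The j-th correction vanishes on words shorter than j div 2, so that the first 2 * length w + 2 of them suffice. *)
 define c' where "c' w = (\<Sum>j<2 * length w + 2. hc (C j) (E j) w)" for w
 define e' where "e' w = (\<Sum>j<2 * length w + 2. HV.KK (E j) w)" for w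
 have hc0: "hc (C j) (E j) w = 0" if "2 * length w + 2 \<le> j" for j w
  by (rule W.vanishD[OF vanish_hc[OF vC[of j] vE[of j]]]) (use that in linarith)
 have KK0: "HV.KK (E j) w = 0" if "2 * length w + 2 \<le> j" for j w
  by (rule V.vanishD[OF HV.vanish_KK[OF vE[of j]]]) (use that in linarith)
 have c'_eq: "c' v = (\<Sum>j<J. hc (C j) (E j) v)" if "2 * length v + 2 \<le> J" for v J
  unfolding c'_def by (rule sum.mono_neutral_left) (use that hc0 in auto)
 have e'_eq: "e' v = (\<Sum>j<J. HV.KK (E j) v)" if "2 * length v + 2 \<le> J" for v J
  unfolding e'_def by (rule sum.mono_neutral_left) (use that KK0 in auto)
 have Mc: "W.MC c'" unfolding W.MC_def
 proof (intro conjI allI impI)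
  show "c' w = 0" if "~ W.ok w" for w unfolding c'_def by (rule sum.neutral) (use W.MC_ok[OF MC_hc[OF m] that] in simp)
  fix X l l' Z assume l: "W.vl l & W.vl l' & same l l'"
  show "c' (X @ [W.ladd l l'] @ Z) = c' (X @ [l] @ Z) + c' (X @ [l'] @ Z)"
   using W.MC_add[OF MC_hc[OF m]] l by (simp add: c'_def sum.distrib)
 qed
 have Me: "V.MC e'" unfolding V.MC_def
 proof (intro conjI allI impI)
  show "e' w = 0" if "~ V.ok w" for w unfolding e'_def by (rule sum.neutral) (use V.MC_ok[OF HV.MC_KK[OF m(2)] that] in simp)
  fix X l l' Z assume l: "V.vl l & V.vl l' & same l l'"
  show "e' (X @ [V.ladd l l'] @ Z) = e' (X @ [l] @ Z) + e' (X @ [l'] @ Z)"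
   using V.MC_add[OF HV.MC_KK[OF m(2)]] l by (simp add: e'_def sum.distrib)
 qed
 have "W.D c' w = c w" for w
 proof -
  let ?J = "2 * length w + 2"
  have "W.D c' w = W.D (%v. \<Sum>j<?J. hc (C j) (E j) v) w" by (rule W.D_cong) (rule c'_eq, simp)
  also have "... = (\<Sum>j<?J. C j w - C (Suc j) w)" by (simp only: W.D_sum CS)
  also have "... = c w - C ?J w" unfolding C0(1)[symmetric] by (rule sum_lessThan_telescope')
  also have "C ?J w = 0" by (rule W.vanishD[OF vC[of ?J]]) simp
  finally show ?thesis by simp
 qed
 moreover have "e w = pull c' w + V.D e' w" for w
 proof -
  let ?J = "2 * length w + 2"
  have "V.D e' w = V.D (%v. \<Sum>j<?J. HV.KK (E j) v) w" by (rule V.D_cong) (rule e'_eq, simp)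
  moreover have "pull c' w = (\<Sum>j<?J. pull (hc (C j) (E j)) w)"
   using c'_eq[of "map F w" ?J] by (simp only: pull_sum[symmetric], simp only: pull_def length_map order_refl)
  ultimately have "pull c' w + V.D e' w = (\<Sum>j<?J. E j w - E (Suc j) w)" unfolding ES[symmetric] by (simp only: V.D_sum sum.distrib)
  also have "... = e w - E ?J w" unfolding C0(2)[symmetric] by (rule sum_lessThan_telescope')
  also have "E ?J w = 0" by (rule V.vanishD[OF vE[of ?J]]) simp
  finally show ?thesis by simp
 qed
 ultimately show ?thesis using Mc Me by blast
qed

end

context aug_map

begin

theorem cone_acyclic:
 fixes c :: "('r, 'k) word => 't::comm_ring_1"
 assumes "W.MC c" "V.MC e" "!!w. W.D c w = 0" "!!w. V.D e w = pull c w"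
 obtains c' e' where "W.MC c'" "V.MC e'" "!!w. W.D c' w = c w" "!!w. e w = pull c' w + V.D e' w"
proof -
 obtain g h k where "additive_homotopy_inverse V.M V.\<delta> W.M W.\<delta> f g h k"
  by (rule additive_homotopy_inverse_exists[OF V.R V.M W.M V.d_lin W.d_lin V.dd W.dd f_lin f_chain f_inj f_surj])
 then interpret aug_qi n V A0 eps W B0 eta f g h k by (intro aug_qi.intro aug_map_axioms)
 have "cone_cocycle c e" using assms by (simp add: cone_cocycle_def)
 from cone_acyclic'[OF this] show thesis using that by blast
qed

end

section \<open>Products of cycles\<close>

context valg

begin

lemma zero_if_functionals_vanish:
 assumes "z : carrier (M e)" "!!h :: 'm => 'r. additive_on (M e) h ==> h z = 0"
 shows "z = \<zero>`M e`"
proof (rule ccontr)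
 assume "z ~= \<zero>`M e`"
 then obtain h :: "'m => 'r" where h: "h z = 1"
  "!!u v. u : carrier (M e) ==> v : carrier (M e) ==> h (u \<oplus>`M e` v) = h u + h v"
  using additive_separating[OF R M assms(1)] by blast
 then have "h z = 0" using assms(2)[of h] by (simp add: additive_on_def)
 then show False using h by simp
qed

lemma \<delta>_closed: "x : carrier (M i) ==> \<delta> i x : carrier (M (i - 1))" by (rule linear_mapD(1)[OF d_lin])

lemma pair_relation:
 fixes h :: "'m => 'r"
 assumes x: "x : carrier (M i)" and y: "y : carrier (M j)" and e: "i + j - 1 = e" and h: "additive_on (M e) h"
 shows "h (mval V [(i - 1, \<delta> i x), (j, y)]) + ksg (i + 1) * h (mval V [(i, x), (j - 1, \<delta> j y)])
  + h (\<delta> (i + j) (mval V [(i, x), (j, y)])) = 0"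
proof -
 have e': "sdeg [(i, x), (j, y)] - 3 = e" using e by simp
 have b: "[(i, x), (j, y)] : hlists M" using x y by simp
 have z: "h (mval V (P @ [(- 2, \<zero>`M (- 2)`)] @ Q)) = 0" if "P @ Q = [(i, x), (j, y)]" for P Q
 proof -
  have PQ: "P : hlists M" "Q : hlists M" using b unfolding that[symmetric] by auto
  have "sdeg P + sdeg Q = i + j + 2" using arg_cong[OF that, of sdeg] by simp
  then have "mval V (P @ [(- 2, \<zero>`M (- 2)`)] @ Q) = \<zero>`M e`"
   by (intro mval_zero[OF PQ]) (use e in simp)
  then show ?thesis using additive_on_zero[OF M h] by simp
 qed
 have c: "mval V [(i, x), (j, y)] : carrier (M (i + j))" by (rule mval_closed'[OF b]) simp
 have "(\<Sum>(x, y, z)\<in>sp3 [(i, x), (j, y)]. ksg (sdeg x) * h (mval V (x @ [mh V y] @ z))) = 0"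
  by (rule A_infinity_relation[OF b]) (unfold e', rule h)
 then show ?thesis using x y z[of "[]" "[(i, x), (j, y)]"] z[of "[(i, x)]" "[(j, y)]"] z[of "[(i, x), (j, y)]" "[]"]
   mval_single[of "mval V [(i, x), (j, y)]" "i + j"] c
  by (simp add: sum_sp3_Cons sum_sp2_Cons mh_def mval_nil mval_single add.commute add.left_commute)
qed

text \<open>The relation of two letters, tested on additive functionals.\<close>

lemma product_of_cycles:
 assumes "x : cycles M \<delta> 0" "y : cycles M \<delta> 0"
 shows "mval V [(0, x), (0, y)] : cycles M \<delta> 0"
proof -
 have x: "x : carrier (M 0)" "\<delta> 0 x = \<zero>`M (- 1)`" and y: "y : carrier (M 0)" "\<delta> 0 y = \<zero>`M (- 1)`"
  using assms by (auto simp: cycles_def)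
 have c: "mval V [(0, x), (0, y)] : carrier (M 0)" by (rule mval_closed') (use x y in simp_all)
 have "\<delta> 0 (mval V [(0, x), (0, y)]) = \<zero>`M (- 1)`"
 proof (rule zero_if_functionals_vanish)
  show "\<delta> 0 (mval V [(0, x), (0, y)]) : carrier (M (- 1))" using \<delta>_closed[OF c] by simp
  fix h :: "'m => 'r" assume h: "additive_on (M (- 1)) h"
  have "mval V [(- 1, \<zero>`M (- 1)`), (0, y)] = \<zero>`M (- 1)`" "mval V [(0, x), (- 1, \<zero>`M (- 1)`)] = \<zero>`M (- 1)`"
   using mval_zero[of "[]" "[(0, y)]" "- 1" "- 1"] mval_zero[of "[(0, x)]" "[]" "- 1" "- 1"] x y by simp_all
  then show "h (\<delta> 0 (mval V [(0, x), (0, y)])) = 0" using pair_relation[OF x(1) y(1) _ h] x(2) y(2) additive_on_zero[OF M h] by simp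
 qed
 then show ?thesis using c by (simp add: cycles_def)
qed

lemma boundaryI: "c : carrier (M 1) ==> \<delta> 1 c : boundaries M \<delta> 0" by (auto simp: boundaries_def)

lemma boundary_neg:
 assumes "z : carrier (M 0)" "c : carrier (M 1)" "!!h :: 'm => 'r. additive_on (M 0) h ==> h z = h (\<delta> 1 c)"
 shows "z : boundaries M \<delta> 0"
proof -
 have dc: "\<delta> 1 c : carrier (M 0)" using \<delta>_closed[OF assms(2)] by simp
 have "z \<oplus>`M 0` \<ominus>`M 0` (\<delta> 1 c) = \<zero>`M 0`"
  by (rule zero_if_functionals_vanish) (use assms dc in \<open>simp_all add: mod_closed[OF M] additive_onD additive_on_neg[OF M]\<close>)
 then have "z = \<delta> 1 c" using mod_diff_zero[OF M assms(1) dc] by blast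
 then show ?thesis using boundaryI[OF assms(2)] by simp
qed

lemma product_with_boundary:
 assumes b: "b : boundaries M \<delta> 0" and y: "y : cycles M \<delta> 0"
 shows "mval V [(0, b), (0, y)] : boundaries M \<delta> 0" "mval V [(0, y), (0, b)] : boundaries M \<delta> 0"
proof -
 obtain c where c: "c : carrier (M 1)" "b = \<delta> 1 c" using b by (auto simp: boundaries_def)
 have y: "y : carrier (M 0)" "\<delta> 0 y = \<zero>`M (- 1)`" using y by (auto simp: cycles_def)
 have bc: "\<delta> 1 c : carrier (M 0)" using \<delta>_closed[OF c(1)] by simp
 have l: "mval V [(1, c), (0, y)] : carrier (M 1)" "mval V [(0, y), (1, c)] : carrier (M 1)"
  by (rule mval_closed', use c y in simp_all)+
 show "mval V [(0, b), (0, y)] : boundaries M \<delta> 0"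
 proof (rule boundary_neg)
  show "mval V [(0, b), (0, y)] : carrier (M 0)" by (rule mval_closed') (use bc c y in simp_all)
  show "\<ominus>`M 1` (mval V [(1, c), (0, y)]) : carrier (M 1)" using l by (simp add: mod_closed[OF M])
  fix h :: "'m => 'r" assume h: "additive_on (M 0) h"
  have "mval V [(1, c), (- 1, \<zero>`M (- 1)`)] = \<zero>`M 0`"
   using mval_zero[of "[(1, c)]" "[]" 0 "- 1"] c by simp
  moreover have "\<delta> 1 (\<ominus>`M 1` (mval V [(1, c), (0, y)])) = \<ominus>`M 0` (\<delta> 1 (mval V [(1, c), (0, y)]))"
   using linear_map_neg[OF M M d_lin l(1)] by simp
  ultimately show "h (mval V [(0, b), (0, y)]) = h (\<delta> 1 (\<ominus>`M 1` (mval V [(1, c), (0, y)])))"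
   using pair_relation[OF c(1) y(1) _ h] y(2) additive_on_zero[OF M h] additive_on_neg[OF M h] \<delta>_closed[OF l(1)] c(2)
   by (simp add: add_eq_0_iff2)
 qed
 show "mval V [(0, y), (0, b)] : boundaries M \<delta> 0"
 proof (rule boundary_neg)
  show "mval V [(0, y), (0, b)] : carrier (M 0)" by (rule mval_closed') (use bc c y in simp_all)
  show "mval V [(0, y), (1, c)] : carrier (M 1)" by (rule l)
  fix h :: "'m => 'r" assume h: "additive_on (M 0) h"
  have "mval V [(- 1, \<zero>`M (- 1)`), (1, c)] = \<zero>`M 0`"
   using mval_zero[of "[]" "[(1, c)]" 0 "- 1"] c by simp
  then show "h (mval V [(0, y), (0, b)]) = h (\<delta> 1 (mval V [(0, y), (1, c)]))"
   using pair_relation[OF y(1) c(1) _ h] y(2) additive_on_zero[OF M h] c(2) by simp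
 qed
qed

end

section \<open>The obstruction and its invariance\<close>

context aug

begin

definition obstruction :: bool where
 "obstruction \<longleftrightarrow> (\<exists>G G'. MC G & MC G' & (\<forall>w. D G w = 0) & (\<forall>w. D G' w = 0) &
  ~ (\<exists>\<gamma>. MC \<gamma> & (\<forall>w. D \<gamma> w = cc G G' w)))"

lemma cc_cong:
 assumes "!!x y z u v. [|ok (x @ y @ z); x ~= []; z ~= []; [u] : hlists M; [v] : hlists M|] ==>
   gr A' x v * gl A u z = gr G' x v * gl G u z + gr H' x v * gl H u z"
 shows "cc A A' w = cc G G' w + cc H H' w"
proof (cases "ok w & isGnd (hd w) & isGnd (last w)")
 case True
 have "(\<Sum>x@y@z=w. if x = [] \<or> z = [] then 0 else pairing (map hel y) (form A A' x z))
  = (\<Sum>x@y@z=w. (if x = [] \<or> z = [] then 0 else pairing (map hel y) (form G G' x z))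
    + (if x = [] \<or> z = [] then 0 else pairing (map hel y) (form H H' x z)))"
 proof (rule sum_sp3_cong, goal_cases)
  case (1 x y z)
  note xyz = 1
  show ?case
  proof (cases "x = [] \<or> z = []")
   case False
   have o: "ok (x @ y @ z)" using True xyz by simp
   have "pairing (map hel y) (form A A' x z) = pairing (map hel y) (%u v. form G G' x z u v + form H H' x z u v)"
    by (rule pairing_cong[OF ok_parts(3)[OF o]]) (use False assms[OF o] in \<open>simp_all add: form_def distrib_left\<close>)
   then show ?thesis using False by (simp add: pairing_add)
  qed simp
 qed
 then show ?thesis using True by (simp only: cc_def if_True simp_thms sum_sp3_add)
next
 case False
 then show ?thesis unfolding cc_def by (simp only: if_False add_0_left)
qed

lemma gl_add: "MC G ==> MC H ==> [u] : hlists M ==> gl (%w. G w + H w) u z = gl G u z + gl H u z"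
 unfolding gl_def by (rule lam_add) (rule gl_endo; assumption)+

lemma gr_add: "MC G ==> MC H ==> [v] : hlists M ==> gr (%w. G w + H w) x v = gr G x v + gr H x v"
 unfolding gr_def by (rule lam_add) (rule gr_endo; assumption)+

lemma cc_add_left: "MC G ==> MC H ==> cc (%w. G w + H w) G' w = cc G G' w + cc H G' w"
 by (rule cc_cong) (simp add: gl_add distrib_left)

lemma cc_add_right: "MC G' ==> MC H' ==> cc G (%w. G' w + H' w) w = cc G G' w + cc G H' w"
 by (rule cc_cong) (simp add: gr_add distrib_right)

lemma cc_zero_left: "cc (%w. 0) G' w = 0" using cc_add_left[OF MC_null MC_null, of G' w] by simp

lemma cc_zero_right: "cc G (%w. 0) w = 0" using cc_add_right[OF MC_null MC_null, of G w] by simp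

lemma tw_tw: "tw (tw c) = c" by (rule ext) (simp add: tw_def flip: mult.assoc)

lemma cc_cocycle:
 assumes "MC G" "MC G'" "!!w. D G w = 0" "!!w. D G' w = 0"
 shows "D (cc G G') w = 0"
proof -
 have "D G = (%w. 0)" "D G' = (%w. 0)" using assms by auto
 then show ?thesis using cc_Leibniz[OF assms(1,2), of w] by (simp add: cc_zero_left cc_zero_right)
qed

text \<open>By the product rule, a primitive of \<open>G\<close> can be multiplied by the cocycle \<open>G'\<close> to obtain a primitive of \<open>cc G G'\<close>.\<close>

lemma cc_boundary_left:
 assumes "MC h" "MC G'" "!!w. D G' w = 0"
 shows "\<exists>\<gamma>. MC \<gamma> & (\<forall>w. D \<gamma> w = cc (D h) G' w)"
proof (intro exI conjI allI)
 have z: "D (tw G') = (%w. 0)" using assms(3) D_tw[of G'] by (auto simp: tw_def)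
 let ?\<gamma> = "%w. 0 + ksg n * cc h (tw G') w"
 show "MC ?\<gamma>" by (rule MC_linear[OF MC_null MC_cc[OF assms(1) MC_tw[OF assms(2)]]])
 show "D ?\<gamma> w = cc (D h) G' w" for w unfolding D_linear cc_Leibniz[OF assms(1) MC_tw[OF assms(2)]] z tw_tw cc_zero_right D_zero
  by (simp flip: mult.assoc)
qed

lemma cc_boundary_right:
 assumes "MC G" "MC h'" "!!w. D G w = 0"
 shows "\<exists>\<gamma>. MC \<gamma> & (\<forall>w. D \<gamma> w = cc G (D h') w)"
proof (intro exI conjI allI)
 have z: "D G = (%w. 0)" using assms(3) by auto
 let ?\<gamma> = "%w. 0 + ksg n * cc G h' w"
 show "MC ?\<gamma>" by (rule MC_linear[OF MC_null MC_cc[OF assms(1,2)]])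
 show "D ?\<gamma> w = cc G (D h') w" for w unfolding D_linear cc_Leibniz[OF assms(1,2)] z cc_zero_left D_zero by (simp flip: mult.assoc)
qed

lemma MC_pull_back_sum:
 assumes "\<exists>\<gamma>. MC \<gamma> & (\<forall>w. D \<gamma> w = a w)" "\<exists>\<gamma>. MC \<gamma> & (\<forall>w. D \<gamma> w = b w)"
 shows "\<exists>\<gamma>. MC \<gamma> & (\<forall>w. D \<gamma> w = a w + b w)"
 by (smt (z3) assms MC_plus D_add)

end

context aug_map

begin

lemma pairing_map:
 assumes b: "b : hlists V.M" and \<beta>: "bilin W.M \<beta>"
 shows "W.pairing (map (hmap f) b) \<beta> = V.pairing b (%u v. \<beta> (hmap f u) (hmap f v))"
proof -
 have "teq W.M (lin_ext (%us. pt (map (hmap f) us)) (ops V [[], b])) (ops W [[], map (hmap f) b])"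
  using f_ops[of 2 "[[], b]"] b by (simp add: blocks_def)
 from teq_EV[OF this BF_balanced[OF W.M \<beta>]]
 have "W.pairing (map (hmap f) b) \<beta> = EV (%r us. BF W.M \<beta> r (map (hmap f) us)) (ops V [[], b])"
  by (simp add: W.pairing_def EV_lin_ext BF_coef_add coef_add_scale)
 also have "... = V.pairing b (%u v. \<beta> (hmap f u) (hmap f v))" unfolding V.pairing_def
 proof (rule EV_cong, goal_cases)
  case (1 w)
  from 1 obtain u v where w: "w = [u, v]" and uv: "[u] : hlists V.M" "[v] : hlists V.M" by (rule V.ops2_key[OF hlists_simps(1) b])
  then show ?case by (simp add: BF_def f_closed)
 qed
 finally show ?thesis .
qed

lemma gl_pull:
 assumes u: "[u] : hlists V.M" and o: "V.ok (Elt (fst u) (snd u) # z)"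
 shows "V.gl (pull G) u z = W.gl G (hmap f u) (map F z)"
proof -
 have "V.ok (Elt (fst u) (t \<odot>`V.M (fst u)` snd u) # z)" for t
  using o u wd_replace[of "Elt (fst u) (t \<odot>`V.M (fst u)` snd u)" "Elt (fst u) (snd u)" "[]" z]
  by (simp add: V.ok_def mod_closed[OF V.M])
 then show ?thesis using u by (simp add: V.gl_def W.gl_def pull_def f_smult)
qed

lemma gr_pull:
 assumes v: "[v] : hlists V.M" and o: "V.ok (x @ [Elt (fst v) (snd v)])"
 shows "V.gr (pull G) x v = W.gr G (map F x) (hmap f v)"
proof -
 have "V.ok (x @ [Elt (fst v) (t \<odot>`V.M (fst v)` snd v)])" for t
  using o v wd_replace[of "Elt (fst v) (t \<odot>`V.M (fst v)` snd v)" "Elt (fst v) (snd v)" x "[]"]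
  by (simp add: V.ok_def mod_closed[OF V.M])
 then show ?thesis using v by (simp add: V.gr_def W.gr_def pull_def f_smult)
qed

text \<open>A morphism carries the copairing of the source to that of the target.\<close>

lemma cc_pull:
 assumes G: "W.MC G" "W.MC G'"
 shows "V.cc (pull G) (pull G') w = pull (W.cc G G') w"
proof (cases "V.ok w & isGnd (hd w) & isGnd (last w)")
 case True
 then have ne: "w ~= []" by (auto simp: V.ok_def wd_iff)
 have e: "isGnd (hd (map F w))" "isGnd (last (map F w))" using True ne by (simp_all add: hd_map last_map)
 have "W.cc G G' (map F w) = (\<Sum>x@y@z=w. if map F x = [] \<or> map F z = [] then 0
   else W.pairing (map hel (map F y)) (W.form G G' (map F x) (map F z)))"
  using True e ok_F[of w] by (simp only: W.cc_def sum_sp3_map if_True simp_thms)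
 also have "... = (\<Sum>x@y@z=w. if x = [] \<or> z = [] then 0 else V.pairing (map hel y) (V.form (pull G) (pull G') x z))"
 proof (rule sum_sp3_cong, goal_cases)
  case (1 x y z)
  note xyz = 1
  show ?case
  proof (cases "x = [] \<or> z = []")
   case False
   have o: "V.ok (x @ y @ z)" using True xyz by simp
   have xz: "x ~= []" "z ~= []" using False by auto
   note p = V.ok_parts[OF o xz]
   have "map hel (map F y) = map (hmap f) (map hel y)" by (rule hel_F[OF p(2)]) (use V.mids_ex[OF p(1)] in simp)
   then have "W.pairing (map hel (map F y)) (W.form G G' (map F x) (map F z))
    = V.pairing (map hel y) (%u v. W.form G G' (map F x) (map F z) (hmap f u) (hmap f v))"
    by (simp only: pairing_map[OF p(3) W.form_bilin[OF G]])
   also have "... = V.pairing (map hel y) (V.form (pull G) (pull G') x z)" by (rule V.pairing_cong[OF p(3)])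
     (simp add: V.form_def W.form_def gl_pull V.ok_end(2)[OF o xz] gr_pull V.ok_end(1)[OF o xz] del: hlists_simps)
   finally show ?thesis using False by simp
  qed auto
 qed
 finally show ?thesis using True by (simp add: V.cc_def pull_def)
next
 case False
 show ?thesis
 proof (cases "V.ok w")
  case True
  then have ne: "w ~= []" by (auto simp: V.ok_def wd_iff)
  then have "~ (isGnd (hd (map F w)) & isGnd (last (map F w)))" using True False by (simp add: hd_map last_map)
  then have "W.cc G G' (map F w) = 0" unfolding W.cc_def by meson
  moreover have "V.cc (pull G) (pull G') w = 0" using False unfolding V.cc_def by meson
  ultimately show ?thesis by (simp add: pull_def)
 qed (simp add: V.cc_def pull_def)
qed

text \<open>A primitive of the pulled back product makes the product a cocycle of the acyclic cone, and hence a coboundary.\<close>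

lemma obstruction_pull_back:
 assumes "W.obstruction"
 shows "V.obstruction"
proof -
 obtain G G' where G: "W.MC G" "W.MC G'" "!!w. W.D G w = 0" "!!w. W.D G' w = 0"
  and N: "~ (\<exists>\<gamma>. W.MC \<gamma> & (\<forall>w. W.D \<gamma> w = W.cc G G' w))"
  using assms unfolding W.obstruction_def by blast
 have z: "pull (%w. 0) w = 0" for w by (simp add: pull_def)
 have D: "W.D G = (%w. 0)" "W.D G' = (%w. 0)" using G by auto
 have "~ (\<exists>\<gamma>. V.MC \<gamma> & (\<forall>w. V.D \<gamma> w = V.cc (pull G) (pull G') w))"
 proof
  assume "\<exists>\<gamma>. V.MC \<gamma> & (\<forall>w. V.D \<gamma> w = V.cc (pull G) (pull G') w)"
  then obtain \<gamma> where g: "V.MC \<gamma>" "!!w. V.D \<gamma> w = pull (W.cc G G') w" unfolding cc_pull[OF G(1,2)] by blast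
  show False
  by (metis cone_acyclic[OF W.MC_cc[OF G(1,2)] g(1) W.cc_cocycle[OF G] g(2)] N )
 qed
 then show ?thesis unfolding V.obstruction_def
  using MC_pull[OF G(1)] MC_pull[OF G(2)] by (intro exI[of _ "pull G"] exI[of _ "pull G'"]) (simp add: D_pull D z)
qed

text \<open>Cocycles on the source are cohomologous to pulled back ones, and products of cohomologous cocycles are
  cohomologous.\<close>

lemma obstruction_push_forward:
 assumes "V.obstruction"
 shows "W.obstruction"
proof -
 obtain G G' where G: "V.MC G" "V.MC G'" "!!w. V.D G w = 0" "!!w. V.D G' w = 0"
  and N: "~ (\<exists>\<gamma>. V.MC \<gamma> & (\<forall>w. V.D \<gamma> w = V.cc G G' w))"
  using assms unfolding V.obstruction_def by blast
 have z: "pull (%w. 0) w = 0" for w by (simp add: pull_def)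
 have ext: "\<exists>H h. W.MC H & V.MC h & (\<forall>w. W.D H w = 0) & K = (%w. pull H w + V.D h w)"
  if K: "V.MC K" "!!w. V.D K w = 0" for K :: "('r, 'm) word => 'r"
 proof (rule cone_acyclic[of "%w. 0" K])
  fix H h assume "W.MC H" "V.MC h" "!!w. W.D H w = (0 :: 'r)" "!!w. K w = pull H w + V.D h w"
  then show ?thesis by (intro exI[of _ H] exI[of _ h]) auto
 qed (simp_all add: W.MC_null K W.D_zero z)
 obtain H h where H: "W.MC H" "V.MC h" "!!w. W.D H w = 0" "G = (%w. pull H w + V.D h w)" using ext[OF G(1,3)] by blast
 obtain H' h' where H': "W.MC H'" "V.MC h'" "!!w. W.D H' w = 0" "G' = (%w. pull H' w + V.D h' w)" using ext[OF G(2,4)] by blast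
 have D0: "W.D H = (%w. 0)" "W.D H' = (%w. 0)" using H(3) H'(3) by auto
 have "~ (\<exists>\<gamma>. W.MC \<gamma> & (\<forall>w. W.D \<gamma> w = W.cc H H' w))"
 proof
  assume "\<exists>\<gamma>. W.MC \<gamma> & (\<forall>w. W.D \<gamma> w = W.cc H H' w)"
  then obtain \<gamma> where g: "W.MC \<gamma>" "!!w. W.D \<gamma> w = W.cc H H' w" by blast
  have 1: "\<exists>\<gamma>. V.MC \<gamma> & (\<forall>w. V.D \<gamma> w = V.cc (pull H) (pull H') w)"
   using MC_pull[OF g(1)] g(2) by (intro exI[of _ "pull \<gamma>"]) (simp add: D_pull cc_pull[OF H(1) H'(1)] pull_def)
  have 2: "\<exists>\<gamma>. V.MC \<gamma> & (\<forall>w. V.D \<gamma> w = V.cc (pull H) (V.D h') w)"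
   by (rule V.cc_boundary_right[OF MC_pull[OF H(1)] H'(2)]) (simp add: D_pull D0 z)
  have 3: "\<exists>\<gamma>. V.MC \<gamma> & (\<forall>w. V.D \<gamma> w = V.cc (V.D h) G' w)"
   by (rule V.cc_boundary_left[OF H(2) G(2,4)])
  have "V.cc G G' w = V.cc (pull H) G' w + V.cc (V.D h) G' w" for w
   unfolding H(4) by (rule V.cc_add_left[OF MC_pull[OF H(1)] V.MC_D[OF H(2)]])
  moreover have "V.cc (pull H) G' w = V.cc (pull H) (pull H') w + V.cc (pull H) (V.D h') w" for w
   unfolding H'(4) by (rule V.cc_add_right[OF MC_pull[OF H'(1)] V.MC_D[OF H'(2)]])
  ultimately show False using N V.MC_pull_back_sum[OF V.MC_pull_back_sum[OF 1 2] 3] by simp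
 qed
 then show ?thesis unfolding W.obstruction_def using H(1,3) H'(1,3) by blast
qed

end

text \<open>Quantifying over the augmentations removes the choice of one.\<close>

definition obstructed :: "int => ('r::comm_ring_1, 'm) vinf => bool" where
 "obstructed n V \<longleftrightarrow> (\<exists>A0 eps. aug n V A0 eps & aug.obstruction n V A0 eps)"

context quasi_isomorphism

begin

lemma f_cycle: "x : cycles V.M V.\<delta> i ==> f i x : cycles W.M W.\<delta> i"
 using f_chain[of x i] f_zero[of "i - 1"] by (auto simp: cycles_def f_closed)

lemma f_boundary: "x : boundaries V.M V.\<delta> 0 ==> f 0 x : boundaries W.M W.\<delta> 0"
 using f_chain[of _ 1] W.boundaryI by (force simp: boundaries_def f_closed)

lemma aug_pull_back:
 assumes "aug n W B0 eta"
 shows "aug_map n V {x : cycles V.M V.\<delta> 0. f 0 x : B0} (%x. eta (f 0 x)) W B0 eta f"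
proof -
 interpret W': aug n W B0 eta by (rule assms)
 let ?A = "{x : cycles V.M V.\<delta> 0. f 0 x : B0}"
 have fc: "x : carrier (V.M 0)" "V.\<delta> 0 x = \<zero>`V.M (- 1)`" if "x : ?A" for x
  using that by (auto simp: cycles_def)
 have m: "f 0 (mval V [(0, x), (0, y)]) = mval W [(0, f 0 x), (0, f 0 y)]" if "x : ?A" "y : ?A" for x y
  using f_mval[of "[(0, x), (0, y)]" 0] fc that by (simp add: hmap_def)
 have "aug n V ?A (%x. eta (f 0 x))"
 proof
  show "qsubspace (V.M 0) ?A" unfolding qsubspace_def
  proof (intro conjI ballI)
   show "?A \<subseteq> carrier (V.M 0)" using fc(1) by blast
   show "\<zero>`V.M 0` : ?A" using linear_map_zero[OF V.M V.M V.d_lin, of 0] qsubspaceD(2)[OF W'.A0_sub]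
    by (simp add: cycles_def mod_closed[OF V.M] f_zero)
   show "x \<oplus>`V.M 0` y : ?A" if "x : ?A" "y : ?A" for x y
    using that fc[OF that(1)] fc[OF that(2)] qsubspaceD(3)[OF W'.A0_sub, of "f 0 x" "f 0 y"] linear_mapD(2)[OF V.d_lin, of x 0 y]
    by (simp add: cycles_def mod_closed[OF V.M] f_add mod_laws(3)[OF V.M])
   show "q \<odot>`V.M 0` x : ?A" if "q : rationals" "x : ?A" for q x
    using that fc[OF that(2)] qsubspaceD(4)[OF W'.A0_sub, of q "f 0 x"] linear_mapD(3)[OF V.d_lin, of x 0 q]
    by (simp add: cycles_def mod_closed[OF V.M] f_smult mod_laws(12)[OF V.M])
  qed
  show "?A \<subseteq> cycles V.M V.\<delta> 0" by blast
  show "boundaries V.M V.\<delta> 0 \<subseteq> ?A"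
  proof
   fix x assume x: "x : boundaries V.M V.\<delta> 0"
   then obtain c where c: "c : carrier (V.M 1)" "x = V.\<delta> 1 c" by (auto simp: boundaries_def)
   then have "x : cycles V.M V.\<delta> 0" using V.dd[OF c(1)] V.\<delta>_closed[OF c(1)] by (simp add: cycles_def)
   then show "x : ?A" using f_boundary[OF x] W'.A0_bd by blast
  qed
  show "eta (f 0 (x \<oplus>`V.M 0` y)) = eta (f 0 x) + eta (f 0 y)" if "x : ?A" "y : ?A" for x y
   using that fc[OF that(1)] fc[OF that(2)] W'.eps_add by (simp add: f_add)
  show "eta (f 0 x) = 0" if "x : boundaries V.M V.\<delta> 0" for x by (rule W'.eps_bd[OF f_boundary[OF that]])
  show "mval V [(0, x), (0, y)] : ?A" if "x : ?A" "y : ?A" for x y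
   using V.product_of_cycles[of x y] W'.A0_mult[of "f 0 x" "f 0 y"] m[OF that] that by simp
  show "eta (f 0 (mval V [(0, x), (0, y)])) = eta (f 0 x) * eta (f 0 y)" if "x : ?A" "y : ?A" for x y
   using W'.eps_mult[of "f 0 x" "f 0 y"] m[OF that] that by simp
 qed
 then show ?thesis by (intro aug_map.intro aug_map_axioms.intro assms quasi_isomorphism_axioms refl) simp_all
qed

text \<open>The new augmentation is defined on \<open>f A0 + boundaries\<close> by \<open>f x + b \<mapsto> eps x\<close>. It is well defined because \<open>f\<close> is
  injective on homology, and multiplicative because a product of a cycle and a boundary is a boundary.\<close>

lemma aug_push_forward:
 assumes "aug n V A0 eps"
 obtains B0 eta where "aug_map n V A0 eps W B0 eta f"
proof -
 interpret V': aug n V A0 eps by (rule assms)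
 note A0c = qsubspaceD(1)[OF V'.A0_sub]
 let ?bd = "boundaries W.M W.\<delta> 0"
 define B0 where "B0 = {f 0 x \<oplus>`W.M 0` b | x b. x : A0 & b : ?bd}"
 define eta where "eta y = eps (SOME x. x : A0 & (\<exists>b\<in>?bd. y = f 0 x \<oplus>`W.M 0` b))" for y
 have fA: "f 0 x : carrier (W.M 0)" if "x : A0" for x by (rule f_closed[OF A0c[OF that]])
 have bc: "b : carrier (W.M 0)" if "b : ?bd" for b using that W.\<delta>_closed[of _ 1] by (auto simp: boundaries_def)
 have bcy: "b : cycles W.M W.\<delta> 0" if "b : ?bd" for b
  using that bc[OF that] W.dd[of _ 1] by (auto simp: boundaries_def cycles_def)
 have bd_add: "b \<oplus>`W.M 0` b' : ?bd" if bb: "b : ?bd" "b' : ?bd" for b b'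
 proof -
  obtain c c' where c: "c : carrier (W.M 1)" "c' : carrier (W.M 1)" "b = W.\<delta> 1 c" "b' = W.\<delta> 1 c'"
   using bb by (auto simp: boundaries_def)
  then have "b \<oplus>`W.M 0` b' = W.\<delta> 1 (c \<oplus>`W.M 1` c')" using linear_mapD(2)[OF W.d_lin, of c 1 c'] by simp
  then show ?thesis using W.boundaryI[of "c \<oplus>`W.M 1` c'"] c by (simp add: mod_closed[OF W.M])
 qed
 have bd_smult: "r \<odot>`W.M 0` b : ?bd" if bb: "b : ?bd" for b r
 proof -
  obtain c where c: "c : carrier (W.M 1)" "b = W.\<delta> 1 c" using bb by (auto simp: boundaries_def)
  then have "r \<odot>`W.M 0` b = W.\<delta> 1 (r \<odot>`W.M 1` c)" using linear_mapD(3)[OF W.d_lin, of c 1 r] by simp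
  then show ?thesis using W.boundaryI[of "r \<odot>`W.M 1` c"] c by (simp add: mod_closed[OF W.M])
 qed
 have bd_neg: "\<ominus>`W.M 0` b : ?bd" if bb: "b : ?bd" for b
  using bd_smult[OF bb, of "- 1"] bc[OF bb] by (simp add: mod_laws(13)[OF W.M] mod_laws(10)[OF W.M])
 have bd_zero: "\<zero>`W.M 0` : ?bd"
  using W.boundaryI[of "\<zero>`W.M 1`"] linear_map_zero[OF W.M W.M W.d_lin, of 1] by (simp add: mod_closed[OF W.M])
 have A0_neg: "\<ominus>`V.M 0` x : A0" if "x : A0" for x by (rule qsubspace_neg[OF V.M V'.A0_sub that])
 have diff: "x \<oplus>`V.M 0` \<ominus>`V.M 0` x' : boundaries V.M V.\<delta> 0"
  if x: "x : cycles V.M V.\<delta> 0" "x' : A0" and b: "b : ?bd" "b' : ?bd"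
   and e: "f 0 x \<oplus>`W.M 0` b = f 0 x' \<oplus>`W.M 0` b'" for x x' b b'
 proof (rule f_inj)
  have xc: "x : carrier (V.M 0)" "x' : carrier (V.M 0)" using x A0c by (auto simp: cycles_def)
  have fx: "f 0 x : carrier (W.M 0)" "f 0 x' : carrier (W.M 0)" using xc by (simp_all add: f_closed)
  have n': "\<ominus>`V.M 0` x' : cycles V.M V.\<delta> 0" using A0_neg[OF x(2)] V'.A0_cycles by blast
  show "x \<oplus>`V.M 0` \<ominus>`V.M 0` x' : cycles V.M V.\<delta> 0"
   using x(1) n' linear_mapD(2)[OF V.d_lin, of x 0 "\<ominus>`V.M 0` x'"] by (simp add: cycles_def mod_closed[OF V.M] mod_laws(3)[OF V.M])
  have "f 0 (x \<oplus>`V.M 0` \<ominus>`V.M 0` x') = f 0 x \<oplus>`W.M 0` \<ominus>`W.M 0` f 0 x'"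
   using xc by (simp add: f_add mod_closed[OF V.M] linear_map_neg[OF V.M W.M f_lin])
  also have "... = ((f 0 x \<oplus>`W.M 0` b) \<oplus>`W.M 0` \<ominus>`W.M 0` b) \<oplus>`W.M 0` \<ominus>`W.M 0` f 0 x'"
   using fx bc[OF b(1)] by (simp add: mod_closed[OF W.M] mod_laws(2,4,5)[OF W.M])
  also have "... = b' \<oplus>`W.M 0` \<ominus>`W.M 0` b" unfolding e using fx bc[OF b(1)] bc[OF b(2)]
   by (simp add: mod_closed[OF W.M] mod_laws(2,4,5)[OF W.M] mod_laws(17)[OF W.M, of "f 0 x'"])
  finally show "f 0 (x \<oplus>`V.M 0` \<ominus>`V.M 0` x') : ?bd" using bd_add[OF b(2) bd_neg[OF b(1)]] by simp
 qed
 have eps_bd: "eps x = eps x'" if x: "x : A0" "x' : A0" "x \<oplus>`V.M 0` \<ominus>`V.M 0` x' : boundaries V.M V.\<delta> 0" for x x'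
 using V'.eps_add[OF qsubspaceD(3)[OF V'.A0_sub x(1) A0_neg[OF x(2)]] x(2)] A0c[OF x(1)] A0c[OF x(2)] V'.eps_bd[OF x(3)] by (simp add: mod_closed[OF V.M] mod_laws(2,4,6)[OF V.M])
 have eta: "eta (f 0 x \<oplus>`W.M 0` b) = eps x" if x: "x : A0" "b : ?bd" for x b
 proof -
  let ?P = "%x'. x' : A0 & (\<exists>b'\<in>?bd. f 0 x \<oplus>`W.M 0` b = f 0 x' \<oplus>`W.M 0` b')"
  have "?P x" using x by blast
  then have "?P (Eps ?P)" by (rule someI)
  then obtain b' where b': "Eps ?P : A0" "b' : ?bd" "f 0 x \<oplus>`W.M 0` b = f 0 (Eps ?P) \<oplus>`W.M 0` b'" by blast
  have xc: "x : cycles V.M V.\<delta> 0" using x(1) V'.A0_cycles by blast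
  show ?thesis unfolding eta_def using eps_bd[OF x(1) b'(1) diff[OF xc b'(1) x(2) b'(2,3)]] by simp
 qed
 have B0I: "f 0 x \<oplus>`W.M 0` b : B0" if "x : A0" "b : ?bd" for x b using that unfolding B0_def by blast
 have f0: "f 0 x \<oplus>`W.M 0` \<zero>`W.M 0` = f 0 x" if "x : A0" for x by (rule mod_laws(4)[OF W.M fA[OF that]])
 have z0: "f 0 \<zero>`V.M 0` \<oplus>`W.M 0` b = b" if "b : ?bd" for b using bc[OF that] by (simp add: f_zero mod_laws(3)[OF W.M])
 note A0z = qsubspaceD(2)[OF V'.A0_sub]
 have prod: "\<exists>b\<in>?bd. mval W [(0, f 0 x \<oplus>`W.M 0` b1), (0, f 0 x' \<oplus>`W.M 0` b2)] = f 0 (mval V [(0, x), (0, x')]) \<oplus>`W.M 0` b"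
  if x: "x : A0" "x' : A0" and b: "b1 : ?bd" "b2 : ?bd" for x x' b1 b2
 proof -
  let ?p = "%y z. mval W [(0, y), (0, z)]"
  have fx: "f 0 x : carrier (W.M 0)" "f 0 x' : carrier (W.M 0)" using fA x by auto
  have fcy: "f 0 x : cycles W.M W.\<delta> 0" "f 0 x' : cycles W.M W.\<delta> 0" using f_cycle x V'.A0_cycles by blast+
  have b12: "b1 : carrier (W.M 0)" "b2 : carrier (W.M 0)" using bc b by auto
  have y: "f 0 x' \<oplus>`W.M 0` b2 : cycles W.M W.\<delta> 0"
   using fcy(2) bcy[OF b(2)] linear_mapD(2)[OF W.d_lin, of "f 0 x'" 0 b2] by (simp add: cycles_def mod_closed[OF W.M] mod_laws(3)[OF W.M])
  then have yc: "f 0 x' \<oplus>`W.M 0` b2 : carrier (W.M 0)" by (simp add: cycles_def)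
  have "?p (f 0 x \<oplus>`W.M 0` b1) (f 0 x' \<oplus>`W.M 0` b2) = ?p (f 0 x) (f 0 x' \<oplus>`W.M 0` b2) \<oplus>`W.M 0` ?p b1 (f 0 x' \<oplus>`W.M 0` b2)"
   using W.mval_add(1)[of "[]" "[(0, f 0 x' \<oplus>`W.M 0` b2)]" "f 0 x" 0 b1 0] fx b12 yc by simp
  also have "?p (f 0 x) (f 0 x' \<oplus>`W.M 0` b2) = ?p (f 0 x) (f 0 x') \<oplus>`W.M 0` ?p (f 0 x) b2"
   using W.mval_add(1)[of "[(0, f 0 x)]" "[]" "f 0 x'" 0 b2 0] fx b12 by simp
  also have "?p (f 0 x) (f 0 x') = f 0 (mval V [(0, x), (0, x')])" using f_mval[of "[(0, x), (0, x')]" 0] A0c x by (simp add: hmap_def)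
  finally have e: "?p (f 0 x \<oplus>`W.M 0` b1) (f 0 x' \<oplus>`W.M 0` b2)
   = (f 0 (mval V [(0, x), (0, x')]) \<oplus>`W.M 0` ?p (f 0 x) b2) \<oplus>`W.M 0` ?p b1 (f 0 x' \<oplus>`W.M 0` b2)" .
  have pb: "?p (f 0 x) b2 : ?bd" "?p b1 (f 0 x' \<oplus>`W.M 0` b2) : ?bd"
   using W.product_with_boundary b fcy y by auto
  show ?thesis by (rule bexI[OF _ bd_add[OF pb]])
    (use e fA[OF V'.A0_mult[OF x]] bc[OF pb(1)] bc[OF pb(2)] in \<open>simp add: mod_laws(2)[OF W.M]\<close>)
 qed
 have augW: "aug n W B0 eta"
 proof
  show "qsubspace (W.M 0) B0" unfolding qsubspace_def
  proof (intro conjI ballI)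
   show "B0 \<subseteq> carrier (W.M 0)" unfolding B0_def using fA bc mod_closed(1)[OF W.M] by blast
   show "\<zero>`W.M 0` : B0" using B0I[OF A0z bd_zero] z0[OF bd_zero] by simp
   show "y \<oplus>`W.M 0` y' : B0" if yy: "y : B0" "y' : B0" for y y'
   proof -
    obtain x b x' b' where 1: "y = f 0 x \<oplus>`W.M 0` b" "y' = f 0 x' \<oplus>`W.M 0` b'" "x : A0" "b : ?bd" "x' : A0" "b' : ?bd"
     using yy unfolding B0_def by blast
    have "y \<oplus>`W.M 0` y' = f 0 (x \<oplus>`V.M 0` x') \<oplus>`W.M 0` (b \<oplus>`W.M 0` b')"
     using 1 mod_add4[OF W.M fA[OF 1(3)] bc[OF 1(4)] fA[OF 1(5)] bc[OF 1(6)]] A0c by (simp add: f_add)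
    then show ?thesis using B0I[OF qsubspaceD(3)[OF V'.A0_sub 1(3,5)] bd_add[OF 1(4,6)]] by simp
   qed
   show "q \<odot>`W.M 0` y : B0" if q: "q : rationals" and yy: "y : B0" for q y
   proof -
    obtain x b where 1: "y = f 0 x \<oplus>`W.M 0` b" "x : A0" "b : ?bd" using yy unfolding B0_def by blast
    have "q \<odot>`W.M 0` y = f 0 (q \<odot>`V.M 0` x) \<oplus>`W.M 0` (q \<odot>`W.M 0` b)"
     using 1 fA bc A0c by (simp add: mod_laws(8)[OF W.M] f_smult)
    then show ?thesis using B0I[OF qsubspaceD(4)[OF V'.A0_sub q 1(2)] bd_smult[OF 1(3)]] by simp
   qed
  qed
  show "B0 \<subseteq> cycles W.M W.\<delta> 0"
  proof
   fix y assume "y : B0"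
   then obtain x b where 1: "y = f 0 x \<oplus>`W.M 0` b" "x : A0" "b : ?bd" unfolding B0_def by blast
   have "f 0 x : cycles W.M W.\<delta> 0" using f_cycle 1(2) V'.A0_cycles by blast
   then show "y : cycles W.M W.\<delta> 0"
    using bcy[OF 1(3)] linear_mapD(2)[OF W.d_lin, of "f 0 x" 0 b] 1(1) by (simp add: cycles_def mod_closed[OF W.M] mod_laws(3)[OF W.M])
  qed
  show "?bd \<subseteq> B0" using B0I[OF A0z] z0 by force
  show "eta y = 0" if y: "y : ?bd" for y using eta[OF A0z y] z0[OF y] V'.eps_zero by simp
  show "eta (y \<oplus>`W.M 0` y') = eta y + eta y'" if yy: "y : B0" "y' : B0" for y y'
  proof -
   obtain x b x' b' where 1: "y = f 0 x \<oplus>`W.M 0` b" "y' = f 0 x' \<oplus>`W.M 0` b'" "x : A0" "b : ?bd" "x' : A0" "b' : ?bd"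
    using yy unfolding B0_def by blast
   have "y \<oplus>`W.M 0` y' = f 0 (x \<oplus>`V.M 0` x') \<oplus>`W.M 0` (b \<oplus>`W.M 0` b')"
    using 1 mod_add4[OF W.M fA[OF 1(3)] bc[OF 1(4)] fA[OF 1(5)] bc[OF 1(6)]] A0c by (simp add: f_add)
   then show ?thesis
    using eta[OF qsubspaceD(3)[OF V'.A0_sub 1(3,5)] bd_add[OF 1(4,6)]] eta[OF 1(3,4)] eta[OF 1(5,6)] V'.eps_add[OF 1(3,5)] 1(1,2) by simp
  qed
  show "mval W [(0, y), (0, y')] : B0" "eta (mval W [(0, y), (0, y')]) = eta y * eta y'" if yy: "y : B0" "y' : B0" for y y'
  proof -
   obtain x b x' b' where 1: "y = f 0 x \<oplus>`W.M 0` b" "y' = f 0 x' \<oplus>`W.M 0` b'" "x : A0" "b : ?bd" "x' : A0" "b' : ?bd"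
    using yy unfolding B0_def by blast
   obtain c where c: "c : ?bd" "mval W [(0, y), (0, y')] = f 0 (mval V [(0, x), (0, x')]) \<oplus>`W.M 0` c"
    using prod[OF 1(3,5,4,6)] unfolding 1(1,2) by blast
   show "mval W [(0, y), (0, y')] : B0" unfolding c(2) by (rule B0I[OF V'.A0_mult[OF 1(3,5)] c(1)])
   show "eta (mval W [(0, y), (0, y')]) = eta y * eta y'"
    unfolding c(2) eta[OF V'.A0_mult[OF 1(3,5)] c(1)] unfolding 1(1,2) eta[OF 1(3,4)] eta[OF 1(5,6)] by (rule V'.eps_mult[OF 1(3,5)])
  qed
 qed
 have A0: "A0 = {x : cycles V.M V.\<delta> 0. f 0 x : B0}"
 proof (intro equalityI subsetI)
  fix x assume x: "x : A0"
  then show "x : {x : cycles V.M V.\<delta> 0. f 0 x : B0}" using V'.A0_cycles B0I[OF x bd_zero] f0[OF x] by auto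
 next
  fix x assume "x : {x : cycles V.M V.\<delta> 0. f 0 x : B0}"
  then have x: "x : cycles V.M V.\<delta> 0" and "f 0 x : B0" by auto
  then obtain x' b where 1: "f 0 x = f 0 x' \<oplus>`W.M 0` b" "x' : A0" "b : ?bd" unfolding B0_def by blast
  have xc: "x : carrier (V.M 0)" "x' : carrier (V.M 0)" using x A0c[OF 1(2)] by (auto simp: cycles_def)
  have "f 0 x \<oplus>`W.M 0` \<zero>`W.M 0` = f 0 x' \<oplus>`W.M 0` b" using 1(1) f_closed[OF xc(1)] by (simp add: mod_laws(4)[OF W.M])
  from diff[OF x 1(2) bd_zero 1(3) this] have "x \<oplus>`V.M 0` \<ominus>`V.M 0` x' : A0" using V'.A0_bd by blast
  from qsubspaceD(3)[OF V'.A0_sub this 1(2)] show "x : A0" using xc by (simp add: mod_closed[OF V.M] mod_laws(2,4,6)[OF V.M])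
 qed
 have "aug_map n V A0 eps W B0 eta f" by (intro aug_map.intro aug_map_axioms.intro assms augW quasi_isomorphism_axioms A0)
   (use eta[OF _ bd_zero] f0 in force)
 then show thesis by (rule that)
qed

theorem obstructed_iff: "obstructed n V \<longleftrightarrow> obstructed n W"
proof
 assume "obstructed n V"
 then obtain A0 eps where a: "aug n V A0 eps" "aug.obstruction n V A0 eps" unfolding obstructed_def by blast
 obtain B0 eta where "aug_map n V A0 eps W B0 eta f" by (rule aug_push_forward[OF a(1)])
 then interpret aug_map n V A0 eps W B0 eta f .
 show "obstructed n W" unfolding obstructed_def using obstruction_push_forward[OF a(2)] W.aug_axioms by blast
next
 assume "obstructed n W"
 then obtain B0 eta where a: "aug n W B0 eta" "aug.obstruction n W B0 eta" unfolding obstructed_def by blast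
 interpret aug_map n V "{x : cycles V.M V.\<delta> 0. f 0 x : B0}" "%x. eta (f 0 x)" W B0 eta f
  by (rule aug_pull_back[OF a(1)])
 show "obstructed n V" unfolding obstructed_def using obstruction_pull_back[OF a(2)] V.aug_axioms by blast
qed

end

section \<open>Chains with a basis\<close>

text \<open>The augmentation of a complex with a basis in every degree.\<close>

definition csum :: "('k \<Rightarrow>\<^sub>0 'r::comm_ring_1) => 'r" where
 "csum x = EV (%r k. r) x"

lemma csum_simps [simp]: "csum (x + y) = csum x + csum y" "csum 0 = 0" "csum (pm_scale r x) = r * csum x"
  "csum (single k r) = r"
proof -
 have c: "coef_add (%r k. r)" by (simp add: coef_add_def)
 show "csum (x + y) = csum x + csum y" "csum 0 = 0" "csum (single k r) = r"
  by (simp_all add: csum_def EV_add[OF c] EV_single[OF c])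
 show "csum (pm_scale r x) = r * csum x" by (simp add: csum_def EV_pm_scale[OF c] EV_mult_left)
qed

lemma csum_sum: "csum (\<Sum>i\<in>I. g i) = (\<Sum>i\<in>I. csum (g i))" by (induction I rule: infinite_finite_induct) simp_all

lemma csum_lin_ext: "csum (lin_ext g p) = EV (%r k. r * csum (g k)) p" by (simp add: lin_ext_def csum_sum EV_def)

definition integral :: "('k \<Rightarrow>\<^sub>0 'r::comm_ring_1) => bool" where
 "integral x \<longleftrightarrow> (\<forall>k. lookup x k : \<int>)"

lemma integral_simps: "integral 0" "integral x ==> integral y ==> integral (x + y)"
  "r : \<int> ==> integral x ==> integral (pm_scale r x)" "r : \<int> ==> integral (single k r)"
 by (simp_all add: integral_def lookup_add lookup_single when_def)

lemma integral_sum: "(!!i. i : I ==> integral (g i)) ==> integral (\<Sum>i\<in>I. g i)"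
 by (induction I rule: infinite_finite_induct) (simp_all add: integral_simps)

lemma integral_lin_ext: "integral p ==> (!!a. a : keys p ==> integral (g a)) ==> integral (lin_ext g p)"
 unfolding lin_ext_def by (intro integral_sum integral_simps) (simp_all add: integral_def)

lemma sgn_pow_Ints: "ksg k : \<int>" by (simp add: sgn_pow_def)

lemma res_of_int: "res (of_int z :: 'r::comm_ring_1) = of_int z"
proof -
 have n: "res (of_nat k :: 'r) = of_nat k" for k by (induction k) simp_all
 show ?thesis by (cases z rule: int_cases) (simp_all add: n del: of_nat_Suc)
qed

lemma sum_single_letter:
 "(\<Sum>i<length w. f (take i w) (w ! i) (drop (Suc i) w))
  = (\<Sum>x@y@z=w. if length y = 1 then f x (hd y) z else (0 :: 't::comm_ring_1))"
proof (induction w arbitrary: f)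
 case (Cons a w)
 have "(\<Sum>y@z=(a # w). if length y = 1 then f [] (hd y) z else 0) = f [] a w"
 proof (cases w)
  case (Cons b w')
  show ?thesis unfolding Cons sum_sp2_Cons by (simp add: split_beta)
 qed (simp add: sum_sp2_Cons)
 then show ?case
  unfolding sum_sp3_Cons using Cons.IH[of "%x. f (a # x)"] by (simp add: sum.lessThan_Suc_shift del: sum.lessThan_Suc)
qed simp

lemma sum_letter_pair:
 "(\<Sum>i<length w - 1. f (take i w) (w ! i) (w ! Suc i) (drop (i + 2) w))
  = (\<Sum>x@y@z=w. if length y = 2 then f x (y ! 0) (y ! 1) z else (0 :: 't::comm_ring_1))"
proof (induction w arbitrary: f)
 case (Cons a w)
 show ?case
 proof (cases w)
  case Nil
  then show ?thesis by (simp add: sum_sp3_Cons sum_sp2_Cons)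
 next
  case w: (Cons b w')
  have "(\<Sum>y@z=w'. if length (a # b # y) = 2 then f [] ((a # b # y) ! 0) ((a # b # y) ! 1) z else 0) = f [] a b w'"
  proof (cases w')
   case (Cons c w'')
   show ?thesis unfolding Cons sum_sp2_Cons by (simp add: split_beta)
  qed simp
  then have "(\<Sum>y@z=(a # w). if length y = 2 then f [] (y ! 0) (y ! 1) z else 0) = f [] a b w'"
   unfolding w sum_sp2_Cons by simp
  then show ?thesis
   unfolding sum_sp3_Cons using Cons.IH[of "%x. f (a # x)"] by (simp add: w sum.lessThan_Suc_shift del: sum.lessThan_Suc)
 qed
qed simp

lemma sum_sp2_first:
 assumes "!!y z. length y ~= 1 ==> f y z = (0 :: 't::comm_ring_1)"
 shows "(\<Sum>y@z=w. f y z) = (case w of [] => 0 | a # r => f [a] r)"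
proof (cases w)
 case (Cons a r)
 show ?thesis
 proof (cases r)
  case r: (Cons b r')
  show ?thesis unfolding Cons r sum_sp2_Cons using assms by (simp add: split_beta)
 qed (use Cons assms in \<open>simp add: sum_sp2_Cons\<close>)
qed (simp add: assms)

lemma sum_sp2_last:
 assumes "!!y z. length z ~= 1 ==> f y z = (0 :: 't::comm_ring_1)"
 shows "(\<Sum>y@z=w. f y z) = (if w = [] then 0 else f (butlast w) [last w])"
proof (cases w rule: rev_cases)
 case (snoc r a)
 show ?thesis
 proof (cases r rule: rev_cases)
  case Nil
  then show ?thesis using snoc assms by (simp add: sum_sp2_Cons)
 next
  case r: (snoc r' b)
  show ?thesis unfolding snoc r using sum_sp2_insert[of f "r' @ [b]" a "[]"] sum_sp2_insert[of "%x x'. f x (x' @ [a])" r' b "[]"] assms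
   by (simp add: split_beta sp2_Nil butlast_append)
 qed
qed (simp add: assms)

text \<open>The properties of the chains on a loop space that are used: the modules are free on bases \<open>S i\<close> in nonnegative degrees, the sum
  of coefficients is an augmentation, and the structure constants are integers. The last property is used to compare
  additive cochains, which are linear over the integers, with linear ones.\<close>

locale based_algebra =
 fixes n :: int and A :: "('r::comm_ring_1, 'k \<Rightarrow>\<^sub>0 'r) dga" and S :: "int => 'k set" and m :: "('r, 'k \<Rightarrow>\<^sub>0 'r) opn"
 assumes R: "rational_algebra TYPE('r)" and alg: "vinf_algebra n (vinf_of A m)"
  and ops_dga: "b : hlists (dmods A) ==> teq (dmods A) (m [b]) (dga_ops A [b])"
  and mods_free: "dmods A i = free_module (S i)" and S_neg: "i < 0 ==> S i = {}"
  and csum_diff: "keys x \<subseteq> S 1 ==> csum (ddiff A 1 x) = 0"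
  and csum_mult: "csum (dmult A 0 0 x y) = csum x * csum y" and csum_unit: "csum (dunit A) = 1"
  and integral_diff: "k : S i ==> integral (ddiff A i (pt k))" and integral_mult: "integral (dmult A i j (pt k) (pt l))"

begin

abbreviation V where "V \<equiv> vinf_of A m"

sublocale valg n V by unfold_locales (rule alg, rule R)

lemma V_sel: "ops V = m" "mods V = dmods A" "diff V = ddiff A" by (simp_all add: vinf_of_def)

lemma M_simps [simp]: "carrier (M i) = {p. keys p \<subseteq> S i}" "add (M i) = (+)"
  "smult (M i) = pm_scale" "zero (M i) = 0" by (simp_all add: V_sel mods_free free_module_def)

lemma ops_dga': "b : hlists M ==> teq M (ops V [b]) (dga_ops A [b])" using ops_dga by (simp add: V_sel)

definition zero_chains where "zero_chains = carrier (M 0)"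

lemma neg_zero: "i < 0 ==> keys x \<subseteq> S i ==> x = 0"
 using S_neg by (metis keys_eq_empty subset_empty)

lemma mval_dga:
 assumes "b : hlists M"
 shows "length b \<ge> 3 ==> mval V b = 0"
  and "b = [a, c] ==> mval V b = pm_scale (ksg (fst a)) (dmult A (fst a) (fst c) (snd a) (snd c))"
proof -
 show "mval V b = 0" if l: "length b \<ge> 3"
 proof -
  have "dga_ops A [b] = 0" using l by (auto simp: dga_ops_def split: list.splits)
  then have "teq M (ops V [b]) 0" using ops_dga'[of b] assms by simp
  moreover have "teq M (pt [(sdeg b - 2, pm_scale 0 0)]) (pm_scale 0 (pt [(sdeg b - 2, 0)]))"
   using teq_pt_smult[of "[]" M "[]" 0 "sdeg b - 2" 0] by simp
  then have "teq M (pt [(sdeg b - 2, 0)]) 0" by (simp add: pm_scale_simps)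
  ultimately have "teq M (ops V [b]) (pt [(sdeg b - 2, 0)])" by (rule teq_trans[OF _ teq_sym])
  then show ?thesis by (intro mval_eq[OF assms]) simp_all
 qed
 show "mval V b = pm_scale (ksg (fst a)) (dmult A (fst a) (fst c) (snd a) (snd c))" if b: "b = [a, c]"
 proof -
  let ?e = "fst a + fst c" and ?p = "dmult A (fst a) (fst c) (snd a) (snd c)"
  let ?s = "ksg (fst a) :: 'r"
  have "teq M (ops V [b]) (single [(?e, ?p)] ?s)"
   using ops_dga'[of b] assms unfolding b by (simp add: dga_ops_def melt_def deg_def)
  then have t: "teq M (single [(?e, ?p)] ?s) (pt [mh V b])" using teq_trans[OF teq_sym mval_teq[OF assms]] by blast
  have "[(?e, ?p)] : hlists M"
  proof (rule ccontr)
   assume n: "[(?e, ?p)] \<notin> hlists M"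
   then have ne: "[(?e, ?p)] ~= [mh V b]" using mh_hlists[OF assms] by metis
   have "?s ~= 0" by (simp add: sgn_pow_def)
   then have "[(?e, ?p)] : keys (single [(?e, ?p)] ?s - pt [mh V b])"
    using ne by (simp add: in_keys_iff lookup_minus lookup_single)
   then show False using keys_span[OF t[unfolded teq_def] M] n by blast
  qed
  then have p: "keys ?p \<subseteq> S ?e" by simp
  have "teq M (pt [(?e, pm_scale ?s ?p)]) (pm_scale ?s (pt [(?e, ?p)]))" using teq_pt_smult[of "[]" M "[]" ?p ?e ?s] p by simp
  then have "teq M (ops V [b]) (pt [(?e, pm_scale ?s ?p)])"
   using teq_trans[OF \<open>teq M (ops V [b]) (Poly_Mapping.single [(?e, ?p)] ?s)\<close> teq_sym] by simp
  then show ?thesis using p keys_pm_scale[of ?s ?p] by (intro mval_eq[OF assms]) (auto simp: b)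
 qed
qed

lemma mult_carrier: "[a, c] : hlists M ==> keys (dmult A (fst a) (fst c) (snd a) (snd c)) \<subseteq> S (fst a + fst c)"
 and mult_mval: "[a, c] : hlists M ==> dmult A (fst a) (fst c) (snd a) (snd c) = pm_scale (ksg (fst a)) (mval V [a, c])"
proof -
 assume h: "[a, c] : hlists M"
 have "mval V [a, c] : carrier (M (fst a + fst c))" by (rule mval_closed'[OF h]) simp
 moreover show "dmult A (fst a) (fst c) (snd a) (snd c) = pm_scale (ksg (fst a)) (mval V [a, c])"
  using mval_dga(2)[OF h refl] by (simp add: pm_scale_simps)
 ultimately show "keys (dmult A (fst a) (fst c) (snd a) (snd c)) \<subseteq> S (fst a + fst c)"
  using keys_pm_scale[of "ksg (fst a)" "mval V [a, c]"] by auto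
qed

sublocale aug n V zero_chains csum unfolding zero_chains_def
proof
 show "qsubspace (M 0) (carrier (M 0))" by (auto simp: qsubspace_def mod_closed[OF M] simp del: M_simps)
 show "carrier (M 0) \<subseteq> cycles M \<delta> 0"
 proof
  fix x assume x: "x : carrier (M 0)"
  then have "\<delta> 0 x : carrier (M (- 1))" using \<delta>_closed[OF x] by simp
  then show "x : cycles M \<delta> 0" using neg_zero[of "- 1"] x by (simp add: cycles_def)
 qed
 show "boundaries M \<delta> 0 \<subseteq> carrier (M 0)" using \<delta>_closed[of _ 1] by (auto simp: boundaries_def simp del: M_simps)
 show "csum x = 0" if "x : boundaries M \<delta> 0" for x using that csum_diff by (auto simp: boundaries_def V_sel(3))
 show "csum (x \<oplus>`M 0` y) = csum x + csum y" for x y by simp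
 show "mval V [(0, x), (0, y)] : carrier (M 0)" if "x : carrier (M 0)" "y : carrier (M 0)" for x y
  by (rule mval_closed') (use that in simp_all)
 show "csum (mval V [(0, x), (0, y)]) = csum x * csum y" if "x : carrier (M 0)" "y : carrier (M 0)" for x y
  using mval_dga(2)[of "[(0, x), (0, y)]" "(0, x)" "(0, y)"] that csum_mult by (simp add: pm_scale_simps)
qed

lemma Cc_all: "Cc i = carrier (M i)"
proof -
 have "x : zero_chains \<longleftrightarrow> keys x \<subseteq> S 0" for x by (simp add: zero_chains_def)
 then show ?thesis unfolding Cc_def using neg_zero[of i] by auto
qed

section \<open>Two cocycles\<close>

text \<open>The cocycles \<open>G1\<close> and \<open>G2\<close> treat a nonscalar end like a letter in the middle, which is possible because every element
  of degree zero belongs to the domain of the augmentation.\<close>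

fun toMid :: "('r, 'k \<Rightarrow>\<^sub>0 'r) letter => ('r, 'k \<Rightarrow>\<^sub>0 'r) letter" where
 "toMid (Elt i x) = Mid i x" | "toMid l = l"

definition G1 :: "('r, 'k \<Rightarrow>\<^sub>0 'r) word => 'r" where
 "G1 w = (if ok w & isElt (hd w) then gval (map toMid w) else 0)"

definition G2 :: "('r, 'k \<Rightarrow>\<^sub>0 'r) word => 'r" where
 "G2 w = (if ok w & isElt (last w) then gval (map toMid w) else 0)"

lemma toMid_simps [simp]: "ldeg (toMid l) = ldeg l" "isGnd (toMid l) = isGnd l" "~ isElt (toMid l)" by (cases l; simp)+

lemma toMid_vl: "vl l ==> vl (toMid l)" by (cases l) (simp_all add: Cc_all)

lemma hel_toMid [simp]: "hel (toMid l) = hel l" by (cases l) simp_all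

lemma toMid_list: "wdeg (map toMid w) = wdeg w" "list_ex isGnd (map toMid w) = list_ex isGnd w" "~ list_ex isElt (map toMid w)"
  "map hel (map toMid w) = map hel w" by (induction w) simp_all

lemma gval_toMid: "(\<forall>l\<in>set w. ~ isElt l) ==> gval (map toMid w) = gval w"
proof -
 assume "\<forall>l\<in>set w. ~ isElt l"
 then have "map toMid w = w"
 proof (induction w)
  case (Cons l w)
  then show ?case by (cases l) simp_all
 qed simp
 then show ?thesis by simp
qed

lemma toMid_mul:
 assumes "list_ex isGnd y ==> \<forall>l\<in>set y. ~ isElt l"
 shows "gval (map toMid (x @ [mul y] @ z)) = gval (map toMid x @ [mul (map toMid y)] @ map toMid z)"
proof (cases "list_ex isGnd y")
 case True
 then show ?thesis using gval_toMid[OF assms[OF True]] by (simp add: mul_def toMid_list)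
next
 case False
 then show ?thesis by (simp add: mul_def toMid_list del: map_map)
qed

lemma proper_subword_ends:
 assumes "wd (x @ y @ z)" "y ~= []" "x ~= [] \<or> z ~= []" "list_ex isGnd y"
 shows "\<forall>l\<in>set y. ~ isElt l" using assms(1-3)
proof (cases rule: wd_subword_cases)
 case (left e as bs e')
 then show ?thesis using assms(4) mids_ex[OF left(6)] by (cases e) (auto simp: isMid_simp)
next
 case (right e as bs e')
 then show ?thesis using assms(4) mids_ex[OF right(6)] by (cases e') (auto simp: isMid_simp)
next
 case (mid e bs cs e')
 then show ?thesis using assms(4) mids_ex[OF mid(5)] by auto
qed

text \<open>An instance of the relation for subwords, for the cochain that multiplies two scalars.\<close>

lemma gval_relation:
 assumes v: "valid U" and U: "U = Gnd i r # as \<or> U = as @ [Gnd i r]" and as: "\<forall>a\<in>set as. isMid a"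
 shows "(\<Sum>x@y@z=U. if y = [] then 0 else ksg (wdeg x) * gval (x @ [mul y] @ z)) = 0"
proof (cases "wdeg U = 3")
 case True
 let ?c = "%w. if ok w then (case w of [Gnd i r, Gnd j s] => r * s | _ => 0) else 0 :: 'r"
 have MC: "MC ?c" unfolding MC_def
 proof (intro conjI allI impI)
  fix X l l' Z assume l: "vl l & vl l' & same l l'"
  show "?c (X @ [ladd l l'] @ Z) = ?c (X @ [l] @ Z) + ?c (X @ [l'] @ Z)"
  proof (cases "length X + length Z = 1")
   case True
   then obtain t where "X = [t] & Z = [] \<or> X = [] & Z = [t]" by (cases X; cases Z) auto
   then show ?thesis using l ok_ladd[of l l' X Z] by (cases t; cases l; cases l') (auto simp: algebra_simps)
  next
   case False
   have "(case w of [Gnd i r, Gnd j s] => r * s | _ => 0) = (0 :: 'r)" if "length w ~= 2" for w :: "('r, 'k \<Rightarrow>\<^sub>0 'r) word"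
    using that by (auto split: list.splits letter.splits)
   then show ?thesis using False by simp
  qed
 qed simp
 have g: "list_ex isGnd U" using U by auto
 have o: "ok [Gnd 0 1, Gnd 0 s]" for s by (simp add: ok_def wd_def wdk_def)
 have "(\<Sum>x@y@z=U. if y = [] then 0 else ksg (wdeg x) * ?c ([Gnd 0 1] @ [mul (x @ [mul y] @ z)] @ [])) = 0"
  by (rule A_infinity_words_scalar[OF MC v g U as])
 moreover have "?c ([Gnd 0 1] @ [mul (x @ [mul y] @ z)] @ []) = gval (x @ [mul y] @ z)" if "x @ y @ z = U" for x y z
 proof -
  have "list_ex isGnd (x @ [mul y] @ z)" using that g by (auto simp: isX_mul)
  moreover have "wdeg (x @ [mul y] @ z) - 2 = 0" using that True by auto
  ultimately have "mul (x @ [mul y] @ z) = Gnd 0 (gval (x @ [mul y] @ z))" using mul_Gnd by metis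
  then show ?thesis using o by simp
 qed
 then have "(\<Sum>x@y@z=U. if y = [] then 0 else ksg (wdeg x) * ?c ([Gnd 0 1] @ [mul (x @ [mul y] @ z)] @ []))
  = (\<Sum>x@y@z=U. if y = [] then 0 else ksg (wdeg x) * gval (x @ [mul y] @ z))" by (intro sum_sp3_cong) simp
 ultimately show ?thesis by simp
next
 case False
 have "gval (x @ [mul y] @ z) = 0" if "x @ y @ z = U" for x y z by (rule gval_degree) (use that False in auto)
 then have "(\<Sum>x@y@z=U. if y = [] then 0 else ksg (wdeg x) * gval (x @ [mul y] @ z)) = (\<Sum>x@y@z=U. 0)"
  by (intro sum_sp3_cong) simp
 then show ?thesis by (simp add: split_beta)
qed

lemma gval_no_scalar: "~ list_ex isGnd w ==> gval w = 0" by (cases w rule: gval.cases) auto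

lemma MC_gval:
 assumes "!!X l l' Z. same l l' ==> e (X @ [ladd l l'] @ Z) = e (X @ [l] @ Z) & e (X @ [l'] @ Z) = e (X @ [l] @ Z)"
 shows "MC (%w. if ok w & e w then gval (map toMid w) else 0)" unfolding MC_def
proof (intro conjI allI impI)
 fix X l l' Z assume l: "vl l & vl l' & same l l'"
 have s: "same (toMid l) (toMid l')" "toMid (ladd l l') = ladd (toMid l) (toMid l')" using l by (cases l; cases l'; auto)+
 have "gval (map toMid X @ [ladd (toMid l) (toMid l')] @ map toMid Z)
  = gval (map toMid X @ [toMid l] @ map toMid Z) + gval (map toMid X @ [toMid l'] @ map toMid Z)" (is "?a = ?b + ?c")
  if o: "ok (X @ [l] @ Z)"
 proof (cases "list_ex isGnd (X @ [l] @ Z)")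
  case True
  have "mul (map toMid X @ [ladd (toMid l) (toMid l')] @ map toMid Z)
   = ladd (mul (map toMid X @ [toMid l] @ map toMid Z)) (mul (map toMid X @ [toMid l'] @ map toMid Z))"
   by (rule mul_ladd(1)[OF s(1)]) (use l o toMid_vl in \<open>auto simp: ok_def\<close>)
  moreover have "list_ex isGnd (map toMid X @ [toMid l] @ map toMid Z)" "list_ex isGnd (map toMid X @ [toMid l'] @ map toMid Z)"
   "list_ex isGnd (map toMid X @ [ladd (toMid l) (toMid l')] @ map toMid Z)" using True l by (cases l; cases l'; auto simp: toMid_list)+
  ultimately show ?thesis by (simp add: mul_def)
 next
  case False
  have "~ list_ex isGnd (map toMid X @ [toMid l] @ map toMid Z)" "~ list_ex isGnd (map toMid X @ [toMid l'] @ map toMid Z)"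
   "~ list_ex isGnd (map toMid X @ [ladd (toMid l) (toMid l')] @ map toMid Z)"
   using False l by (cases l; cases l'; auto simp: toMid_list)+
  then show ?thesis by (simp only: gval_no_scalar not_False_eq_True add_0_left)
 qed
 then show "(if ok (X @ [ladd l l'] @ Z) & e (X @ [ladd l l'] @ Z) then gval (map toMid (X @ [ladd l l'] @ Z)) else 0)
  = (if ok (X @ [l] @ Z) & e (X @ [l] @ Z) then gval (map toMid (X @ [l] @ Z)) else 0)
  + (if ok (X @ [l'] @ Z) & e (X @ [l'] @ Z) then gval (map toMid (X @ [l'] @ Z)) else 0)"
  using ok_ladd[of l l' X Z] assms[of l l' X Z] l s(2) by simp
qed simp

lemma MC_G1: "MC G1" unfolding G1_def[abs_def]
proof (rule MC_gval)
 fix X Z :: "('r, 'k \<Rightarrow>\<^sub>0 'r) word" and l l' :: "('r, 'k \<Rightarrow>\<^sub>0 'r) letter" assume "same l l'"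
 then show "isElt (hd (X @ [ladd l l'] @ Z)) = isElt (hd (X @ [l] @ Z)) & isElt (hd (X @ [l'] @ Z)) = isElt (hd (X @ [l] @ Z))"
  by (cases X; cases l; cases l') auto
qed

lemma MC_G2: "MC G2" unfolding G2_def[abs_def]
proof (rule MC_gval)
 fix X Z :: "('r, 'k \<Rightarrow>\<^sub>0 'r) word" and l l' :: "('r, 'k \<Rightarrow>\<^sub>0 'r) letter" assume "same l l'"
 then show "isElt (last (X @ [ladd l l'] @ Z)) = isElt (last (X @ [l] @ Z)) & isElt (last (X @ [l'] @ Z)) = isElt (last (X @ [l] @ Z))"
  by (cases Z; cases l; cases l') auto
qed

lemma isElt_ends_mul:
 assumes "wd (x @ y @ z)" "y ~= []" "x ~= [] \<or> z ~= []"
 shows "isElt (hd (x @ [mul y] @ z)) = isElt (hd (x @ y @ z))" "isElt (last (x @ [mul y] @ z)) = isElt (last (x @ y @ z))"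
proof -
 have "isElt (hd (x @ [mul y] @ z)) = isElt (hd (x @ y @ z)) & isElt (last (x @ [mul y] @ z)) = isElt (last (x @ y @ z))" using assms
 proof (cases rule: wd_subword_cases)
  case (left e as bs e')
  then show ?thesis using mids_ex[OF left(6)] by (cases e) (auto simp: isX_mul isMid_simp)
 next
  case (right e as bs e')
  then show ?thesis using mids_ex[OF right(6)] by (cases e') (auto simp: isX_mul isMid_simp)
 next
  case (mid e bs cs e')
  then show ?thesis by auto
 qed
 then show "isElt (hd (x @ [mul y] @ z)) = isElt (hd (x @ y @ z))" "isElt (last (x @ [mul y] @ z)) = isElt (last (x @ y @ z))" by auto
qed

lemma D_gval:
 assumes w: "ok w" and one: "\<exists>i r as. (map toMid w = Gnd i r # as \<or> map toMid w = as @ [Gnd i r]) & (\<forall>a\<in>set as. isMid a)"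
 shows "(\<Sum>x@y@z=w. if y = [] \<or> y = w then 0 else ksg (wdeg x) * gval (map toMid (x @ [mul y] @ z))) = 0"
proof -
 obtain i r as where U: "map toMid w = Gnd i r # as \<or> map toMid w = as @ [Gnd i r]" and as: "\<forall>a\<in>set as. isMid a"
  using one by (elim exE conjE) (rule that)
 have v: "valid (map toMid w)" using w toMid_vl by (auto simp: ok_def)
 have "(\<Sum>x@y@z=w. if y = [] \<or> y = w then 0 else ksg (wdeg x) * gval (map toMid (x @ [mul y] @ z)))
  = (\<Sum>x@y@z=w. if map toMid y = [] then 0 else ksg (wdeg (map toMid x)) * gval (map toMid x @ [mul (map toMid y)] @ map toMid z))"
 proof (rule sum_sp3_cong, goal_cases)
  case (1 x y z)
  note xyz = 1
  show ?case
  proof (cases "y = w")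
   case True
   then have "length x + length z = 0" using arg_cong[OF xyz, of length] by simp
   then show ?thesis using True by (simp add: gval_length)
  next
   case False
   show ?thesis
   proof (cases "y = []")
    case ne: False
    have "wd (x @ y @ z)" "x ~= [] \<or> z ~= []" using w xyz False by (auto simp: ok_def)
    from toMid_mul[OF proper_subword_ends[OF this(1) ne this(2)]]
    show ?thesis using ne False by (simp add: toMid_list del: map_append list.map)
   qed simp
  qed
 qed
 also have "... = 0" using gval_relation[OF v U as] unfolding sum_sp3_map .
 finally show ?thesis .
qed

lemma D_G:
 assumes "!!x y z. wd (x @ y @ z) ==> y ~= [] ==> x ~= [] \<or> z ~= [] ==> e (x @ [mul y] @ z) = e (x @ y @ z)"
  and e: "!!w. e w ==> wd w ==> isElt (hd w) \<or> isElt (last w)"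
 shows "D (%w. if ok w & e w then gval (map toMid w) else 0) w = 0"
proof (cases "ok w")
 case True
 have "D (%w. if ok w & e w then gval (map toMid w) else 0) w
  = (if e w then (\<Sum>x@y@z=w. if y = [] \<or> y = w then 0 else ksg (wdeg x) * gval (map toMid (x @ [mul y] @ z))) else 0)"
 proof -
  have o: "ok (x @ [mul y] @ z)" "e (x @ [mul y] @ z) = e w" if "x @ y @ z = w" "y ~= []" "y ~= w" for x y z
  proof -
   have xz: "x ~= [] \<or> z ~= []" using that by auto
   show "ok (x @ [mul y] @ z)" by (rule ok_mul[OF _ that(2) xz]) (use True that in simp)
   show "e (x @ [mul y] @ z) = e w" using assms(1)[of x y z] True that xz by (simp add: ok_def)
  qed
  have "D (%w. if ok w & e w then gval (map toMid w) else 0) w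
   = (\<Sum>x@y@z=w. if e w then (if y = [] \<or> y = w then 0 else ksg (wdeg x) * gval (map toMid (x @ [mul y] @ z))) else 0)"
   unfolding D_def if_P[OF True] by (rule sum_sp3_cong) (use o in auto)
  then show ?thesis by (cases "e w") (simp_all add: split_beta)
 qed
 moreover have "(\<Sum>x@y@z=w. if y = [] \<or> y = w then 0 else ksg (wdeg x) * gval (map toMid (x @ [mul y] @ z))) = 0" if ew: "e w"
 proof -
  obtain a as a' where w: "w = a # as @ [a']" "~ isMid a" "~ isMid a'" "\<forall>a\<in>set as. isMid a"
   using True unfolding ok_def wd_iff by blast
  have tm: "\<forall>a\<in>set (map toMid as). isMid a" using w(4) by (auto simp: isMid_simp)
  have ae: "isElt a \<or> isElt a'" using e[OF ew] True w by (simp add: ok_def)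
  show ?thesis
  proof (cases "isGnd a \<or> isGnd a'")
   case False
   have "~ list_ex isGnd (map toMid (x @ [mul y] @ z))" if "x @ y @ z = w" for x y z
   proof -
    have "~ list_ex isGnd (x @ y @ z)" unfolding that w(1) using False mids_ex[OF w(4)] by simp
    then show ?thesis by (simp add: toMid_list isX_mul del: map_append list.map)
   qed
   then have "(\<Sum>x@y@z=w. if y = [] \<or> y = w then 0 else ksg (wdeg x) * gval (map toMid (x @ [mul y] @ z))) = (\<Sum>x@y@z=w. 0)"
    by (intro sum_sp3_cong) (simp only: gval_no_scalar not_False_eq_True mult_zero_right if_cancel)
   then show ?thesis by (simp add: split_beta)
  next
   case True': True
   show ?thesis
   proof (rule D_gval[OF True])
    from True' show "\<exists>i r as. (map toMid w = Gnd i r # as \<or> map toMid w = as @ [Gnd i r]) & (\<forall>a\<in>set as. isMid a)"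
    proof
     assume "isGnd a"
     then obtain i r where a: "a = Gnd i r" by (cases a) auto
     then have "isElt a'" using ae by simp
     then have "isMid (toMid a')" by (cases a') auto
     then show ?thesis using w(1) a tm by (intro exI[of _ i] exI[of _ r] exI[of _ "map toMid as @ [toMid a']"]) auto
    next
     assume "isGnd a'"
     then obtain i r where a: "a' = Gnd i r" by (cases a') auto
     then have "isElt a" using ae by simp
     then have "isMid (toMid a)" by (cases a) auto
     then show ?thesis using w(1) a tm by (intro exI[of _ i] exI[of _ r] exI[of _ "toMid a # map toMid as"]) auto
    qed
   qed
  qed
 qed
 ultimately show ?thesis by simp
qed (simp add: D_def)

lemma D_G1: "D G1 w = 0" unfolding G1_def[abs_def] by (rule D_G[where e = "%w. isElt (hd w)"], rule isElt_ends_mul(1)) simp_all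

lemma D_G2: "D G2 w = 0" unfolding G2_def[abs_def] by (rule D_G[where e = "%w. isElt (last w)"], rule isElt_ends_mul(2)) simp_all

end

lemma sum_sp3_whole:
 fixes w :: "'l list"
 shows "(\<Sum>x@y@z=w. if x = [] & z = [] then f y else (0 :: 't::comm_ring_1)) = f w"
proof -
 have "(\<Sum>x@y@z=w. if x = [] & z = [] then f y else 0) = (\<Sum>(x, y, z)\<in>{([] :: 'l list, w, [] :: 'l list)}. f y)"
  by (rule sum.mono_neutral_cong_right) (auto split: if_splits)
 then show ?thesis by simp
qed

context based_algebra

begin

definition mids :: "('k \<Rightarrow>\<^sub>0 'r) helem list => ('r, 'k \<Rightarrow>\<^sub>0 'r) word" where
 "mids as = map (%a. Mid (fst a) (snd a)) as"

lemma mids_simps [simp]: "mids [] = []" "mids (a # as) = Mid (fst a) (snd a) # mids as" "mids (as @ bs) = mids as @ mids bs"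
  "map hel (mids as) = as" "wdeg (mids as) = sdeg as" "map toMid (mids as) = mids as" "length (mids as) = length as"
  "mids as = [] \<longleftrightarrow> as = []" "~ list_ex isGnd (mids as)" "~ list_ex isElt (mids as)"
proof -
 show "map hel (mids as) = as" "wdeg (mids as) = sdeg as" "map toMid (mids as) = mids as"
  "~ list_ex isGnd (mids as)" "~ list_ex isElt (mids as)" by (induction as) (simp_all add: mids_def)
qed (simp_all add: mids_def)

lemma mids_isMid: "a : set (mids as) ==> isMid a" by (auto simp: mids_def)

lemma mids_valid: "as : hlists M ==> valid (mids as)" by (induction as) (simp_all add: Cc_all)

definition scalar_word where "scalar_word as = Gnd 0 1 # mids as @ [Gnd 0 1]"

lemma ok_scalar_word: "as : hlists M ==> ok (scalar_word as)"
 unfolding ok_def wd_iff scalar_word_def using mids_valid[of as] mids_isMid[of _ as] by auto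

text \<open>The augmentation, extended by zero to all degrees.\<close>

definition ep :: "('k \<Rightarrow>\<^sub>0 'r) helem => 'r" where
 "ep a = (if fst a = 0 then csum (snd a) else 0)"

definition \<beta>0 :: "('k \<Rightarrow>\<^sub>0 'r) helem => ('k \<Rightarrow>\<^sub>0 'r) helem => 'r residue_field" where
 "\<beta>0 u v = res (ep u) * res (ep v)"

lemma \<beta>0_bilin: "bilin M \<beta>0" by (rule bilinI) (simp_all add: \<beta>0_def ep_def algebra_simps)

lemma lam_scalar: "lam (%t. t * c) = res c" using lam_smult[of "%t. t" c] by (simp add: additive_endo_def lam_id)

lemma gl_G1:
 assumes u: "[u] : hlists M" and z: "as : hlists M"
 shows "gl G1 u (mids as @ [Gnd 0 1]) = (if as = [] then res (ep u) else 0)"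
proof -
 have o: "ok (Elt (fst u) (pm_scale t (snd u)) # mids as @ [Gnd 0 1])" for t
  unfolding ok_def wd_iff using u mids_valid[OF z] mids_isMid[of _ as] keys_pm_scale[of t "snd u"] by auto
 show ?thesis by (simp add: o lam_scalar lam_zero gl_def G1_def ep_def gval_length)
qed

lemma gr_G2:
 assumes v: "[v] : hlists M" and z: "as : hlists M"
 shows "gr G2 (Gnd 0 1 # mids as) v = (if as = [] then res (ep v) else 0)"
proof -
 have o: "ok (Gnd 0 1 # mids as @ [Elt (fst v) (pm_scale t (snd v))])" for t
  unfolding ok_def wd_iff using v mids_valid[OF z] mids_isMid[of _ as] keys_pm_scale[of t "snd v"] by auto
 show ?thesis by (simp add: o lam_scalar lam_zero gr_def G2_def ep_def gval_length)
qed

text \<open>\<open>G1\<close> and \<open>G2\<close> are zero on words with letters in the middle, so that only the decomposition with the whole of \<open>as\<close> in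
  the copairing counts.\<close>

lemma cc_scalar_word:
 assumes as: "as : hlists M"
 shows "cc G1 G2 (scalar_word as) = ksg (1 + n) * pairing as \<beta>0"
proof -
 let ?e = "Gnd 0 1 :: ('r, 'k \<Rightarrow>\<^sub>0 'r) letter"
 define g where "g x y z = (if x = [] \<or> z = [] then 0 else pairing (map hel y) (form G1 G2 x z))" for x y z :: "('r, 'k \<Rightarrow>\<^sub>0 'r) word"
 have "cc G1 G2 (scalar_word as) = (\<Sum>x@y@z=(scalar_word as). g x y z)"
  using ok_scalar_word[OF as] by (simp add: cc_def g_def scalar_word_def)
 also have "... = (\<Sum>y@z=(scalar_word as). g [] y z) + (\<Sum>x@y@z=(mids as @ ?e # []). g (?e # x) y z)"
  unfolding scalar_word_def by (rule sum_sp3_Cons)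
 also have "(\<Sum>y@z=(scalar_word as). g [] y z) = 0" by (simp add: g_def split_beta)
 also have "(\<Sum>x@y@z=(mids as @ ?e # []). g (?e # x) y z) = (\<Sum>x@y@z=(mids as). g (?e # x) y (z @ [?e]))"
  unfolding sum_sp3_insert[of "%x. g (?e # x)"] by (simp add: g_def sp2_Nil sp3_Nil split_beta)
 also have "... = (\<Sum>x@y@z=as. g (?e # mids x) (mids y) (mids z @ [?e]))"
  using sum_sp3_map[of "%x y z. g (?e # x) y (z @ [?e])" "%a. Mid (fst a) (snd a)" as] by (simp only: mids_def)
 also have "... = (\<Sum>x@y@z=as. if x = [] & z = [] then ksg (1 + n) * pairing y \<beta>0 else 0)"
 proof (rule sum_sp3_cong, goal_cases)
  case (1 x y z)
  from 1 have h: "x : hlists M" "y : hlists M" "z : hlists M" using as by auto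
  have "pairing y (form G1 G2 (?e # mids x) (mids z @ [?e])) = pairing y (%u v. (if x = [] & z = [] then ksg (1 + n) else 0) * \<beta>0 u v)"
  proof (rule pairing_cong[OF h(2)], goal_cases)
   case (1 u v)
   note u = 1(1) and v = 1(2)
   show ?case
    unfolding form_def gl_G1[OF u h(3)] gr_G2[OF v h(1)] by (auto simp: \<beta>0_def ep_def)
  qed
  then show ?case
   by (simp add: g_def pairing_scale)
 qed
 also have "... = ksg (1 + n) * pairing as \<beta>0" by (rule sum_sp3_whole)
 finally show ?thesis by simp
qed

section \<open>Multilinear functions and their values on basis elements\<close>

definition multilinear :: "(('k \<Rightarrow>\<^sub>0 'r) helem list => 'r residue_field) => bool" where
 "multilinear f \<longleftrightarrow> (\<forall>P Q d x y r. P : hlists M & Q : hlists M & x : carrier (M d) & y : carrier (M d) -->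
  f (P @ [(d, pm_scale r x + y)] @ Q) = res r * f (P @ [(d, x)] @ Q) + f (P @ [(d, y)] @ Q))"

lemma multilinearD: "multilinear f ==> P : hlists M ==> Q : hlists M ==> x : carrier (M d) ==> y : carrier (M d) ==>
  f (P @ [(d, pm_scale r x + y)] @ Q) = res r * f (P @ [(d, x)] @ Q) + f (P @ [(d, y)] @ Q)" unfolding multilinear_def by blast

lemma multilinear_zero:
 assumes "multilinear f" "P : hlists M" "Q : hlists M"
 shows "f (P @ [(d, 0)] @ Q) = 0" using multilinearD[OF assms, of 0 d 0 1] by (simp add: pm_scale_simps)

lemma multilinear_smult:
 assumes "multilinear f" "P : hlists M" "Q : hlists M" "x : carrier (M d)"
 shows "f (P @ [(d, pm_scale r x)] @ Q) = res r * f (P @ [(d, x)] @ Q)"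
 using multilinearD[OF assms(1-4), of 0 r] multilinear_zero[OF assms(1-3), of d] by simp

definition basis_word :: "('k \<Rightarrow>\<^sub>0 'r) helem list => bool" where
 "basis_word as \<longleftrightarrow> (\<forall>a\<in>set as. \<exists>k\<in>S (fst a). snd a = pt k)"

lemma basis_word_hlists: "basis_word as ==> as : hlists M" by (induction as) (auto simp: basis_word_def)

text \<open>The multilinear extension of the values of \<open>g\<close> on basis words. It replaces an additive cochain by a linear one.\<close>

fun ME :: "(('k \<Rightarrow>\<^sub>0 'r) helem list => 'r residue_field) => ('k \<Rightarrow>\<^sub>0 'r) helem list => 'r residue_field" where
 "ME g [] = g []"
| "ME g (a # as) = EV (%r k. res r * ME (%v. g ((fst a, pt k) # v)) as) (snd a)"

lemma coef_add_res: "coef_add (%r k. res r * h k)" by (simp add: coef_add_def distrib_right)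

lemma EV_res_scale: "EV (%s k. res (r * s) * h k) x = res r * EV (%s k. res s * h k) x"
 by (simp add: EV_def sum_distrib_left mult.assoc)

lemma multilinear_ME: "multilinear (ME g)" unfolding multilinear_def
proof (intro allI impI, goal_cases)
 case (1 P Q d x y r)
 show ?case
 proof (induction P arbitrary: g)
  case Nil
  show ?case by (simp add: EV_add[OF coef_add_res] EV_pm_scale[OF coef_add_res] EV_res_scale del: res_simps)
 next
  case (Cons a P)
  have "EV (%s k. res s * ME (%v. g ((fst a, pt k) # v)) (P @ [(d, pm_scale r x + y)] @ Q)) (snd a)
   = EV (%s k. res r * (res s * ME (%v. g ((fst a, pt k) # v)) (P @ [(d, x)] @ Q))
     + res s * ME (%v. g ((fst a, pt k) # v)) (P @ [(d, y)] @ Q)) (snd a)" unfolding Cons.IH by (simp add: algebra_simps)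
  then show ?case by (simp add: EV_distrib EV_mult_left)
 qed
qed

lemma slot_expand:
 assumes add: "!!x y. x : carrier (M d) ==> y : carrier (M d) ==> h (x + y) = h x + (h y :: 'r residue_field)"
  and sm: "!!k. k : keys x ==> h (pm_scale (lookup x k) (pt k)) = res (lookup x k) * h (pt k)"
  and x: "x : carrier (M d)"
 shows "h x = EV (%r k. res r * h (pt k)) x"
proof -
 have h0: "h 0 = 0" using add[of 0 0] by simp
 have "h (\<Sum>k\<in>K. pm_scale (lookup x k) (pt k)) = (\<Sum>k\<in>K. h (pm_scale (lookup x k) (pt k)))
  & (\<Sum>k\<in>K. pm_scale (lookup x k) (pt k)) : carrier (M d)"
  if "finite K" "K \<subseteq> keys x" for K using that
 proof (induction K rule: finite_induct)
  case empty
  then show ?case by (simp add: h0)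
 next
  case (insert k K)
  have k: "pm_scale (lookup x k) (pt k) : carrier (M d)"
   using insert.prems x keys_pm_scale[of "lookup x k" "pt k"] by auto
  have IH: "h (\<Sum>k\<in>K. pm_scale (lookup x k) (pt k)) = (\<Sum>k\<in>K. h (pm_scale (lookup x k) (pt k)))"
   "(\<Sum>k\<in>K. pm_scale (lookup x k) (pt k)) : carrier (M d)" using insert by auto
  show ?case unfolding sum.insert[OF insert(1,2)] using add[OF k IH(2)] IH(1) mod_closed(1)[OF M k IH(2)] by (simp only: M_simps simp_thms)
 qed
 from this[of "keys x"] have hx: "h x = (\<Sum>k\<in>keys x. h (pm_scale (lookup x k) (pt k)))"
  using pm_expand[of x] by simp
 show ?thesis unfolding hx EV_def by (rule sum.cong[OF refl]) (rule sm)
qed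

lemma multilinear_expand:
 assumes f: "multilinear f" and P: "P : hlists M" "Q : hlists M" "x : carrier (M d)"
 shows "f (P @ [(d, x)] @ Q) = EV (%r k. res r * f (P @ [(d, pt k)] @ Q)) x"
proof (rule slot_expand[where h = "%x. f (P @ [(d, x)] @ Q)", OF _ _ P(3)])
 show "f (P @ [(d, x + y)] @ Q) = f (P @ [(d, x)] @ Q) + f (P @ [(d, y)] @ Q)" if "x : carrier (M d)" "y : carrier (M d)" for x y
  using multilinearD[OF f P(1,2) that, of 1] by (simp add: pm_scale_simps)
 show "f (P @ [(d, pm_scale (lookup x k) (pt k))] @ Q) = res (lookup x k) * f (P @ [(d, pt k)] @ Q)"
  if "k : keys x" for k by (rule multilinear_smult[OF f P(1,2)]) (use that P(3) in auto)
qed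

lemma multilinear_eq_ME:
 assumes f: "multilinear f" and P: "P : hlists M" "as : hlists M"
 shows "f (P @ as) = ME (%v. f (P @ v)) as" using P
proof (induction as arbitrary: P)
 case (Cons a as)
 have a: "snd a : carrier (M (fst a))" "as : hlists M" using Cons.prems by auto
 have "f (P @ [(fst a, snd a)] @ as) = EV (%r k. res r * f (P @ [(fst a, pt k)] @ as)) (snd a)"
  by (rule multilinear_expand[OF f Cons.prems(1) a(2,1)])
 also have "... = EV (%r k. res r * ME (%v. f (P @ (fst a, pt k) # v)) as) (snd a)"
 proof (rule EV_cong, goal_cases)
  case (1 k)
  from 1 have "P @ [(fst a, pt k)] : hlists M" using Cons.prems(1) a(1) by auto
  from Cons.IH[OF this a(2)]
  show ?case by simp
 qed
 finally show ?case by simp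
qed simp

lemma ME_cong:
 assumes "as : hlists M" "!!v. basis_word v ==> f v = g v"
 shows "ME f as = ME g as" using assms
proof (induction as arbitrary: f g)
 case Nil
 then show ?case by (simp add: basis_word_def)
next
 case (Cons a as)
 have "EV (%r k. res r * ME (%v. f ((fst a, pt k) # v)) as) (snd a) = EV (%r k. res r * ME (%v. g ((fst a, pt k) # v)) as) (snd a)"
 proof (rule EV_cong, goal_cases)
  case (1 k)
  from 1 have k: "k : S (fst a)" using Cons.prems(1) by auto
  have "ME (%v. f ((fst a, pt k) # v)) as = ME (%v. g ((fst a, pt k) # v)) as"
  proof (rule Cons.IH)
   show "as : hlists M" using Cons.prems(1) by simp
   show "f ((fst a, pt k) # v) = g ((fst a, pt k) # v)" if "basis_word v" for v
    by (rule Cons.prems(2)) (use that k in \<open>auto simp: basis_word_def intro: bexI[of _ k]\<close>)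
  qed
  then show ?case by simp
 qed
 then show ?case by simp
qed

lemma multilinear_ext:
 assumes "multilinear f" "multilinear g" "!!v. basis_word v ==> f v = g v" "as : hlists M"
 shows "f as = g as" using multilinear_eq_ME[OF assms(1) hlists_simps(1) assms(4)] multilinear_eq_ME[OF assms(2) hlists_simps(1) assms(4)]
  ME_cong[OF assms(4,3)] by simp

lemma ME_basis_word: "basis_word as ==> ME g as = g as"
proof (induction as arbitrary: g)
 case (Cons a as)
 obtain k where k: "snd a = pt k" using Cons.prems by (auto simp: basis_word_def)
 have "ME (%v. g ((fst a, pt k) # v)) as = g ((fst a, pt k) # as)"
  by (rule Cons.IH) (use Cons.prems in \<open>simp add: basis_word_def\<close>)
 then show ?case using k by (cases a) (simp add: EV_single[OF coef_add_res])
qed simp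

text \<open>An additive function is linear over the integers, so that the extension does not change its value when at most one letter
  differs from a basis element and this letter has integral coefficients.\<close>

lemma ME_integral:
 assumes add: "!!P Q d x y. P : hlists M ==> Q : hlists M ==> x : carrier (M d) ==> y : carrier (M d) ==>
   g (P @ [(d, x + y)] @ Q) = g (P @ [(d, x)] @ Q) + g (P @ [(d, y)] @ Q)"
  and P: "basis_word P" "basis_word Q" and x: "x : carrier (M d)" "integral x"
 shows "ME g (P @ [(d, x)] @ Q) = g (P @ [(d, x)] @ Q)"
proof -
 note PQ = basis_word_hlists[OF P(1)] basis_word_hlists[OF P(2)]
 have "g (P @ [(d, x)] @ Q) = EV (%r k. res r * g (P @ [(d, pt k)] @ Q)) x"
 proof (rule slot_expand[where h = "%x. g (P @ [(d, x)] @ Q)", OF add[OF PQ] _ x(1)])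
  fix k assume "k : keys x"
  then have k: "pt k : carrier (M d)" using x(1) by auto
  have g0: "g (P @ [(d, 0)] @ Q) = 0" using add[OF PQ, of 0 d 0] by simp
  have kc: "pm_scale r (pt k) : carrier (M d)" for r using k keys_pm_scale[of r "pt k"] by auto
  have nat: "g (P @ [(d, pm_scale (of_nat j) (pt k))] @ Q) = of_nat j * g (P @ [(d, pt k)] @ Q)" for j
  proof (induction j)
   case (Suc j)
   have e: "pm_scale (of_nat (Suc j)) (pt k) = pt k + pm_scale (of_nat j) (pt k)" by (simp only: of_nat_Suc pm_scale_simps)
   show ?case unfolding e using Suc add[OF PQ k kc, of "of_nat j"] by (simp add: distrib_right)
  qed (use g0 in \<open>simp add: pm_scale_simps\<close>)
  obtain q where q: "lookup x k = of_int q" using x(2) unfolding integral_def by (metis Ints_cases)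
  have "g (P @ [(d, pm_scale (of_int q) (pt k))] @ Q) = of_int q * g (P @ [(d, pt k)] @ Q)"
  proof (cases q rule: int_cases)
   case (nonneg j)
   then show ?thesis using nat[of j] by simp
  next
   case (neg j)
   have e: "pm_scale (of_int q) (pt k) + pm_scale (of_nat (Suc j)) (pt k) = (0 :: 'k \<Rightarrow>\<^sub>0 'r)"
    unfolding neg pm_scale_simps(2)[symmetric] by (simp only: of_int_minus of_int_of_nat_eq add.left_inverse pm_scale_simps)
   have "g (P @ [(d, pm_scale (of_int q) (pt k))] @ Q) + of_nat (Suc j) * g (P @ [(d, pt k)] @ Q) = 0"
    using add[OF PQ kc kc, of "of_int q" "of_nat (Suc j)"] unfolding e nat g0 by simp
   then show ?thesis unfolding neg by (simp add: add_eq_0_iff2 del: of_nat_Suc)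
  qed
  then show "g (P @ [(d, pm_scale (lookup x k) (pt k))] @ Q) = res (lookup x k) * g (P @ [(d, pt k)] @ Q)"
   unfolding q res_of_int .
 qed
 also have "... = EV (%r k. res r * ME g (P @ [(d, pt k)] @ Q)) x"
 proof (rule EV_cong, goal_cases)
  case (1 k)
  from 1 have "basis_word (P @ [(d, pt k)] @ Q)" using P x(1) by (auto simp: basis_word_def)
  then show ?case
   by (simp only: ME_basis_word)
 qed
 also have "... = ME g (P @ [(d, x)] @ Q)" by (rule multilinear_expand[OF multilinear_ME PQ x(1), symmetric])
 finally show ?thesis by simp
qed

end

lemma sum_sp3_lin:
 "(!!x y z. x @ y @ z = w ==> a x y z = s * b x y z + (c x y z :: 't::comm_ring_1)) ==>
  (\<Sum>x@y@z=w. a x y z) = s * (\<Sum>x@y@z=w. b x y z) + (\<Sum>x@y@z=w. c x y z)"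
 unfolding sum_distrib_left sum.distrib[symmetric] by (rule sum.cong) auto

lemma sum_sp2_lin:
 "(!!x y. x @ y = w ==> a x y = s * b x y + (c x y :: 't::comm_ring_1)) ==>
  (\<Sum>x@y=w. a x y) = s * (\<Sum>x@y=w. b x y) + (\<Sum>x@y=w. c x y)"
 unfolding sum_distrib_left sum.distrib[symmetric] by (rule sum.cong) auto

context based_algebra

begin

text \<open>The coboundary of a Hochschild cochain with trivial coefficients on both sides, in the bar form.\<close>

definition del :: "(('k \<Rightarrow>\<^sub>0 'r) helem list => 'r residue_field) => ('k \<Rightarrow>\<^sub>0 'r) helem list => 'r residue_field" where
 "del f as = (\<Sum>x@y@z=as. if y = [] then 0 else ksg (1 + sdeg x) * f (x @ [mh V y] @ z))
  + (case as of [] => 0 | a # r => res (ep a) * f r)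
  + (if as = [] then 0 else ksg (1 + sdeg (butlast as)) * (res (ep (last as)) * f (butlast as)))"

lemma mh_linear:
 assumes "P : hlists M" "Q : hlists M" "x : carrier (M d)" "y : carrier (M d)"
 shows "mval V (P @ [(d, pm_scale r x + y)] @ Q) = pm_scale r (mval V (P @ [(d, x)] @ Q)) + mval V (P @ [(d, y)] @ Q)"
proof -
 have s: "pm_scale r x : carrier (M d)" using mod_closed(3)[OF M assms(3), of r] by simp
 show ?thesis using mval_add(1)[OF assms(1,2) s assms(4) refl] mval_add(2)[OF assms(1-3) assms(3) refl, of r] by simp
qed

lemma multilinear_del:
 assumes f: "multilinear f"
 shows "multilinear (del f)" unfolding multilinear_def
proof (intro allI impI, goal_cases)
 case (1 P Q d x y r)
 from 1 have PQ: "P : hlists M" "Q : hlists M" and x: "x : carrier (M d)" and y: "y : carrier (M d)" by auto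
 have rx: "pm_scale r x : carrier (M d)" using mod_closed(3)[OF M x, of r] by simp
 note fl = multilinearD[OF f _ _ x y, of _ _ r]
 let ?t = "%x. (d, x) :: ('k \<Rightarrow>\<^sub>0 'r) helem" and ?c = "pm_scale r x + y"
 define F where "F x y z = (if y = [] then 0 else ksg (1 + sdeg x) * f (x @ [mh V y] @ z))" for x y z
 have 1: "(\<Sum>z'@b@z=Q. F (P @ ?t ?c # z') b z) = res r * (\<Sum>z'@b@z=Q. F (P @ ?t x # z') b z) + (\<Sum>z'@b@z=Q. F (P @ ?t y # z') b z)"
 proof (rule sum_sp3_lin, goal_cases)
  case (1 z' b z)
  from 1 have "z' @ [mh V b] @ z : hlists M" using PQ(2) mh_hlists[of b] by (auto simp del: M_simps)
  from fl[OF PQ(1) this]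
  show ?case by (simp add: F_def algebra_simps)
 qed
 have 2: "(\<Sum>a@a'=P. \<Sum>z'@z=Q. F a (a' @ ?t ?c # z') z)
  = res r * (\<Sum>a@a'=P. \<Sum>z'@z=Q. F a (a' @ ?t x # z') z) + (\<Sum>a@a'=P. \<Sum>z'@z=Q. F a (a' @ ?t y # z') z)"
 proof (rule sum_sp2_lin, rule sum_sp2_lin)
  fix a a' z' z assume "a @ a' = P" "z' @ z = Q"
  then have h: "a : hlists M" "a' : hlists M" "z' : hlists M" "z : hlists M" using PQ by (auto simp del: M_simps)
  let ?e = "sdeg a' + d + sdeg z' - 1"
  have mh: "mh V (a' @ ?t u # z') = (?e, mval V (a' @ [?t u] @ z'))" for u by (simp add: mh_def)
  have c: "mval V (a' @ [?t u] @ z') : carrier (M ?e)" if "u : carrier (M d)" for u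
   by (rule mval_closed') (use h that in \<open>simp_all del: M_simps\<close>)
  show "F a (a' @ ?t ?c # z') z = res r * F a (a' @ ?t x # z') z + F a (a' @ ?t y # z') z"
   using multilinearD[OF f h(1,4) c[OF x] c[OF y], of r] mh_linear[OF h(2,3) x y, of r] by (simp add: F_def mh algebra_simps)
 qed
 have 3: "(\<Sum>a@b@a'=P. F a b (a' @ ?t ?c # Q)) = res r * (\<Sum>a@b@a'=P. F a b (a' @ ?t x # Q)) + (\<Sum>a@b@a'=P. F a b (a' @ ?t y # Q))"
 proof (rule sum_sp3_lin, goal_cases)
  case (1 a b a')
  from 1 have "a @ [mh V b] @ a' : hlists M" using PQ(1) mh_hlists[of b] by (auto simp del: M_simps)
  from fl[OF this PQ(2)]
  show ?case by (simp add: F_def algebra_simps)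
 qed
 have sum: "(\<Sum>a@b@c=(P @ [?t ?c] @ Q). F a b c) = res r * (\<Sum>a@b@c=(P @ [?t x] @ Q). F a b c) + (\<Sum>a@b@c=(P @ [?t y] @ Q). F a b c)"
  using 1 2 3 by (simp add: sum_sp3_insert algebra_simps)
 have ept: "res (ep (?t ?c)) = res r * res (ep (?t x)) + res (ep (?t y))" by (simp add: ep_def)
 define H where "H as = (case as of [] => 0 | a # w => res (ep a) * f w)" for as
 have hd: "H (P @ [?t ?c] @ Q) = res r * H (P @ [?t x] @ Q) + H (P @ [?t y] @ Q)"
 proof (cases P)
  case Nil
  then show ?thesis using ept by (simp add: H_def algebra_simps)
 next
  case (Cons p P')
  have "P' : hlists M" using PQ(1) Cons by simp
  from fl[OF this PQ(2)] show ?thesis by (simp add: H_def Cons algebra_simps)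
 qed
 define L where "L as = (if as = [] then 0 else ksg (1 + sdeg (butlast as)) * (res (ep (last as)) * f (butlast as)))" for as
 have tl: "L (P @ [?t ?c] @ Q) = res r * L (P @ [?t x] @ Q) + L (P @ [?t y] @ Q)"
 proof (cases Q rule: rev_cases)
  case Nil
  then show ?thesis using ept by (simp add: L_def algebra_simps)
 next
  case (snoc Q' q)
  have "Q' : hlists M" using PQ(2) snoc by (auto simp del: M_simps)
  from fl[OF PQ(1) this] show ?thesis by (simp add: L_def snoc butlast_append algebra_simps)
 qed
 have de: "del f as = (\<Sum>a@b@c=as. F a b c) + H as + L as" for as by (simp add: del_def F_def H_def L_def)
 show ?case
  unfolding de sum hd tl by (simp add: algebra_simps)
qed

lemma basis_word_append [simp]: "basis_word (x @ y) \<longleftrightarrow> basis_word x & basis_word y" by (auto simp: basis_word_def)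

lemma integral_mval:
 assumes "basis_word y" "y ~= []"
 shows "integral (mval V y)"
proof -
 note h = basis_word_hlists[OF assms(1)]
 consider a where "y = [a]" | a c where "y = [a, c]" | "length y \<ge> 3"
  using assms(2) by (cases y rule: remdups_adj.cases) (auto simp: Suc_le_eq)
 then show ?thesis
 proof cases
  case 1
  then obtain k where k: "k : S (fst a)" "snd a = pt k" using assms(1) by (auto simp: basis_word_def)
  have "mval V y = ddiff A (fst a) (pt k)" using mval_single[of "pt k" "fst a"] k 1 by (cases a) (simp add: V_sel(3))
  then show ?thesis using integral_diff[OF k(1)] by simp
 next
  case 2
  then obtain k l where k: "snd a = pt k" "snd c = pt l" using assms(1) by (auto simp: basis_word_def)
  show ?thesis unfolding mval_dga(2)[OF h 2] k by (rule integral_simps(3)[OF sgn_pow_Ints integral_mult])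
 next
  case 3
  then show ?thesis using mval_dga(1)[OF h] by (simp add: integral_simps(1))
 qed
qed

lemma scalar_word_additive:
 assumes c: "MC \<gamma>" and "P : hlists M" "Q : hlists M" "x : carrier (M d)" "y : carrier (M d)"
 shows "\<gamma> (scalar_word (P @ [(d, x + y)] @ Q)) = \<gamma> (scalar_word (P @ [(d, x)] @ Q)) + \<gamma> (scalar_word (P @ [(d, y)] @ Q))"
 using MC_add[OF c, of "Mid d x" "Mid d y" "Gnd 0 1 # mids P" "mids Q @ [Gnd 0 1]"] assms(4,5) by (simp add: scalar_word_def Cc_all)

lemma ep_basis: "k : S (fst a) ==> snd a = pt k ==> ep a = (if fst a = 0 then 1 else 0)"
 by (simp add: ep_def)

lemma D_scalar_word:
 assumes c: "MC \<gamma>" and b: "basis_word as"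
 shows "D \<gamma> (scalar_word as) = del (%as. \<gamma> (scalar_word as)) as"
proof -
 let ?e = "Gnd 0 1 :: ('r, 'k \<Rightarrow>\<^sub>0 'r) letter"
 let ?w = "scalar_word as"
 note h = basis_word_hlists[OF b]
 define g where "g x y z = (if y = [] \<or> y = ?w then 0 else ksg (wdeg x) * \<gamma> (x @ [mul y] @ z))" for x y z
 have z: "\<gamma> (X @ [Gnd i 0] @ Z) = 0" for X i Z by (rule MC_zero_Gnd[OF c])
 have "D \<gamma> ?w = (\<Sum>x@y@z=?w. g x y z)" using ok_scalar_word[OF h] by (simp add: D_def g_def)
 also have "... = (\<Sum>y@z=?w. g [] y z) + (\<Sum>x@y@z=(mids as @ ?e # []). g (?e # x) y z)"
  unfolding scalar_word_def by (rule sum_sp3_Cons)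
 also have "(\<Sum>y@z=?w. g [] y z) = (case as of [] => 0 | a # r => res (ep a) * \<gamma> (scalar_word r))"
 proof -
  have "(\<Sum>y@z=?w. g [] y z) = g [] [] ?w + ((\<Sum>y@z=(mids as). g [] (?e # y) (z @ [?e])) + (\<Sum>(y, z)\<in>sp2 []. g [] (?e # mids as @ ?e # y) z))"
   unfolding scalar_word_def sum_sp2_Cons using sum_sp2_insert[of "%y. g [] (?e # y)" "mids as" ?e "[]"] by simp
  also have "(\<Sum>(y, z)\<in>sp2 []. g [] (?e # mids as @ ?e # y) z) = 0" by (simp add: g_def scalar_word_def)
  also have "(\<Sum>y@z=(mids as). g [] (?e # y) (z @ [?e])) = (case mids as of [] => 0 | a # r => g [] [?e, a] (r @ [?e]))"
  proof (rule sum_sp2_first)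
   fix y z :: "('r, 'k \<Rightarrow>\<^sub>0 'r) word" assume "length y ~= 1"
   then have "mul (?e # y) = Gnd (wdeg (?e # y) - 2) 0" using gval_length[of "?e # y"] by (simp add: mul_def)
   then show "g [] (?e # y) (z @ [?e]) = 0" using z[of "[]" "wdeg (?e # y) - 2" "z @ [?e]"] by (simp add: g_def)
  qed
  also have "... = (case as of [] => 0 | a # r => res (ep a) * \<gamma> (scalar_word r))"
  proof (cases as)
   case (Cons a r)
   obtain k where k: "k : S (fst a)" "snd a = pt k" using b Cons by (auto simp: basis_word_def)
   have m: "mul [?e, Mid (fst a) (snd a)] = Gnd (fst a) (ep a)" by (simp add: mul_def k ep_def)
   have "[?e, Mid (fst a) (snd a)] ~= ?w" by (simp add: scalar_word_def Cons)
   then have "g [] [?e, Mid (fst a) (snd a)] (mids r @ [?e]) = \<gamma> (Gnd (fst a) (ep a) # mids r @ [?e])" by (simp add: g_def m)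
   also have "... = res (ep a) * \<gamma> (scalar_word r)"
    using z[of "[]" "fst a" "mids r @ [?e]"] ep_basis[OF k] by (simp add: scalar_word_def)
   finally show ?thesis by (simp add: Cons)
  qed simp
  finally show ?thesis by (simp add: g_def)
 qed
 also have "(\<Sum>x@y@z=(mids as @ ?e # []). g (?e # x) y z)
  = (\<Sum>x@y=(mids as). g (?e # x) (y @ [?e]) []) + (\<Sum>x@y@z=(mids as). g (?e # x) y (z @ [?e]))"
  unfolding sum_sp3_insert[of "%x. g (?e # x)"] by (simp add: g_def sp2_Nil sp3_Nil split_beta)
 also have "(\<Sum>x@y=(mids as). g (?e # x) (y @ [?e]) []) = (if mids as = [] then 0 else g (?e # butlast (mids as)) [last (mids as), ?e] [])"
  using sum_sp2_last[of "%x y. g (?e # x) (y @ [?e]) []" "mids as"]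
 proof -
  assume A: "(!!y z. length z ~= 1 ==> g (?e # y) (z @ [?e]) [] = 0) ==>
   (\<Sum>x@y=(mids as). g (?e # x) (y @ [?e]) []) = (if mids as = [] then 0 else g (?e # butlast (mids as)) ([last (mids as)] @ [?e]) [])"
  have "g (?e # x) (y @ [?e]) [] = 0" if "length y ~= 1" for x y
  proof -
   have "mul (y @ [?e]) = Gnd (wdeg (y @ [?e]) - 2) 0" using gval_length[of "y @ [?e]"] that by (simp add: mul_def)
   then show ?thesis using z[of "?e # x" "wdeg (y @ [?e]) - 2" "[]"] by (simp add: g_def)
  qed
  from A[OF this] show ?thesis by simp
 qed
 also have "... = (if as = [] then 0 else ksg (1 + sdeg (butlast as)) * (res (ep (last as)) * \<gamma> (scalar_word (butlast as))))"
 proof (cases as rule: rev_cases)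
  case (snoc r a)
  obtain k where k: "k : S (fst a)" "snd a = pt k" using b snoc by (auto simp: basis_word_def)
  have m: "mul [Mid (fst a) (snd a), ?e] = Gnd (fst a) (ep a)" by (simp add: mul_def k ep_def)
  have "[Mid (fst a) (snd a), ?e] ~= ?w" by (simp add: scalar_word_def)
  then have "g (?e # mids r) [Mid (fst a) (snd a), ?e] [] = ksg (1 + sdeg r) * \<gamma> ((?e # mids r) @ [Gnd (fst a) (ep a)])"
   by (simp add: g_def m)
  also have "\<gamma> ((?e # mids r) @ [Gnd (fst a) (ep a)]) = res (ep a) * \<gamma> (scalar_word r)"
   using z[of "?e # mids r" "fst a" "[]"] ep_basis[OF k] by (simp add: scalar_word_def)
  finally show ?thesis by (simp add: snoc butlast_append)
 qed simp
 also have "(\<Sum>x@y@z=(mids as). g (?e # x) y (z @ [?e])) = (\<Sum>x@y@z=as. g (?e # mids x) (mids y) (mids z @ [?e]))"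
  using sum_sp3_map[of "%x y z. g (?e # x) y (z @ [?e])" "%a. Mid (fst a) (snd a)" as] by (simp only: mids_def)
 also have "... = (\<Sum>x@y@z=as. if y = [] then 0 else ksg (1 + sdeg x) * \<gamma> (scalar_word (x @ [mh V y] @ z)))"
 proof (rule sum_sp3_cong, goal_cases)
  case (1 x y z)
  have "mids y ~= ?w" using mids_isMid[of ?e y] by (auto simp: scalar_word_def)
  then show ?case
   by (simp add: g_def scalar_word_def mul_def mh_def)
 qed
 finally show ?thesis by (simp add: del_def algebra_simps)
qed

text \<open>On basis words, every term of the coboundary has at most one letter which is not a basis element, and its coefficients
  are integers.\<close>

lemma del_ME:
 assumes add: "!!P Q d x y. P : hlists M ==> Q : hlists M ==> x : carrier (M d) ==> y : carrier (M d) ==>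
   g (P @ [(d, x + y)] @ Q) = g (P @ [(d, x)] @ Q) + g (P @ [(d, y)] @ Q)" and b: "basis_word as"
 shows "del (ME g) as = del g as"
proof -
 have "(\<Sum>x@y@z=as. if y = [] then 0 else ksg (1 + sdeg x) * ME g (x @ [mh V y] @ z))
  = (\<Sum>x@y@z=as. if y = [] then 0 else ksg (1 + sdeg x) * g (x @ [mh V y] @ z))"
 proof (rule sum_sp3_cong, goal_cases)
  case (1 x y z)
  from 1 have bw: "basis_word x" "basis_word y" "basis_word z" using b by auto
  show ?case
   using ME_integral[OF add bw(1,3) mval_closed[OF basis_word_hlists[OF bw(2)]] integral_mval[OF bw(2)]] by (simp add: mh_def)
 qed
 moreover have "(case as of [] => 0 | a # r => res (ep a) * ME g r) = (case as of [] => 0 | a # r => res (ep a) * g r)"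
  using b by (cases as) (simp_all add: ME_basis_word basis_word_def)
 moreover have "ME g (butlast as) = g (butlast as)"
  by (rule ME_basis_word) (use b in_set_butlastD[of _ as] in \<open>auto simp: basis_word_def\<close>)
 ultimately show ?thesis by (simp only: del_def)
qed

text \<open>A primitive of the product of the two cocycles, made linear, is a Hochschild cochain whose coboundary is the augmented
  copairing. Both sides are multilinear, and agree on basis words.\<close>

lemma del_eq_pairing:
 assumes c: "MC \<gamma>" and D: "!!w. D \<gamma> w = cc G1 G2 w" and as: "as : hlists M"
 shows "del (ME (%as. \<gamma> (scalar_word as))) as = ksg (1 + n) * pairing as \<beta>0"
proof (rule multilinear_ext[OF multilinear_del[OF multilinear_ME] _ _ as])
 show "multilinear (%as. ksg (1 + n) * pairing as \<beta>0)" unfolding multilinear_def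
 proof (intro allI impI, goal_cases)
  case (1 P Q d x y r)
  from 1 have PQ: "P : hlists M" "Q : hlists M" and x: "x : carrier (M d)" and y: "y : carrier (M d)" by auto
  have rx: "pm_scale r x : carrier (M d)" using mod_closed(3)[OF M x, of r] by simp
  have "pairing (P @ [(d, pm_scale r x)] @ Q) \<beta>0 = res r * pairing (P @ [(d, x)] @ Q) \<beta>0"
   using teq_EV[OF ops2_add(4)[OF PQ hlists_simps(1) x x, of r] BF_balanced[OF M \<beta>0_bilin]]
   by (simp add: pairing_def EV_pm_scale[OF BF_coef_add] EV_BF_scale)
  then show ?case
   using pairing_linear[OF \<beta>0_bilin PQ rx y] by (simp add: algebra_simps)
 qed
 fix v assume v: "basis_word v"
 have "del (ME (%as. \<gamma> (scalar_word as))) v = del (%as. \<gamma> (scalar_word as)) v"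
  by (rule del_ME[OF scalar_word_additive[OF c] v])
 then show "del (ME (%as. \<gamma> (scalar_word as))) v = ksg (1 + n) * pairing v \<beta>0"
  using D_scalar_word[OF c v] cc_scalar_word[OF basis_word_hlists[OF v]] D by simp
qed

end

context based_algebra

begin

lemma ep_melt:
 assumes "[a, c] : hlists M"
 shows "ep (melt A a c) = ep a * ep c"
proof -
 obtain i x j y where ac: "a = (i, x)" "c = (j, y)" by (cases a, cases c)
 have xy: "x : carrier (M i)" "y : carrier (M j)" using assms ac by simp_all
 consider "i + j ~= 0" | "i = 0" "j = 0" | "i < 0" "j = - i" | "j < 0" "i = - j" by linarith
 then show ?thesis
 proof cases
  case 1
  then show ?thesis by (auto simp: ac ep_def melt_def)
 next
  case 2
  then show ?thesis by (simp add: ac ep_def melt_def csum_mult)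
 next
  case 3
  then have "x = 0" using neg_zero xy by simp
  moreover have "mval V [(i, 0), (j, y)] = 0" using mval_zero[of "[]" "[(j, y)]" 0 i] xy 3 by simp
  ultimately have "dmult A i j x y = 0" using mult_mval[OF assms] ac by (simp add: pm_scale_simps)
  then show ?thesis using 3 by (simp add: ac ep_def melt_def)
 next
  case 4
  then have "y = 0" using neg_zero xy by simp
  moreover have "mval V [(i, x), (j, 0)] = 0" using mval_zero[of "[(i, x)]" "[]" 0 j] xy 4 by simp
  ultimately have "dmult A i j x y = 0" using mult_mval[OF assms] ac by (simp add: pm_scale_simps)
  then show ?thesis using 4 by (simp add: ac ep_def melt_def)
 qed
qed

lemma melt_hlists: "[a, c] : hlists M ==> [melt A a c] : hlists M" using mult_carrier[of a c] by (simp add: melt_def)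

lemma ep_delt: "[a] : hlists M ==> ep (delt A a) = 0"
 using csum_diff[of "snd a"] by (cases a) (auto simp: ep_def delt_def)

text \<open>The contraction of a Hochschild chain \<open>a\<^sub>0[a\<^sub>1|\<dots>|a\<^sub>k]\<close> with a cochain \<open>f\<close>: it is \<open>\<epsilon>(a\<^sub>0) f(a\<^sub>1, \<dots>, a\<^sub>k)\<close>.\<close>

definition cap_form :: "(('k \<Rightarrow>\<^sub>0 'r) helem list => 'r residue_field) => 'r => ('k \<Rightarrow>\<^sub>0 'r) helem list => 'r residue_field" where
 "cap_form f r as = res r * (if as = [] then 0 else res (ep (hd as)) * f (tl as))"

lemma cap_form_coef_add: "coef_add (cap_form f)" by (simp add: coef_add_def cap_form_def distrib_right)

lemma cap_form_balanced:
 assumes f: "multilinear f"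
 shows "balanced M (cap_form f)"
proof -
 have lin: "cap_form f r (P @ [(d, pm_scale s x + y)] @ Q) = res s * cap_form f r (P @ [(d, x)] @ Q) + cap_form f r (P @ [(d, y)] @ Q)"
  if "P : hlists M" "Q : hlists M" "x : carrier (M d)" "y : carrier (M d)" for P Q d x y r s
 proof (cases P)
  case Nil
  then show ?thesis by (simp add: cap_form_def ep_def algebra_simps)
 next
  case (Cons p P')
  have "P' : hlists M" using that(1) Cons by simp
  from multilinearD[OF f this that(2-4), of s] show ?thesis by (simp add: cap_form_def Cons algebra_simps)
 qed
 have lin0: "cap_form f r (P @ [(d, 0)] @ Q) = 0" if "P : hlists M" "Q : hlists M" for P Q d r
  using lin[of P Q 0 d 0 r 1] that by (simp add: pm_scale_simps)
 show ?thesis unfolding balanced_def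
 proof (intro conjI allI impI cap_form_coef_add)
  fix as bs d x y r
  assume "as : hlists M & bs : hlists M & x : carrier (M d) & y : carrier (M d)"
  then show "cap_form f r (as @ [(d, x \<oplus>`M d` y)] @ bs) = cap_form f r (as @ [(d, x)] @ bs) + cap_form f r (as @ [(d, y)] @ bs)"
   using lin[of as bs x d y r 1] by (simp add: pm_scale_simps)
 next
  fix as bs d x r s
  assume *: "as : hlists M & bs : hlists M & x : carrier (M d)"
  then have "cap_form f r (as @ [(d, pm_scale s x)] @ bs) = res s * cap_form f r (as @ [(d, x)] @ bs)"
   using lin[of as bs x d 0 r s] lin0[of as bs r d] by simp
  then show "cap_form f r (as @ [(d, s \<odot>`M d` x)] @ bs) = cap_form f (r * s) (as @ [(d, x)] @ bs)"
   by (simp add: cap_form_def algebra_simps)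
 qed
qed

text \<open>The Hochschild differential is dual to \<open>del\<close> after augmentation of the coefficient: the two terms that multiply \<open>a\<^sub>0\<close> by
  \<open>a\<^sub>1\<close> or \<open>a\<^sub>k\<close> become the action on the scalar ends.\<close>

lemma hh_b_cap:
 assumes f: "multilinear f" and h: "as : hlists M" "as ~= []"
 shows "EV (cap_form f) (hh_b A (pt as)) = res (ep (hd as)) * del f (tl as)"
proof -
 obtain a0 as' where as: "as = a0 # as'" using h(2) by (cases as) auto
 have a0: "[a0] : hlists M" and h': "as' : hlists M" using h as by simp_all
 note Fc = cap_form_coef_add[of f]
 define \<psi> where "\<psi> w = (if w = [] then 0 else res (ep (hd w)) * f (tl w))" for w
 have cf: "cap_form f s w = res s * \<psi> w" for s w by (simp add: cap_form_def \<psi>_def)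
 let ?e = "res (ep a0)"
 have e0: "?e = 0 \<or> fst a0 = 0" by (auto simp: ep_def)
 have "EV (cap_form f) (hh_b A (pt as)) = (\<Sum>i<length as. ksg (sdeg (take i as)) * \<psi> (as[i := delt A (as ! i)])) +
  (\<Sum>i<length as - 1. ksg (sdeg (take i as) + deg (as ! i)) * \<psi> (take i as @ [melt A (as ! i) (as ! Suc i)] @ drop (i + 2) as)) +
  (if length as < 2 then 0
   else ksg (sdeg [last as] * sdeg (butlast as) + deg (last as)) * \<psi> (melt A (last as) (hd as) # tl (butlast as)))"
  unfolding hh_b_def lin_ext_single by (simp add: pm_scale_simps EV_add[OF Fc] EV_sum[OF Fc] EV_single[OF Fc] cf)
 also have "(\<Sum>i<length as. ksg (sdeg (take i as)) * \<psi> (as[i := delt A (as ! i)]))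
  = ?e * (\<Sum>x@y@z=as'. if length y = 1 then ksg (1 + sdeg x) * f (x @ [delt A (hd y)] @ z) else 0)"
 proof -
  let ?F = "%x a z. ksg (sdeg x) * \<psi> (x @ delt A a # z)"
  have "(\<Sum>i<length as. ksg (sdeg (take i as)) * \<psi> (as[i := delt A (as ! i)])) = (\<Sum>i<length as. ?F (take i as) (as ! i) (drop (Suc i) as))"
   by (rule sum.cong[OF refl]) (simp add: upd_conv_take_nth_drop)
  also have "... = (\<Sum>x@y@z=as. if length y = 1 then ?F x (hd y) z else 0)" by (rule sum_single_letter)
  also have "... = (\<Sum>y@z=as. if length y = 1 then ?F [] (hd y) z else 0)
    + (\<Sum>x@y@z=as'. if length y = 1 then ?F (a0 # x) (hd y) z else 0)" unfolding as by (rule sum_sp3_Cons)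
  also have "(\<Sum>y@z=as. if length y = 1 then ?F [] (hd y) z else 0) = (\<Sum>y@z=as. 0)"
  proof (rule sum_sp2_cong)
   fix y z assume "y @ z = as"
   then show "(if length y = 1 then ?F [] (hd y) z else 0) = 0" using ep_delt[OF a0] as by (cases y) (auto simp: \<psi>_def)
  qed
  also have "(\<Sum>y@z=as. 0) = (0 :: 'r residue_field)" by (simp add: split_beta)
  also have "(\<Sum>x@y@z=as'. if length y = 1 then ?F (a0 # x) (hd y) z else 0)
   = ?e * (\<Sum>x@y@z=as'. if length y = 1 then ksg (1 + sdeg x) * f (x @ [delt A (hd y)] @ z) else 0)"
   unfolding sum_distrib_left by (rule sum.cong[OF refl]) (use e0 in \<open>auto simp: \<psi>_def\<close>)
  finally show ?thesis by simp
 qed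
 also have "(\<Sum>i<length as - 1. ksg (sdeg (take i as) + deg (as ! i)) * \<psi> (take i as @ [melt A (as ! i) (as ! Suc i)] @ drop (i + 2) as))
  = ?e * (case as' of [] => 0 | a # r => res (ep a) * f r)
  + ?e * (\<Sum>x@y@z=as'. if length y = 2 then ksg (1 + sdeg x + fst (y ! 0)) * f (x @ [melt A (y ! 0) (y ! 1)] @ z) else 0)"
 proof -
  let ?F = "%x a c z. ksg (sdeg x + deg a) * \<psi> (x @ [melt A a c] @ z)"
  have "(\<Sum>i<length as - 1. ksg (sdeg (take i as) + deg (as ! i)) * \<psi> (take i as @ [melt A (as ! i) (as ! Suc i)] @ drop (i + 2) as))
   = (\<Sum>x@y@z=as. if length y = 2 then ?F x (y ! 0) (y ! 1) z else 0)" by (rule sum_letter_pair)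
  also have "... = (\<Sum>y@z=as. if length y = 2 then ?F [] (y ! 0) (y ! 1) z else 0)
    + (\<Sum>x@y@z=as'. if length y = 2 then ?F (a0 # x) (y ! 0) (y ! 1) z else 0)" unfolding as by (rule sum_sp3_Cons)
  also have "(\<Sum>y@z=as. if length y = 2 then ?F [] (y ! 0) (y ! 1) z else 0)
   = (\<Sum>y@z=as'. if length (a0 # y) = 2 then ?F [] ((a0 # y) ! 0) ((a0 # y) ! 1) z else 0)" unfolding as sum_sp2_Cons by simp
  also have "... = (case as' of [] => 0 | a # r => if length [a0, a] = 2 then ?F [] ([a0, a] ! 0) ([a0, a] ! 1) r else 0)"
   by (rule sum_sp2_first) simp
  also have "... = ?e * (case as' of [] => 0 | a # r => res (ep a) * f r)"
  proof (cases as')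
   case (Cons a r)
   have "ep (melt A a0 a) = ep a0 * ep a" by (rule ep_melt) (use a0 h' Cons in simp)
   then show ?thesis using e0 by (auto simp: Cons \<psi>_def deg_def)
  qed simp
  also have "(\<Sum>x@y@z=as'. if length y = 2 then ?F (a0 # x) (y ! 0) (y ! 1) z else 0)
   = ?e * (\<Sum>x@y@z=as'. if length y = 2 then ksg (1 + sdeg x + fst (y ! 0)) * f (x @ [melt A (y ! 0) (y ! 1)] @ z) else 0)"
   unfolding sum_distrib_left by (rule sum.cong[OF refl]) (use e0 in \<open>auto simp: \<psi>_def deg_def\<close>)
  finally show ?thesis .
 qed
 also have "(if length as < 2 then 0
   else ksg (sdeg [last as] * sdeg (butlast as) + deg (last as)) * \<psi> (melt A (last as) (hd as) # tl (butlast as)))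
  = ?e * (if as' = [] then 0 else ksg (1 + sdeg (butlast as')) * (res (ep (last as')) * f (butlast as')))"
 proof (cases "as' = []")
  case False
  have l: "[last as', a0] : hlists M" using a0 h' False last_in_set[OF False] by (auto simp: hlists_def)
  have c: "ep (last as') = 0 \<or> fst (last as') = 0" by (auto simp: ep_def)
  show ?thesis using False e0 c ep_melt[OF l] by (auto simp: as \<psi>_def deg_def)
 qed (simp add: as)
 finally have 1: "EV (cap_form f) (hh_b A (pt as)) = ?e *
   ((\<Sum>x@y@z=as'. if length y = 1 then ksg (1 + sdeg x) * f (x @ [delt A (hd y)] @ z) else 0)
  + (\<Sum>x@y@z=as'. if length y = 2 then ksg (1 + sdeg x + fst (y ! 0)) * f (x @ [melt A (y ! 0) (y ! 1)] @ z) else 0)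
  + (case as' of [] => 0 | a # r => res (ep a) * f r)
  + (if as' = [] then 0 else ksg (1 + sdeg (butlast as')) * (res (ep (last as')) * f (butlast as'))))"
  by (simp add: distrib_left ac_simps)
 have "(\<Sum>x@y@z=as'. if y = [] then 0 else ksg (1 + sdeg x) * f (x @ [mh V y] @ z))
  = (\<Sum>x@y@z=as'. (if length y = 1 then ksg (1 + sdeg x) * f (x @ [delt A (hd y)] @ z) else 0)
   + (if length y = 2 then ksg (1 + sdeg x + fst (y ! 0)) * f (x @ [melt A (y ! 0) (y ! 1)] @ z) else 0))"
 proof (rule sum_sp3_cong, goal_cases)
  case (1 x y z)
  from 1 have hx: "x : hlists M" "y : hlists M" "z : hlists M" using h' by (auto simp del: M_simps)
  consider "y = []" | a where "y = [a]" | a c where "y = [a, c]" | "length y \<ge> 3"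
   by (cases y rule: remdups_adj.cases) (auto simp: Suc_le_eq)
  then show ?case
  proof cases
   case 1
   then show ?thesis by simp
  next
   case 2
   then have "mh V y = delt A a" using hx mval_single[of "snd a" "fst a"] by (cases a) (simp add: mh_def delt_def V_sel(3))
   then show ?thesis using 2 by simp
  next
   case 3
   have hac: "[a, c] : hlists M" using hx(2) 3 by simp
   have "dmult A (fst a) (fst c) (snd a) (snd c) : carrier (M (fst a + fst c))" using mult_carrier[OF hac] by simp
   from multilinear_smult[OF f hx(1,3) this, of "ksg (fst a)"]
   have "f (x @ [mh V y] @ z) = ksg (fst a) * f (x @ [melt A a c] @ z)" using mval_dga(2)[OF hx(2) 3] 3 by (simp add: mh_def melt_def)
   then show ?thesis using 3 by (simp add: sgn_pow_add mult.assoc)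
  next
   case 4
   have "f (x @ [mh V y] @ z) = 0" using mval_dga(1)[OF hx(2) 4] multilinear_zero[OF f hx(1,3)] by (simp add: mh_def)
   then show ?thesis using 4 by auto
  qed
 qed
 then show ?thesis unfolding 1 by (simp only: as list.sel del_def sum_sp3_add)
qed

text \<open>The augmentation of an output, as a functional on formal tensors.\<close>

definition unit_form :: "'r => ('k \<Rightarrow>\<^sub>0 'r) helem list => 'r residue_field" where
 "unit_form r us = (if length us = 1 then res r * res (ep (hd us)) else 0)"

lemma unit_form_coef_add: "coef_add unit_form" by (simp add: coef_add_def unit_form_def distrib_right)

lemma unit_form_balanced: "balanced M unit_form" unfolding balanced_def
 using unit_form_coef_add by (auto simp: unit_form_def ep_def distrib_left)

text \<open>Up to sign, \<open>g\<^sub>\<phi>\<close> maps \<open>a\<^sub>0[a\<^sub>1|\<dots>|a\<^sub>k]\<close> to \<open>u a\<^sub>0 v\<close>, where \<open>u \<otimes> v\<close> is the copairing of \<open>a\<^sub>1, \<dots>, a\<^sub>k\<close>; and the augmentation is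
  multiplicative.\<close>

lemma unit_form_gmap:
 assumes \<omega>: "keys \<omega> \<subseteq> {as : hlists M. as ~= []}"
 shows "EV unit_form (gmap A (2 - n) m \<omega> []) = EV (%r as. res r * (res (ep (hd as)) * (ksg (1 + n) * pairing (tl as) \<beta>0))) \<omega>"
proof -
 note Ec = unit_form_coef_add
 define g :: "('k \<Rightarrow>\<^sub>0 'r) helem list => ('k \<Rightarrow>\<^sub>0 'r) helem list => (('k \<Rightarrow>\<^sub>0 'r) helem list \<Rightarrow>\<^sub>0 'r)"
  where "g as us = (case us of [u, v] => single [melt A (melt A u (hd as)) v]
     (ksg (sdeg (tl as) * sdeg ([] :: ('k \<Rightarrow>\<^sub>0 'r) helem list) + (2 - n) * sdeg [hd as] + sdeg [u] * sdeg [hd as]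
      + deg (hd as))) | _ => 0)" for as us
 have "EV unit_form (gmap A (2 - n) m \<omega> []) = EV (%r as. EV (%s us. EV (%t. unit_form (r * (s * t))) (g as us)) (ops V [[], tl as])) \<omega>"
  unfolding gmap_def V_sel(1) g_def[symmetric] by (simp add: EV_lin_ext Ec coef_add_scale)
 also have "... = EV (%r as. res r * (res (ep (hd as)) * (ksg (1 + n) * pairing (tl as) \<beta>0))) \<omega>"
 proof (rule EV_cong, goal_cases)
  case (1 as)
  from 1 have h: "as : hlists M" "as ~= []" using \<omega> by auto
  then have a0: "[hd as] : hlists M" and tl: "tl as : hlists M" by (cases as; simp)+
  let ?r = "lookup \<omega> as"
  have "EV (%s us. EV (%t. unit_form (?r * (s * t))) (g as us)) (ops V [[], tl as])
   = EV (%s us. (res ?r * (res (ep (hd as)) * ksg (1 + n))) * BF M \<beta>0 s us) (ops V [[], tl as])"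
  proof (rule EV_cong, goal_cases)
   case (1 us)
   from 1 obtain u v where us: "us = [u, v]" and uv: "[u] : hlists M" "[v] : hlists M" by (rule ops2_key[OF hlists_simps(1) tl])
   have h1: "[u, hd as] : hlists M" using uv a0 by simp
   have h2: "[melt A u (hd as), v] : hlists M" using melt_hlists[OF h1] uv by simp
   let ?sg = "ksg (sdeg (tl as) * sdeg ([] :: ('k \<Rightarrow>\<^sub>0 'r) helem list) + (2 - n) * sdeg [hd as] + sdeg [u] * sdeg [hd as] + deg (hd as)) :: 'r"
   have e: "ep (melt A (melt A u (hd as)) v) = ep u * ep (hd as) * ep v" using ep_melt[OF h2] ep_melt[OF h1] by simp
   have c: "ep u = 0 \<or> fst u = 0" "ep (hd as) = 0 \<or> fst (hd as) = 0" by (auto simp: ep_def)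
   have s: "ksg (3 - n) = (ksg (1 + n) :: 'r residue_field)" by (rule sgn_pow_cong) simp
   have "EV (%t. unit_form (?r * (s * t))) (g as us) = unit_form (?r * (s * ?sg)) [melt A (melt A u (hd as)) v]" for s
    by (simp add: g_def us Ec coef_add_scale coef_add_scale2)
   also have "unit_form (?r * (s * ?sg)) [melt A (melt A u (hd as)) v] = (res ?r * (res (ep (hd as)) * ksg (1 + n))) * BF M \<beta>0 s us" for s
   proof (cases "ep u = 0 \<or> ep (hd as) = 0")
    case True
    then show ?thesis by (auto simp: unit_form_def e BF_def \<beta>0_def us)
   next
    case False
    then have "?sg = ksg (3 - n)" using c by (intro sgn_pow_cong) (simp add: deg_def)
    then have "res ?sg = ksg (1 + n)" using s by simp
    then show ?thesis using uv by (simp add: unit_form_def e BF_def \<beta>0_def us ac_simps del: M_simps)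
   qed
   finally show ?case .
  qed
  also have "... = res ?r * (res (ep (hd as)) * (ksg (1 + n) * pairing (tl as) \<beta>0))"
   unfolding EV_mult_left pairing_def by (simp only: mult.assoc)
  finally show ?case .
 qed
 finally show ?thesis .
qed

text \<open>With no inputs, the coboundary of a Hochschild cochain is the differential of its value, whose augmentation is zero; the
  commutator terms concern cochains with inputs.\<close>

lemma unit_form_coboundary:
 assumes f: "multi_op M 1 2 f"
 shows "EV unit_form (hh_codiff A 2 f [[]]) = 0"
proof -
 note Ec = unit_form_coef_add
 have sets: "{..<length [[]]} = {0}" "{1..length [[]]} = {1}" by auto
 have sp: "splits (Suc 0) [[]] = [([], [[]], [])]" by (simp add: splits_def)
 have uf: "unit_form (r * ksg (sdeg (take (Suc 0) us) * sdeg (drop (Suc 0) us))) (rotate (Suc 0) us) = unit_form r us" for r us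
  by (cases us; cases "tl us") (auto simp: unit_form_def)
 have nec: "EV unit_form (nec 1 a b x y [[]]) = EV unit_form (nec_term 1 a b x y 1 [[]] ([], [[]], []))" for a b x y
  unfolding nec_def sets by (simp add: sp EV_lin_ext[OF Ec] Let_def Ec coef_add_scale uf del: rotate_Suc)
 have "EV unit_form (nec_term 1 (- 1) 2 (dga_ops A) f 1 [[]] ([], [[]], [])) = 0"
 proof -
  have "EV unit_form (nec_term 1 (- 1) 2 (dga_ops A) f 1 [[]] ([], [[]], [])) = EV (%r w. 0) (f [[]])"
   unfolding nec_term_def prod.case EV_lin_ext[OF Ec]
  proof (rule EV_cong, goal_cases)
   case (1 w)
   note w = 1
   have "[[]] : blocks M 1" by (simp add: blocks_def)
   then have "w : hlists M & length w = 1 & sdeg w = 2" using f w unfolding multi_op_def by fastforce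
   then obtain u where u: "w = [u]" "[u] : hlists M" by (cases w) auto
   show ?case
    by (simp add: u dga_ops_def Ec coef_add_scale pm_scale_simps unit_form_def ep_delt[OF u(2)])
  qed
  then show ?thesis by (simp add: EV_def)
 qed
 moreover have "nec_term 1 2 (- 1) f (dga_ops A) 1 [[]] ([], [[]], []) = 0" by (simp add: nec_term_def dga_ops_def)
 ultimately show ?thesis unfolding hh_codiff_def EV_diff[OF Ec] EV_pm_scale[OF Ec]
  using nec[of "- 1" 2 "dga_ops A" f] nec[of 2 "- 1" f "dga_ops A"] by (simp add: sgn_pow_def)
qed

theorem compatible_implies_obstruction:
 assumes \<omega>: "hh_cycle A n \<omega>" and comp: "compatible_with A n m \<omega>"
 shows obstruction unfolding obstruction_def
proof (rule exI[of _ G1], rule exI[of _ G2], intro conjI allI MC_G1 MC_G2 D_G1 D_G2 notI)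
 assume "\<exists>\<gamma>. MC \<gamma> & (\<forall>w. D \<gamma> w = cc G1 G2 w)"
 then obtain \<gamma> where \<gamma>: "MC \<gamma>" "!!w. D \<gamma> w = cc G1 G2 w" by blast
 define f where "f = ME (%as. \<gamma> (scalar_word as))"
 have f: "multilinear f" unfolding f_def by (rule multilinear_ME)
 have keys: "keys \<omega> \<subseteq> {as : hlists M. as ~= []}" and b0: "teq M (hh_b A \<omega>) 0"
  using \<omega> by (auto simp: hh_cycle_def hh_chains_def V_sel(2))
 note Fc = cap_form_coef_add[of f]
 have "0 = EV (cap_form f) (hh_b A \<omega>)" using teq_EV[OF b0 cap_form_balanced[OF f]] by simp
 also have "... = EV (%r as. res r * EV (cap_form f) (hh_b A (pt as))) \<omega>"
 proof -
  have "(%s. cap_form f (r * s)) = (%s w. res r * cap_form f s w)" for r by (intro ext) (simp add: cap_form_def mult.assoc)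
  then have "EV (cap_form f) (lin_ext g \<omega>) = EV (%r as. res r * EV (cap_form f) (lin_ext g (pt as))) \<omega>" for g
   by (simp add: EV_lin_ext[OF Fc] EV_mult_left pm_scale_simps)
  then show ?thesis unfolding hh_b_def .
 qed
 also have "... = EV (%r as. res r * (res (ep (hd as)) * (ksg (1 + n) * pairing (tl as) \<beta>0))) \<omega>"
 proof (rule EV_cong, goal_cases)
  case (1 as)
  from 1 have h: "as : hlists M" "as ~= []" using keys by auto
  then have tl: "tl as : hlists M" by (cases as) simp_all
  show ?case
   unfolding hh_b_cap[OF f h] using del_eq_pairing[OF \<gamma> tl] by (simp only: f_def)
 qed
 also have "... = EV unit_form (gmap A (2 - n) m \<omega> [])" by (rule unit_form_gmap[OF keys, symmetric])
 finally have g0: "EV unit_form (gmap A (2 - n) m \<omega> []) = 0" by simp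
 obtain F where F: "multi_op M 1 2 F" "teq M (gmap A (2 - n) m \<omega> [] - pt [uelt A]) (hh_codiff A 2 F [[]])"
  using comp unfolding compatible_with_def V_sel(2)[symmetric] by (auto dest!: bspec[of _ _ "[]"])
 from teq_EV[OF F(2) unit_form_balanced]
 have "EV unit_form (pt [uelt A]) = 0" unfolding EV_diff[OF unit_form_coef_add] g0 unit_form_coboundary[OF F(1)] by simp
 then show False by (simp add: unit_form_coef_add unit_form_def ep_def uelt_def csum_unit)
qed

end

section \<open>Chains on the based loop space\<close>

lemma csum_lin_ext_const: "(!!k. csum (g k) = c) ==> csum (lin_ext g p) = csum p * c"
 by (simp add: csum_lin_ext EV_mult_right) (simp add: csum_def)

lemma shuffles_00: "shuffles_of [0, 0] = {[]}" by (auto simp: shuffles_of_def less_2_cases_iff nth_Cons')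

lemma csum_cross_00: "csum (cross [0, 0] fs) = 1" by (simp add: cross_def shuffles_00 csum_sum inversions_def)

lemma integral_expand: "(!!c. c : set cs ==> integral c) ==> integral (expand cs)"
proof (induction cs)
 case (Cons c cs)
 then show ?case by (auto intro!: integral_lin_ext integral_simps)
qed (simp add: integral_simps)

text \<open>Products of simplices are sums of simplices over shuffles with signs.\<close>

lemma integral_cross: "integral (cross ps fs)" unfolding cross_def by (intro integral_sum integral_simps sgn_pow_Ints)

lemma based_algebra_loop:
 fixes X :: "'a topology" and m :: "('r::comm_ring_1, 'a moore simplex \<Rightarrow>\<^sub>0 'r) opn"
 assumes R: "rational_algebra TYPE('r)" and m: "pre_CY (loop_dga X b) n m"
 shows "based_algebra n (loop_dga X b) (%i. if i < 0 then {} else singular_simplex_set (nat i) (loop_space X b)) m"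
proof
 let ?A = "loop_dga X b :: ('r, 'a moore simplex \<Rightarrow>\<^sub>0 'r) dga"
 show "rational_algebra TYPE('r)" by (rule R)
 show "vinf_algebra n (vinf_of ?A m)" using m by (simp add: pre_CY_def)
 show "teq (dmods ?A) (m [b']) (dga_ops ?A [b'])" if "b' : hlists (dmods ?A)" for b' using m that by (simp add: pre_CY_def)
 show "dmods ?A i = free_module (if i < 0 then {} else singular_simplex_set (nat i) (loop_space X b))" for i
  by (simp add: loop_dga_def sing_mod_def)
 show "(if i < 0 then {} else singular_simplex_set (nat i) (loop_space X b)) = {}" if "i < 0" for i using that by simp
 show "csum (ddiff ?A 1 x) = 0" for x
 proof -
  have "{..nat 1} = {0, 1}" by auto
  then have "csum (\<Sum>k\<le>nat 1. single (singular_face (nat 1) k \<sigma>) (ksg (int k) :: 'r)) = 0" for \<sigma> :: "'a moore simplex"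
   by (simp add: csum_sum)
  then show ?thesis by (simp add: loop_dga_def sing_diff_def csum_lin_ext EV_def del: nat_1)
 qed
 show "csum (dmult ?A 0 0 x y) = csum x * csum y" for x y by (simp add: loop_dga_def csum_lin_ext_const[of _ 1] ez_def csum_cross_00)
   (subst csum_lin_ext_const[of _ "csum y"], subst csum_lin_ext_const[of _ 1], simp_all add: csum_lin_ext_const[of _ 1])
 show "csum (dunit ?A) = 1" by (simp add: loop_dga_def)
 show "integral (ddiff ?A i (pt k))" for i k by (simp add: loop_dga_def sing_diff_def pm_scale_simps integral_simps(1))
   (intro impI integral_sum integral_simps sgn_pow_Ints)
 show "integral (dmult ?A i j (pt k) (pt l))" for i j k l unfolding loop_dga_def dga.select_convs ez_def
  by (intro integral_lin_ext integral_expand integral_cross) (auto intro!: integral_simps)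
qed

section \<open>The induced structure on homology is not obstructed\<close>

context aug

begin

text \<open>The zero cochain is a primitive of the zero product.\<close>

lemma no_obstruction:
 assumes "!!y \<beta>. y : hlists M ==> bilin M \<beta> ==> pairing y \<beta> = 0"
 shows "~ obstruction"
proof
 assume obstruction
 then obtain G G' where G: "MC G" "MC G'" and N: "~ (\<exists>\<gamma>. MC \<gamma> & (\<forall>w. D \<gamma> w = cc G G' w))"
  unfolding obstruction_def by blast
 have "cc G G' w = 0" for w
 proof (cases "ok w & isGnd (hd w) & isGnd (last w)")
  case True
  have "(\<Sum>x@y@z=w. if x = [] \<or> z = [] then 0 else pairing (map hel y) (form G G' x z)) = (\<Sum>x@y@z=w. 0)"
  proof (rule sum_sp3_cong, goal_cases)
   case (1 x y z)
   note xyz = 1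
   show ?case
    using assms[OF ok_parts(3)[of x y z] form_bilin[OF G]] True xyz by auto
  qed
  then show ?thesis using True by (simp add: cc_def split_beta)
 next
  case False
  then show ?thesis unfolding cc_def by meson
 qed
 then show False using N MC_null D_zero by metis
qed

end

definition homology_vinf :: "('r::comm_ring_1, 'm) vinf => ('r, 'm set) opn => ('r, 'm set) vinf" where
 "homology_vinf V h = \<lparr>mods = homology (mods V) (diff V), diff = (%i _. \<zero>`homology (mods V) (diff V) (i - 1)`), ops = h\<rparr>"

text \<open>The induced copairing can only be nonzero on the empty block. There its two outputs have total degree \<open>- n\<close>, so that one of them
  lies in a module of negative degree, which is zero.\<close>

lemma homology_not_obstructed:
 fixes V :: "('r::comm_ring_1, 'm) vinf"
 assumes n: "n \<ge> 1" and h: "induced_ops V h" and V: "!!i. i < 0 ==> carrier (mods V i) \<subseteq> {z i}"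
 shows "~ obstructed n (homology_vinf V h)"
proof
 let ?H = "homology_vinf V h"
 assume "obstructed n ?H"
 then obtain A0 eps where a: "aug n ?H A0 eps" and o: "aug.obstruction n ?H A0 eps" unfolding obstructed_def by blast
 interpret aug n ?H A0 eps by (rule a)
 have neg: "x = \<zero>`M i`" if "x : carrier (M i)" "i < 0" for x i
 proof -
  have "carrier (M i) \<subseteq> {hclass (mods V) (diff V) i (z i)}"
   using V[OF that(2)] by (auto simp: homology_vinf_def homology_def cycles_def)
  then show ?thesis using that(1) mod_closed(2)[OF M, of i] by blast
 qed
 have "pairing y \<beta> = 0" if y: "y : hlists M" and b: "bilin M \<beta>" for y \<beta>
 proof (cases "y = []")
  case True
  have b0: "\<beta> (d, \<zero>`M d`) v = 0" "\<beta> v (d, \<zero>`M d`) = 0" if "[v] : hlists M" for d v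
   using bilinD(3)[OF b mod_closed(2)[OF M] that, of d 0] bilinD(4)[OF b mod_closed(2)[OF M] that, of d 0]
   by (simp_all add: mod_laws(12)[OF M])
  have "pairing y \<beta> = pairing y (%u v. 0)"
  proof (rule pairing_cong[OF y])
   fix u v assume u: "[u] : hlists M" and v: "[v] : hlists M" and uv: "fst u + fst v = sdeg y - n"
   then have "fst u < 0 \<or> fst v < 0" using True n by auto
   then show "\<beta> u v = 0"
   proof
    assume "fst u < 0"
    then have "u = (fst u, \<zero>`M (fst u)`)" using neg[of "snd u" "fst u"] u by (cases u) simp
    then show ?thesis using b0(1)[OF v] by metis
   next
    assume "fst v < 0"
    then have "v = (fst v, \<zero>`M (fst v)`)" using neg[of "snd v" "fst v"] v by (cases v) simp
    then show ?thesis using b0(2)[OF u] by metis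
   qed
  qed
  then show ?thesis by (simp add: pairing_zero)
 next
  case False
  have "teq M (ops ?H [[], y]) 0"
  proof -
   have "\<forall>l\<ge>1. \<forall>bl\<in>blocks (homology (mods V) (diff V)) l. map length bl \<notin> {[2], [0, 0]} --> teq (homology (mods V) (diff V)) (h bl) 0"
    using h unfolding induced_ops_def Let_def by blast
   from spec[OF this, of 2]
   have "\<forall>bl\<in>blocks M 2. map length bl \<notin> {[2], [0, 0]} --> teq M (ops ?H bl) 0"
    by (simp add: homology_vinf_def)
   moreover have "[[], y] : blocks M 2" using y by (simp add: blocks_def)
   ultimately show ?thesis using False by simp
  qed
  from teq_EV[OF this BF_balanced[OF M b]] show ?thesis by (simp add: pairing_def)
 qed
 from no_obstruction[OF this] show False using o by blast
qed

lemma obstructed_linked: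
 fixes V :: "('r::comm_ring_1, 'm) vinf" and W :: "('r, 'k) vinf"
 assumes R: "rational_algebra TYPE('r)" and l: "linked n V W"
 shows "obstructed n V \<longleftrightarrow> obstructed n W"
proof -
 have a: "valg n V" "valg n W" using l R by (auto simp: linked_def intro: valg.intro)
 from l consider f where "quasi_iso V W f" | f where "quasi_iso W V f" unfolding linked_def by blast
 then show ?thesis
 proof cases
  case 1
  interpret quasi_isomorphism n V W f by (intro quasi_isomorphism.intro quasi_isomorphism_axioms.intro a 1)
  show ?thesis by (rule obstructed_iff)
 next
  case 2
  interpret quasi_isomorphism n W V f by (intro quasi_isomorphism.intro quasi_isomorphism_axioms.intro a 2)
  show ?thesis by (rule obstructed_iff[symmetric])
 qed
qed

lemma formal_obstructed:
 fixes V :: "('r::comm_ring_1, 'm) vinf"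
 assumes R: "rational_algebra TYPE('r)" and V: "obstructed n V" and f: "formal TYPE('u) n V"
 obtains h where "induced_ops V h"
  "obstructed n (homology_vinf V h)"
proof -
 obtain h and U U' :: "('r, 'u) vinf" where h: "induced_ops V h" "linked n V U" "equivclp (linked n) U U'"
  "linked n U' (homology_vinf V h)" using f unfolding formal_def homology_vinf_def by blast
 have "obstructed n U" using obstructed_linked[OF R h(2)] V by blast
 with h(3) have "obstructed n U'"
 proof (induction rule: equivclp_induct)
  case (step y z)
  then show ?case using obstructed_linked[OF R, of n y z] obstructed_linked[OF R, of n z y] by blast
 qed
 then show thesis using that[OF h(1)] obstructed_linked[OF R h(4)] by blast
qed

theorem theorem2p31:
  fixes X :: "'a topology" and b :: 'a and n :: nat
    and \<xi> :: "('a simplex \<Rightarrow>\<^sub>0 'r::comm_ring_1) set"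
    and \<L> :: "('r, 'a moore simplex \<Rightarrow>\<^sub>0 'r) tensor set
        \<Rightarrow> (nat \<Rightarrow> ('r, 'a moore simplex \<Rightarrow>\<^sub>0 'r) tensor) set
        \<Rightarrow> ('r, 'a moore simplex \<Rightarrow>\<^sub>0 'r) opn set"
    and m :: "('r, 'a moore simplex \<Rightarrow>\<^sub>0 'r) opn"
  assumes "rational_algebra TYPE('r)"
    and "n \<ge> 1"
    and "local_PD_pair X n \<xi>"
    and "b \<in> topspace X"
    and "legendre_bijection (loop_dga X b :: ('r, 'a moore simplex \<Rightarrow>\<^sub>0 'r) dga) (int n) \<L>"
    and "compatible_with_fundamental_class X b n \<xi> \<L> m"
  shows "\<not> formal TYPE('u) (int n) (vinf_of (loop_dga X b) m)"
proof
 let ?A = "loop_dga X b :: ('r, 'a moore simplex \<Rightarrow>\<^sub>0 'r) dga" and ?V = "vinf_of (loop_dga X b) m"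
 assume f: "formal TYPE('u) (int n) ?V"
 obtain \<Lambda> \<omega> where \<omega>: "hh_image ?A (int n) \<Lambda> \<omega>" "m : pre_CY_space ?A (int n) \<omega>"
  using assms(6) unfolding compatible_with_fundamental_class_def Let_def by blast
 have cyc: "hh_cycle ?A (int n) \<omega>" using \<omega>(1) by (simp add: hh_image_def)
 have m: "pre_CY ?A (int n) m" "compatible_with ?A (int n) m \<omega>" using \<omega>(2) by (simp_all add: pre_CY_space_def)
 interpret based_algebra "int n" ?A "%i. if i < 0 then {} else singular_simplex_set (nat i) (loop_space X b)" m
  by (rule based_algebra_loop[OF assms(1) m(1)])
 have "obstructed (int n) ?V" unfolding obstructed_def using compatible_implies_obstruction[OF cyc m(2)] aug_axioms by blast
 then obtain h where h: "induced_ops ?V h"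
  "obstructed (int n) (homology_vinf ?V h)" by (rule formal_obstructed[OF assms(1) _ f])
 have "carrier (mods ?V i) \<subseteq> {0}" if "i < 0" for i using that by simp
 from homology_not_obstructed[OF _ h(1) this] show False using h(2) assms(2) by simp
qed

end
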